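(* Let $s\in\mathbb{R}$, $1\le p<\infty$, $0<q\le\infty$, let $W:\mathbb{R}^n\to M_m(\mathbb{C})$ be a matrix weight in $\mathcal{A}_p$, and let $\vec f\in[\mathcal{S}'(\mathbb{R}^n)]^m$. Then $\vec f\in M^{s}_{p,q}(W)$ if and only if there exists a sequence of continuous functions $\{\vec f_k\}_{k\in\mathbb{Z}^n}\subset L^p(W)$ such that $\vec f=\sum_{k\in\mathbb{Z}^n}\square_k\vec f_k$ in $[\mathcal{S}'(\mathbb{R}^n)]^m$ and $\|\{\langle k\rangle^{s}\vec f_k\}_{k\in\mathbb{Z}^n}\|_{\ell^q(L^p(W))}<\infty$. In this case, $$\|\vec f\|_{M^{s}_{p,q}(W)}\sim\inf\|\{\langle k\rangle^{s}\vec f_k\}_{k\in\mathbb{Z}^n}\|_{\ell^q(L^p(W))},$$ where the infimum is taken over all sequences of continuous functions $\{\vec f_k\}_{k\in\mathbb{Z}^n}\subset L^p(W)$ such that $\vec f=\sum_{k\in\mathbb{Z}^n}\square_k\vec f_k$ in $[\mathcal{S}'(\mathbb{R}^n)]^m$ and $\|\{\langle k\rangle^{s}\vec f_k\}_{k\in\mathbb{Z}^n}\|_{\ell^q(L^p(W))}<\infty$, and the equivalence constants do not depend on $\vec f$.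
   Context: Fix $n,m\in\mathbb{N}$. $M_m(\mathbb{C})$ is the set of complex $m\times m$ matrices, $|\cdot|$ is the Euclidean norm on $\mathbb{C}^m$ and $\|\cdot\|$ the operator norm on $M_m(\mathbb{C})$. A matrix weight is a function $W:\mathbb{R}^n\to M_m(\mathbb{C})$ such that $W(x)$ is nonnegative definite for every $x$, invertible for almost every $x$, and has locally integrable entries. For $1<p<\infty$, $W\in\mathcal{A}_p$ means $\sup_B\frac1{|B|}\int_B\big(\frac1{|B|}\int_B\|W^{1/p}(x)W^{-1/p}(y)\|^{p'}dy\big)^{p/p'}dx<\infty$, with $1/p+1/p'=1$; $W\in\mathcal{A}_1$ means $\sup_B\operatorname{ess\,sup}_{y\in B}\frac1{|B|}\int_B\|W(t)W^{-1}(y)\|dt<\infty$; suprema are over all balls $B\subset\mathbb{R}^n$. $L^p(W)$ is the space of measurable $\vec f:\mathbb{R}^n\to\mathbb{C}^m$ with $\|\vec f\|_{L^p(W)}=\big(\int_{\mathbb{R}^n}|W^{1/p}(x)\vec f(x)|^pdx\big)^{1/p}<\infty$. For a sequence, $\|\{\vec g_k\}_{k\in\mathbb{Z}^n}\|_{\ell^q(L^p(W))}=\big(\sum_{k}\|\vec g_k\|_{L^p(W)}^q\big)^{1/q}$ (supremum over $k$ if $q=\infty$). Let $Q_k=k+[-1/2,1/2)^n$ for $k\in\mathbb{Z}^n$. $Y$ is the set of sequences $\{\phi_k\}_{k\in\mathbb{Z}^n}$ of smooth functions such that, with constants $c>0$ and $C_\beta$ independent of $k$: $|\phi_k(\xi)|\ge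 c$ for $\xi\in Q_k$; $\operatorname{supp}\phi_k\subset\{\xi:|\xi-k|\le\sqrt n\}$; $\sum_k\phi_k(\xi)=1$ for all $\xi$; and $|D^\alpha\phi_k(\xi)|\le C_\beta$ for all $\xi\in\mathbb{R}^n$, $|\alpha|\le\beta$. Fix $\{\phi_k\}\in Y$ and let $\square_k=\mathcal{F}^{-1}\phi_k\mathcal{F}$, acting componentwise on $[\mathcal{S}'(\mathbb{R}^n)]^m$, the space of $m$-vectors of tempered distributions. Put $\langle k\rangle=(1+|k|^2)^{1/2}$ with $|k|=|k_1|+\dots+|k_n|$. $M^s_{p,q}(W)$ is the set of $\vec f\in[\mathcal{S}'(\mathbb{R}^n)]^m$ with $\|\vec f\|_{M^s_{p,q}(W)}=\big(\sum_{k\in\mathbb{Z}^n}(\langle k\rangle^s\|W^{1/p}\square_k\vec f\|_{L^p})^q\big)^{1/q}<\infty$ (supremum over $k$ if $q=\infty$). *)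

theory Defs
  imports "HOL-Analysis.Analysis" "HOL-Probability.Essential_Supremum"
begin

definition adjoint_matrix :: "complex^'m^'m \<Rightarrow> complex^'m^'m" where
  "adjoint_matrix A = (\<chi> i j. cnj (A $ j $ i))"

definition unitary_matrix :: "complex^'m^'m \<Rightarrow> bool" where
  "unitary_matrix U \<longleftrightarrow> adjoint_matrix U ** U = mat 1 \<and> U ** adjoint_matrix U = mat 1"

definition diag_matrix :: "('m \<Rightarrow> real) \<Rightarrow> complex^'m^'m" where
  "diag_matrix d = (\<chi> i j. if i = j then complex_of_real (d i) else 0)"

definition nonneg_definite :: "complex^'m^'m \<Rightarrow> bool" where
  "nonneg_definite A \<longleftrightarrow>
     adjoint_matrix A = A \<and> (\<forall>v. 0 \<le> Re (\<Sum>i\<in>UNIV. cnj (v $ i) * (A *v v) $ i))"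

text \<open>Functional calculus for a nonnegative definite matrix: diagonalise by a unitary matrix and
  take powers of the eigenvalues. The result does not depend on the diagonalisation. Since
  \<open>0 powr r = 0\<close>, a negative power of a singular matrix vanishes on its kernel.\<close>

definition matrix_powr :: "complex^'m^'m \<Rightarrow> real \<Rightarrow> complex^'m^'m" where
  "matrix_powr A r = (THE B. \<exists>U d. unitary_matrix U \<and> (\<forall>i. 0 \<le> d i) \<and>
     A = U ** diag_matrix d ** adjoint_matrix U \<and>
     B = U ** diag_matrix (\<lambda>i. d i powr r) ** adjoint_matrix U)"

definition op_norm :: "complex^'m^'m \<Rightarrow> real" where
  "op_norm A = onorm (\<lambda>v. A *v v)"

definition matrix_weight :: "(real^'n \<Rightarrow> complex^'m^'m) \<Rightarrow> bool" where
  "matrix_weight W \<longleftrightarrow>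
     (\<forall>x. nonneg_definite (W x)) \<and>
     (AE x in lebesgue. invertible (W x)) \<and>
     (\<forall>i j K. compact K \<longrightarrow> set_integrable lebesgue K (\<lambda>x. W x $ i $ j))"

text \<open>Power of an extended nonnegative number, meant for exponents \<open>r > 0\<close>.\<close>

definition ennpowr :: "ennreal \<Rightarrow> real \<Rightarrow> ennreal" where
  "ennpowr x r = (if x = top then top else ennreal (enn2real x powr r))"

definition average :: "(real^'n) set \<Rightarrow> (real^'n \<Rightarrow> ennreal) \<Rightarrow> ennreal" where
  "average B f = (\<integral>\<^sup>+x\<in>B. f x \<partial>lebesgue) / emeasure lebesgue B"

definition balls :: "(real^'n) set set" where
  "balls = {ball c r |c r. 0 < r}"

definition Ap_const :: "real \<Rightarrow> (real^'n \<Rightarrow> complex^'m^'m) \<Rightarrow> ennreal" where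
  "Ap_const p W = (let p' = p / (p - 1) in
     SUP B\<in>balls. average B (\<lambda>x.
       ennpowr (average B (\<lambda>y.
         ennreal (op_norm (matrix_powr (W x) (1/p) ** matrix_powr (W y) (- 1/p)) powr p')))
       (p / p')))"

definition A1_const :: "(real^'n \<Rightarrow> complex^'m^'m) \<Rightarrow> ennreal" where
  "A1_const W =
     (SUP B\<in>balls. esssup (restrict_space lebesgue B) (\<lambda>y.
       average B (\<lambda>t. ennreal (op_norm (W t ** matrix_inv (W y))))))"

definition Muckenhoupt :: "real \<Rightarrow> (real^'n \<Rightarrow> complex^'m^'m) set" where
  "Muckenhoupt p =
     {W. matrix_weight W \<and> (if p = 1 then A1_const W < top else Ap_const p W < top)}"

definition LpW_norm :: "real \<Rightarrow> (real^'n \<Rightarrow> complex^'m^'m) \<Rightarrow> (real^'n \<Rightarrow> complex^'m) \<Rightarrow> ennreal" where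
  "LpW_norm p W f =
     ennpowr (\<integral>\<^sup>+x. ennreal (norm (matrix_powr (W x) (1/p) *v f x) powr p) \<partial>lebesgue) (1/p)"

definition LpW :: "real \<Rightarrow> (real^'n \<Rightarrow> complex^'m^'m) \<Rightarrow> (real^'n \<Rightarrow> complex^'m) set" where
  "LpW p W = {f. f \<in> borel_measurable lebesgue \<and> LpW_norm p W f < top}"

definition lq_norm :: "ennreal \<Rightarrow> ('k \<Rightarrow> ennreal) \<Rightarrow> ennreal" where
  "lq_norm q a = (if q = top then (SUP k. a k)
     else ennpowr (\<Sum>\<^sub>\<infinity>k. ennpowr (a k) (enn2real q)) (1 / enn2real q))"

definition lqLpW_norm ::
    "ennreal \<Rightarrow> real \<Rightarrow> (real^'n \<Rightarrow> complex^'m^'m) \<Rightarrow> (int^'n \<Rightarrow> real^'n \<Rightarrow> complex^'m) \<Rightarrow> ennreal" where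
  "lqLpW_norm q p W g = lq_norm q (\<lambda>k. LpW_norm p W (g k))"

definition partial_deriv :: "'n \<Rightarrow> (real^'n \<Rightarrow> complex) \<Rightarrow> real^'n \<Rightarrow> complex" where
  "partial_deriv j f x = vector_derivative (\<lambda>t. f (x + t *\<^sub>R axis j 1)) (at 0)"

text \<open>A multi-index \<open>\<alpha>\<close> is given as a list of directions, with \<open>\<bar>\<alpha>\<bar>\<close> its length. For smooth
  functions the order of the list does not matter.\<close>

definition iter_partial :: "'n list \<Rightarrow> (real^'n \<Rightarrow> complex) \<Rightarrow> real^'n \<Rightarrow> complex" where
  "iter_partial \<alpha> f = foldr partial_deriv \<alpha> f"

definition smooth_fun :: "(real^'n \<Rightarrow> complex) \<Rightarrow> bool" where
  "smooth_fun f \<longleftrightarrow> (\<forall>\<alpha>. iter_partial \<alpha> f differentiable_on UNIV)"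

definition schwartz :: "(real^'n \<Rightarrow> complex) set" where
  "schwartz = {\<psi>. smooth_fun \<psi> \<and>
     (\<forall>N \<alpha>. bdd_above (range (\<lambda>x. (1 + norm x) ^ N * norm (iter_partial \<alpha> \<psi> x))))}"

definition schwartz_seminorm :: "nat \<Rightarrow> 'n list \<Rightarrow> (real^'n \<Rightarrow> complex) \<Rightarrow> real" where
  "schwartz_seminorm N \<alpha> \<psi> = (SUP x. (1 + norm x) ^ N * norm (iter_partial \<alpha> \<psi> x))"

definition schwartz_topology :: "(real^'n \<Rightarrow> complex) topology" where
  "schwartz_topology = topology_generated_by
     {{\<psi> \<in> schwartz. schwartz_seminorm N \<alpha> (\<lambda>x. \<psi> x - \<psi>\<^sub>0 x) < e} |N \<alpha> \<psi>\<^sub>0 e.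
        \<psi>\<^sub>0 \<in> schwartz \<and> 0 < e}"

text \<open>Functionals are total functions; only their values on \<^const>\<open>schwartz\<close> matter.\<close>

type_synonym 'n functional = "((real, 'n) vec \<Rightarrow> complex) \<Rightarrow> complex"

definition tempered :: "('n::finite) functional set" where
  "tempered = {u.
     (\<forall>\<psi>\<in>schwartz. \<forall>\<eta>\<in>schwartz. \<forall>a b. u (\<lambda>x. a * \<psi> x + b * \<eta> x) = a * u \<psi> + b * u \<eta>) \<and>
     continuous_map schwartz_topology euclidean u}"

definition tempered_vec :: "(('n::finite) functional ^ 'm) set" where
  "tempered_vec = {f. \<forall>i. f $ i \<in> tempered}"

definition regular_distr :: "(real^'n \<Rightarrow> complex) \<Rightarrow> 'n functional" where
  "regular_distr g = (\<lambda>\<psi>. LINT x|lebesgue. g x * \<psi> x)"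

definition regular_distr_vec :: "(real^'n \<Rightarrow> complex^'m) \<Rightarrow> 'n functional ^ 'm" where
  "regular_distr_vec g = (\<chi> i. regular_distr (\<lambda>x. g x $ i))"

text \<open>The continuous function by which a distribution is given. It exists for distributions with
  compactly supported Fourier transform (Paley-Wiener-Schwartz) and is unique.\<close>

definition function_of :: "('n::finite) functional \<Rightarrow> real^'n \<Rightarrow> complex" where
  "function_of u = (THE g. continuous_on UNIV g \<and>
     (\<forall>\<psi>\<in>schwartz. integrable lebesgue (\<lambda>x. g x * \<psi> x) \<and> u \<psi> = regular_distr g \<psi>))"

definition function_of_vec :: "('n::finite) functional ^ 'm \<Rightarrow> real^'n \<Rightarrow> complex^'m" where
  "function_of_vec f x = (\<chi> i. function_of (f $ i) x)"

text \<open>The normalising constant plays no role in \<open>F\<^sup>-\<^sup>1 \<phi>\<^sub>k F\<close>, but the frequency variable is the angular one: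
  no \<open>2 * pi\<close> in the exponent.\<close>

definition fourier :: "(real^'n \<Rightarrow> complex) \<Rightarrow> real^'n \<Rightarrow> complex" where
  "fourier \<psi> \<xi> = (LINT x|lebesgue. exp (- \<i> * complex_of_real (x \<bullet> \<xi>)) * \<psi> x)"

definition inv_fourier :: "(real^'n \<Rightarrow> complex) \<Rightarrow> real^'n \<Rightarrow> complex" where
  "inv_fourier \<psi> x = complex_of_real (1 / (2 * pi) ^ CARD('n)) *
     (LINT \<xi>|lebesgue. exp (\<i> * complex_of_real (x \<bullet> \<xi>)) * \<psi> \<xi>)"

definition distr_fourier :: "('n::finite) functional \<Rightarrow> 'n functional" where
  "distr_fourier u = (\<lambda>\<psi>. u (fourier \<psi>))"

definition distr_inv_fourier :: "('n::finite) functional \<Rightarrow> 'n functional" where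
  "distr_inv_fourier u = (\<lambda>\<psi>. u (inv_fourier \<psi>))"

definition distr_mult :: "(real^'n \<Rightarrow> complex) \<Rightarrow> 'n functional \<Rightarrow> 'n functional" where
  "distr_mult \<phi> u = (\<lambda>\<psi>. u (\<lambda>\<xi>. \<phi> \<xi> * \<psi> \<xi>))"

definition freq_box :: "(int^'n \<Rightarrow> real^'n \<Rightarrow> complex) \<Rightarrow> int^'n \<Rightarrow> 'n functional ^ 'm \<Rightarrow> 'n functional ^ 'm" where
  "freq_box \<phi> k f = (\<chi> i. distr_inv_fourier (distr_mult (\<phi> k) (distr_fourier (f $ i))))"

definition real_vec :: "int^'n \<Rightarrow> real^'n" where
  "real_vec k = (\<chi> i. real_of_int (k $ i))"

definition unit_cube :: "int^'n \<Rightarrow> (real^'n) set" where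
  "unit_cube k = {\<xi>. \<forall>i. real_of_int (k $ i) - 1/2 \<le> \<xi> $ i \<and> \<xi> $ i < real_of_int (k $ i) + 1/2}"

definition class_Y :: "(int^'n \<Rightarrow> real^'n \<Rightarrow> complex) set" where
  "class_Y = {\<phi>.
     (\<forall>k. smooth_fun (\<phi> k)) \<and>
     (\<exists>c>0. \<forall>k. \<forall>\<xi>\<in>unit_cube k. c \<le> norm (\<phi> k \<xi>)) \<and>
     (\<forall>k. closure {\<xi>. \<phi> k \<xi> \<noteq> 0} \<subseteq> {\<xi>. norm (\<xi> - real_vec k) \<le> sqrt (real CARD('n))}) \<and>
     (\<forall>\<xi>. ((\<lambda>k. \<phi> k \<xi>) has_sum 1) UNIV) \<and>
     (\<forall>\<beta>. \<exists>C. \<forall>k \<xi> \<alpha>. length \<alpha> \<le> \<beta> \<longrightarrow> norm (iter_partial \<alpha> (\<phi> k) \<xi>) \<le> C)}"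

definition bracket :: "int^'n \<Rightarrow> real" where
  "bracket k = sqrt (1 + (\<Sum>i\<in>UNIV. \<bar>real_of_int (k $ i)\<bar>)\<^sup>2)"

definition mod_norm ::
    "(int^'n \<Rightarrow> real^'n \<Rightarrow> complex) \<Rightarrow> real \<Rightarrow> real \<Rightarrow> ennreal \<Rightarrow> (real^'n \<Rightarrow> complex^'m^'m) \<Rightarrow>
     'n functional ^ 'm \<Rightarrow> ennreal" where
  "mod_norm \<phi> s p q W f =
     lq_norm q (\<lambda>k. ennreal (bracket k powr s) * LpW_norm p W (function_of_vec (freq_box \<phi> k f)))"

definition mod_space ::
    "(int^'n \<Rightarrow> real^'n \<Rightarrow> complex) \<Rightarrow> real \<Rightarrow> real \<Rightarrow> ennreal \<Rightarrow> (real^'n \<Rightarrow> complex^'m^'m) \<Rightarrow>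
     ('n functional ^ 'm) set" where
  "mod_space \<phi> s p q W = {f \<in> tempered_vec. mod_norm \<phi> s p q W f < top}"

text \<open>Unconditional convergence of a series of vectors of tempered distributions, in the weak-*
  topology in each component.\<close>

definition distr_sums :: "('k \<Rightarrow> ('n::finite) functional ^ 'm) \<Rightarrow> 'n functional ^ 'm \<Rightarrow> bool" where
  "distr_sums u f \<longleftrightarrow> (\<forall>i. \<forall>\<psi>\<in>schwartz. ((\<lambda>k. (u k $ i) \<psi>) has_sum (f $ i) \<psi>) UNIV)"

definition decompositions ::
    "(int^'n \<Rightarrow> real^'n \<Rightarrow> complex) \<Rightarrow> real \<Rightarrow> real \<Rightarrow> ennreal \<Rightarrow> (real^'n \<Rightarrow> complex^'m^'m) \<Rightarrow>
     'n functional ^ 'm \<Rightarrow> (int^'n \<Rightarrow> real^'n \<Rightarrow> complex^'m) set" where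
  "decompositions \<phi> s p q W f = {F.
     (\<forall>k. continuous_on UNIV (F k) \<and> F k \<in> LpW p W) \<and>
     distr_sums (\<lambda>k. freq_box \<phi> k (regular_distr_vec (F k))) f \<and>
     lqLpW_norm q p W (\<lambda>k x. bracket k powr s *\<^sub>R F k x) < top}"

end

theory Submission
  imports Defs "HOL-Probability.Characteristic_Functions" "HOL-Probability.Sinc_Integral"
begin

text \<open>Since \<open>\<phi>\<^sub>k \<phi>\<^sub>l\<close> vanishes unless \<open>l - k\<close> lies in a fixed finite set \<open>\<Lambda>\<close>, the operator
  \<open>\<Sum>l\<in>\<Lambda>. \<box>\<^bsub>k+l\<^esub>\<close> is the identity on the range of \<open>\<box>\<^sub>k\<close>. Hence \<open>f\<^sub>k = (\<Sum>l\<in>\<Lambda>. \<box>\<^bsub>k+l\<^esub> f)\<close>, a continuous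
  function by the Paley-Wiener-Schwartz theorem, decomposes \<open>f\<close>, and the norm of this sequence is bounded by that of \<open>f\<close>.
  Conversely, a decomposition gives \<open>\<box>\<^sub>k f = (\<Sum>l\<in>\<Lambda>. \<box>\<^sub>k \<box>\<^bsub>k+l\<^esub> f\<^bsub>k+l\<^esub>)\<close>, where \<open>\<box>\<^sub>k \<box>\<^bsub>k+l\<^esub>\<close> is the convolution with a
  kernel that decays faster than any power, uniformly in \<open>k\<close>. Such convolutions are uniformly bounded on \<open>L\<^sup>p(W)\<close>: applied to
  a ball containing two unit cubes, the Muckenhoupt condition bounds the passage from one cube to the other by a power
  of their distance, and the decay of the kernel makes the sum over all pairs of cubes converge.\<close>

section \<open>Powers of nonnegative definite matrices\<close>

text \<open>The integrand of the Muckenhoupt constant, the operator norm of W(x)^(1/p) W(y)^(-1/p),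
  is also the factor lost when W(x)^(1/p) F(y) is compared with W(y)^(1/p) F(y). Weighted
  convolution is thereby reduced to a scalar integral operator. The decay order 6n of the kernels is
  fixed there: passing between cubes at distance D costs (1 + D)^(n p), lattice sums need order 2n,
  hence cube weights of order 3n, and they enter twice. Two notions are definite descriptions and
  must first be shown to denote: matrix powers, by diagonalisation and uniqueness of the functional
  calculus, and \<open>function_of\<close>, by a continuous representative and its uniqueness. From
  a decomposition to the pieces of f the argument is pointwise: the weak series is evaluated at the
  one test function whose pairing with f is the value of \<box>_k f at x. All but finitely many
  terms vanish there, so no convergence in L^p(W) enters. Neighbour sums have a fixed number of
  terms, so crude constants suffice, also for q < 1, where l^q is only quasi-normed.\<close>

definition cinner :: "complex^'m \<Rightarrow> complex^'m \<Rightarrow> complex" where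
  "cinner x y = (\<Sum>i\<in>UNIV. cnj (x $ i) * y $ i)"

lemma cinner_add_left: "cinner (x + y) z = cinner x z + cinner y z"
  and cinner_add_right: "cinner z (x + y) = cinner z x + cinner z y"
  and cinner_diff_left: "cinner (x - y) z = cinner x z - cinner y z"
  and cinner_diff_right: "cinner z (x - y) = cinner z x - cinner z y"
  and cinner_smult_left: "cinner (c *s x) z = cnj c * cinner x z"
  and cinner_smult_right: "cinner z (c *s x) = c * cinner z x"
  by (simp_all add: cinner_def algebra_simps sum.distrib sum_subtractf sum_distrib_left)

lemmas cinner_simps = cinner_add_left cinner_add_right cinner_diff_left cinner_diff_right
  cinner_smult_left cinner_smult_right

lemma cnj_cinner: "cnj (cinner x y) = cinner y x"
  by (simp add: cinner_def mult.commute)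

lemma cinner_self: "cinner x x = complex_of_real ((norm x)\<^sup>2)"
proof -
  have "cinner x x = (\<Sum>i\<in>UNIV. complex_of_real ((norm (x $ i))\<^sup>2))"
    unfolding cinner_def by (intro sum.cong refl trans[OF mult.commute complex_norm_square[symmetric]])
  also have "\<dots> = complex_of_real ((norm x)\<^sup>2)"
    by (simp add: norm_vec_def L2_set_def sum_nonneg)
  finally show ?thesis .
qed

lemma cinner_adjoint: "cinner x (A *v y) = cinner (adjoint_matrix A *v x) y"
proof -
  have "cinner x (A *v y) = (\<Sum>i\<in>UNIV. \<Sum>j\<in>UNIV. cnj (x $ i) * A $ i $ j * y $ j)"
    by (simp add: cinner_def matrix_vector_mult_def sum_distrib_left mult.assoc)
  also have "\<dots> = (\<Sum>j\<in>UNIV. \<Sum>i\<in>UNIV. cnj (x $ i) * A $ i $ j * y $ j)"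
    by (rule sum.swap)
  also have "\<dots> = cinner (adjoint_matrix A *v x) y"
    by (simp add: cinner_def matrix_vector_mult_def adjoint_matrix_def sum_distrib_right
        sum_distrib_left mult.commute mult.left_commute)
  finally show ?thesis .
qed

lemma adjoint_mult_entry: "(adjoint_matrix U ** B) $ i $ j = cinner (column i U) (column j B)"
  by (simp add: matrix_matrix_mult_def adjoint_matrix_def cinner_def column_def)

text \<open>A left inverse of a square matrix is also a right inverse, so orthonormal columns give
  both equations of \<open>unitary_matrix\<close>.\<close>

lemma unitary_matrix_iff:
  "unitary_matrix U \<longleftrightarrow> (\<forall>i j. cinner (column i U) (column j U) = (if i = j then 1 else 0))"
proof -
  have "unitary_matrix U \<longleftrightarrow> adjoint_matrix U ** U = mat 1"
    unfolding unitary_matrix_def using matrix_left_right_inverse by blast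
  then show ?thesis
    by (simp add: vec_eq_iff adjoint_mult_entry mat_def)
qed

lemma column_mult: "column j (A ** B) = A *v column j B"
  by (simp add: column_def matrix_matrix_mult_def matrix_vector_mult_def vec_eq_iff)

lemma mult_diag_entry: "(X ** diag_matrix d) $ i $ j = X $ i $ j * complex_of_real (d j)"
  and diag_mult_entry: "(diag_matrix d ** X) $ i $ j = complex_of_real (d i) * X $ i $ j"
  by (simp_all add: matrix_matrix_mult_def diag_matrix_def if_distrib[where f="\<lambda>x. _ * x"]
      if_distrib[where f="\<lambda>x. x * _"] cong: if_cong)

text \<open>The first-order condition at a maximum: for small t the linear term decides the sign, so
  it has to vanish.\<close>

lemma linear_quadratic_nonpos:
  fixes a b :: real
  assumes "\<And>t. a * t + b * t\<^sup>2 \<le> 0"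
  shows "a = 0"
proof (rule ccontr)
  assume a: "a \<noteq> 0"
  \<comment> \<open>With this choice the expression is a^2 (1 + |b| + b) / (1 + |b|)^2, positive
    because 1 + |b| + b is at least 1.\<close>
  define t where "t = a / (1 + \<bar>b\<bar>)"
  have "a * t + b * t\<^sup>2 = a\<^sup>2 * (1 + \<bar>b\<bar> + b) / (1 + \<bar>b\<bar>)\<^sup>2"
  proof -
    have nz: "1 + \<bar>b\<bar> \<noteq> 0" by linarith
    have "a * t = a\<^sup>2 * (1 + \<bar>b\<bar>) / (1 + \<bar>b\<bar>)\<^sup>2"
      unfolding t_def using nz by (simp add: power2_eq_square)
    moreover have "b * t\<^sup>2 = a\<^sup>2 * b / (1 + \<bar>b\<bar>)\<^sup>2"
      unfolding t_def by (simp add: power_divide)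
    ultimately show ?thesis by (simp add: add_divide_distrib[symmetric] distrib_left)
  qed
  moreover have "\<dots> > 0" using a by (intro divide_pos_pos mult_pos_pos) (auto simp: add_pos_nonneg abs_if)
  ultimately show False using assms[of t] by linarith
qed

text \<open>The frame vectors are the rows of \<open>V\<close>, so that they are plain components;
  transposition turns frames into unitary matrices. Compactness yields the maximiser in the
  diagonalisation and later the closed graph of the functional calculus.\<close>

lemma compact_orthonormal_frames:
  "compact {V :: complex^'m^'m. \<forall>i j. cinner (V $ i) (V $ j) = (if i = j then 1 else 0)}"
    (is "compact ?S")
proof -
  have "closed ?S"
    unfolding cinner_def by (intro closed_Collect_all closed_Collect_eq continuous_intros)
  moreover have "bounded ?S"
  proof (rule boundedI)
    fix V :: "complex^'m^'m" assume V: "V \<in> ?S"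
    have n1: "norm (V $ i) = 1" for i
    proof -
      have "cinner (V $ i) (V $ i) = 1" using V by simp
      then have "(norm (V $ i))\<^sup>2 = 1" by (metis cinner_self of_real_eq_1_iff)
      then show ?thesis using norm_ge_zero[of "V $ i"] by (auto simp: power2_eq_1_iff)
    qed
    have "norm V \<le> (\<Sum>i\<in>UNIV. norm (V $ i))"
      unfolding norm_vec_def by (rule L2_set_le_sum) simp
    then show "norm V \<le> real CARD('m)" by (simp add: n1)
  qed
  ultimately show ?thesis by (simp add: compact_eq_bounded_closed)
qed

text \<open>A maximiser, over orthonormal frames, of a weighted trace with pairwise distinct weights is an
  eigenframe: rotating it in the plane of two of its vectors must not increase the trace to first
  order.\<close>

lemma hermitian_diagonalisable:
  fixes A :: "complex^'m^'m"
  assumes herm: "adjoint_matrix A = A"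
  obtains U d where "unitary_matrix U" "A = U ** diag_matrix d ** adjoint_matrix U"
    "\<And>i. d i = Re (cinner (column i U) (A *v column i U))"
proof -
  define S where "S = {V :: complex^'m^'m. \<forall>i j. cinner (V $ i) (V $ j) = (if i = j then 1 else 0)}"
  have comp: "compact S" unfolding S_def by (rule compact_orthonormal_frames)
  have ne: "S \<noteq> {}"
  proof -
    have "(\<chi> i. axis i 1) \<in> S"
      by (auto simp: S_def cinner_def axis_def if_distrib[where f="\<lambda>x. _ * x"]
          if_distrib[where f="\<lambda>x. x * _"] if_distrib[where f=cnj] cong: if_cong)
    then show ?thesis by blast
  qed
  \<comment> \<open>Distinctness is what counts: with w i = w j a rotation in that plane would leave
    the trace unchanged and say nothing about the (i, j) entry.\<close>
  obtain w :: "'m \<Rightarrow> nat" where w: "inj w"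
    using finite_imp_inj_to_nat_seg[OF finite_class.finite_UNIV] by blast
  define q where "q x = Re (cinner x (A *v x))" for x
  define \<psi> where "\<psi> V = (\<Sum>i\<in>UNIV. real (w i) * q (V $ i))" for V :: "complex^'m^'m"
  have cont: "continuous_on S \<psi>"
    unfolding \<psi>_def q_def cinner_def matrix_vector_mult_def
    by (intro continuous_intros)
  obtain V where V: "V \<in> S" and max: "\<And>V'. V' \<in> S \<Longrightarrow> \<psi> V' \<le> \<psi> V"
    using continuous_attains_sup[OF comp ne cont] by blast
  have orth: "cinner (V $ i) (V $ j) = (if i = j then 1 else 0)" for i j
    using V by (simp add: S_def)
  have hermA: "cinner y (A *v x) = cnj (cinner x (A *v y))" for x y
    by (metis cinner_adjoint cnj_cinner herm)
  have off: "cinner (V $ i) (A *v V $ j) = 0" if ij: "i \<noteq> j" for i j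
  proof (rule ccontr)
    define b where "b = cinner (V $ i) (A *v V $ j)"
    assume "cinner (V $ i) (A *v V $ j) \<noteq> 0"
    then have b: "b \<noteq> 0" by (simp add: b_def)
    \<comment> \<open>The phase of b is removed: z * b = |b|, so the first-order term of the
      rotation below is real and positive.\<close>
    define z where "z = cnj (sgn b)"
    have zz: "z * cnj z = 1"
      using complex_norm_square[of z] b by (simp add: z_def norm_sgn)
    have zb: "Re (z * b) = norm b"
    proof -
      have "b = cnj z * of_real (norm b)" using b by (simp add: z_def sgn_eq)
      then have "z * b = of_real (norm b)" using zz by (metis mult.assoc mult_1)
      then show ?thesis by simp
    qed
    define D where "D = q (V $ j) - q (V $ i)"
    \<comment> \<open>The rotated pair is V_i + t z V_j and V_j - t (cnj z) V_i, divided by sqrt (1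
      + t^2). Multiplying \<psi> V' \<le> \<psi> V by 1 + t^2 cancels the terms of order zero and
      leaves this product.\<close>
    have key: "(real (w i) - real (w j)) * (2 * t * norm b + t\<^sup>2 * D) \<le> 0" for t :: real
    proof -
      define r where "r = 1 / sqrt (1 + t\<^sup>2)"
      define x where "x = V $ i + (of_real t * z) *s V $ j"
      define y where "y = V $ j - (of_real t * cnj z) *s V $ i"
      define V' where "V' = (\<chi> k. if k = i then of_real r *s x
          else if k = j then of_real r *s y else V $ k)"
      have pos: "1 + t\<^sup>2 > 0" by (simp add: add_pos_nonneg)
      have rr: "r * r * (1 + t\<^sup>2) = 1"
        unfolding r_def using pos by simp
      have rrc: "complex_of_real r * complex_of_real r * (1 + complex_of_real t * complex_of_real t) = 1"
        using arg_cong[OF rr, of complex_of_real] by (simp add: power2_eq_square)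
      have zz': "cnj z * z = 1" using zz by (simp add: mult.commute)
      have xx: "cinner x x = 1 + of_real t * of_real t"
        using ij zz by (simp add: x_def cinner_simps orth)
      have yy: "cinner y y = 1 + of_real t * of_real t"
        using ij zz zz' by (simp add: y_def cinner_simps orth)
      have xy: "cinner x y = 0" "cinner y x = 0"
        using ij by (simp_all add: x_def y_def cinner_simps orth)
      have others: "cinner x (V $ k) = 0" "cinner y (V $ k) = 0"
        "cinner (V $ k) x = 0" "cinner (V $ k) y = 0" if "k \<noteq> i" "k \<noteq> j" for k
        using ij that by (simp_all add: x_def y_def cinner_simps orth)
      have "V' \<in> S"
        unfolding S_def V'_def using ij rrc
        by (auto simp: cinner_simps xx yy xy others orth mult.assoc)
      then have le: "\<psi> V' \<le> \<psi> V" by (rule max)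
      have split: "\<psi> X = real (w i) * q (X $ i) + real (w j) * q (X $ j) +
          (\<Sum>k\<in>UNIV - {i, j}. real (w k) * q (X $ k))" for X
      proof -
        have "\<psi> X = (\<Sum>k\<in>{i, j}. real (w k) * q (X $ k)) + (\<Sum>k\<in>UNIV - {i, j}. real (w k) * q (X $ k))"
          unfolding \<psi>_def by (subst sum.union_disjoint[symmetric]) (auto intro!: sum.cong)
        then show ?thesis using ij by simp
      qed
      have rest: "(\<Sum>k\<in>UNIV - {i, j}. real (w k) * q (V' $ k)) =
          (\<Sum>k\<in>UNIV - {i, j}. real (w k) * q (V $ k))"
        by (intro sum.cong) (auto simp: V'_def)
      have qr: "q (of_real r *s u) = r\<^sup>2 * q u" for u
        by (simp add: q_def cinner_simps vector_scalar_commute power2_eq_square mult.assoc)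
      have bji: "cinner (V $ j) (A *v V $ i) = cnj b" unfolding b_def by (rule hermA)
      have Azz: "Re (cnj z * (z * c)) = Re c" "Re (z * (cnj z * c)) = Re c" for c
        by (simp_all add: mult.assoc[symmetric] zz zz')
      have Rc: "Re (cnj z * cnj b) = norm b" using zb by simp
      have qx: "q x = q (V $ i) + 2 * t * norm b + t\<^sup>2 * q (V $ j)"
      proof -
        have "cinner x (A *v x) = cinner (V $ i) (A *v V $ i) + of_real t * (z * b)
            + of_real t * cnj (z * b) + of_real (t * t) * (z * cnj z) * cinner (V $ j) (A *v V $ j)"
          by (simp add: x_def cinner_simps vector_scalar_commute
              b_def[symmetric] bji algebra_simps)
        then show ?thesis using zb zz by (simp add: q_def power2_eq_square)
      qed
      have qy: "q y = q (V $ j) - 2 * t * norm b + t\<^sup>2 * q (V $ i)"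
      proof -
        have "cinner y (A *v y) = cinner (V $ j) (A *v V $ j) - of_real t * (z * b)
            - of_real t * cnj (z * b) + of_real (t * t) * (z * cnj z) * cinner (V $ i) (A *v V $ i)"
          by (simp add: y_def cinner_simps vector_scalar_commute
              b_def[symmetric] bji algebra_simps)
        then show ?thesis using zb zz by (simp add: q_def power2_eq_square)
      qed
      have "real (w i) * (r\<^sup>2 * q x) + real (w j) * (r\<^sup>2 * q y)
          \<le> real (w i) * q (V $ i) + real (w j) * q (V $ j)"
        using le ij unfolding split rest by (simp add: V'_def qr)
      moreover have "r\<^sup>2 = 1 / (1 + t\<^sup>2)" using pos by (simp add: r_def power_divide)
      ultimately have "real (w i) * q x + real (w j) * q y
          \<le> (1 + t\<^sup>2) * (real (w i) * q (V $ i) + real (w j) * q (V $ j))"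
        using pos by (simp add: divide_simps mult.commute)
      then show ?thesis unfolding qx qy D_def by (simp add: algebra_simps)
    qed
    have "((real (w i) - real (w j)) * (2 * norm b)) * t + ((real (w i) - real (w j)) * D) * t\<^sup>2 \<le> 0" for t
      using key[of t] by (simp add: algebra_simps)
    then have "(real (w i) - real (w j)) * (2 * norm b) = 0"
      by (rule linear_quadratic_nonpos)
    moreover have "w i \<noteq> w j" using w ij by (simp add: inj_eq)
    ultimately show False using b by simp
  qed
  define U where "U = transpose V"
  define d where "d i = q (V $ i)" for i
  have col: "column i U = V $ i" for i
    by (simp add: U_def column_def transpose_def vec_eq_iff)
  have un: "unitary_matrix U" by (simp add: unitary_matrix_iff col orth)
  have "adjoint_matrix U ** (A ** U) = diag_matrix d"
  proof -
    have "(adjoint_matrix U ** (A ** U)) $ i $ j = diag_matrix d $ i $ j" for i j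
    proof (cases "i = j")
      case True
      have "cinner (V $ i) (A *v V $ i) = of_real (d i)"
        using hermA[of "V $ i" "V $ i"] by (simp add: d_def q_def complex_eq_iff)
      then show ?thesis using True
        by (simp add: adjoint_mult_entry column_mult col diag_matrix_def)
    next
      case False
      then show ?thesis by (simp add: adjoint_mult_entry column_mult col diag_matrix_def off)
    qed
    then show ?thesis by (simp add: vec_eq_iff)
  qed
  moreover have "U ** (adjoint_matrix U ** (A ** U)) ** adjoint_matrix U =
      (U ** adjoint_matrix U) ** A ** (U ** adjoint_matrix U)"
    by (simp only: matrix_mul_assoc)
  ultimately have "A = U ** diag_matrix d ** adjoint_matrix U"
    using un by (simp add: unitary_matrix_def)
  with un show ?thesis by (rule that) (simp add: d_def q_def col)
qed

text \<open>The eigenvalues supplied by the diagonalisation are values of the quadratic form at the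
  columns of \<open>U\<close>, so they inherit its sign.\<close>

lemma nonneg_definite_diagonalisable:
  assumes "nonneg_definite A"
  obtains U d where "unitary_matrix U" "\<And>i. 0 \<le> d i" "A = U ** diag_matrix d ** adjoint_matrix U"
proof -
  obtain U d where *: "unitary_matrix U" "A = U ** diag_matrix d ** adjoint_matrix U"
    "\<And>i. d i = Re (cinner (column i U) (A *v column i U))"
    using hermitian_diagonalisable[of A] assms unfolding nonneg_definite_def by blast
  then show ?thesis using that[of U d] assms
    unfolding nonneg_definite_def cinner_def by metis
qed

section \<open>Uniqueness of the functional calculus; inverse powers\<close>

text \<open>The matrix \<open>X\<close> intertwines the two diagonal matrices, so X_ij (d_j - e_i) =
  0. Wherever X_ij is nonzero the eigenvalues agree, hence so do their images under an arbitrary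
  \<open>h\<close>. This makes the definite description in \<open>matrix_powr\<close> well
  defined.\<close>

lemma functional_calculus_unique:
  assumes "unitary_matrix U" "unitary_matrix V"
    and eq: "U ** diag_matrix d ** adjoint_matrix U = V ** diag_matrix e ** adjoint_matrix V"
  shows "U ** diag_matrix (\<lambda>i. h (d i)) ** adjoint_matrix U =
    V ** diag_matrix (\<lambda>i. h (e i)) ** adjoint_matrix V"
proof -
  define X where "X = adjoint_matrix V ** U"
  have u: "adjoint_matrix U ** U = mat 1" "U ** adjoint_matrix U = mat 1"
    "adjoint_matrix V ** V = mat 1" "V ** adjoint_matrix V = mat 1"
    using assms by (simp_all add: unitary_matrix_def)
  have "X ** diag_matrix d ** (adjoint_matrix U ** U) =
      adjoint_matrix V ** (U ** diag_matrix d ** adjoint_matrix U) ** U"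
    unfolding X_def by (simp only: matrix_mul_assoc)
  also have "\<dots> = (adjoint_matrix V ** V) ** diag_matrix e ** X"
    unfolding eq X_def by (simp only: matrix_mul_assoc)
  finally have XD: "X ** diag_matrix d = diag_matrix e ** X" by (simp add: u)
  have "X $ i $ j * complex_of_real (h (d j)) = complex_of_real (h (e i)) * X $ i $ j" for i j
  proof -
    have "X $ i $ j * complex_of_real (d j) = complex_of_real (e i) * X $ i $ j"
      using arg_cong[OF XD, of "\<lambda>M. M $ i $ j"] by (simp add: mult_diag_entry diag_mult_entry)
    then show ?thesis by (cases "X $ i $ j = 0") auto
  qed
  then have XD': "X ** diag_matrix (\<lambda>i. h (d i)) = diag_matrix (\<lambda>i. h (e i)) ** X"
    by (simp add: vec_eq_iff mult_diag_entry diag_mult_entry)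
  have "(V ** adjoint_matrix V) ** U ** diag_matrix (\<lambda>i. h (d i)) ** adjoint_matrix U =
      V ** (X ** diag_matrix (\<lambda>i. h (d i))) ** adjoint_matrix U"
    unfolding X_def by (simp only: matrix_mul_assoc)
  also have "\<dots> = V ** (diag_matrix (\<lambda>i. h (e i)) ** X) ** adjoint_matrix U"
    by (simp only: XD')
  also have "\<dots> = V ** diag_matrix (\<lambda>i. h (e i)) ** adjoint_matrix V ** (U ** adjoint_matrix U)"
    unfolding X_def by (simp only: matrix_mul_assoc)
  finally show ?thesis by (simp add: u)
qed

lemma matrix_powr_eq:
  assumes "unitary_matrix U" "\<And>i. 0 \<le> d i" "A = U ** diag_matrix d ** adjoint_matrix U"
  shows "matrix_powr A r = U ** diag_matrix (\<lambda>i. d i powr r) ** adjoint_matrix U"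
  unfolding matrix_powr_def
proof (rule the_equality)
  show "\<exists>Ua da. unitary_matrix Ua \<and> (\<forall>i. 0 \<le> da i) \<and> A = Ua ** diag_matrix da ** adjoint_matrix Ua \<and>
     U ** diag_matrix (\<lambda>i. d i powr r) ** adjoint_matrix U =
     Ua ** diag_matrix (\<lambda>i. da i powr r) ** adjoint_matrix Ua"
    using assms by blast
next
  fix B
  assume "\<exists>U d. unitary_matrix U \<and> (\<forall>i. 0 \<le> d i) \<and> A = U ** diag_matrix d ** adjoint_matrix U \<and>
     B = U ** diag_matrix (\<lambda>i. d i powr r) ** adjoint_matrix U"
  then show "B = U ** diag_matrix (\<lambda>i. d i powr r) ** adjoint_matrix U"
    using functional_calculus_unique[where h="\<lambda>t. t powr r"] assms by metis
qed

lemma matrix_powr_one: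
  assumes "nonneg_definite A" shows "matrix_powr A 1 = A"
proof -
  obtain U d where *: "unitary_matrix U" "\<And>i. 0 \<le> d i" "A = U ** diag_matrix d ** adjoint_matrix U"
    using nonneg_definite_diagonalisable[OF assms] by blast
  show ?thesis using matrix_powr_eq[OF *, of 1] * by simp
qed

text \<open>Invertibility makes all eigenvalues positive, which the scalar identity needs: at a zero
  eigenvalue both powers would be 0, since \<open>0 powr r = 0\<close>.\<close>

lemma matrix_powr_inverse:
  fixes A :: "complex^'m^'m"
  assumes "nonneg_definite A" "invertible A"
  shows "matrix_powr A (- r) ** matrix_powr A r = mat 1"
proof -
  obtain U d where *: "unitary_matrix U" "\<And>i. 0 \<le> d i" "A = U ** diag_matrix d ** adjoint_matrix U"
    using nonneg_definite_diagonalisable[OF assms(1)] by blast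
  have u: "adjoint_matrix U ** U = mat 1" "U ** adjoint_matrix U = mat 1"
    using * by (simp_all add: unitary_matrix_def)
  obtain B where B: "B ** A = mat 1" using assms(2) by (auto simp: invertible_def)
  \<comment> \<open>A zero eigenvalue would let \<open>A\<close> annihilate a column of
    \<open>U\<close>, which is a unit vector.\<close>
  have d: "d i > 0" for i
  proof (rule ccontr)
    assume "\<not> 0 < d i"
    then have "d i = 0" using *(2)[of i] by simp
    then have "column i (U ** diag_matrix d) = 0"
      by (simp add: vec_eq_iff column_def mult_diag_entry)
    moreover have "A ** U = U ** diag_matrix d ** (adjoint_matrix U ** U)"
      unfolding *(3) by (simp only: matrix_mul_assoc)
    ultimately have "A *v column i U = 0" by (simp add: u flip: column_mult)
    then have "B *v (A *v column i U) = 0" by simp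
    then have "column i U = 0"
      using B by (simp add: matrix_vector_mul_assoc)
    moreover have "cinner (column i U) (column i U) = 1"
      using *(1) by (simp add: unitary_matrix_iff)
    ultimately show False by (simp add: cinner_def)
  qed
  have "diag_matrix (\<lambda>i. d i powr - r) ** diag_matrix (\<lambda>i. d i powr r) = (mat 1 :: complex^'m^'m)"
  proof -
    have "complex_of_real (d i powr - r) * complex_of_real (d i powr r) = 1" for i
      using d[of i] by (simp add: powr_minus flip: of_real_mult)
    then show ?thesis
      by (simp add: vec_eq_iff diag_mult_entry) (simp add: diag_matrix_def mat_def)
  qed
  moreover have "matrix_powr A (- r) ** matrix_powr A r = U ** (diag_matrix (\<lambda>i. d i powr - r) **
      (adjoint_matrix U ** U) ** diag_matrix (\<lambda>i. d i powr r)) ** adjoint_matrix U"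
    unfolding matrix_powr_eq[OF *] by (simp only: matrix_mul_assoc)
  ultimately show ?thesis by (simp add: u)
qed

section \<open>Continuity and measurability of matrix powers\<close>

text \<open>Described through diagonalisations, with the eigenvalues stored as a vector, so that the
  set is the image of (unitary matrices) x I^m under a continuous map and is compact whenever
  \<open>I\<close> is.\<close>

definition psd_spectrum_in :: "real set \<Rightarrow> (complex^'m^'m) set" where
  "psd_spectrum_in I = {U ** diag_matrix (\<lambda>i. d $ i) ** adjoint_matrix U | U (d :: real^'m).
     unitary_matrix U \<and> (\<forall>i. d $ i \<in> I)}"

lemma compact_unitary: "compact {U :: complex^'m^'m. unitary_matrix U}"
proof -
  let ?S = "{V :: complex^'m^'m. \<forall>i j. cinner (V $ i) (V $ j) = (if i = j then 1 else 0)}"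
  have c: "column i V = transpose V $ i" for i and V :: "complex^'m^'m"
    by (simp add: column_def transpose_def vec_eq_iff)
  have u: "unitary_matrix U \<longleftrightarrow> transpose U \<in> ?S" for U :: "complex^'m^'m"
    unfolding unitary_matrix_iff c by (rule mem_Collect_eq[symmetric])
  have "{U :: complex^'m^'m. unitary_matrix U} = transpose ` ?S"
  proof (intro set_eqI iffI)
    fix U :: "complex^'m^'m" assume "U \<in> {U. unitary_matrix U}"
    then have "transpose U \<in> ?S" unfolding mem_Collect_eq u by simp
    from imageI[OF this, of transpose] show "U \<in> transpose ` ?S" unfolding transpose_transpose .
  next
    fix U :: "complex^'m^'m" assume "U \<in> transpose ` ?S"
    then obtain V where V: "U = transpose V" "V \<in> ?S" by (rule imageE)
    then show "U \<in> {U. unitary_matrix U}"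
      unfolding V(1) mem_Collect_eq[of _ unitary_matrix] u transpose_transpose by simp
  qed
  moreover have "continuous_on ?S transpose"
    unfolding transpose_def by (intro continuous_intros)
  ultimately show ?thesis using compact_continuous_image[OF _ compact_orthonormal_frames] by (simp only:)
qed

lemma continuous_on_matrix_mult [continuous_intros]:
  fixes f :: "'a::topological_space \<Rightarrow> complex^'m^'m"
  assumes "continuous_on S f" "continuous_on S g"
  shows "continuous_on S (\<lambda>x. f x ** g x)"
  unfolding matrix_matrix_mult_def by (intro continuous_intros assms)

lemma continuous_on_adjoint [continuous_intros]:
  assumes "continuous_on S f"
  shows "continuous_on S (\<lambda>x. adjoint_matrix (f x))"
  unfolding adjoint_matrix_def by (intro continuous_intros assms)

text \<open>Continuity holds because the graph of the functional calculus is a continuous image of a compact set.\<close>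

lemma continuous_on_matrix_powr:
  assumes I: "compact I" "I \<subseteq> {0..}" and h: "continuous_on I (\<lambda>t. t powr r)"
  shows "compact (psd_spectrum_in I :: (complex^'m^'m) set)"
    and "continuous_on (psd_spectrum_in I :: (complex^'m^'m) set) (\<lambda>A. matrix_powr A r)"
proof -
  let ?K = "psd_spectrum_in I :: (complex^'m^'m) set"
  define E where "E = {d :: real^'m. \<forall>i. d $ i \<in> I}"
  define P where "P = {U :: complex^'m^'m. unitary_matrix U} \<times> E"
  define g where "g h x = (case x of (U :: complex^'m^'m, d :: real^'m) \<Rightarrow>
      U ** diag_matrix (\<lambda>i. h (d $ i)) ** adjoint_matrix U)" for h x
  have "closed E"
  proof -
    have "E = (\<Inter>i. (\<lambda>d. d $ i) -` I)" by (auto simp: E_def)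
    then show ?thesis using compact_imp_closed[OF I(1)]
      by (simp add: closed_INT closed_vimage_vec_nth)
  qed
  moreover have "bounded E"
  proof -
    obtain M where M: "\<And>t. t \<in> I \<Longrightarrow> \<bar>t\<bar> \<le> M"
      using compact_imp_bounded[OF I(1)] by (auto simp: bounded_iff)
    show ?thesis
    proof (rule boundedI)
      fix d assume "d \<in> E"
      have "norm d \<le> (\<Sum>i\<in>UNIV. \<bar>d $ i\<bar>)" by (rule norm_le_l1_cart)
      also have "\<dots> \<le> (\<Sum>i\<in>(UNIV::'m set). M)"
        using \<open>d \<in> E\<close> M by (intro sum_mono) (auto simp: E_def)
      finally show "norm d \<le> (\<Sum>i\<in>(UNIV::'m set). M)" .
    qed
  qed
  ultimately have "compact E" by (simp add: compact_eq_bounded_closed)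
  then have P: "compact P" unfolding P_def by (intro compact_Times compact_unitary)
  have g: "continuous_on P (g h)" if "continuous_on I h" for h
  proof -
    have d: "continuous_on P (\<lambda>x. h (snd x $ i))" for i
    proof (rule continuous_on_compose2[OF that])
      show "continuous_on P (\<lambda>x. snd x $ i)" by (intro continuous_intros)
      show "(\<lambda>x. snd x $ i) ` P \<subseteq> I" by (auto simp: P_def E_def)
    qed
    have "continuous_on P (\<lambda>x. diag_matrix (\<lambda>i. h (snd x $ i)) :: complex^'m^'m)"
      unfolding diag_matrix_def
    proof (intro continuous_on_vec_lambda)
      fix i j :: 'm
      show "continuous_on P (\<lambda>x. if i = j then complex_of_real (h (snd x $ i)) else 0)"
        by (cases "i = j") (simp_all only: if_True if_False simp_thms continuous_on_of_real[OF d] continuous_on_const)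
    qed
    from continuous_on_matrix_mult[OF continuous_on_matrix_mult[OF continuous_on_fst[OF continuous_on_id] this]
        continuous_on_adjoint[OF continuous_on_fst[OF continuous_on_id]]]
    have "continuous_on P (\<lambda>x. fst x ** diag_matrix (\<lambda>i. h (snd x $ i)) ** adjoint_matrix (fst x))" .
    then show ?thesis by (simp add: g_def[abs_def] case_prod_beta)
  qed
  have K: "?K = g (\<lambda>t. t) ` P"
    by (auto simp: psd_spectrum_in_def g_def P_def E_def image_iff)
  show "compact ?K" unfolding K by (rule compact_continuous_image[OF g[OF continuous_on_id] P])
  \<comment> \<open>Argument and power are parametrised by the same pair (U, d). The graph is thus
    compact although the eigenvectors cannot be chosen continuously in the matrix.\<close>
  define G where "G = (\<lambda>x. (g (\<lambda>t. t) x, g (\<lambda>t. t powr r) x)) ` P"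
  have G: "compact G" unfolding G_def
    by (rule compact_continuous_image[OF continuous_on_Pair[OF g[OF continuous_on_id] g[OF h]] P])
  have powr: "matrix_powr (g (\<lambda>t. t) x) r = g (\<lambda>t. t powr r) x" if "x \<in> P" for x
    using that I(2) by (auto simp: g_def P_def E_def intro!: matrix_powr_eq)
  have graph: "(\<lambda>A. (A, matrix_powr A r)) ` ?K = G"
    unfolding K G_def image_image by (rule image_cong[OF refl]) (simp only: powr)
  have T: "compact (snd ` G)" by (rule compact_continuous_image[OF continuous_on_snd[OF continuous_on_id] G])
  have im: "(A, matrix_powr A r) \<in> G" if "A \<in> ?K" for A
    using imageI[OF that, of "\<lambda>A. (A, matrix_powr A r)"] unfolding graph .
  then have im': "matrix_powr A r \<in> snd ` G" if "A \<in> ?K" for A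
    using that by (metis image_eqI snd_conv)
  then have "(\<lambda>A. matrix_powr A r) \<in> ?K \<rightarrow> snd ` G" by simp
  moreover have "closedin (top_of_set (?K \<times> snd ` G)) ((\<lambda>A. (A, matrix_powr A r)) ` ?K)"
  proof (rule closed_subset)
    show "closed ((\<lambda>A. (A, matrix_powr A r)) ` ?K)" unfolding graph by (rule compact_imp_closed[OF G])
  next
    show "(\<lambda>A. (A, matrix_powr A r)) ` ?K \<subseteq> ?K \<times> snd ` G" using im' by auto
  qed
  ultimately show "continuous_on ?K (\<lambda>A. matrix_powr A r)"
    by (subst continuous_closed_graph_eq[OF T]) simp_all
qed

text \<open>For r \<le> 0 the function \<open>t powr r\<close> jumps at 0, so the power is not
  continuous on all nonnegative definite matrices. It is continuous on matrices with spectrum in {0}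
  \<union> [1/k, k], and countably many such pieces exhaust the space.\<close>

lemma borel_measurable_matrix_powr:
  fixes W :: "'a \<Rightarrow> complex^'m^'m"
  assumes W: "W \<in> borel_measurable M" and psd: "\<And>x. x \<in> space M \<Longrightarrow> nonneg_definite (W x)"
  shows "(\<lambda>x. matrix_powr (W x) r) \<in> borel_measurable M"
proof -
  define I where "I k = {0} \<union> {1 / real (Suc k) .. real (Suc k)}" for k
  let ?K = "\<lambda>k. psd_spectrum_in (I k) :: (complex^'m^'m) set"
  have I: "compact (I k)" "I k \<subseteq> {0..}" "continuous_on (I k) (\<lambda>t. t powr r)" for k
  proof -
    show "compact (I k)" unfolding I_def by (intro compact_Un) auto
    have *: "0 < 1 / real (Suc k)" by simp
    then show "I k \<subseteq> {0..}" by (auto simp: I_def simp del: of_nat_Suc)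
    show "continuous_on (I k) (\<lambda>t. t powr r)"
      unfolding I_def
    proof (rule continuous_on_closed_Un)
      show "continuous_on {1 / real (Suc k)..real (Suc k)} (\<lambda>t. t powr r)"
        using * by (intro continuous_on_powr continuous_on_id continuous_on_const)
          (auto simp del: of_nat_Suc)
    qed simp_all
  qed
  have K: "?K k \<in> sets borel" for k
    by (intro borel_closed compact_imp_closed continuous_on_matrix_powr(1)[OF I])
  define \<Omega> where "\<Omega> k = {x \<in> space M. W x \<in> ?K k}" for k
  have \<Omega>: "\<Omega> k \<in> sets M" for k
    using measurable_sets[OF W K, of k] by (simp add: \<Omega>_def vimage_def Int_def conj_commute)
  have cover: "\<exists>k. x \<in> \<Omega> k" if x: "x \<in> space M" for x
  proof -
    obtain U d where *: "unitary_matrix U" "\<And>i. 0 \<le> d i" "W x = U ** diag_matrix d ** adjoint_matrix U"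
      using nonneg_definite_diagonalisable[OF psd[OF x]] by blast
    \<comment> \<open>One bound for all eigenvalues and their reciprocals; a zero eigenvalue adds
      nothing because \<open>inverse 0 = 0\<close>, and it is caught by the isolated point of
      \<open>I k\<close>.\<close>
    obtain k where k: "(\<Sum>i\<in>UNIV. d i + inverse (d i)) \<le> real k" using real_arch_simple by blast
    have d: "d i \<in> I k" for i
    proof -
      have "d i + inverse (d i) \<le> (\<Sum>i\<in>UNIV. d i + inverse (d i))"
        using *(2) by (intro member_le_sum) auto
      then have le: "d i + inverse (d i) \<le> real (Suc k)" using k by simp
      show ?thesis
      proof (cases "d i = 0")
        case False
        then have pos: "d i > 0" using *(2)[of i] by simp
        then have "inverse (d i) \<le> real (Suc k)" "d i \<le> real (Suc k)"
          using le positive_imp_inverse_positive[OF pos] by linarith+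
        then have "1 / real (Suc k) \<le> d i"
          using pos by (simp add: field_simps del: of_nat_Suc)
        then show ?thesis using \<open>d i \<le> real (Suc k)\<close> by (simp add: I_def)
      qed (simp add: I_def)
    qed
    have "($) (vec_lambda d) = d" by (rule ext) simp
    then have "W x \<in> ?K k" unfolding psd_spectrum_in_def
      using * d by (intro CollectI exI[of _ U] exI[of _ "\<chi> i. d i"]) auto
    then show ?thesis using x by (auto simp: \<Omega>_def)
  qed
  show ?thesis
  proof (rule measurable_piecewise_restrict[of "range \<Omega>"])
    show "countable (range \<Omega>)" by simp
    show "space M \<subseteq> \<Union> (range \<Omega>)" using cover by auto
  next
    fix A assume "A \<in> range \<Omega>"
    then obtain k where A: "A = \<Omega> k" by blast
    show "A \<inter> space M \<in> sets M" using \<Omega> A by auto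
    have "W \<in> measurable (restrict_space M A) (restrict_space borel (?K k))"
      unfolding A by (intro measurable_restrict_space3 W) (auto simp: \<Omega>_def)
    moreover have "(\<lambda>A. matrix_powr A r) \<in> borel_measurable (restrict_space borel (?K k))"
      by (intro borel_measurable_continuous_on_restrict continuous_on_matrix_powr(2)[OF I])
    ultimately show "(\<lambda>x. matrix_powr (W x) r) \<in> borel_measurable (restrict_space M A)"
      by (rule measurable_compose)
  qed
qed

lemma borel_measurable_vec:
  fixes f :: "'a \<Rightarrow> 'b::euclidean_space^'n"
  assumes "\<And>i. (\<lambda>x. f x $ i) \<in> borel_measurable M"
  shows "f \<in> borel_measurable M"
proof (subst borel_measurable_euclidean_space, intro ballI)
  fix b :: "'b^'n" assume "b \<in> Basis"
  then obtain i u where b: "b = axis i u" by (auto simp: Basis_vec_def)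
  show "(\<lambda>x. f x \<bullet> b) \<in> borel_measurable M"
    unfolding b inner_axis using assms[of i] by measurable
qed

text \<open>Local integrability gives measurability only of the entries cut off to compact sets; the
  cut-offs to growing balls converge pointwise.\<close>

lemma matrix_weight_measurable:
  fixes W :: "real^'n \<Rightarrow> complex^'m^'m"
  assumes "matrix_weight W"
  shows "W \<in> borel_measurable lebesgue"
proof (intro borel_measurable_vec)
  fix i j
  have m: "(\<lambda>x. indicator (cball 0 (real k)) x *\<^sub>R (W x $ i $ j)) \<in> borel_measurable lebesgue" for k
    using assms unfolding matrix_weight_def set_integrable_def
    by (intro borel_measurable_integrable) auto
  show "(\<lambda>x. W x $ i $ j) \<in> borel_measurable lebesgue"
  proof (rule borel_measurable_LIMSEQ_metric[OF m])
    fix x :: "real^'n"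
    obtain k0 :: nat where "norm x \<le> real k0" using real_arch_simple by blast
    then have "indicator (cball 0 (real k)) x *\<^sub>R (W x $ i $ j) = W x $ i $ j" if "k \<ge> k0" for k
      using that by (simp add: indicator_def)
    then show "(\<lambda>k. indicator (cball 0 (real k)) x *\<^sub>R (W x $ i $ j)) \<longlonglongrightarrow> W x $ i $ j"
      by (intro tendsto_eventually) (auto simp: eventually_sequentially)
  qed
qed

section \<open>The operator norm: bounds and measurability\<close>

lemma norm_mult_le_op_norm: "norm (A *v v) \<le> op_norm A * norm v"
  unfolding op_norm_def by (rule onorm) simp

lemma op_norm_nonneg: "0 \<le> op_norm A"
  unfolding op_norm_def by (rule onorm_pos_le) simp

text \<open>A crude comparison that serves only to make \<open>op_norm\<close> Lipschitz, hence
  Borel.\<close>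

lemma op_norm_le_norm:
  fixes A :: "complex^'m^'m"
  shows "op_norm A \<le> real CARD('m) * real CARD('m) * norm A"
  unfolding op_norm_def
proof (rule onorm_bound)
  fix v :: "complex^'m"
  have "norm (A *v v) \<le> (\<Sum>i\<in>UNIV. norm ((A *v v) $ i))"
    unfolding norm_vec_def by (rule L2_set_le_sum) simp
  also have "\<dots> \<le> (\<Sum>i\<in>(UNIV::'m set). \<Sum>j\<in>(UNIV::'m set). norm A * norm v)"
  proof (intro sum_mono)
    fix i :: 'm
    have "norm ((A *v v) $ i) \<le> (\<Sum>j\<in>UNIV. norm (A $ i $ j) * norm (v $ j))"
      unfolding matrix_vector_mult_def using norm_sum[of "\<lambda>j. A $ i $ j * v $ j" UNIV]
      by (simp only: vec_lambda_beta norm_mult)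
    also have "\<dots> \<le> (\<Sum>j\<in>(UNIV::'m set). norm A * norm v)"
      using order_trans[OF Finite_Cartesian_Product.norm_nth_le[of "A $ i"] Finite_Cartesian_Product.norm_nth_le[of A]]
      by (intro sum_mono mult_mono Finite_Cartesian_Product.norm_nth_le) simp_all
    finally show "norm ((A *v v) $ i) \<le> (\<Sum>j\<in>(UNIV::'m set). norm A * norm v)" .
  qed
  finally show "norm (A *v v) \<le> real CARD('m) * real CARD('m) * norm A * norm v"
    by (simp add: mult.assoc)
qed simp

lemma borel_measurable_op_norm [measurable (raw)]:
  fixes f :: "'a \<Rightarrow> complex^'m^'m"
  assumes [measurable]: "f \<in> borel_measurable M"
  shows "(\<lambda>x. op_norm (f x)) \<in> borel_measurable M"
proof -
  define C where "C = real CARD('m) * real CARD('m)"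
  have tri: "op_norm A \<le> op_norm B + C * norm (A - B)" for A B :: "complex^'m^'m"
  proof -
    have "op_norm (B + (A - B)) \<le> op_norm B + op_norm (A - B)"
      unfolding op_norm_def matrix_vector_mult_add_rdistrib by (intro onorm_triangle) simp_all
    then show ?thesis using op_norm_le_norm[of "A - B"] by (simp add: C_def)
  qed
  have "C-lipschitz_on UNIV (op_norm :: complex^'m^'m \<Rightarrow> real)"
  proof (rule lipschitz_onI)
    fix A B :: "complex^'m^'m"
    show "dist (op_norm A) (op_norm B) \<le> C * dist A B"
      using tri[of A B] tri[of B A] by (simp add: dist_norm norm_minus_commute abs_le_iff)
  qed (simp add: C_def)
  then have "continuous_on UNIV (op_norm :: complex^'m^'m \<Rightarrow> real)"
    by (rule lipschitz_on_continuous_on)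
  then show ?thesis using assms by (rule borel_measurable_continuous_on)
qed

section \<open>Convolution operators on matrix weighted spaces\<close>

lemma ennpowr_top [simp]: "ennpowr top r = top"
  by (simp add: ennpowr_def)

lemma ennpowr_ennreal: "0 \<le> x \<Longrightarrow> ennpowr (ennreal x) r = ennreal (x powr r)"
  by (simp add: ennpowr_def)

lemma ennpowr_zero [simp]: "ennpowr 0 r = 0"
  by (simp add: ennpowr_def)

lemma ennpowr_one [simp]: "ennpowr x 1 = x"
  by (cases x rule: ennreal_cases) (simp_all add: ennpowr_ennreal)

lemma ennpowr_mono: "0 \<le> r \<Longrightarrow> x \<le> y \<Longrightarrow> ennpowr x r \<le> ennpowr y r"
  by (cases x rule: ennreal_cases; cases y rule: ennreal_cases)
    (auto simp: ennpowr_ennreal top_unique intro!: ennreal_leI powr_mono2)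

lemma ennpowr_mult: "0 < r \<Longrightarrow> ennpowr (x * y) r = ennpowr x r * ennpowr y r"
proof -
  assume r: "0 < r"
  show ?thesis
  proof (cases "x = top \<or> y = top")
    case False
    then obtain a b where "x = ennreal a" "y = ennreal b" "0 \<le> a" "0 \<le> b"
      by (metis ennreal_cases)
    then show ?thesis by (simp add: ennpowr_ennreal powr_mult flip: ennreal_mult)
  next
    case True
    have nz: "ennpowr z r = 0 \<longleftrightarrow> z = 0" for z
      by (cases z rule: ennreal_cases) (auto simp: ennpowr_ennreal ennreal_eq_0_iff)
    from True show ?thesis
      by (auto simp: ennreal_top_mult ennreal_mult_top nz)
  qed
qed

lemma ennpowr_ennpowr: "ennpowr (ennpowr x r) s = ennpowr x (r * s)"
  by (cases x rule: ennreal_cases) (simp_all add: ennpowr_ennreal powr_powr)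

lemma ennpowr_eq_top_iff [simp]: "ennpowr x r = top \<longleftrightarrow> x = top"
  by (simp add: ennpowr_def)

lemma ennpowr_less_top_iff [simp]: "ennpowr x r < top \<longleftrightarrow> x < top"
  by (metis ennpowr_eq_top_iff less_top)

lemma ennpowr_eq_0_iff [simp]: "ennpowr x r = 0 \<longleftrightarrow> x = 0"
  by (cases x rule: ennreal_cases) (auto simp: ennpowr_ennreal ennreal_eq_0_iff)

lemma borel_measurable_ennpowr [measurable (raw)]:
  assumes [measurable]: "f \<in> borel_measurable M"
  shows "(\<lambda>x. ennpowr (f x) r) \<in> borel_measurable M"
  unfolding ennpowr_def by measurable

text \<open>Raised to the power p, so that the exponent p - 1 = p / p' of the inner average in
  \<open>Ap_const\<close> appears directly and no roots occur. Norms equal to 0 or infinity are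
  separated, since the proof through Young's inequality divides by both norms.\<close>

lemma nn_integral_Holder:
  fixes f g :: "'a \<Rightarrow> real"
  assumes p: "1 < p"
    and [measurable]: "f \<in> borel_measurable M" "g \<in> borel_measurable M"
    and nn: "\<And>x. 0 \<le> f x" "\<And>x. 0 \<le> g x"
  defines "p' \<equiv> p / (p - 1)"
  shows "ennpowr (\<integral>\<^sup>+x. ennreal (f x * g x) \<partial>M) p \<le>
    ennpowr (\<integral>\<^sup>+x. ennreal (f x powr p') \<partial>M) (p - 1) * (\<integral>\<^sup>+x. ennreal (g x powr p) \<partial>M)"
proof -
  define F where "F = (\<integral>\<^sup>+x. ennreal (f x powr p') \<partial>M)"
  define G where "G = (\<integral>\<^sup>+x. ennreal (g x powr p) \<partial>M)"
  have p': "1 < p'" "1/p' + 1/p = 1" using p by (simp_all add: p'_def field_simps)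
  consider "F = 0 \<or> G = 0" | "F \<noteq> 0" "G \<noteq> 0" "F = top \<or> G = top"
    | a b where "F = ennreal a" "G = ennreal b" "0 < a" "0 < b"
  proof (cases "F = 0 \<or> G = 0")
    case False
    show ?thesis
    proof (cases "F = top \<or> G = top")
      case True then show ?thesis using False that(2) by blast
    next
      case fin: False
      then obtain a b where "F = ennreal a" "G = ennreal b" "0 \<le> a" "0 \<le> b" by (metis ennreal_cases)
      then show ?thesis using False that(3)[of a b] by (cases "a = 0"; cases "b = 0") auto
    qed
  qed (use that in blast)
  then have "ennpowr (\<integral>\<^sup>+x. ennreal (f x * g x) \<partial>M) p \<le> ennpowr F (p - 1) * G"
  proof cases
    case 1
    then have "AE x in M. f x * g x = 0"
      using p p' nn
      by (auto simp: F_def G_def nn_integral_0_iff_AE ennreal_eq_0_iff elim: eventually_mono)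
    then have "(\<integral>\<^sup>+x. ennreal (f x * g x) \<partial>M) = 0"
      by (subst nn_integral_0_iff_AE) (auto elim: eventually_mono)
    then show ?thesis by simp
  next
    case 2
    then show ?thesis using p by (auto simp: ennreal_top_mult ennreal_mult_top)
  next
    case (3 a b)
    \<comment> \<open>\<open>u\<close> and \<open>v\<close> are the norms of f and g; Young's
      inequality is applied to the normalised functions f / u and g / v.\<close>
    define u where "u = a powr (1/p')"
    define v where "v = b powr (1/p)"
    have pos: "0 < u" "0 < v" using 3 by (simp_all add: u_def v_def)
    have up: "u powr p' = a" "v powr p = b" using 3 p p' by (simp_all add: u_def v_def powr_powr)
    have "(\<integral>\<^sup>+x. ennreal (f x * g x) \<partial>M) \<le>
        (\<integral>\<^sup>+x. ennreal (u * v / p' / a) * ennreal (f x powr p') + ennreal (u * v / p / b) * ennreal (g x powr p) \<partial>M)"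
    proof (rule nn_integral_mono)
      fix x
      have "(f x / u) * (g x / v) \<le> (f x / u) powr p' / p' + (g x / v) powr p / p"
        using p p' nn pos by (intro Youngs_inequality) auto
      then have "(u * v) * ((f x / u) * (g x / v)) \<le> (u * v) * (f x powr p' / a / p' + g x powr p / b / p)"
        using pos nn by (intro mult_left_mono) (auto simp: powr_divide up)
      then have "f x * g x \<le> u * v / p' / a * (f x powr p') + u * v / p / b * (g x powr p)"
        using pos by (simp add: field_simps)
      then have "ennreal (f x * g x) \<le> ennreal (u * v / p' / a * (f x powr p') + u * v / p / b * (g x powr p))"
        by (rule ennreal_leI)
      also have "\<dots> = ennreal (u * v / p' / a) * ennreal (f x powr p') + ennreal (u * v / p / b) * ennreal (g x powr p)"
      proof -
        have lin: "ennreal (A * X + B * Y) = ennreal A * ennreal X + ennreal B * ennreal Y"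
          if "0 \<le> A" "0 \<le> X" "0 \<le> B" "0 \<le> Y" for A B X Y
          using that by (simp add: ennreal_mult)
        show ?thesis by (rule lin) (use pos 3 p p' in auto)
      qed
      finally show "ennreal (f x * g x) \<le> ennreal (u * v / p' / a) * ennreal (f x powr p') + ennreal (u * v / p / b) * ennreal (g x powr p)" .
    qed
    also have "\<dots> = ennreal (u * v / p' / a) * F + ennreal (u * v / p / b) * G"
      unfolding F_def G_def by (subst nn_integral_add) (auto simp: nn_integral_cmult)
    also have "\<dots> = ennreal (u * v / p' + u * v / p)"
      using pos 3 p p' by (simp add: ennreal_plus flip: ennreal_mult)
    also have "u * v / p' + u * v / p = u * v"
    proof -
      have "u * v / p' + u * v / p = u * v * (1 / p' + 1 / p)" by (simp add: distrib_left)
      then show ?thesis using p' by simp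
    qed
    finally have "ennpowr (\<integral>\<^sup>+x. ennreal (f x * g x) \<partial>M) p \<le> ennpowr (ennreal (u * v)) p"
      using p by (intro ennpowr_mono[of p]) auto
    also have "\<dots> = ennreal (u powr p * b)"
      using pos by (simp add: ennpowr_ennreal powr_mult up)
    also have "u powr p = a powr (p - 1)"
      using p 3 by (simp add: u_def powr_powr p'_def)
    finally show ?thesis using 3 by (simp add: ennpowr_ennreal ennreal_mult)
  qed
  then show ?thesis by (simp add: F_def G_def)
qed

text \<open>Weights are measurable only for the completed measure, so Tonelli's theorem is wanted
  for \<open>lebesgue\<close> itself; sigma-finiteness passes from \<open>lborel\<close> to its
  completion.\<close>

lemma sigma_finite_lebesgue: "sigma_finite_measure (lebesgue :: 'a::euclidean_space measure)"
proof -
  obtain A :: "nat \<Rightarrow> 'a set" where A: "range A \<subseteq> sets lborel" "(\<Union>i. A i) = space lborel"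
    "\<And>i. emeasure lborel (A i) \<noteq> \<infinity>"
    using lborel.sigma_finite by metis
  show ?thesis
  proof (standard, intro exI[of _ "range A"] conjI ballI)
    show "range A \<subseteq> sets lebesgue" using A(1) by (auto intro: sets_completionI_sets)
    show "\<Union> (range A) = space lebesgue" using A(2) by simp
    fix a assume "a \<in> range A"
    then show "emeasure lebesgue a \<noteq> \<infinity>" using A by (auto simp: emeasure_completion subset_eq main_part_sets)
  qed auto
qed

interpretation lebesgue: sigma_finite_measure "lebesgue :: 'a::euclidean_space measure"
  by (rule sigma_finite_lebesgue)

interpretation lebesgue_pair: pair_sigma_finite
  "lebesgue :: 'a::euclidean_space measure" "lebesgue :: 'b::euclidean_space measure" ..

section \<open>Unit cubes and lattice sums\<close>

lemma countable_vec_int: "countable (UNIV :: (int^'n) set)"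
proof -
  have "inj (\<lambda>x :: int^'n. (\<lambda>i. x $ i))" by (auto intro!: injI simp: vec_eq_iff fun_eq_iff)
  moreover have "countable (UNIV :: ('n \<Rightarrow> int) set)" by simp
  ultimately show ?thesis by (rule countable_image_inj_on[OF countable_subset, OF subset_UNIV, rotated])
qed

definition cube_index :: "real^'n \<Rightarrow> int^'n" where
  "cube_index x = (\<chi> i. \<lfloor>x $ i + 1/2\<rfloor>)"

lemma mem_unit_cube_iff: "x \<in> unit_cube a \<longleftrightarrow> a = cube_index x"
proof -
  have "(real_of_int (a $ i) - 1/2 \<le> x $ i \<and> x $ i < real_of_int (a $ i) + 1/2) \<longleftrightarrow> a $ i = \<lfloor>x $ i + 1/2\<rfloor>" for i
    by linarith
  then show ?thesis by (simp add: unit_cube_def cube_index_def vec_eq_iff)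
qed

lemma sets_unit_cube [measurable]: "unit_cube (a :: int^'n) \<in> sets borel"
proof -
  have "{x :: real^'n. \<forall>i\<in>UNIV. real_of_int (a $ i) - 1/2 \<le> x $ i \<and> x $ i < real_of_int (a $ i) + 1/2} \<in> sets borel"
    by measurable
  then show ?thesis by (simp add: unit_cube_def)
qed

lemma sets_lebesgue_unit_cube [measurable]: "unit_cube (a :: int^'n) \<in> sets lebesgue"
  using sets_unit_cube by (simp add: sets_completionI_sets)

lemma ennreal_mult_divide_cancel: "0 < v \<Longrightarrow> ennreal v * (X / ennreal v) = X"
proof -
  assume v: "0 < v"
  have "ennreal v * (X / ennreal v) = X * ennreal v / ennreal v"
    by (simp only: ennreal_times_divide mult.commute)
  also have "\<dots> = X" using v by (intro mult_divide_eq_ennreal) auto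
  finally show ?thesis .
qed

lemma measurable_ident_lebesgue: "(\<lambda>x. x) \<in> borel_measurable (lebesgue :: 'a::euclidean_space measure)"
  by (intro measurable_completion) simp

text \<open>The half-open cubes partition the space. The sum over cubes is an integral for the
  counting measure, so that sums and integrals are exchanged by the same rules.\<close>

lemma nn_integral_unit_cubes:
  fixes h :: "real^'n \<Rightarrow> ennreal"
  assumes [measurable]: "h \<in> borel_measurable lebesgue"
  shows "(\<integral>\<^sup>+x. h x \<partial>lebesgue) =
    (\<integral>\<^sup>+a. (\<integral>\<^sup>+x. h x * indicator (unit_cube a) x \<partial>lebesgue) \<partial>count_space UNIV)"
proof -
  have "(\<integral>\<^sup>+x. h x \<partial>lebesgue) = (\<integral>\<^sup>+x. \<integral>\<^sup>+a. h x * indicator (unit_cube a) x \<partial>count_space UNIV \<partial>lebesgue)"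
  proof (rule nn_integral_cong)
    fix x :: "real^'n"
    have "(\<integral>\<^sup>+a. h x * indicator (unit_cube a) x \<partial>count_space UNIV) =
        (\<integral>\<^sup>+a. h x * indicator {cube_index x} a \<partial>count_space UNIV)"
      by (intro nn_integral_cong) (auto simp: indicator_def mem_unit_cube_iff)
    also have "\<dots> = h x" by (subst nn_integral_cmult_indicator) auto
    finally show "h x = (\<integral>\<^sup>+a. h x * indicator (unit_cube a) x \<partial>count_space UNIV)" by simp
  qed
  also have "\<dots> = (\<integral>\<^sup>+a. (\<integral>\<^sup>+x. h x * indicator (unit_cube a) x \<partial>lebesgue) \<partial>count_space UNIV)"
    by (intro nn_integral_count_space_nn_integral countable_vec_int) measurable
  finally show ?thesis .
qed

lemma norm_unit_cube_le:
  fixes x :: "real^'n"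
  assumes "x \<in> unit_cube a" shows "norm (x - real_vec a) \<le> real CARD('n)"
proof -
  have "norm (x - real_vec a) \<le> (\<Sum>i\<in>UNIV. \<bar>(x - real_vec a) $ i\<bar>)" by (rule norm_le_l1_cart)
  also have "\<dots> \<le> (\<Sum>i\<in>(UNIV::'n set). 1)"
  proof (rule sum_mono)
    fix i :: 'n
    have "real_of_int (a $ i) - 1/2 \<le> x $ i" "x $ i < real_of_int (a $ i) + 1/2"
      using assms by (simp_all add: unit_cube_def)
    then show "\<bar>(x - real_vec a) $ i\<bar> \<le> 1" by (simp add: real_vec_def abs_le_iff)
  qed
  finally show ?thesis by simp
qed

lemma emeasure_unit_cube_ge: "1 \<le> emeasure lborel (unit_cube (a :: int^'n))"
proof -
  let ?l = "real_vec a - (\<chi> i. 1/2)" and ?u = "real_vec a + (\<chi> i. 1/2)"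
  have "emeasure lborel (box ?l ?u) = ennreal (\<Prod>b\<in>Basis. (?u - ?l) \<bullet> b)"
    by (rule emeasure_lborel_box) (auto simp: Basis_vec_def inner_axis)
  also have "(\<Prod>b\<in>Basis. (?u - ?l) \<bullet> b) = 1"
    by (rule prod.neutral) (auto simp: Basis_vec_def inner_axis)
  finally have "1 = emeasure lborel (box ?l ?u)" by simp
  also have "\<dots> \<le> emeasure lborel (unit_cube a)"
    by (rule emeasure_mono) (auto simp: mem_box_cart unit_cube_def real_vec_def less_imp_le)
  finally show ?thesis .
qed

lemma nn_integral_inverse_1_plus_square_finite:
  "(\<integral>\<^sup>+t. ennreal (1 / (1 + t\<^sup>2)) \<partial>lborel) < \<infinity>"
proof -
  have "integrable lborel (\<lambda>t::real. inverse (1 + t\<^sup>2) :: real)"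
    using integrable_inverse_1_plus_square by (simp add: set_integrable_def einterval_def)
  then have "(\<integral>\<^sup>+t. ennreal (norm (inverse (1 + (t :: real)\<^sup>2))) \<partial>lborel) < \<infinity>"
    unfolding integrable_iff_bounded by (rule conjunct2)
  then show ?thesis by (simp add: divide_inverse)
qed

text \<open>The order 2n comes from comparing with the product of the n functions 1 / (1 + x_b^2),
  each of whose denominators is at most (1 + |x|)^2; the integral of the product is a power of a
  one-dimensional integral.\<close>

lemma nn_integral_inverse_power_norm_finite:
  assumes N: "2 * CARD('n) \<le> N"
  shows "(\<integral>\<^sup>+x. ennreal (1 / (1 + norm (x :: real^'n)) ^ N) \<partial>lborel) < \<infinity>"
proof -
  have "(\<integral>\<^sup>+x. ennreal (1 / (1 + norm (x :: real^'n)) ^ N) \<partial>lborel) \<le>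
      (\<integral>\<^sup>+x. (\<Prod>b\<in>(Basis :: (real^'n) set). ennreal (1 / (1 + (x \<bullet> b)\<^sup>2))) \<partial>lborel)"
  proof (rule nn_integral_mono)
    fix x :: "real^'n"
    have "(\<Prod>b\<in>(Basis :: (real^'n) set). (1 + (x \<bullet> b)\<^sup>2)) \<le> (\<Prod>b\<in>(Basis :: (real^'n) set). (1 + norm x)\<^sup>2)"
    proof (rule prod_mono, safe)
      fix b :: "real^'n" assume "b \<in> Basis"
      then have "\<bar>x \<bullet> b\<bar> \<le> norm x" by (rule Basis_le_norm)
      then have "(x \<bullet> b)\<^sup>2 \<le> (norm x)\<^sup>2" by (metis abs_le_square_iff abs_norm_cancel)
      then show "1 + (x \<bullet> b)\<^sup>2 \<le> (1 + norm x)\<^sup>2" using norm_ge_zero[of x] unfolding power2_sum one_power2 by linarith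
    qed simp
    also have "\<dots> = (1 + norm x) ^ (2 * CARD('n))"
      by (simp add: power_mult[symmetric] prod_constant)
    also have "\<dots> \<le> (1 + norm x) ^ N" using N by (intro power_increasing) auto
    finally have "1 / (1 + norm x) ^ N \<le> 1 / (\<Prod>b\<in>(Basis :: (real^'n) set). (1 + (x \<bullet> b)\<^sup>2))"
      by (intro divide_left_mono) (auto intro!: mult_pos_pos prod_pos add_pos_nonneg zero_less_power)
    also have "\<dots> = (\<Prod>b\<in>(Basis :: (real^'n) set). 1 / (1 + (x \<bullet> b)\<^sup>2))"
      by (simp add: prod_dividef)
    finally show "ennreal (1 / (1 + norm x) ^ N) \<le> (\<Prod>b\<in>(Basis :: (real^'n) set). ennreal (1 / (1 + (x \<bullet> b)\<^sup>2)))"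
      by (subst prod_ennreal) (auto intro: ennreal_leI)
  qed
  also have "\<dots> = (\<Prod>b\<in>(Basis :: (real^'n) set). (\<integral>\<^sup>+t. ennreal (1 / (1 + t\<^sup>2)) \<partial>lborel))"
    by (rule nn_integral_lborel_prod) auto
  also have "\<dots> < \<infinity>"
    using nn_integral_inverse_1_plus_square_finite
    by (simp add: power_less_top_ennreal)
  finally show ?thesis .
qed

text \<open>For x in the cube b, 1 + |x - a| is at most (1 + n) (1 + |a - b|), so each term is
  dominated by an integral over its cube. Translation invariance makes the total independent of
  \<open>a\<close>.\<close>

lemma lattice_sum_finite:
  assumes N: "2 * CARD('n) \<le> N"
  obtains S where "S < \<infinity>" "\<And>a :: int^'n. (\<integral>\<^sup>+b. ennreal (1 / (1 + norm (real_vec a - real_vec b)) ^ N) \<partial>count_space UNIV) \<le> S"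
proof
  define n where "n = real CARD('n)"
  define S where "S = ennreal ((1 + n) ^ N) * (\<integral>\<^sup>+x. ennreal (1 / (1 + norm (x :: real^'n)) ^ N) \<partial>lborel)"
  show "S < \<infinity>"
    unfolding S_def using nn_integral_inverse_power_norm_finite[OF N] by (simp add: ennreal_mult_less_top)
  fix a :: "int^'n"
  have le: "ennreal (1 / (1 + norm (real_vec a - real_vec b)) ^ N) \<le>
      (\<integral>\<^sup>+x. (ennreal ((1 + n) ^ N) * ennreal (1 / (1 + norm (x - real_vec a)) ^ N)) * indicator (unit_cube b) x \<partial>lebesgue)"
    for b :: "int^'n"
  proof -
    let ?c = "ennreal (1 / (1 + norm (real_vec a - real_vec b)) ^ N)"
    have "?c * 1 \<le> ?c * emeasure lborel (unit_cube b)"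
      by (intro mult_left_mono emeasure_unit_cube_ge) simp
    also have "\<dots> = (\<integral>\<^sup>+x. ?c * indicator (unit_cube b) x \<partial>lebesgue)"
      by (subst nn_integral_cmult_indicator) (simp_all add: sets_completionI_sets)
    also have "\<dots> \<le> (\<integral>\<^sup>+x. (ennreal ((1 + n) ^ N) * ennreal (1 / (1 + norm (x - real_vec a)) ^ N)) * indicator (unit_cube b) x \<partial>lebesgue)"
    proof (intro nn_integral_mono)
      fix x :: "real^'n"
      show "?c * indicator (unit_cube b) x \<le> (ennreal ((1 + n) ^ N) * ennreal (1 / (1 + norm (x - real_vec a)) ^ N)) * indicator (unit_cube b) x"
      proof (cases "x \<in> unit_cube b")
        case True
        let ?d = "norm (real_vec a - real_vec b)"
        have "norm (x - real_vec a) \<le> norm (x - real_vec b) + ?d"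
          using norm_triangle_ineq4[of "x - real_vec b" "real_vec a - real_vec b"] by simp
        also have "\<dots> \<le> n + ?d" using norm_unit_cube_le[OF True] by (simp add: n_def)
        finally have le: "norm (x - real_vec a) \<le> n + ?d" .
        have "1 + norm (x - real_vec a) \<le> (1 + n) * (1 + ?d)"
        proof -
          have "0 \<le> n * ?d" by (simp add: n_def)
          moreover have "(1 + n) * (1 + ?d) = 1 + n + ?d + n * ?d" by (simp add: algebra_simps)
          ultimately show ?thesis using le by linarith
        qed
        then have "(1 + norm (x - real_vec a)) ^ N \<le> (1 + n) ^ N * (1 + ?d) ^ N"
          by (metis power_mono power_mult_distrib add_nonneg_nonneg norm_ge_zero zero_le_one)
        then have "1 / (1 + ?d) ^ N \<le> (1 + n) ^ N * (1 / (1 + norm (x - real_vec a)) ^ N)"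
          by (simp add: divide_simps add_nonneg_eq_0_iff) (simp add: mult.commute add_pos_nonneg zero_less_power)
        then show ?thesis using True by (simp add: n_def ennreal_leI flip: ennreal_mult)
      qed simp
    qed
    finally show ?thesis by simp
  qed
  have m [measurable]: "(\<lambda>x. norm (x - real_vec a)) \<in> borel_measurable lebesgue"
    by (intro measurable_completion) simp
  have "(\<integral>\<^sup>+b. ennreal (1 / (1 + norm (real_vec a - real_vec b)) ^ N) \<partial>count_space UNIV) \<le>
     (\<integral>\<^sup>+x. (ennreal ((1 + n) ^ N) * ennreal (1 / (1 + norm (x - real_vec a)) ^ N)) \<partial>lebesgue)"
    by (subst nn_integral_unit_cubes) (measurable, auto intro!: nn_integral_mono le)
  also have "\<dots> = ennreal ((1 + n) ^ N) * (\<integral>\<^sup>+x. ennreal (1 / (1 + norm (x - real_vec a)) ^ N) \<partial>lebesgue)"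
    by (rule nn_integral_cmult) measurable
  also have "(\<integral>\<^sup>+x. ennreal (1 / (1 + norm (x - real_vec a)) ^ N) \<partial>lebesgue) =
      (\<integral>\<^sup>+x. ennreal (1 / (1 + norm (x - real_vec a)) ^ N) \<partial>lborel)"
    by (rule nn_integral_completion)
  also have "(\<integral>\<^sup>+x. ennreal (1 / (1 + norm (x - real_vec a)) ^ N) \<partial>lborel) =
      (\<integral>\<^sup>+x. ennreal (1 / (1 + norm x) ^ N) \<partial>distr lborel borel ((+) (- real_vec a)))"
    by (subst nn_integral_distr) simp_all
  also have "\<dots> = (\<integral>\<^sup>+x. ennreal (1 / (1 + norm (x :: real^'n)) ^ N) \<partial>lborel)"
    by (simp add: lborel_distr_plus)
  finally show "(\<integral>\<^sup>+b. ennreal (1 / (1 + norm (real_vec a - real_vec b)) ^ N) \<partial>count_space UNIV) \<le> S"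
    by (simp add: S_def)
qed

section \<open>The Muckenhoupt condition for pairs of cubes\<close>

text \<open>The integrand of \<open>Ap_const\<close>. Where W(y) is invertible, |W(x)^(1/p) v| is at
  most this kernel times |W(y)^(1/p) v|, which turns matrix weighted estimates into scalar
  ones.\<close>

definition weight_kernel :: "real \<Rightarrow> (real^'n \<Rightarrow> complex^'m^'m) \<Rightarrow> real^'n \<Rightarrow> real^'n \<Rightarrow> real" where
  "weight_kernel p W x y = op_norm (matrix_powr (W x) (1/p) ** matrix_powr (W y) (- 1/p))"

lemma weight_kernel_nonneg: "0 \<le> weight_kernel p W x y"
  by (simp add: weight_kernel_def op_norm_nonneg)

lemma measurable_matrix_powr_weight:
  "matrix_weight W \<Longrightarrow> (\<lambda>x. matrix_powr (W x) r) \<in> borel_measurable lebesgue"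
  by (intro borel_measurable_matrix_powr matrix_weight_measurable) (auto simp: matrix_weight_def)

lemma borel_measurable_matrix_mult [measurable (raw)]:
  fixes f g :: "'a \<Rightarrow> complex^'m^'m"
  assumes "f \<in> borel_measurable M" "g \<in> borel_measurable M"
  shows "(\<lambda>x. f x ** g x) \<in> borel_measurable M"
  using assms by (rule borel_measurable_continuous_Pair) (intro continuous_intros)

lemma borel_measurable_matrix_vector_mult [measurable (raw)]:
  fixes f :: "'a \<Rightarrow> complex^'m^'m"
  assumes "f \<in> borel_measurable M" "g \<in> borel_measurable M"
  shows "(\<lambda>x. f x *v g x) \<in> borel_measurable M"
  using assms by (rule borel_measurable_continuous_Pair) (simp add: matrix_vector_mult_def, intro continuous_intros)

lemma measurable_weight_kernel:
  assumes "matrix_weight W"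
  shows "(\<lambda>z. weight_kernel p W (fst z) (snd z)) \<in> borel_measurable (lebesgue \<Otimes>\<^sub>M lebesgue)"
  unfolding weight_kernel_def
  by (intro borel_measurable_op_norm borel_measurable_matrix_mult
      measurable_compose[OF measurable_fst measurable_matrix_powr_weight[OF assms]]
      measurable_compose[OF measurable_snd measurable_matrix_powr_weight[OF assms]])

lemma measurable_weight_kernel1:
  assumes "matrix_weight W"
  shows "weight_kernel p W x \<in> borel_measurable lebesgue"
  using measurable_compose_Pair1[OF _ measurable_weight_kernel[OF assms], of x p] by simp

lemma measurable_weight_kernel2:
  assumes "matrix_weight W"
  shows "(\<lambda>x. weight_kernel p W x y) \<in> borel_measurable lebesgue"
  using measurable_compose[OF measurable_Pair2' measurable_weight_kernel[OF assms], of y p] by simp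

lemma unit_cubes_in_ball:
  fixes a b :: "int^'n"
  defines "R \<equiv> norm (real_vec a - real_vec b) + real CARD('n) + 1"
  shows "unit_cube a \<subseteq> ball (real_vec a) R" "unit_cube b \<subseteq> ball (real_vec a) R"
proof -
  show "unit_cube a \<subseteq> ball (real_vec a) R"
  proof
    fix x assume "x \<in> unit_cube a"
    from norm_unit_cube_le[OF this] norm_ge_zero[of "real_vec a - real_vec b"]
    show "x \<in> ball (real_vec a) R" unfolding R_def mem_ball dist_norm norm_minus_commute[of "real_vec a" x]
      by linarith
  qed
  show "unit_cube b \<subseteq> ball (real_vec a) R"
  proof
    fix x assume "x \<in> unit_cube b"
    from norm_unit_cube_le[OF this] norm_triangle_ineq[of "real_vec a - real_vec b" "real_vec b - x"]
    show "x \<in> ball (real_vec a) R" unfolding R_def mem_ball dist_norm by (simp add: norm_minus_commute)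
  qed
qed

text \<open>Connects the \<open>matrix_inv\<close> of \<open>A1_const\<close> with the power -1 in
  \<open>weight_kernel\<close>.\<close>

lemma matrix_inv_eq:
  fixes A :: "complex^'m^'m"
  assumes "B ** A = mat 1" shows "matrix_inv A = B"
proof -
  have AB: "A ** B = mat 1" using assms matrix_left_right_inverse by blast
  have "A ** matrix_inv A = mat 1 \<and> matrix_inv A ** A = mat 1"
    unfolding matrix_inv_def by (rule someI[of _ B]) (use AB assms in blast)
  then have "B ** (A ** matrix_inv A) = B" by simp
  then show ?thesis unfolding matrix_mul_assoc assms by simp
qed

text \<open>\<open>v\<close> is the volume of a ball containing both cubes. Hoelder's inequality in
  y isolates the p'-norm of the kernel; enlarging both cubes to the ball produces the iterated
  average in \<open>Ap_const\<close>. Undoing the averages costs v^(p-1) inside and v outside,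
  together v^p.\<close>

lemma cube_estimate_gt1:
  fixes W :: "real^'n \<Rightarrow> complex^'m^'m" and a b :: "int^'n"
  assumes p: "1 < p" and W: "matrix_weight W"
    and [measurable]: "h \<in> borel_measurable lebesgue" and h: "\<And>y. 0 \<le> h y"
  defines "v \<equiv> unit_ball_vol (real CARD('n)) * (norm (real_vec a - real_vec b) + real CARD('n) + 1) ^ CARD('n)"
  shows "(\<integral>\<^sup>+x. ennpowr (\<integral>\<^sup>+y. ennreal (weight_kernel p W x y * h y) * indicator (unit_cube b) y \<partial>lebesgue) p
      * indicator (unit_cube a) x \<partial>lebesgue)
    \<le> ennreal (v powr p) * Ap_const p W * (\<integral>\<^sup>+y. ennreal (h y powr p) * indicator (unit_cube b) y \<partial>lebesgue)"
proof -
  define p' where "p' = p / (p - 1)"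
  define R where "R = norm (real_vec a - real_vec b) + real CARD('n) + 1"
  define B where "B = ball (real_vec a) R"
  have R: "0 < R" unfolding R_def by (simp add: add_nonneg_pos)
  have v: "0 < v" unfolding v_def using R by (simp add: R_def)
  have B: "B \<in> balls" "emeasure lebesgue B = ennreal v" "B \<in> sets lebesgue"
    using R by (auto simp: balls_def B_def v_def R_def emeasure_ball sets_completionI_sets)
  have cub: "unit_cube a \<subseteq> B" "unit_cube b \<subseteq> B"
    unfolding B_def R_def by (rule unit_cubes_in_ball)+
  have pp: "p / p' = p - 1" "0 < p'" using p by (simp_all add: p'_def)
  note [measurable] = measurable_weight_kernel[OF W] measurable_weight_kernel1[OF W] B(3)
  define M where "M = weight_kernel p W"
  have [measurable]: "M x \<in> borel_measurable lebesgue" for x by (simp add: M_def)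
  have M2 [measurable]: "(\<lambda>z. M (fst z) (snd z)) \<in> borel_measurable (lebesgue \<Otimes>\<^sub>M lebesgue)"
    by (simp add: M_def)
  have M0: "0 \<le> M x y" for x y by (simp add: M_def weight_kernel_nonneg)
  define I where "I x = (\<integral>\<^sup>+y. ennreal (M x y powr p') * indicator B y \<partial>lebesgue)" for x
  have I_meas [measurable]: "I \<in> borel_measurable lebesgue"
  proof -
    have "(\<lambda>z. ennreal (M (fst z) (snd z) powr p') * indicator B (snd z)) \<in> borel_measurable (lebesgue \<Otimes>\<^sub>M lebesgue)"
      by measurable
    from lebesgue.borel_measurable_nn_integral_fst[OF this] show ?thesis by (simp add: I_def[abs_def])
  qed
  define H where "H = (\<integral>\<^sup>+y. ennreal (h y powr p) * indicator (unit_cube b) y \<partial>lebesgue)"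
  have hold: "ennpowr (\<integral>\<^sup>+y. ennreal (M x y * h y) * indicator (unit_cube b) y \<partial>lebesgue) p \<le> ennpowr (I x) (p - 1) * H" for x
  proof -
    let ?i = "indicator (unit_cube b) :: real^'n \<Rightarrow> real"
    have "ennpowr (\<integral>\<^sup>+y. ennreal (M x y * h y) * indicator (unit_cube b) y \<partial>lebesgue) p =
        ennpowr (\<integral>\<^sup>+y. ennreal ((M x y * ?i y) * (h y * ?i y)) \<partial>lebesgue) p"
      by (intro arg_cong[where f="\<lambda>z. ennpowr z p"] nn_integral_cong) (auto simp: indicator_def)
    also have "\<dots> \<le> ennpowr (\<integral>\<^sup>+y. ennreal ((M x y * ?i y) powr p') \<partial>lebesgue) (p - 1)
        * (\<integral>\<^sup>+y. ennreal ((h y * ?i y) powr p) \<partial>lebesgue)"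
      unfolding p'_def by (rule nn_integral_Holder[OF p]) (auto simp: M0 h)
    also have "(\<integral>\<^sup>+y. ennreal ((h y * ?i y) powr p) \<partial>lebesgue) = H"
      unfolding H_def by (intro nn_integral_cong) (auto simp: indicator_def)
    also have "ennpowr (\<integral>\<^sup>+y. ennreal ((M x y * ?i y) powr p') \<partial>lebesgue) (p - 1) \<le> ennpowr (I x) (p - 1)"
      unfolding I_def using p cub
      by (intro ennpowr_mono[of "p - 1"] nn_integral_mono) (auto simp: indicator_def)
    finally show ?thesis by (simp add: mult_right_mono)
  qed
  have avg: "ennpowr (I x) (p - 1) = ennreal (v powr (p - 1)) * ennpowr (average B (\<lambda>y. ennreal (M x y powr p'))) (p - 1)" for x
  proof -
    have "I x = ennreal v * (I x / ennreal v)"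
      by (rule ennreal_mult_divide_cancel[OF v, symmetric])
    also have "I x / ennreal v = average B (\<lambda>y. ennreal (M x y powr p'))"
      by (simp add: average_def I_def B(2))
    finally have "ennpowr (I x) (p - 1) = ennpowr (ennreal v * average B (\<lambda>y. ennreal (M x y powr p'))) (p - 1)"
      by simp
    then show ?thesis using p v by (simp add: ennpowr_mult ennpowr_ennreal)
  qed
  have Ap: "average B (\<lambda>x. ennpowr (average B (\<lambda>y. ennreal (M x y powr p'))) (p - 1)) \<le> Ap_const p W"
    unfolding Ap_const_def Let_def p'_def[symmetric] pp M_def weight_kernel_def using B(1) by (rule SUP_upper)
  have Bint: "(\<integral>\<^sup>+x. ennpowr (I x) (p - 1) * indicator B x \<partial>lebesgue) \<le> ennreal (v powr p) * Ap_const p W"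
  proof -
    define J where "J x = ennpowr (average B (\<lambda>y. ennreal (M x y powr p'))) (p - 1)" for x
    have Jm: "J \<in> borel_measurable lebesgue"
    proof -
      have "J = (\<lambda>x. ennpowr (I x / ennreal v) (p - 1))"
        by (simp add: J_def[abs_def] average_def I_def B(2))
      then show ?thesis by simp
    qed
    note [measurable] = Jm
    have "(\<integral>\<^sup>+x. ennpowr (I x) (p - 1) * indicator B x \<partial>lebesgue) =
        (\<integral>\<^sup>+x. ennreal (v powr (p - 1)) * (J x * indicator B x) \<partial>lebesgue)"
      by (simp add: avg J_def mult.assoc)
    also have "\<dots> = ennreal (v powr (p - 1)) * (\<integral>\<^sup>+x. J x * indicator B x \<partial>lebesgue)"
      by (rule nn_integral_cmult) measurable
    also have "(\<integral>\<^sup>+x. J x * indicator B x \<partial>lebesgue) = ennreal v * average B J"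
      unfolding average_def B(2) by (rule ennreal_mult_divide_cancel[OF v, symmetric])
    also have "ennreal v * average B J \<le> ennreal v * Ap_const p W"
      using Ap by (intro mult_left_mono) (auto simp: J_def[abs_def])
    also have "ennreal (v powr (p - 1)) * (ennreal v * Ap_const p W) = ennreal (v powr p) * Ap_const p W"
    proof -
      have "v powr (p - 1) * v = v powr p" using v by (simp add: powr_diff)
      then show ?thesis using v by (simp add: mult.assoc[symmetric] flip: ennreal_mult)
    qed
    finally show ?thesis by (simp add: mult_left_mono)
  qed
  have "(\<integral>\<^sup>+x. ennpowr (\<integral>\<^sup>+y. ennreal (M x y * h y) * indicator (unit_cube b) y \<partial>lebesgue) p * indicator (unit_cube a) x \<partial>lebesgue)
      \<le> (\<integral>\<^sup>+x. (ennpowr (I x) (p - 1) * indicator B x) * H \<partial>lebesgue)"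
    using hold cub by (intro nn_integral_mono) (auto simp: indicator_def)
  also have "\<dots> = (\<integral>\<^sup>+x. ennpowr (I x) (p - 1) * indicator B x \<partial>lebesgue) * H"
    by (rule nn_integral_multc) measurable
  also have "\<dots> \<le> ennreal (v powr p) * Ap_const p W * H"
    by (intro mult_right_mono Bint) simp
  finally show ?thesis by (simp add: M_def H_def)
qed

text \<open>Tonelli's theorem takes the place of Hoelder's inequality: with the x-integral innermost
  and the cube enlarged to the ball of volume \<open>v\<close>, that integral is \<open>v\<close>
  times an average bounded by the constant for almost every y.\<close>

lemma cube_estimate_1:
  fixes W :: "real^'n \<Rightarrow> complex^'m^'m" and a b :: "int^'n"
  assumes W: "matrix_weight W"
    and [measurable]: "h \<in> borel_measurable lebesgue" and h: "\<And>y. 0 \<le> h y"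
  defines "v \<equiv> unit_ball_vol (real CARD('n)) * (norm (real_vec a - real_vec b) + real CARD('n) + 1) ^ CARD('n)"
  shows "(\<integral>\<^sup>+x. (\<integral>\<^sup>+y. ennreal (weight_kernel 1 W x y * h y) * indicator (unit_cube b) y \<partial>lebesgue)
      * indicator (unit_cube a) x \<partial>lebesgue)
    \<le> ennreal v * A1_const W * (\<integral>\<^sup>+y. ennreal (h y) * indicator (unit_cube b) y \<partial>lebesgue)"
proof -
  define R where "R = norm (real_vec a - real_vec b) + real CARD('n) + 1"
  define B where "B = ball (real_vec a) R"
  have R: "0 < R" unfolding R_def by (simp add: add_nonneg_pos)
  have v: "0 < v" unfolding v_def using R by (simp add: R_def)
  have B: "B \<in> balls" "emeasure lebesgue B = ennreal v" "B \<in> sets lebesgue"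
    using R by (auto simp: balls_def B_def v_def R_def emeasure_ball sets_completionI_sets)
  have cub: "unit_cube a \<subseteq> B" "unit_cube b \<subseteq> B"
    unfolding B_def R_def by (rule unit_cubes_in_ball)+
  define M where "M = weight_kernel 1 W"
  have M2 [measurable]: "(\<lambda>z. M (fst z) (snd z)) \<in> borel_measurable (lebesgue \<Otimes>\<^sub>M lebesgue)"
    by (simp add: M_def measurable_weight_kernel[OF W])
  have [measurable]: "(\<lambda>x. M x y) \<in> borel_measurable lebesgue" for y
    by (simp add: M_def measurable_weight_kernel2[OF W])
  have M0: "0 \<le> M x y" for x y by (simp add: M_def weight_kernel_nonneg)
  have "AE y in restrict_space lebesgue B. average B (\<lambda>t. ennreal (op_norm (W t ** matrix_inv (W y)))) \<le> A1_const W"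
  proof -
    let ?f = "\<lambda>y. average B (\<lambda>t. ennreal (op_norm (W t ** matrix_inv (W y))))"
    have "esssup (restrict_space lebesgue B) ?f \<le> A1_const W"
      unfolding A1_const_def using B(1) by (rule SUP_upper)
    then show ?thesis using esssup_AE[of ?f "restrict_space lebesgue B"]
      by (auto elim!: eventually_mono intro: order_trans)
  qed
  then have ae: "AE y in lebesgue. y \<in> B \<longrightarrow> average B (\<lambda>t. ennreal (op_norm (W t ** matrix_inv (W y)))) \<le> A1_const W"
    using B(3) by (subst (asm) AE_restrict_space_iff) auto
  have inv: "AE y in lebesgue. invertible (W y)" and nn: "\<And>x. nonneg_definite (W x)"
    using W by (auto simp: matrix_weight_def)
  \<comment> \<open>The essential supremum controls almost every y only; intersecting with the
    points where W(y) is invertible identifies the kernel with the norm of W(x) W(y)^(-1).\<close>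
  have ae2: "AE y in lebesgue. y \<in> B \<longrightarrow> (\<integral>\<^sup>+x. ennreal (M x y) * indicator B x \<partial>lebesgue) \<le> ennreal v * A1_const W"
    using ae inv
  proof eventually_elim
    case (elim y)
    have Mxy: "M x y = op_norm (W x ** matrix_inv (W y))" for x
      using matrix_inv_eq[of "matrix_powr (W y) (- 1)" "W y"] matrix_powr_inverse[OF nn elim(2), of 1]
      by (simp add: M_def weight_kernel_def matrix_powr_one nn)
    have *: "(\<integral>\<^sup>+x. ennreal (M x y) * indicator B x \<partial>lebesgue) = ennreal v * average B (\<lambda>t. ennreal (op_norm (W t ** matrix_inv (W y))))"
      unfolding average_def B(2) Mxy by (rule ennreal_mult_divide_cancel[OF v, symmetric])
    show ?case unfolding * using elim(1) by (auto intro: mult_left_mono)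
  qed
  have "(\<integral>\<^sup>+x. (\<integral>\<^sup>+y. ennreal (M x y * h y) * indicator (unit_cube b) y \<partial>lebesgue) * indicator (unit_cube a) x \<partial>lebesgue)
    \<le> (\<integral>\<^sup>+x. (\<integral>\<^sup>+y. (ennreal (M x y) * indicator B x) * (ennreal (h y) * indicator (unit_cube b) y) \<partial>lebesgue) \<partial>lebesgue)"
    using cub by (intro nn_integral_mono) (auto simp: indicator_def ennreal_mult M0 h mult.assoc)
  also have "\<dots> = (\<integral>\<^sup>+y. (\<integral>\<^sup>+x. (ennreal (M x y) * indicator B x) * (ennreal (h y) * indicator (unit_cube b) y) \<partial>lebesgue) \<partial>lebesgue)"
  proof (rule lebesgue_pair.Fubini'[symmetric])
    note [measurable] = B(3)
    show "(\<lambda>(x, y). (ennreal (M x y) * indicator B x) * (ennreal (h y) * indicator (unit_cube b) y)) \<in> borel_measurable (lebesgue \<Otimes>\<^sub>M lebesgue)"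
      unfolding case_prod_beta by measurable
  qed
  also have "\<dots> = (\<integral>\<^sup>+y. (\<integral>\<^sup>+x. ennreal (M x y) * indicator B x \<partial>lebesgue) * (ennreal (h y) * indicator (unit_cube b) y) \<partial>lebesgue)"
  proof (intro nn_integral_cong nn_integral_multc)
    note [measurable] = B(3)
    show "(\<lambda>x. ennreal (M x y) * indicator B x) \<in> borel_measurable lebesgue" for y by measurable
  qed
  also have "\<dots> \<le> (\<integral>\<^sup>+y. ennreal v * A1_const W * (ennreal (h y) * indicator (unit_cube b) y) \<partial>lebesgue)"
    using ae2 cub by (intro nn_integral_mono_AE) (auto elim!: eventually_mono simp: indicator_def intro: mult_right_mono)
  also have "\<dots> = ennreal v * A1_const W * (\<integral>\<^sup>+y. ennreal (h y) * indicator (unit_cube b) y \<partial>lebesgue)"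
    by (rule nn_integral_cmult) measurable
  finally show ?thesis by (simp add: M_def)
qed

text \<open>A ball around two cubes with centres at distance d has volume at most a constant times
  (1 + d)^n. The p-th power of this volume is the price for passing from one cube to the
  other.\<close>

lemma cube_estimate:
  fixes W :: "real^'n \<Rightarrow> complex^'m^'m"
  assumes p: "1 \<le> p" and W: "W \<in> Muckenhoupt p"
  obtains A where "A < \<infinity>"
    "\<And>(a :: int^'n) b h. h \<in> borel_measurable lebesgue \<Longrightarrow> (\<And>y. 0 \<le> h y) \<Longrightarrow>
      (\<integral>\<^sup>+x. ennpowr (\<integral>\<^sup>+y. ennreal (weight_kernel p W x y * h y) * indicator (unit_cube b) y \<partial>lebesgue) p
        * indicator (unit_cube a) x \<partial>lebesgue)
      \<le> A * ennreal ((1 + norm (real_vec a - real_vec b)) powr (real CARD('n) * p)) *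
        (\<integral>\<^sup>+y. ennreal (h y powr p) * indicator (unit_cube b) y \<partial>lebesgue)"
proof -
  define n where "n = CARD('n)"
  define X where "X = (if p = 1 then A1_const W else Ap_const p W)"
  define A where "A = ennreal ((unit_ball_vol (real n) * (1 + real n) ^ n) powr p) * X"
  have mw: "matrix_weight W" and X: "X < \<infinity>"
    using W by (auto simp: Muckenhoupt_def X_def split: if_splits)
  have "A < \<infinity>" using X by (simp add: A_def ennreal_mult_less_top)
  moreover have "(\<integral>\<^sup>+x. ennpowr (\<integral>\<^sup>+y. ennreal (weight_kernel p W x y * h y) * indicator (unit_cube b) y \<partial>lebesgue) p
        * indicator (unit_cube a) x \<partial>lebesgue)
      \<le> A * ennreal ((1 + norm (real_vec a - real_vec b)) powr (real CARD('n) * p)) *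
        (\<integral>\<^sup>+y. ennreal (h y powr p) * indicator (unit_cube b) y \<partial>lebesgue)" (is "?L \<le> _ * ?H")
    if h: "h \<in> borel_measurable lebesgue" "\<And>y. 0 \<le> h y" for a b :: "int^'n" and h
  proof -
    define d where "d = norm (real_vec a - real_vec b)"
    define v where "v = unit_ball_vol (real n) * (d + real n + 1) ^ n"
    have d: "0 \<le> d" by (simp add: d_def)
    have "?L \<le> ennreal (v powr p) * X * ?H"
    proof (cases "p = 1")
      case True
      then show ?thesis using cube_estimate_1[OF mw h, where a=a and b=b] h d
        by (simp add: X_def v_def d_def n_def abs_of_nonneg)
    next
      case False
      then show ?thesis using cube_estimate_gt1[OF _ mw h, where p=p and a=a and b=b] p
        by (simp add: X_def v_def d_def n_def)
    qed
    also have "\<dots> \<le> A * ennreal ((1 + d) powr (real n * p)) * ?H"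
    proof (intro mult_right_mono)
      have "d + real n + 1 \<le> (1 + real n) * (1 + d)" using mult_nonneg_nonneg[of "real n" d] d
        by (simp add: algebra_simps)
      then have "(d + real n + 1) ^ n \<le> ((1 + real n) * (1 + d)) ^ n"
        using d by (intro power_mono) auto
      then have "v \<le> (unit_ball_vol (real n) * (1 + real n) ^ n) * (1 + d) ^ n"
        unfolding v_def by (simp add: power_mult_distrib mult_left_mono mult.assoc)
      then have "v powr p \<le> ((unit_ball_vol (real n) * (1 + real n) ^ n) * (1 + d) ^ n) powr p"
        using p d by (intro powr_mono2) (auto simp: v_def)
      also have "\<dots> = (unit_ball_vol (real n) * (1 + real n) ^ n) powr p * (1 + d) powr (real n * p)"
        using d by (simp add: powr_mult powr_powr[symmetric] powr_realpow)
      finally have "ennreal (v powr p) \<le> ennreal ((unit_ball_vol (real n) * (1 + real n) ^ n) powr p) * ennreal ((1 + d) powr (real n * p))"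
        by (simp add: ennreal_leI flip: ennreal_mult)
      then have "ennreal (v powr p) * X \<le> ennreal ((unit_ball_vol (real n) * (1 + real n) ^ n) powr p) * ennreal ((1 + d) powr (real n * p)) * X"
        by (rule mult_right_mono) simp
      then show "ennreal (v powr p) * X \<le> A * ennreal ((1 + d) powr (real n * p))"
        by (simp add: A_def mult_ac)
    qed simp
    finally show ?thesis by (simp add: d_def n_def)
  qed
  ultimately show thesis by (rule that)
qed

section \<open>Weighted bounds for integral operators and convolutions\<close>

lemma measurable_weighted_kernel_integral:
  fixes W :: "real^'n \<Rightarrow> complex^'m^'m"
  assumes mw: "matrix_weight W" and [measurable]: "h \<in> borel_measurable lebesgue"
  shows "(\<lambda>x. \<integral>\<^sup>+y. ennreal (weight_kernel p W x y * h y / (1 + norm (x - y)) ^ N) \<partial>lebesgue)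
    \<in> borel_measurable lebesgue"
proof -
  note [measurable] = measurable_weight_kernel[OF mw]
  have n1: "(\<lambda>z :: (real^'n) \<times> (real^'n). norm (fst z - snd z)) \<in> borel_measurable (lebesgue \<Otimes>\<^sub>M lebesgue)"
    by (rule measurable_compose[OF _ borel_measurable_norm]) (intro borel_measurable_diff
        measurable_compose[OF measurable_fst measurable_ident_lebesgue]
        measurable_compose[OF measurable_snd measurable_ident_lebesgue])
  note [measurable] = n1
  have "(\<lambda>z. ennreal (weight_kernel p W (fst z) (snd z) * h (snd z) / (1 + norm (fst z - snd z)) ^ N)) \<in> borel_measurable (lebesgue \<Otimes>\<^sub>M lebesgue)"
    by measurable
  from lebesgue.borel_measurable_nn_integral_fst[OF this] show ?thesis by simp
qed

text \<open>A sum with summable weights is at most a constant times its largest term divided by the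
  weight; this replaces Jensen's inequality in passing from single cubes to all cubes.\<close>

theorem weighted_kernel_bound:
  fixes W :: "real^'n \<Rightarrow> complex^'m^'m"
  assumes p: "1 \<le> p" and W: "W \<in> Muckenhoupt p"
  obtains C where "C < \<infinity>"
    "\<And>h. h \<in> borel_measurable lebesgue \<Longrightarrow> (\<And>y. 0 \<le> h y) \<Longrightarrow>
      (\<integral>\<^sup>+x. ennpowr (\<integral>\<^sup>+y. ennreal (weight_kernel p W x y * h y / (1 + norm (x - y)) ^ (6 * CARD('n))) \<partial>lebesgue) p \<partial>lebesgue)
      \<le> C * (\<integral>\<^sup>+y. ennreal (h y powr p) \<partial>lebesgue)"
proof -
  define n where "n = CARD('n)"
  define D where "D a b = norm (real_vec a - real_vec b)" for a b :: "int^'n"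
  \<comment> \<open>The kernel decay of order 6n is \<tau> squared. One factor \<tau> is summed over
    the cubes; the p-th power of the other absorbs the cost (1 + D)^(n p) and leaves (1 + D)^(-2 n
    p), at most (1 + D)^(-2 n) as p \<ge> 1, which is summable again.\<close>
  define \<tau> where "\<tau> a b = 1 / (1 + D a b) ^ (3 * n)" for a b
  have D0: "0 \<le> D a b" for a b by (simp add: D_def)
  have \<tau>0: "0 \<le> \<tau> a b" for a b using D0[of a b] by (simp add: \<tau>_def)
  obtain S where S: "S < \<infinity>" "\<And>a. (\<integral>\<^sup>+b. ennreal (\<tau> a b) \<partial>count_space UNIV) \<le> S"
    using lattice_sum_finite[where 'n='n, of "3 * n"] by (auto simp: n_def \<tau>_def D_def)
  obtain S' where S': "S' < \<infinity>" "\<And>a. (\<integral>\<^sup>+b. ennreal (1 / (1 + D a b) ^ (2 * n)) \<partial>count_space UNIV) \<le> S'"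
    using lattice_sum_finite[where 'n='n, of "2 * n"] by (auto simp: n_def D_def)
  obtain A where A: "A < \<infinity>"
    "\<And>(a :: int^'n) b h. h \<in> borel_measurable lebesgue \<Longrightarrow> (\<And>y. 0 \<le> h y) \<Longrightarrow>
      (\<integral>\<^sup>+x. ennpowr (\<integral>\<^sup>+y. ennreal (weight_kernel p W x y * h y) * indicator (unit_cube b) y \<partial>lebesgue) p
        * indicator (unit_cube a) x \<partial>lebesgue)
      \<le> A * ennreal ((1 + D a b) powr (real n * p)) *
        (\<integral>\<^sup>+y. ennreal (h y powr p) * indicator (unit_cube b) y \<partial>lebesgue)"
    by (rule cube_estimate[OF assms, folded D_def n_def]) (rule that, assumption, simp)
  have mw: "matrix_weight W" using W by (auto simp: Muckenhoupt_def)
  define M where "M = weight_kernel p W"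
  have [measurable]: "M x \<in> borel_measurable lebesgue" for x by (simp add: M_def measurable_weight_kernel1[OF mw])
  have M2 [measurable]: "(\<lambda>z. M (fst z) (snd z)) \<in> borel_measurable (lebesgue \<Otimes>\<^sub>M lebesgue)"
    by (simp add: M_def measurable_weight_kernel[OF mw])
  have M0: "0 \<le> M x y" for x y by (simp add: M_def weight_kernel_nonneg)
  \<comment> \<open>The loss in replacing |x - y| by the distance of the cube centres: each point is
    within n of its centre, so 1 + D is at most (1 + 2 n) (1 + |x - y|).\<close>
  define K where "K = (1 + 2 * real n) ^ (6 * n)"
  define K2 where "K2 = ennpowr (ennreal K * S) p"
  define C where "C = K2 * A * S'"
  have K2: "K2 < \<infinity>"
    using S(1) by (simp add: K2_def ennreal_mult_less_top)
  have "C < \<infinity>"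
    unfolding C_def using K2 A(1) S'(1) by (simp add: ennreal_mult_less_top)
  moreover have "(\<integral>\<^sup>+x. ennpowr (\<integral>\<^sup>+y. ennreal (M x y * h y / (1 + norm (x - y)) ^ (6 * n)) \<partial>lebesgue) p \<partial>lebesgue)
      \<le> C * (\<integral>\<^sup>+y. ennreal (h y powr p) \<partial>lebesgue)"
    if hm [measurable]: "h \<in> borel_measurable lebesgue" and h: "\<And>y. 0 \<le> h y" for h
  proof -
    define c where "c b x = (\<integral>\<^sup>+y. ennreal (M x y * h y) * indicator (unit_cube b) y \<partial>lebesgue)" for b x
    have c_meas [measurable]: "c b \<in> borel_measurable lebesgue" for b
    proof -
      have "(\<lambda>z. ennreal (M (fst z) (snd z) * h (snd z)) * indicator (unit_cube b) (snd z)) \<in> borel_measurable (lebesgue \<Otimes>\<^sub>M lebesgue)"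
        by measurable
      from lebesgue.borel_measurable_nn_integral_fst[OF this] show ?thesis by (simp add: c_def[abs_def])
    qed
    define T where "T x = (\<integral>\<^sup>+y. ennreal (M x y * h y / (1 + norm (x - y)) ^ (6 * n)) \<partial>lebesgue)" for x
    have T_meas [measurable]: "T \<in> borel_measurable lebesgue"
      unfolding T_def[abs_def] M_def by (rule measurable_weighted_kernel_integral[OF mw hm])
    have Tle: "T x \<le> (\<integral>\<^sup>+b. ennreal K * (ennreal (\<tau> a b) * (ennreal (\<tau> a b) * c b x)) \<partial>count_space UNIV)"
      if x: "x \<in> unit_cube a" for x a
    proof -
      have "T x = (\<integral>\<^sup>+b. (\<integral>\<^sup>+y. ennreal (M x y * h y / (1 + norm (x - y)) ^ (6 * n)) * indicator (unit_cube b) y \<partial>lebesgue) \<partial>count_space UNIV)"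
      proof -
        have [measurable]: "(\<lambda>y. norm (x - y)) \<in> borel_measurable lebesgue"
          by (intro measurable_completion) simp
        show ?thesis unfolding T_def by (rule nn_integral_unit_cubes) measurable
      qed
      also have "\<dots> \<le> (\<integral>\<^sup>+b. ennreal K * (ennreal (\<tau> a b) * (ennreal (\<tau> a b) * c b x)) \<partial>count_space UNIV)"
      proof (rule nn_integral_mono)
        fix b :: "int^'n"
        have "(\<integral>\<^sup>+y. ennreal (M x y * h y / (1 + norm (x - y)) ^ (6 * n)) * indicator (unit_cube b) y \<partial>lebesgue)
          \<le> (\<integral>\<^sup>+y. ennreal (K * \<tau> a b * \<tau> a b) * (ennreal (M x y * h y) * indicator (unit_cube b) y) \<partial>lebesgue)"
        proof (rule nn_integral_mono)
          fix y
          show "ennreal (M x y * h y / (1 + norm (x - y)) ^ (6 * n)) * indicator (unit_cube b) y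
            \<le> ennreal (K * \<tau> a b * \<tau> a b) * (ennreal (M x y * h y) * indicator (unit_cube b) y)"
          proof (cases "y \<in> unit_cube b")
            case True
            have "D a b \<le> norm (x - y) + norm (real_vec a - x) + norm (y - real_vec b)"
              unfolding D_def using norm_triangle_ineq[of "(real_vec a - x) + (x - y)" "y - real_vec b"]
                norm_triangle_ineq[of "real_vec a - x" "x - y"] by simp
            then have "D a b \<le> norm (x - y) + 2 * real n"
              using norm_unit_cube_le[OF x] norm_unit_cube_le[OF True] by (simp add: n_def norm_minus_commute)
            moreover have "0 \<le> real n * norm (x - y)" by simp
            moreover have "(1 + 2 * real n) * (1 + norm (x - y)) =
                1 + norm (x - y) + 2 * real n + 2 * (real n * norm (x - y))"
              by (simp add: algebra_simps)
            ultimately have "1 + D a b \<le> (1 + 2 * real n) * (1 + norm (x - y))"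
              by linarith
            then have "(1 + D a b) ^ (6 * n) \<le> ((1 + 2 * real n) * (1 + norm (x - y))) ^ (6 * n)"
              using D0[of a b] by (intro power_mono) auto
            then have "(1 + D a b) ^ (6 * n) \<le> K * (1 + norm (x - y)) ^ (6 * n)"
              by (simp add: K_def power_mult_distrib)
            then have "1 / (1 + norm (x - y)) ^ (6 * n) \<le> K / (1 + D a b) ^ (6 * n)"
              using D0[of a b] by (simp add: divide_simps add_pos_nonneg zero_less_power mult.commute)
            also have "\<dots> = K * \<tau> a b * \<tau> a b"
              by (simp add: \<tau>_def flip: power_add)
            finally have "(M x y * h y) * (1 / (1 + norm (x - y)) ^ (6 * n)) \<le> (M x y * h y) * (K * \<tau> a b * \<tau> a b)"
              using M0 h by (intro mult_left_mono) auto
            then have "ennreal (M x y * h y / (1 + norm (x - y)) ^ (6 * n)) \<le> ennreal ((K * \<tau> a b * \<tau> a b) * (M x y * h y))"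
              by (intro ennreal_leI) (simp add: mult.commute)
            also have "\<dots> = ennreal (K * \<tau> a b * \<tau> a b) * ennreal (M x y * h y)"
              by (rule ennreal_mult) (auto simp: K_def \<tau>0 M0 h)
            finally show ?thesis using True by simp
          qed simp
        qed
        also have "\<dots> = ennreal (K * \<tau> a b * \<tau> a b) * c b x"
          unfolding c_def by (rule nn_integral_cmult) measurable
        also have "ennreal (K * \<tau> a b * \<tau> a b) = ennreal K * (ennreal (\<tau> a b) * ennreal (\<tau> a b))"
          using \<tau>0[of a b] by (simp add: ennreal_mult K_def mult.assoc)
        finally show "(\<integral>\<^sup>+y. ennreal (M x y * h y / (1 + norm (x - y)) ^ (6 * n)) * indicator (unit_cube b) y \<partial>lebesgue)
          \<le> ennreal K * (ennreal (\<tau> a b) * (ennreal (\<tau> a b) * c b x))"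
          by (simp add: mult.assoc)
      qed
      finally show ?thesis .
    qed
    have Tp: "ennpowr (T x) p \<le> K2 * (\<integral>\<^sup>+b. ennreal (\<tau> a b powr p) * ennpowr (c b x) p \<partial>count_space UNIV)"
      if x: "x \<in> unit_cube a" for x a
    proof -
      define Y where "Y = (\<integral>\<^sup>+b. ennpowr (ennreal (\<tau> a b) * c b x) p \<partial>count_space UNIV)"
      have Yeq: "Y = (\<integral>\<^sup>+b. ennreal (\<tau> a b powr p) * ennpowr (c b x) p \<partial>count_space UNIV)"
        unfolding Y_def using p by (simp add: ennpowr_mult ennpowr_ennreal \<tau>0)
      have "ennreal (\<tau> a b) * c b x \<le> ennpowr Y (1/p)" for b
      proof -
        have "ennpowr (ennreal (\<tau> a b) * c b x) p \<le> Y"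
          unfolding Y_def by (rule nn_integral_ge_point) simp
        then have "ennpowr (ennpowr (ennreal (\<tau> a b) * c b x) p) (1/p) \<le> ennpowr Y (1/p)"
          using p by (intro ennpowr_mono[of "1/p"]) auto
        then show ?thesis using p by (simp add: ennpowr_ennpowr)
      qed
      then have "T x \<le> (\<integral>\<^sup>+b. ennreal K * (ennreal (\<tau> a b) * ennpowr Y (1/p)) \<partial>count_space UNIV)"
        by (intro order_trans[OF Tle[OF x]] nn_integral_mono mult_left_mono) auto
      also have "\<dots> = ennreal K * (\<integral>\<^sup>+b. ennreal (\<tau> a b) \<partial>count_space UNIV) * ennpowr Y (1/p)"
        by (simp add: nn_integral_cmult nn_integral_multc mult.assoc)
      also have "\<dots> \<le> (ennreal K * S) * ennpowr Y (1/p)"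
        by (intro mult_right_mono mult_left_mono S(2)) auto
      finally have "ennpowr (T x) p \<le> ennpowr ((ennreal K * S) * ennpowr Y (1/p)) p"
        using p by (intro ennpowr_mono[of p]) auto
      also have "\<dots> = K2 * Y"
        using p by (simp add: ennpowr_mult[of p] ennpowr_ennpowr K2_def)
      finally show ?thesis unfolding Yeq .
    qed
    define H where "H b = (\<integral>\<^sup>+y. ennreal (h y powr p) * indicator (unit_cube b) y \<partial>lebesgue)" for b
    have single: "ennreal (\<tau> a b powr p) * (\<integral>\<^sup>+x. ennpowr (c b x) p * indicator (unit_cube a) x \<partial>lebesgue)
      \<le> A * ennreal (1 / (1 + D a b) ^ (2 * n)) * H b" for a b
    proof -
      have pos: "0 < 1 + D a b" using D0[of a b] by simp
      have "\<tau> a b powr p * (1 + D a b) powr (real n * p) = (1 + D a b) powr (- (2 * (real n * p)))"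
      proof -
        have "\<tau> a b = (1 + D a b) powr (- (3 * real n))"
          using pos by (simp add: \<tau>_def powr_minus_divide powr_realpow[symmetric])
        then show ?thesis using pos by (simp add: powr_powr flip: powr_add) (simp add: algebra_simps)
      qed
      also have "\<dots> \<le> (1 + D a b) powr (- (2 * (real n * 1)))"
      proof (rule powr_mono)
        show "- (2 * (real n * p)) \<le> - (2 * (real n * 1))"
          using mult_left_mono[OF p, of "real n"] by simp
        show "1 \<le> 1 + D a b" using D0[of a b] by simp
      qed
      also have "\<dots> = 1 / (1 + D a b) ^ (2 * n)"
        using pos by (simp add: powr_minus_divide powr_realpow[symmetric])
      finally have le: "ennreal (\<tau> a b powr p) * ennreal ((1 + D a b) powr (real n * p)) \<le> ennreal (1 / (1 + D a b) ^ (2 * n))"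
        by (simp add: ennreal_leI flip: ennreal_mult)
      have "ennreal (\<tau> a b powr p) * (\<integral>\<^sup>+x. ennpowr (c b x) p * indicator (unit_cube a) x \<partial>lebesgue) \<le>
          ennreal (\<tau> a b powr p) * (A * ennreal ((1 + D a b) powr (real n * p)) * H b)"
        using A(2)[OF hm h] unfolding c_def H_def M_def by (intro mult_left_mono) auto
      also have "\<dots> = (ennreal (\<tau> a b powr p) * ennreal ((1 + D a b) powr (real n * p))) * (A * H b)"
        by (simp add: mult_ac)
      also have "\<dots> \<le> ennreal (1 / (1 + D a b) ^ (2 * n)) * (A * H b)"
        by (intro mult_right_mono le) simp
      finally show ?thesis by (simp add: mult_ac)
    qed
    have "(\<integral>\<^sup>+x. ennpowr (T x) p \<partial>lebesgue) = (\<integral>\<^sup>+a. (\<integral>\<^sup>+x. ennpowr (T x) p * indicator (unit_cube a) x \<partial>lebesgue) \<partial>count_space UNIV)"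
      by (rule nn_integral_unit_cubes) measurable
    also have "\<dots> \<le> (\<integral>\<^sup>+a. K2 * (\<integral>\<^sup>+b. A * ennreal (1 / (1 + D a b) ^ (2 * n)) * H b \<partial>count_space UNIV) \<partial>count_space UNIV)"
    proof (rule nn_integral_mono)
      fix a :: "int^'n"
      have "(\<integral>\<^sup>+x. ennpowr (T x) p * indicator (unit_cube a) x \<partial>lebesgue) \<le>
          (\<integral>\<^sup>+x. (\<integral>\<^sup>+b. K2 * (ennreal (\<tau> a b powr p) * (ennpowr (c b x) p * indicator (unit_cube a) x)) \<partial>count_space UNIV) \<partial>lebesgue)"
      proof (rule nn_integral_mono)
        fix x
        show "ennpowr (T x) p * indicator (unit_cube a) x \<le>
          (\<integral>\<^sup>+b. K2 * (ennreal (\<tau> a b powr p) * (ennpowr (c b x) p * indicator (unit_cube a) x)) \<partial>count_space UNIV)"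
          using Tp[of x a] by (cases "x \<in> unit_cube a") (simp_all add: nn_integral_cmult)
      qed
      also have "\<dots> = (\<integral>\<^sup>+b. (\<integral>\<^sup>+x. K2 * (ennreal (\<tau> a b powr p) * (ennpowr (c b x) p * indicator (unit_cube a) x)) \<partial>lebesgue) \<partial>count_space UNIV)"
        by (rule nn_integral_count_space_nn_integral[OF countable_vec_int]) measurable
      also have "\<dots> = (\<integral>\<^sup>+b. K2 * (ennreal (\<tau> a b powr p) * (\<integral>\<^sup>+x. ennpowr (c b x) p * indicator (unit_cube a) x \<partial>lebesgue)) \<partial>count_space UNIV)"
        by (intro nn_integral_cong) (simp add: nn_integral_cmult)
      also have "\<dots> \<le> (\<integral>\<^sup>+b. K2 * (A * ennreal (1 / (1 + D a b) ^ (2 * n)) * H b) \<partial>count_space UNIV)"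
        by (intro nn_integral_mono mult_left_mono single) simp
      finally show "(\<integral>\<^sup>+x. ennpowr (T x) p * indicator (unit_cube a) x \<partial>lebesgue) \<le>
          K2 * (\<integral>\<^sup>+b. A * ennreal (1 / (1 + D a b) ^ (2 * n)) * H b \<partial>count_space UNIV)"
        by (simp add: nn_integral_cmult)
    qed
    \<comment> \<open>With the sum over a taken first, the weights add up to at most S' for every b,
      and what remains is the full norm of h cut into cubes.\<close>
    also have "\<dots> = K2 * (\<integral>\<^sup>+b. (\<integral>\<^sup>+a. A * ennreal (1 / (1 + D a b) ^ (2 * n)) * H b \<partial>count_space UNIV) \<partial>count_space UNIV)"
      by (subst nn_integral_cmult, simp, subst nn_integral_count_space_nn_integral[OF countable_vec_int], simp_all)
    also have "\<dots> = K2 * (\<integral>\<^sup>+b. A * (\<integral>\<^sup>+a. ennreal (1 / (1 + D b a) ^ (2 * n)) \<partial>count_space UNIV) * H b \<partial>count_space UNIV)"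
    proof -
      have "D a b = D b a" for a b unfolding D_def by (rule norm_minus_commute)
      then have "(\<integral>\<^sup>+a. A * ennreal (1 / (1 + D a b) ^ (2 * n)) * H b \<partial>count_space UNIV) =
          A * (\<integral>\<^sup>+a. ennreal (1 / (1 + D b a) ^ (2 * n)) \<partial>count_space UNIV) * H b" for b
        by (simp add: nn_integral_cmult nn_integral_multc)
      then show ?thesis by simp
    qed
    also have "\<dots> \<le> K2 * (\<integral>\<^sup>+b. A * S' * H b \<partial>count_space UNIV)"
      by (intro mult_left_mono nn_integral_mono mult_right_mono S'(2)) auto
    also have "\<dots> = C * (\<integral>\<^sup>+b. H b \<partial>count_space UNIV)"
      by (simp add: nn_integral_cmult C_def mult.assoc)
    also have "(\<integral>\<^sup>+b. H b \<partial>count_space UNIV) = (\<integral>\<^sup>+y. ennreal (h y powr p) \<partial>lebesgue)"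
      unfolding H_def by (rule nn_integral_unit_cubes[symmetric]) measurable
    finally show ?thesis by (simp add: T_def)
  qed
  ultimately show thesis using that by (simp add: M_def n_def)
qed

lemma borel_measurable_vec_nth: "(\<lambda>x :: 'b::real_normed_vector^'n. x $ i) \<in> borel_measurable borel"
  by (intro borel_measurable_continuous_onI continuous_intros)

lemma norm_smult: "norm (c *s v) = norm c * norm (v :: complex^'m)"
  by (simp add: norm_vec_def norm_mult L2_set_right_distrib)

text \<open>With h(y) = |W(y)^(1/p) F(y)|, the norm of W(x)^(1/p) K(x - y) F(y) is at most
  \<open>c\<close> times the integrand of \<open>J\<close>, so the scalar bound applies.
  Integrability of J^p makes \<open>J\<close> finite almost everywhere, and this is what makes the
  convolution converge absolutely. The bound is linear in \<open>c\<close>, hence common to all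
  kernels with the same decay constant.\<close>

lemma LpW_norm_convolution_le:
  fixes W :: "real^'n \<Rightarrow> complex^'m^'m"
  assumes p: "1 \<le> p" and W: "W \<in> Muckenhoupt p"
  obtains C where "C < \<infinity>"
    "\<And>K c F. K \<in> borel_measurable borel \<Longrightarrow> 0 \<le> c \<Longrightarrow>
      (\<And>z. norm (K z) \<le> c / (1 + norm z) ^ (6 * CARD('n))) \<Longrightarrow> F \<in> LpW p W \<Longrightarrow>
      LpW_norm p W (\<lambda>x. \<chi> i. LINT y|lebesgue. F y $ i * K (x - y)) \<le> C * ennreal c * LpW_norm p W F"
proof -
  define N where "N = 6 * CARD('n)"
  have mw: "matrix_weight W" using W by (auto simp: Muckenhoupt_def)
  have inv: "AE y in lebesgue. invertible (W y)" and nn: "\<And>x. nonneg_definite (W x)"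
    using mw by (auto simp: matrix_weight_def)
  have pinv: "matrix_powr (W x) (- 1/p) ** matrix_powr (W x) (1/p) = mat 1" if "invertible (W x)" for x
    using matrix_powr_inverse[OF nn that, of "1/p"] by simp
  obtain C where C: "C < \<infinity>" and bound:
    "\<And>h. h \<in> borel_measurable lebesgue \<Longrightarrow> (\<And>y. 0 \<le> h y) \<Longrightarrow>
      (\<integral>\<^sup>+x. ennpowr (\<integral>\<^sup>+y. ennreal (weight_kernel p W x y * h y / (1 + norm (x - y)) ^ N) \<partial>lebesgue) p \<partial>lebesgue)
      \<le> C * (\<integral>\<^sup>+y. ennreal (h y powr p) \<partial>lebesgue)"
    by (rule weighted_kernel_bound[OF p W, folded N_def]) (rule that, assumption, simp)
  have "ennpowr C (1/p) < \<infinity>" using C by simp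
  moreover have "LpW_norm p W (\<lambda>x. \<chi> i. LINT y|lebesgue. F y $ i * K (x - y)) \<le> ennpowr C (1/p) * ennreal c * LpW_norm p W F"
    if K [measurable]: "K \<in> borel_measurable borel" and c: "0 \<le> c"
      and Kle: "\<And>z. norm (K z) \<le> c / (1 + norm z) ^ N" and F: "F \<in> LpW p W" for K c F
  proof -
    have Fm [measurable]: "F \<in> borel_measurable lebesgue" and Fn: "LpW_norm p W F < top"
      using F by (auto simp: LpW_def)
    note [measurable] = measurable_matrix_powr_weight[OF mw] measurable_weight_kernel1[OF mw]
    define h where "h y = norm (matrix_powr (W y) (1/p) *v F y)" for y
    have hm [measurable]: "h \<in> borel_measurable lebesgue" unfolding h_def[abs_def] by measurable
    have h0: "0 \<le> h y" for y by (simp add: h_def)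
    define J where "J x = (\<integral>\<^sup>+y. ennreal (weight_kernel p W x y * h y / (1 + norm (x - y)) ^ N) \<partial>lebesgue)" for x
    have Jm [measurable]: "J \<in> borel_measurable lebesgue"
      using measurable_weighted_kernel_integral[OF mw hm] by (simp add: J_def[abs_def])
    have Hn: "(\<integral>\<^sup>+y. ennreal (h y powr p) \<partial>lebesgue) < top"
      using Fn by (simp add: LpW_norm_def h_def)
    have Jle: "(\<integral>\<^sup>+x. ennpowr (J x) p \<partial>lebesgue) \<le> C * (\<integral>\<^sup>+y. ennreal (h y powr p) \<partial>lebesgue)"
      unfolding J_def by (rule bound[OF hm h0])
    also have "\<dots> < top" using C Hn by (simp add: ennreal_mult_less_top)
    finally have "AE x in lebesgue. ennpowr (J x) p \<noteq> \<infinity>"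
      by (intro nn_integral_PInf_AE) auto
    then have Jfin: "AE x in lebesgue. J x < top" by (simp add: less_top)
    define G where "G x = (\<chi> i. LINT y|lebesgue. F y $ i * K (x - y))" for x
    have Gle: "AE x in lebesgue. ennreal (norm (matrix_powr (W x) (1/p) *v G x)) \<le> ennreal c * J x"
      using Jfin inv
    proof eventually_elim
      case (elim x)
      define A where "A = matrix_powr (W x) (1/p)"
      define A' where "A' = matrix_powr (W x) (- 1/p)"
      have A'A: "A' ** A = mat 1" unfolding A_def A'_def by (rule pinv[OF elim(2)])
      have Kx [measurable]: "(\<lambda>y. K (x - y)) \<in> borel_measurable lebesgue"
        by (intro measurable_completion) simp
      have [measurable]: "(\<lambda>y. norm (x - y)) \<in> borel_measurable lebesgue"
        by (intro measurable_completion) simp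
      define f where "f y = K (x - y) *s F y" for y
      have fm [measurable]: "f \<in> borel_measurable lebesgue"
      proof (rule borel_measurable_vec)
        fix i
        have [measurable]: "(\<lambda>y. F y $ i) \<in> borel_measurable lebesgue"
          using measurable_compose[OF Fm borel_measurable_vec_nth[of i]] by simp
        show "(\<lambda>y. f y $ i) \<in> borel_measurable lebesgue" by (simp add: f_def)
      qed
      have AF: "AE y in lebesgue. ennreal (norm (A *v f y)) \<le> ennreal c * ennreal (weight_kernel p W x y * h y / (1 + norm (x - y)) ^ N)"
        using inv
      proof eventually_elim
        case (elim y)
        have "A *v F y = (A ** matrix_powr (W y) (- 1/p)) *v (matrix_powr (W y) (1/p) *v F y)"
          by (metis matrix_vector_mul_assoc matrix_mul_assoc pinv[OF elim] matrix_mul_rid)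
        then have le: "norm (A *v F y) \<le> weight_kernel p W x y * h y"
          unfolding weight_kernel_def h_def A_def by (metis norm_mult_le_op_norm)
        have "norm (A *v f y) = norm (K (x - y)) * norm (A *v F y)"
          by (simp add: f_def vector_scalar_commute norm_smult)
        also have "\<dots> \<le> (c / (1 + norm (x - y)) ^ N) * (weight_kernel p W x y * h y)"
          using c by (intro mult_mono Kle le) auto
        finally have "ennreal (norm (A *v f y)) \<le> ennreal (c * (weight_kernel p W x y * h y / (1 + norm (x - y)) ^ N))"
          by (intro ennreal_leI) simp
        also have "\<dots> = ennreal c * ennreal (weight_kernel p W x y * h y / (1 + norm (x - y)) ^ N)"
          by (rule ennreal_mult) (use c weight_kernel_nonneg[of p W x y] h0[of y] in auto)
        finally show ?case .
      qed
      have nnle: "(\<integral>\<^sup>+y. ennreal (norm (A *v f y)) \<partial>lebesgue) \<le> ennreal c * J x"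
      proof -
        have "(\<integral>\<^sup>+y. ennreal (norm (A *v f y)) \<partial>lebesgue) \<le>
            (\<integral>\<^sup>+y. ennreal c * ennreal (weight_kernel p W x y * h y / (1 + norm (x - y)) ^ N) \<partial>lebesgue)"
          by (rule nn_integral_mono_AE[OF AF])
        also have "\<dots> = ennreal c * J x" unfolding J_def by (rule nn_integral_cmult) measurable
        finally show ?thesis .
      qed
      have iAf: "integrable lebesgue (\<lambda>y. A *v f y)"
      proof (rule integrableI_bounded)
        show "(\<integral>\<^sup>+y. ennreal (norm (A *v f y)) \<partial>lebesgue) < \<infinity>"
          using nnle elim(1) by (auto intro: le_less_trans simp: ennreal_mult_less_top)
      qed measurable
      \<comment> \<open>The estimate controls A f only. Applying the inverse matrix gives
        integrability of f itself, so the component integrals in \<open>G\<close> are genuine and A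
        may be moved under the integral.\<close>
      have "integrable lebesgue (\<lambda>y. A' *v (A *v f y))"
        by (rule integrable_bounded_linear[OF _ iAf]) simp
      then have intf: "integrable lebesgue f"
        by (simp add: matrix_vector_mul_assoc A'A)
      have "G x = (LINT y|lebesgue. f y)"
      proof -
        have "(LINT y|lebesgue. f y) $ i = (LINT y|lebesgue. f y $ i)" for i
          by (rule integral_bounded_linear[OF bounded_linear_vec_nth intf, symmetric])
        then show ?thesis by (simp add: vec_eq_iff G_def f_def mult.commute)
      qed
      then have "A *v G x = (LINT y|lebesgue. A *v f y)"
        using integral_bounded_linear[OF matrix_vector_mul_bounded_linear[of A] intf] by simp
      then have "ennreal (norm (A *v G x)) \<le> (\<integral>\<^sup>+y. ennreal (norm (A *v f y)) \<partial>lebesgue)"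
        using integral_norm_bound_ennreal[OF iAf] by simp
      then show ?case using nnle by (simp add: A_def)
    qed
    have "(\<integral>\<^sup>+x. ennreal (norm (matrix_powr (W x) (1/p) *v G x) powr p) \<partial>lebesgue) \<le>
        (\<integral>\<^sup>+x. ennpowr (ennreal c) p * ennpowr (J x) p \<partial>lebesgue)"
      using Gle
    proof (intro nn_integral_mono_AE, eventually_elim)
      case (elim x)
      then have "ennpowr (ennreal (norm (matrix_powr (W x) (1/p) *v G x))) p \<le> ennpowr (ennreal c * J x) p"
        using p by (intro ennpowr_mono[of p]) auto
      then show ?case using p by (simp add: ennpowr_ennreal ennpowr_mult)
    qed
    also have "\<dots> = ennpowr (ennreal c) p * (\<integral>\<^sup>+x. ennpowr (J x) p \<partial>lebesgue)"
      by (rule nn_integral_cmult) measurable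
    also have "\<dots> \<le> ennpowr (ennreal c) p * (C * (\<integral>\<^sup>+y. ennreal (h y powr p) \<partial>lebesgue))"
      by (intro mult_left_mono Jle) simp
    finally have "LpW_norm p W G \<le> ennpowr (ennpowr (ennreal c) p * (C * (\<integral>\<^sup>+y. ennreal (h y powr p) \<partial>lebesgue))) (1/p)"
      unfolding LpW_norm_def using p by (intro ennpowr_mono[of "1/p"]) auto
    also have "\<dots> = ennpowr C (1/p) * ennreal c * LpW_norm p W F"
      using p by (simp add: ennpowr_mult[of "1/p"] ennpowr_ennpowr LpW_norm_def h_def mult_ac)
    finally show ?thesis by (simp add: G_def[abs_def])
  qed
  ultimately show thesis unfolding N_def by (rule that)
qed

lemma measurable_convolution:
  fixes F :: "real^'n \<Rightarrow> complex^'m"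
  assumes F: "F \<in> borel_measurable lebesgue" and K: "K \<in> borel_measurable borel"
  shows "(\<lambda>x. \<chi> i. LINT y|lebesgue. F y $ i * K (x - y)) \<in> borel_measurable lebesgue"
proof (rule borel_measurable_vec)
  fix i
  have Fi: "(\<lambda>y. F y $ i) \<in> borel_measurable lebesgue"
    using measurable_compose[OF F borel_measurable_vec_nth[of i]] by simp
  have [measurable]: "(\<lambda>z. K (fst z - snd z)) \<in> borel_measurable (lebesgue \<Otimes>\<^sub>M lebesgue)"
    by (rule measurable_compose[OF _ K]) (intro borel_measurable_diff
        measurable_compose[OF measurable_fst measurable_ident_lebesgue]
        measurable_compose[OF measurable_snd measurable_ident_lebesgue])
  have [measurable]: "(\<lambda>z :: (real^'n) \<times> (real^'n). F (snd z) $ i) \<in> borel_measurable (lebesgue \<Otimes>\<^sub>M lebesgue)"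
    by (rule measurable_compose[OF measurable_snd Fi])
  have "(\<lambda>x. LINT y|lebesgue. F y $ i * K (x - y)) \<in> borel_measurable lebesgue"
    by (rule lebesgue.borel_measurable_lebesgue_integral) (simp add: case_prod_beta)
  then show "(\<lambda>x. (\<chi> i. LINT y|lebesgue. F y $ i * K (x - y)) $ i) \<in> borel_measurable lebesgue" by simp
qed

lemma LpW_norm_scaleR:
  fixes W :: "real^'n \<Rightarrow> complex^'m^'m"
  assumes p: "1 \<le> p" and W: "matrix_weight W" and F [measurable]: "F \<in> borel_measurable lebesgue" and c: "0 \<le> c"
  shows "LpW_norm p W (\<lambda>x. c *\<^sub>R F x) = ennreal c * LpW_norm p W F"
proof -
  note [measurable] = measurable_matrix_powr_weight[OF W]
  have "(\<integral>\<^sup>+x. ennreal (norm (matrix_powr (W x) (1/p) *v (c *\<^sub>R F x)) powr p) \<partial>lebesgue) =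
      (\<integral>\<^sup>+x. ennreal (c powr p) * ennreal (norm (matrix_powr (W x) (1/p) *v F x) powr p) \<partial>lebesgue)"
    using c by (simp add: linear_scale[OF matrix_vector_mul_linear] powr_mult flip: ennreal_mult)
  also have "\<dots> = ennreal (c powr p) * (\<integral>\<^sup>+x. ennreal (norm (matrix_powr (W x) (1/p) *v F x) powr p) \<partial>lebesgue)"
    by (rule nn_integral_cmult) measurable
  finally show ?thesis
    using p c by (simp add: LpW_norm_def ennpowr_mult ennpowr_ennreal powr_powr)
qed

text \<open>A crude substitute for Minkowski's inequality: the sum is at most the number of terms
  times the largest one. The factor is harmless because the number of terms is always that of the
  neighbours.\<close>

lemma LpW_norm_sum_le:
  fixes W :: "real^'n \<Rightarrow> complex^'m^'m" and F :: "'i \<Rightarrow> real^'n \<Rightarrow> complex^'m"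
  assumes p: "1 \<le> p" and W: "matrix_weight W" and A: "finite A"
    and F: "\<And>i. i \<in> A \<Longrightarrow> F i \<in> borel_measurable lebesgue"
  shows "LpW_norm p W (\<lambda>x. \<Sum>i\<in>A. F i x) \<le>
    ennreal (real (card A) * real (card A) powr (1/p)) * (\<Sum>i\<in>A. LpW_norm p W (F i))"
proof -
  note [measurable] = measurable_matrix_powr_weight[OF W] F
  define k where "k = real (card A)"
  define g where "g i x = norm (matrix_powr (W x) (1/p) *v F i x)" for i x
  have g0: "0 \<le> g i x" for i x by (simp add: g_def)
  define S where "S = (\<Sum>i\<in>A. LpW_norm p W (F i))"
  have pt: "norm (matrix_powr (W x) (1/p) *v (\<Sum>i\<in>A. F i x)) powr p \<le> k powr p * (\<Sum>i\<in>A. g i x powr p)" for x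
  proof -
    define m where "m = (\<Sum>i\<in>A. g i x powr p)"
    have m0: "0 \<le> m" unfolding m_def by (intro sum_nonneg) simp
    have "norm (matrix_powr (W x) (1/p) *v (\<Sum>i\<in>A. F i x)) \<le> (\<Sum>i\<in>A. g i x)"
      unfolding g_def by (simp add: linear_sum[OF matrix_vector_mul_linear] norm_sum)
    also have "\<dots> \<le> (\<Sum>i\<in>A. m powr (1/p))"
    proof (rule sum_mono)
      fix i assume "i \<in> A"
      then have "g i x powr p \<le> m" unfolding m_def using A by (intro member_le_sum) auto
      then have "(g i x powr p) powr (1/p) \<le> m powr (1/p)" using p by (intro powr_mono2) auto
      then show "g i x \<le> m powr (1/p)" using p g0[of i x] by (simp add: powr_powr)
    qed
    also have "\<dots> = k * m powr (1/p)" by (simp add: k_def)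
    finally have "norm (matrix_powr (W x) (1/p) *v (\<Sum>i\<in>A. F i x)) powr p \<le> (k * m powr (1/p)) powr p"
      using p by (intro powr_mono2) auto
    also have "\<dots> = k powr p * m" using p m0 by (simp add: powr_mult powr_powr k_def)
    finally show ?thesis by (simp add: m_def)
  qed
  have "(\<integral>\<^sup>+x. ennreal (norm (matrix_powr (W x) (1/p) *v (\<Sum>i\<in>A. F i x)) powr p) \<partial>lebesgue) \<le>
      (\<integral>\<^sup>+x. ennreal (k powr p) * (\<Sum>i\<in>A. ennreal (g i x powr p)) \<partial>lebesgue)"
    using pt by (intro nn_integral_mono) (simp add: ennreal_leI sum_nonneg flip: ennreal_mult)
  also have "\<dots> = ennreal (k powr p) * (\<Sum>i\<in>A. \<integral>\<^sup>+x. ennreal (g i x powr p) \<partial>lebesgue)"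
    unfolding g_def by (subst nn_integral_cmult, measurable, subst nn_integral_sum, measurable)
  also have "\<dots> \<le> ennreal (k powr p) * (\<Sum>i\<in>A. ennpowr S p)"
  proof (intro mult_left_mono sum_mono)
    fix i assume "i \<in> A"
    then have "LpW_norm p W (F i) \<le> S" unfolding S_def using A by (intro member_le_sum) auto
    then have "ennpowr (LpW_norm p W (F i)) p \<le> ennpowr S p" using p by (intro ennpowr_mono[of p]) auto
    then show "(\<integral>\<^sup>+x. ennreal (g i x powr p) \<partial>lebesgue) \<le> ennpowr S p"
      using p by (simp add: LpW_norm_def ennpowr_ennpowr g_def)
  qed simp
  also have "\<dots> = ennreal (k powr p) * (ennreal k * ennpowr S p)"
    by (simp add: k_def ennreal_of_nat_eq_real_of_nat)
  finally have "LpW_norm p W (\<lambda>x. \<Sum>i\<in>A. F i x) \<le> ennpowr (ennreal (k powr p) * (ennreal k * ennpowr S p)) (1/p)"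
    unfolding LpW_norm_def using p by (intro ennpowr_mono[of "1/p"]) auto
  also have "\<dots> = ennreal (k * k powr (1/p)) * S"
    using p by (simp add: ennpowr_mult[of "1/p"] ennpowr_ennpowr ennpowr_ennreal powr_powr k_def ennreal_mult mult.assoc)
  finally show ?thesis by (simp add: k_def S_def)
qed

section \<open>Schwartz functions\<close>

lemma iter_partial_Nil [simp]: "iter_partial [] f = f"
  and iter_partial_Cons [simp]: "iter_partial (j # \<alpha>) f = partial_deriv j (iter_partial \<alpha> f)"
  and iter_partial_append: "iter_partial (\<alpha> @ \<beta>) f = iter_partial \<alpha> (iter_partial \<beta> f)"
  by (simp_all add: iter_partial_def)

lemma partial_deriv_eq:
  assumes "(f has_derivative D) (at x)"
  shows "partial_deriv j f x = D (axis j 1)"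
proof -
  have "((\<lambda>t. f (x + t *\<^sub>R axis j 1)) has_derivative (\<lambda>t. D (t *\<^sub>R axis j 1))) (at 0)"
  proof (rule has_derivative_compose[where g=f and f="\<lambda>t. x + t *\<^sub>R axis j 1" and f'="\<lambda>t. t *\<^sub>R axis j 1"])
    show "((\<lambda>t. x + t *\<^sub>R axis j 1) has_derivative (\<lambda>t. t *\<^sub>R axis j 1)) (at 0)"
      by (auto intro!: derivative_eq_intros)
    show "(f has_derivative D) (at (x + 0 *\<^sub>R axis j 1))" using assms by simp
  qed
  moreover have "D (t *\<^sub>R axis j 1) = t *\<^sub>R D (axis j 1)" for t
    using assms by (simp add: has_derivative_bounded_linear linear_scale bounded_linear.linear)
  ultimately have "((\<lambda>t. f (x + t *\<^sub>R axis j 1)) has_vector_derivative D (axis j 1)) (at 0)"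
    by (simp add: has_vector_derivative_def)
  then show ?thesis unfolding partial_deriv_def by (rule vector_derivative_at)
qed

lemma has_derivative_frechet:
  assumes "f differentiable_on UNIV"
  shows "(f has_derivative frechet_derivative f (at x)) (at x)"
  using assms frechet_derivative_works[of f "at x"] by (simp add: differentiable_on_def)

lemma partial_deriv_frechet:
  "f differentiable_on UNIV \<Longrightarrow> partial_deriv j f x = frechet_derivative f (at x) (axis j 1)"
  by (rule partial_deriv_eq[OF has_derivative_frechet])

lemma smooth_fun_differentiable: "smooth_fun f \<Longrightarrow> f differentiable_on UNIV"
  unfolding smooth_fun_def by (metis iter_partial_Nil)

lemma smooth_fun_iter_partial: "smooth_fun f \<Longrightarrow> smooth_fun (iter_partial \<alpha> f)"
  unfolding smooth_fun_def by (simp flip: iter_partial_append)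

lemma smooth_fun_partial_deriv: "smooth_fun f \<Longrightarrow> smooth_fun (partial_deriv j f)"
  using smooth_fun_iter_partial[of f "[j]"] by simp

lemma smooth_fun_continuous: "smooth_fun f \<Longrightarrow> continuous_on UNIV f"
  by (intro differentiable_imp_continuous_on smooth_fun_differentiable)

text \<open>Smoothness is proved by exhibiting a class of differentiable functions closed under
  partial derivatives; explicit formulas for the iterated derivatives are avoided.\<close>

lemma smooth_fun_coinduct:
  assumes "f \<in> S" "\<And>g. g \<in> S \<Longrightarrow> g differentiable_on UNIV" "\<And>g j. g \<in> S \<Longrightarrow> partial_deriv j g \<in> S"
  shows "smooth_fun f"
proof -
  have "iter_partial \<alpha> f \<in> S" for \<alpha> by (induction \<alpha>) (use assms in auto)
  then show ?thesis using assms(2) by (simp add: smooth_fun_def)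
qed

lemma partial_deriv_add:
  assumes "f differentiable_on UNIV" "g differentiable_on UNIV"
  shows "partial_deriv j (\<lambda>x. f x + g x) = (\<lambda>x. partial_deriv j f x + partial_deriv j g x)"
proof
  fix x
  show "partial_deriv j (\<lambda>x. f x + g x) x = partial_deriv j f x + partial_deriv j g x"
    using partial_deriv_eq[OF has_derivative_add[OF has_derivative_frechet[OF assms(1)] has_derivative_frechet[OF assms(2)]]]
    by (simp add: partial_deriv_frechet assms)
qed

lemma partial_deriv_mult:
  assumes "f differentiable_on UNIV" "g differentiable_on UNIV"
  shows "partial_deriv j (\<lambda>x. f x * g x) = (\<lambda>x. partial_deriv j f x * g x + f x * partial_deriv j g x)"
proof
  fix x
  show "partial_deriv j (\<lambda>x. f x * g x) x = partial_deriv j f x * g x + f x * partial_deriv j g x"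
    using partial_deriv_eq[OF has_derivative_mult[OF has_derivative_frechet[OF assms(1)] has_derivative_frechet[OF assms(2)]]]
    by (simp add: partial_deriv_frechet assms add.commute)
qed

lemma partial_deriv_const [simp]: "partial_deriv j (\<lambda>x. c) = (\<lambda>x. 0)"
  by (intro ext) (simp add: partial_deriv_eq[OF has_derivative_const])

lemma smooth_fun_const: "smooth_fun (\<lambda>x. c)"
  by (rule smooth_fun_coinduct[where S="range (\<lambda>c x. c)"]) auto

text \<open>By the product rule a partial derivative of a product is a sum of two products, so sums
  must be included to obtain a class closed under differentiation.\<close>

inductive_set product_sums :: "(real^'n \<Rightarrow> complex) set" where
  base: "smooth_fun f \<Longrightarrow> smooth_fun g \<Longrightarrow> (\<lambda>x. f x * g x) \<in> product_sums"
| add: "u \<in> product_sums \<Longrightarrow> v \<in> product_sums \<Longrightarrow> (\<lambda>x. u x + v x) \<in> product_sums"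

lemma product_sums_smooth:
  assumes "u \<in> product_sums" shows "smooth_fun u"
proof (rule smooth_fun_coinduct[OF assms])
  have diff: "g differentiable_on UNIV" if "g \<in> product_sums" for g :: "real^'n \<Rightarrow> complex"
    using that
  proof induction
    case (base f g)
    then show ?case unfolding differentiable_on_def
      by (intro ballI differentiable_mult) (auto dest: smooth_fun_differentiable simp: differentiable_on_def)
  next
    case (add u v)
    then show ?case unfolding differentiable_on_def by (intro ballI differentiable_add) auto
  qed
  show "g differentiable_on UNIV" if "g \<in> product_sums" for g :: "real^'n \<Rightarrow> complex" using that by (rule diff)
  show "partial_deriv j g \<in> product_sums" if "g \<in> product_sums" for g :: "real^'n \<Rightarrow> complex" and j
    using that
  proof induction
    case (base f g)
    then show ?case
      by (auto simp: partial_deriv_mult smooth_fun_differentiable intro!: product_sums.intros smooth_fun_partial_deriv)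
  next
    case (add u v)
    then show ?case by (auto simp: partial_deriv_add diff intro: product_sums.add)
  qed
qed

lemma smooth_fun_mult: "smooth_fun f \<Longrightarrow> smooth_fun g \<Longrightarrow> smooth_fun (\<lambda>x. f x * g x)"
  by (rule product_sums_smooth[OF product_sums.base])

lemma smooth_fun_add:
  assumes "smooth_fun f" "smooth_fun g" shows "smooth_fun (\<lambda>x. f x + g x)"
proof -
  have "(\<lambda>x. 1 * f x + 1 * g x) \<in> product_sums"
    by (intro product_sums.intros smooth_fun_const assms)
  then show ?thesis using product_sums_smooth by simp
qed

lemma iter_partial_add:
  assumes "smooth_fun f" "smooth_fun g"
  shows "iter_partial \<alpha> (\<lambda>x. f x + g x) = (\<lambda>x. iter_partial \<alpha> f x + iter_partial \<alpha> g x)"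
  by (induction \<alpha>) (use assms in \<open>auto simp: smooth_fun_def partial_deriv_add\<close>)

lemma iter_partial_cmult:
  assumes "smooth_fun f"
  shows "iter_partial \<alpha> (\<lambda>x. c * f x) = (\<lambda>x. c * iter_partial \<alpha> f x)"
  by (induction \<alpha>) (use assms in \<open>auto simp: smooth_fun_def partial_deriv_mult\<close>)

lemma smooth_fun_cmult: "smooth_fun f \<Longrightarrow> smooth_fun (\<lambda>x. c * f x)"
  by (intro smooth_fun_mult smooth_fun_const)

lemma smooth_fun_sum:
  assumes "finite A" "\<And>i. i \<in> A \<Longrightarrow> smooth_fun (f i)"
  shows "smooth_fun (\<lambda>x. \<Sum>i\<in>A. f i x)"
  using assms by (induction A) (auto intro: smooth_fun_const smooth_fun_add)

lemma iter_partial_zero [simp]: "iter_partial \<alpha> (\<lambda>x. 0) = (\<lambda>x. 0)"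
  by (induction \<alpha>) auto

lemma iter_partial_sum:
  assumes "finite A" "\<And>i. i \<in> A \<Longrightarrow> smooth_fun (f i)"
  shows "iter_partial \<alpha> (\<lambda>x. \<Sum>i\<in>A. f i x) = (\<lambda>x. \<Sum>i\<in>A. iter_partial \<alpha> (f i) x)"
  using assms by (induction A) (auto simp: iter_partial_add smooth_fun_sum)

text \<open>Leibniz' rule without binomial coefficients: every derivative doubles the number of
  terms. The induction removes the innermost derivative, the last entry of the list, so that the
  hypothesis is applied to derivatives of f and g at the same point.\<close>

lemma iter_partial_mult_bound:
  assumes "smooth_fun f" "smooth_fun g"
    and "\<And>\<beta>. length \<beta> \<le> length \<alpha> \<Longrightarrow> norm (iter_partial \<beta> f x) \<le> A"
    and "\<And>\<beta>. length \<beta> \<le> length \<alpha> \<Longrightarrow> norm (iter_partial \<beta> g x) \<le> B"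
  shows "norm (iter_partial \<alpha> (\<lambda>x. f x * g x) x) \<le> 2 ^ length \<alpha> * A * B"
  using assms
proof (induction \<alpha> arbitrary: f g rule: rev_induct)
  case Nil
  have "norm (f x) \<le> A" "norm (g x) \<le> B" using Nil.prems(3)[of "[]"] Nil.prems(4)[of "[]"] by auto
  then have "norm (f x) * norm (g x) \<le> A * B"
    using order_trans[OF norm_ge_zero[of "f x"]] by (intro mult_mono) auto
  then show ?case by (simp add: norm_mult)
next
  case (snoc j \<alpha>)
  note d = smooth_fun_differentiable[OF snoc.prems(1)] smooth_fun_differentiable[OF snoc.prems(2)]
  note s = smooth_fun_partial_deriv[OF snoc.prems(1), of j] smooth_fun_partial_deriv[OF snoc.prems(2), of j]
  have "iter_partial (\<alpha> @ [j]) (\<lambda>x. f x * g x) x =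
      iter_partial \<alpha> (\<lambda>x. partial_deriv j f x * g x) x + iter_partial \<alpha> (\<lambda>x. f x * partial_deriv j g x) x"
    by (simp add: iter_partial_append partial_deriv_mult d iter_partial_add smooth_fun_mult s snoc.prems(1,2))
  also have "norm \<dots> \<le> 2 ^ length \<alpha> * A * B + 2 ^ length \<alpha> * A * B"
  proof (intro order_trans[OF norm_triangle_ineq] add_mono snoc.IH s snoc.prems(1,2))
    fix \<beta> :: "'a list" assume b: "length \<beta> \<le> length \<alpha>"
    show "norm (iter_partial \<beta> (partial_deriv j f) x) \<le> A"
      using snoc.prems(3)[of "\<beta> @ [j]"] b by (simp add: iter_partial_append)
    show "norm (iter_partial \<beta> (partial_deriv j g) x) \<le> B"
      using snoc.prems(4)[of "\<beta> @ [j]"] b by (simp add: iter_partial_append)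
  qed (use snoc.prems(3,4) in auto)
  finally show ?case by (simp add: mult_ac)
qed

section \<open>Seminorm bounds and closure properties of Schwartz functions\<close>

text \<open>A single index for both the weight and the number of derivatives makes the family of
  seminorms directed. A predicate with an explicit constant avoids conditionally complete
  suprema.\<close>

definition schwartz_bound :: "nat \<Rightarrow> (real^'n \<Rightarrow> complex) \<Rightarrow> real \<Rightarrow> bool" where
  "schwartz_bound N \<psi> c \<longleftrightarrow>
    (\<forall>\<alpha> x. length \<alpha> \<le> N \<longrightarrow> (1 + norm x) ^ N * norm (iter_partial \<alpha> \<psi> x) \<le> c)"

lemma schwartz_bound_nonneg:
  assumes "schwartz_bound N \<psi> c" shows "0 \<le> c"
proof -
  have "norm (\<psi> 0) \<le> c" using assms[unfolded schwartz_bound_def, rule_format, of "[]" 0] by simp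
  then show ?thesis using norm_ge_zero order_trans by blast
qed

lemma schwartz_boundD:
  assumes "schwartz_bound N \<psi> c" "length \<alpha> \<le> N" "k \<le> N"
  shows "norm (iter_partial \<alpha> \<psi> x) \<le> c / (1 + norm x) ^ k"
proof -
  have pos: "0 < (1 + norm x) ^ k" by (simp add: add_pos_nonneg)
  have "(1 + norm x) ^ k * norm (iter_partial \<alpha> \<psi> x) \<le> (1 + norm x) ^ N * norm (iter_partial \<alpha> \<psi> x)"
    using assms(3) by (intro mult_right_mono power_increasing) auto
  also have "\<dots> \<le> c" using assms unfolding schwartz_bound_def by blast
  finally show ?thesis using pos by (simp add: pos_le_divide_eq mult.commute)
qed

lemma schwartz_bound_mono:
  assumes "schwartz_bound N \<psi> c" "M \<le> N" "c \<le> d" shows "schwartz_bound M \<psi> d"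
  unfolding schwartz_bound_def
proof (intro allI impI)
  fix \<alpha> :: "'a list" and x :: "real^'a" assume a: "length \<alpha> \<le> M"
  have pos: "0 < (1 + norm x) ^ M" by (simp add: add_pos_nonneg)
  show "(1 + norm x) ^ M * norm (iter_partial \<alpha> \<psi> x) \<le> d"
    using schwartz_boundD[OF assms(1), of \<alpha> M x] a assms(2,3) pos by (simp add: pos_le_divide_eq mult.commute)
qed

lemma schwartz_smooth: "\<psi> \<in> schwartz \<Longrightarrow> smooth_fun \<psi>"
  by (simp add: schwartz_def)

text \<open>There are only finitely many lists of length at most \<open>N\<close>, so the separate
  bounds can be added up.\<close>

lemma schwartzE_bound:
  fixes \<psi> :: "real^'n \<Rightarrow> complex"
  assumes "\<psi> \<in> schwartz" obtains c where "schwartz_bound N \<psi> c"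
proof -
  have "\<forall>\<alpha> :: 'n list. \<exists>c. \<forall>x. (1 + norm x) ^ N * norm (iter_partial \<alpha> \<psi> x) \<le> c"
    using assms by (auto simp: schwartz_def bdd_above_def)
  from choice[OF this] obtain c where c: "\<And>(\<alpha> :: 'n list) x. (1 + norm x) ^ N * norm (iter_partial \<alpha> \<psi> x) \<le> c \<alpha>" by blast
  define S where "S = {\<alpha> :: 'n list. length \<alpha> \<le> N}"
  have fin: "finite S" unfolding S_def using finite_lists_length_le[of "UNIV :: 'n set" N] by simp
  have "schwartz_bound N \<psi> (\<Sum>\<alpha>\<in>S. \<bar>c \<alpha>\<bar>)"
    unfolding schwartz_bound_def
  proof (intro allI impI)
    fix \<alpha> :: "'n list" and x :: "real^'n" assume "length \<alpha> \<le> N"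
    then have "\<bar>c \<alpha>\<bar> \<le> (\<Sum>\<alpha>\<in>S. \<bar>c \<alpha>\<bar>)" using fin by (intro member_le_sum) (auto simp: S_def)
    then show "(1 + norm x) ^ N * norm (iter_partial \<alpha> \<psi> x) \<le> (\<Sum>\<alpha>\<in>S. \<bar>c \<alpha>\<bar>)"
      using c[of x \<alpha>] by linarith
  qed
  then show thesis by (rule that)
qed

lemma schwartzI_bound:
  fixes \<psi> :: "real^'n \<Rightarrow> complex"
  assumes "smooth_fun \<psi>" "\<And>N. \<exists>c. schwartz_bound N \<psi> c"
  shows "\<psi> \<in> schwartz"
  unfolding schwartz_def
proof (intro CollectI conjI allI assms(1))
  fix N and \<alpha> :: "'n list"
  obtain c where c: "schwartz_bound (max N (length \<alpha>)) \<psi> c" using assms(2) by blast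
  show "bdd_above (range (\<lambda>x. (1 + norm x) ^ N * norm (iter_partial \<alpha> \<psi> x)))"
  proof (rule bdd_aboveI2)
    fix x :: "real^'n"
    have pos: "0 < (1 + norm x) ^ N" by (simp add: add_pos_nonneg)
    show "(1 + norm x) ^ N * norm (iter_partial \<alpha> \<psi> x) \<le> c"
      using schwartz_boundD[OF c, of \<alpha> N x] pos by (simp add: pos_le_divide_eq mult.commute)
  qed
qed

lemma schwartz_partial_deriv: "\<psi> \<in> schwartz \<Longrightarrow> partial_deriv j \<psi> \<in> schwartz"
proof -
  assume \<psi>: "\<psi> \<in> schwartz"
  have it: "iter_partial \<alpha> (partial_deriv j \<psi>) = iter_partial (\<alpha> @ [j]) \<psi>" for \<alpha>
    by (simp add: iter_partial_append)
  from \<psi> show ?thesis by (simp add: schwartz_def smooth_fun_def it)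
qed

lemma schwartz_iter_partial: "\<psi> \<in> schwartz \<Longrightarrow> iter_partial \<alpha> \<psi> \<in> schwartz"
  by (induction \<alpha>) (auto intro: schwartz_partial_deriv)

lemma schwartz_coinduct:
  fixes \<psi> :: "real^'n \<Rightarrow> complex"
  assumes "\<psi> \<in> S" "\<And>g. g \<in> S \<Longrightarrow> g differentiable_on UNIV" "\<And>g j. g \<in> S \<Longrightarrow> partial_deriv j g \<in> S"
    and "\<And>g N. g \<in> S \<Longrightarrow> \<exists>c. \<forall>x. (1 + norm x) ^ N * norm (g x) \<le> c"
  shows "\<psi> \<in> schwartz"
proof -
  have it: "iter_partial \<alpha> \<psi> \<in> S" for \<alpha> by (induction \<alpha>) (use assms in auto)
  have "smooth_fun \<psi>" by (rule smooth_fun_coinduct[OF assms(1-3)])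
  moreover have "bdd_above (range (\<lambda>x. (1 + norm x) ^ N * norm (iter_partial \<alpha> \<psi> x)))" for N \<alpha>
    using assms(4)[OF it[of \<alpha>], of N] by (auto intro: bdd_aboveI2)
  ultimately show ?thesis by (simp add: schwartz_def)
qed

definition growth_bound :: "nat \<Rightarrow> nat \<Rightarrow> real \<Rightarrow> (real^'n \<Rightarrow> complex) \<Rightarrow> bool" where
  "growth_bound m k C g \<longleftrightarrow> (\<forall>\<alpha> x. length \<alpha> \<le> m \<longrightarrow> norm (iter_partial \<alpha> g x) \<le> C * (1 + norm x) ^ k)"

text \<open>A multiplier of polynomial growth \<open>k\<close> consumes \<open>k\<close> orders of
  decay; the factor 2^m is the number of terms in Leibniz' rule.\<close>

lemma schwartz_bound_mult:
  assumes "smooth_fun g" "smooth_fun \<psi>" "growth_bound m k C g" "schwartz_bound (m + k) \<psi> c"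
  shows "schwartz_bound m (\<lambda>x. g x * \<psi> x) (2 ^ m * C * c)"
  unfolding schwartz_bound_def
proof (intro allI impI)
  fix \<alpha> :: "'a list" and x :: "real^'a" assume a: "length \<alpha> \<le> m"
  define r where "r = 1 + norm x"
  have r: "1 \<le> r" "0 < r" by (simp_all add: r_def add_pos_nonneg)
  have C: "0 \<le> C"
  proof -
    have "norm (g 0) \<le> C"
      using assms(3)[unfolded growth_bound_def, rule_format, of "[]" 0] by simp
    then show ?thesis using norm_ge_zero order_trans by blast
  qed
  have c: "0 \<le> c" by (rule schwartz_bound_nonneg[OF assms(4)])
  have "norm (iter_partial \<alpha> (\<lambda>x. g x * \<psi> x) x) \<le> 2 ^ length \<alpha> * (C * r ^ k) * (c / r ^ (m + k))"
  proof (rule iter_partial_mult_bound[OF assms(1,2)])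
    fix \<beta> :: "'a list" assume b: "length \<beta> \<le> length \<alpha>"
    show "norm (iter_partial \<beta> g x) \<le> C * r ^ k"
      using assms(3) a b by (auto simp: growth_bound_def r_def)
    show "norm (iter_partial \<beta> \<psi> x) \<le> c / r ^ (m + k)"
      using schwartz_boundD[OF assms(4), of \<beta> "m + k" x] a b by (simp add: r_def)
  qed
  also have "\<dots> \<le> 2 ^ m * (C * r ^ k) * (c / r ^ (m + k))"
    using a r C c by (intro mult_right_mono power_increasing) auto
  also have "\<dots> = 2 ^ m * C * c / r ^ m" using r by (simp add: power_add)
  finally show "(1 + norm x) ^ m * norm (iter_partial \<alpha> (\<lambda>x. g x * \<psi> x) x) \<le> 2 ^ m * C * c"
    using r by (simp add: r_def[symmetric] pos_le_divide_eq mult.commute)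
qed

lemma schwartz_mult:
  assumes "smooth_fun g" "\<And>m. \<exists>k C. growth_bound m k C g" "\<psi> \<in> schwartz"
  shows "(\<lambda>x. g x * \<psi> x) \<in> schwartz"
proof (rule schwartzI_bound)
  show "smooth_fun (\<lambda>x. g x * \<psi> x)" by (rule smooth_fun_mult[OF assms(1) schwartz_smooth[OF assms(3)]])
  fix m
  obtain k C where k: "growth_bound m k C g" using assms(2) by blast
  obtain c where "schwartz_bound (m + k) \<psi> c" by (rule schwartzE_bound[OF assms(3)])
  from schwartz_bound_mult[OF assms(1) schwartz_smooth[OF assms(3)] k this]
  show "\<exists>c. schwartz_bound m (\<lambda>x. g x * \<psi> x) c" by blast
qed

lemma growth_bound_schwartz:
  assumes "\<psi> \<in> schwartz" shows "\<exists>C. growth_bound m 0 C \<psi>"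
proof -
  obtain c where c: "schwartz_bound m \<psi> c" by (rule schwartzE_bound[OF assms])
  show ?thesis using schwartz_boundD[OF c, of _ 0] by (auto simp: growth_bound_def)
qed

lemma schwartz_cmult:
  fixes \<psi> :: "real^'n \<Rightarrow> complex"
  assumes "\<psi> \<in> schwartz" shows "(\<lambda>x. c * \<psi> x) \<in> schwartz"
proof (rule schwartz_mult[OF smooth_fun_const _ assms])
  show "\<exists>k C. growth_bound m k C (\<lambda>x :: real^'n. c)" for m
  proof (intro exI)
    have "norm (iter_partial \<alpha> (\<lambda>x. c) x) \<le> norm c" for \<alpha> :: "'n list" and x :: "real^'n"
      by (induction \<alpha> rule: rev_induct) (auto simp: iter_partial_append)
    then show "growth_bound m 0 (norm c) (\<lambda>x :: real^'n. c)" by (simp add: growth_bound_def)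
  qed
qed

lemma schwartz_add:
  assumes "\<psi> \<in> schwartz" "\<eta> \<in> schwartz" shows "(\<lambda>x. \<psi> x + \<eta> x) \<in> schwartz"
proof (rule schwartzI_bound)
  note s = schwartz_smooth[OF assms(1)] schwartz_smooth[OF assms(2)]
  show "smooth_fun (\<lambda>x. \<psi> x + \<eta> x)" by (intro smooth_fun_add s)
  fix N
  obtain c where c: "schwartz_bound N \<psi> c" by (rule schwartzE_bound[OF assms(1)])
  obtain d where d: "schwartz_bound N \<eta> d" by (rule schwartzE_bound[OF assms(2)])
  have "schwartz_bound N (\<lambda>x. \<psi> x + \<eta> x) (c + d)"
    unfolding schwartz_bound_def
  proof (intro allI impI)
    fix \<alpha> :: "'a list" and x :: "real^'a" assume a: "length \<alpha> \<le> N"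
    have "(1 + norm x) ^ N * norm (iter_partial \<alpha> (\<lambda>x. \<psi> x + \<eta> x) x) \<le>
        (1 + norm x) ^ N * (norm (iter_partial \<alpha> \<psi> x) + norm (iter_partial \<alpha> \<eta> x))"
      by (intro mult_left_mono) (simp_all add: iter_partial_add[OF s] norm_triangle_ineq)
    also have "\<dots> \<le> c + d"
      using c d a unfolding schwartz_bound_def distrib_left by (intro add_mono) auto
    finally show "(1 + norm x) ^ N * norm (iter_partial \<alpha> (\<lambda>x. \<psi> x + \<eta> x) x) \<le> c + d" .
  qed
  then show "\<exists>c. schwartz_bound N (\<lambda>x. \<psi> x + \<eta> x) c" by blast
qed

lemma schwartz_zero: "(\<lambda>x. 0) \<in> schwartz"
  by (rule schwartz_coinduct[where S="{\<lambda>x. 0}"]) auto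

lemma schwartz_sum:
  assumes "finite A" "\<And>i. i \<in> A \<Longrightarrow> f i \<in> schwartz"
  shows "(\<lambda>x. \<Sum>i\<in>A. f i x) \<in> schwartz"
  using assms by (induction A) (auto intro: schwartz_zero schwartz_add)

lemma has_derivative_similarity:
  assumes "g differentiable_on UNIV"
  shows "((\<lambda>x. g (a *\<^sub>R x + b)) has_derivative (\<lambda>h. frechet_derivative g (at (a *\<^sub>R x + b)) (a *\<^sub>R h))) (at x)"
  by (rule has_derivative_compose[OF _ has_derivative_frechet[OF assms]]) (auto intro!: derivative_eq_intros)

lemma schwartz_similarity:
  fixes \<psi> :: "real^'n \<Rightarrow> complex"
  assumes "\<psi> \<in> schwartz" "a \<noteq> 0" shows "(\<lambda>x. \<psi> (a *\<^sub>R x + b)) \<in> schwartz"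
proof -
  define S where "S = {(\<lambda>x. \<eta> (a *\<^sub>R x + b)) | \<eta> :: real^'n \<Rightarrow> complex. \<eta> \<in> schwartz}"
  have d: "\<eta> differentiable_on UNIV" if "\<eta> \<in> schwartz" for \<eta> :: "real^'n \<Rightarrow> complex"
    using that by (intro smooth_fun_differentiable schwartz_smooth)
  show ?thesis
  proof (rule schwartz_coinduct[of _ S])
    show "(\<lambda>x. \<psi> (a *\<^sub>R x + b)) \<in> S" using assms(1) by (auto simp: S_def)
  next
    fix g assume "g \<in> S"
    then obtain \<eta> where \<eta>: "g = (\<lambda>x. \<eta> (a *\<^sub>R x + b))" "\<eta> \<in> schwartz" by (auto simp: S_def)
    show "g differentiable_on UNIV"
      unfolding \<eta>(1) differentiable_on_def using has_derivative_similarity[OF d[OF \<eta>(2)]]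
      by (auto simp: differentiable_def)
    fix j
    have "partial_deriv j g = (\<lambda>x. complex_of_real a * partial_deriv j \<eta> (a *\<^sub>R x + b))"
    proof
      fix x
      have "partial_deriv j g x = frechet_derivative \<eta> (at (a *\<^sub>R x + b)) (a *\<^sub>R axis j 1)"
        unfolding \<eta>(1) by (rule partial_deriv_eq[OF has_derivative_similarity[OF d[OF \<eta>(2)]]])
      also have "\<dots> = a *\<^sub>R partial_deriv j \<eta> (a *\<^sub>R x + b)"
        by (simp add: linear_scale[OF has_derivative_linear[OF has_derivative_frechet[OF d[OF \<eta>(2)]]]]
            partial_deriv_frechet[OF d[OF \<eta>(2)]])
      finally show "partial_deriv j g x = complex_of_real a * partial_deriv j \<eta> (a *\<^sub>R x + b)"
        by (simp add: scaleR_conv_of_real)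
    qed
    then show "partial_deriv j g \<in> S" unfolding S_def
      using schwartz_cmult[OF schwartz_partial_deriv[OF \<eta>(2), of j], of a]
      by (intro CollectI exI[of _ "\<lambda>y. complex_of_real a * partial_deriv j \<eta> y"] conjI)
  next
    fix g N assume "g \<in> S"
    then obtain \<eta> where \<eta>: "g = (\<lambda>x. \<eta> (a *\<^sub>R x + b))" "\<eta> \<in> schwartz" by (auto simp: S_def)
    obtain c where c: "schwartz_bound N \<eta> c" by (rule schwartzE_bound[OF \<eta>(2)])
    \<comment> \<open>Chosen so that 1 + |x| is at most L (1 + |a x + b|), which carries the
      polynomial weight through the substitution.\<close>
    define L where "L = 1 + norm b / \<bar>a\<bar> + 1 / \<bar>a\<bar>"
    have "(1 + norm x) ^ N * norm (g x) \<le> L ^ N * c" for x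
    proof -
      define r where "r = 1 + norm (a *\<^sub>R x + b)"
      have "\<bar>a\<bar> * norm x \<le> norm (a *\<^sub>R x + b) + norm b"
        using norm_triangle_ineq4[of "a *\<^sub>R x + b" b] by simp
      then have "norm x \<le> (norm (a *\<^sub>R x + b) + norm b) / \<bar>a\<bar>"
        using assms(2) by (simp add: pos_le_divide_eq mult.commute)
      also have "\<dots> = norm (a *\<^sub>R x + b) / \<bar>a\<bar> + norm b / \<bar>a\<bar>" by (rule add_divide_distrib)
      finally have "1 + norm x \<le> L + norm (a *\<^sub>R x + b) / \<bar>a\<bar>"
        unfolding L_def using divide_nonneg_nonneg[of 1 "\<bar>a\<bar>"] by linarith
      also have "\<dots> \<le> L * r"
      proof -
        have "norm (a *\<^sub>R x + b) / \<bar>a\<bar> = (1 / \<bar>a\<bar>) * norm (a *\<^sub>R x + b)" by simp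
        also have "\<dots> \<le> L * norm (a *\<^sub>R x + b)" by (intro mult_right_mono) (auto simp: L_def)
        finally show ?thesis by (simp add: r_def distrib_left)
      qed
      finally have "(1 + norm x) ^ N \<le> (L * r) ^ N" by (intro power_mono) auto
      then have "(1 + norm x) ^ N * norm (g x) \<le> L ^ N * (r ^ N * norm (g x))"
        by (simp add: power_mult_distrib mult_right_mono flip: mult.assoc)
      also have "\<dots> \<le> L ^ N * c"
      proof (rule mult_left_mono)
        show "r ^ N * norm (g x) \<le> c"
          using c[unfolded schwartz_bound_def, rule_format, of "[]" "a *\<^sub>R x + b"] by (simp add: r_def \<eta>(1))
      qed (simp add: L_def)
      finally show ?thesis .
    qed
    then show "\<exists>c. \<forall>x. (1 + norm x) ^ N * norm (g x) \<le> c" by blast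
  qed
qed

lemma schwartz_cnj:
  fixes \<psi> :: "real^'n \<Rightarrow> complex"
  assumes "\<psi> \<in> schwartz" shows "(\<lambda>x. cnj (\<psi> x)) \<in> schwartz"
proof -
  define S where "S = {(\<lambda>x. cnj (\<eta> x)) | \<eta> :: real^'n \<Rightarrow> complex. \<eta> \<in> schwartz}"
  have d: "((\<lambda>x. cnj (\<eta> x)) has_derivative (\<lambda>h. cnj (frechet_derivative \<eta> (at x) h))) (at x)"
    if "\<eta> \<in> schwartz" for \<eta> :: "real^'n \<Rightarrow> complex" and x
    by (rule bounded_linear.has_derivative[OF bounded_linear_cnj
        has_derivative_frechet[OF smooth_fun_differentiable[OF schwartz_smooth[OF that]]]])
  show ?thesis
  proof (rule schwartz_coinduct[of _ S])
    show "(\<lambda>x. cnj (\<psi> x)) \<in> S" using assms(1) by (auto simp: S_def)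
  next
    fix g assume "g \<in> S"
    then obtain \<eta> where \<eta>: "g = (\<lambda>x. cnj (\<eta> x))" "\<eta> \<in> schwartz" by (auto simp: S_def)
    show "g differentiable_on UNIV"
      unfolding \<eta>(1) differentiable_on_def using d[OF \<eta>(2)] by (auto simp: differentiable_def)
    fix j
    have "partial_deriv j g = (\<lambda>x. cnj (partial_deriv j \<eta> x))"
      using partial_deriv_eq[OF d[OF \<eta>(2)]] smooth_fun_differentiable[OF schwartz_smooth[OF \<eta>(2)]]
      by (auto simp: \<eta>(1) partial_deriv_frechet)
    then show "partial_deriv j g \<in> S" using schwartz_partial_deriv[OF \<eta>(2)] by (auto simp: S_def)
  next
    fix g N assume "g \<in> S"
    then obtain \<eta> where \<eta>: "g = (\<lambda>x. cnj (\<eta> x))" "\<eta> \<in> schwartz" by (auto simp: S_def)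
    obtain c where c: "schwartz_bound N \<eta> c" by (rule schwartzE_bound[OF \<eta>(2)])
    have "(1 + norm x) ^ N * norm (g x) \<le> c" for x
      using c[unfolded schwartz_bound_def, rule_format, of "[]" x] by (simp add: \<eta>(1))
    then show "\<exists>c. \<forall>x. (1 + norm x) ^ N * norm (g x) \<le> c" by blast
  qed
qed

lemma integrable_inverse_power_norm:
  assumes "2 * CARD('n) \<le> N"
  shows "integrable lborel (\<lambda>x :: real^'n. 1 / (1 + norm x) ^ N)"
  by (rule integrableI_nonneg) (use nn_integral_inverse_power_norm_finite[OF assms] in \<open>auto simp: less_top\<close>)

text \<open>The type argument only carries the dimension: this is the L^1 norm of the model function
  with which all integrability bounds are compared.\<close>

definition decay_integral :: "('n::finite) itself \<Rightarrow> real" where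
  "decay_integral _ = (LINT x|lborel. 1 / (1 + norm (x :: real^'n)) ^ (2 * CARD('n)))"

lemma integrable_of_decay:
  fixes g :: "real^'n \<Rightarrow> 'b::{banach, second_countable_topology}"
  assumes m: "g \<in> borel_measurable borel" and le: "\<And>x. norm (g x) \<le> c / (1 + norm x) ^ (2 * CARD('n))"
  shows "integrable lborel g" "(LINT x|lborel. norm (g x)) \<le> c * decay_integral TYPE('n)"
proof -
  have i: "integrable lborel (\<lambda>x :: real^'n. c * (1 / (1 + norm x) ^ (2 * CARD('n))))"
    using integrable_inverse_power_norm[where 'n='n, of "2 * CARD('n)"] by (intro integrable_mult_right) simp
  show g: "integrable lborel g"
  proof (rule Bochner_Integration.integrable_bound[OF i])
    show "AE x in lborel. norm (g x) \<le> norm (c * (1 / (1 + norm x) ^ (2 * CARD('n))))"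
      using order_trans[OF le divide_right_mono[OF abs_ge_self[of c]]] by (intro AE_I2) simp
  qed (use m in simp)
  have "(LINT x|lborel. norm (g x)) \<le> (LINT x|lborel. c * (1 / (1 + norm (x :: real^'n)) ^ (2 * CARD('n))))"
    by (rule integral_mono[OF integrable_norm[OF g] i]) (use le in simp)
  also have "\<dots> = c * decay_integral TYPE('n)"
    unfolding decay_integral_def by (rule integral_mult_right_zero)
  finally show "(LINT x|lborel. norm (g x)) \<le> c * decay_integral TYPE('n)" .
qed

lemma schwartz_borel: "\<psi> \<in> schwartz \<Longrightarrow> \<psi> \<in> borel_measurable borel"
  by (intro borel_measurable_continuous_onI smooth_fun_continuous schwartz_smooth)

lemma schwartz_integrable_bound:
  fixes \<psi> :: "real^'n \<Rightarrow> complex"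
  assumes "\<psi> \<in> schwartz" "schwartz_bound N \<psi> c" "length \<alpha> \<le> N" "2 * CARD('n) \<le> N"
  shows "(LINT x|lborel. norm (iter_partial \<alpha> \<psi> x)) \<le> c * decay_integral TYPE('n)"
  using schwartz_boundD[OF assms(2,3,4)]
  by (intro integrable_of_decay schwartz_borel schwartz_iter_partial assms(1))

lemma schwartz_integrable:
  fixes \<psi> :: "real^'n \<Rightarrow> complex"
  assumes "\<psi> \<in> schwartz" shows "integrable lborel \<psi>"
proof -
  obtain c where c: "schwartz_bound (2 * CARD('n)) \<psi> c" by (rule schwartzE_bound[OF assms])
  show ?thesis
    using schwartz_boundD[OF c, of "[]" "2 * CARD('n)"]
    by (intro integrable_of_decay schwartz_borel assms) simp
qed

section \<open>The Fourier transform\<close>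

text \<open>The plane wave exp (i x . \<xi>). It is symmetric in its arguments, so it serves as
  kernel of both transforms and also, as a function of the frequency, as something to be localised
  by \<phi>_k.\<close>

definition character :: "real^'n \<Rightarrow> real^'n \<Rightarrow> complex" where
  "character \<xi> x = exp (\<i> * complex_of_real (x \<bullet> \<xi>))"

lemma norm_character [simp]: "norm (character \<xi> x) = 1"
  by (simp add: character_def norm_exp_eq_Re)

lemma character_add: "character (\<xi> + \<eta>) x = character \<xi> x * character \<eta> x"
  by (simp add: character_def inner_add_right distrib_left exp_add)

lemma character_commute: "character \<xi> x = character x \<xi>"
  by (simp add: character_def inner_commute)

lemma has_derivative_character:
  "(character \<xi> has_derivative (\<lambda>h. \<i> * complex_of_real (h \<bullet> \<xi>) * character \<xi> x)) (at x)"
proof -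
  have "((\<lambda>x. \<i> * complex_of_real (x \<bullet> \<xi>)) has_derivative (\<lambda>h. \<i> * complex_of_real (h \<bullet> \<xi>))) (at x)"
    by (auto intro!: derivative_eq_intros)
  from has_derivative_compose[OF this has_field_derivative_imp_has_derivative[OF DERIV_exp]]
  show ?thesis by (simp add: character_def[abs_def] mult_ac)
qed

lemma partial_deriv_character: "partial_deriv j (character \<xi>) = (\<lambda>x. (\<i> * complex_of_real (\<xi> $ j)) * character \<xi> x)"
  by (intro ext) (simp add: partial_deriv_eq[OF has_derivative_character] inner_axis inner_commute[of _ \<xi>])

lemma smooth_fun_character: "smooth_fun (character \<xi>)"
proof (rule smooth_fun_coinduct[of _ "range (\<lambda>c x. c * character \<xi> x)"])
  show "character \<xi> \<in> range (\<lambda>c x. c * character \<xi> x)" by (rule range_eqI[of _ _ 1]) simp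
next
  have d: "character \<xi> differentiable_on UNIV"
    using has_derivative_character by (auto simp: differentiable_on_def differentiable_def)
  fix g assume "g \<in> range (\<lambda>c x. c * character \<xi> x)"
  then obtain c where g: "g = (\<lambda>x. c * character \<xi> x)" by auto
  have cd: "(\<lambda>x. c) differentiable_on UNIV" by simp
  show "g differentiable_on UNIV"
    using d unfolding g differentiable_on_def by (intro ballI differentiable_mult) auto
  fix j
  have "partial_deriv j g = (\<lambda>x. (c * (\<i> * complex_of_real (\<xi> $ j))) * character \<xi> x)"
    unfolding g by (simp add: partial_deriv_mult[OF cd d] partial_deriv_character mult.assoc)
  then show "partial_deriv j g \<in> range (\<lambda>c x. c * character \<xi> x)" by blast
qed

text \<open>The monomial (i \<xi>)^\<alpha>, the eigenvalue of \<open>iter_partial\<close> on the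
  character of frequency \<xi>.\<close>

definition symbol :: "'n list \<Rightarrow> real^'n \<Rightarrow> complex" where
  "symbol \<alpha> \<xi> = prod_list (map (\<lambda>j. \<i> * complex_of_real (\<xi> $ j)) \<alpha>)"

lemma symbol_simps [simp]: "symbol [] \<xi> = 1" "symbol (j # \<alpha>) \<xi> = \<i> * complex_of_real (\<xi> $ j) * symbol \<alpha> \<xi>"
  by (simp_all add: symbol_def)

lemma iter_partial_character: "iter_partial \<alpha> (character \<xi>) = (\<lambda>x. symbol \<alpha> \<xi> * character \<xi> x)"
proof (induction \<alpha>)
  case (Cons j \<alpha>)
  have "partial_deriv j (\<lambda>x. symbol \<alpha> \<xi> * character \<xi> x) = (\<lambda>x. symbol \<alpha> \<xi> * partial_deriv j (character \<xi>) x)"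
    using iter_partial_cmult[OF smooth_fun_character, of "[j]"] by simp
  then show ?case using Cons by (simp add: partial_deriv_character mult_ac)
qed simp

lemma abs_component_le: "\<bar>x $ j\<bar> \<le> norm (x :: real^'n)"
  by (rule component_le_norm_cart)

lemma norm_symbol_le: "norm (symbol \<alpha> \<xi>) \<le> (1 + norm \<xi>) ^ length \<alpha>"
proof (induction \<alpha>)
  case (Cons j \<alpha>)
  have "norm (symbol (j # \<alpha>) \<xi>) = \<bar>\<xi> $ j\<bar> * norm (symbol \<alpha> \<xi>)" by (simp add: norm_mult)
  also have "\<dots> \<le> (1 + norm \<xi>) * (1 + norm \<xi>) ^ length \<alpha>"
    using abs_component_le[of \<xi> j] by (intro mult_mono Cons) auto
  finally show ?case by simp
qed simp

lemma growth_bound_character: "growth_bound m 0 ((1 + norm \<xi>) ^ m) (character \<xi>)"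
  unfolding growth_bound_def
proof (intro allI impI)
  fix \<alpha> :: "'a list" and x :: "real^'a" assume "length \<alpha> \<le> m"
  then have "(1 + norm \<xi>) ^ length \<alpha> \<le> (1 + norm \<xi>) ^ m" by (intro power_increasing) auto
  then show "norm (iter_partial \<alpha> (character \<xi>) x) \<le> (1 + norm \<xi>) ^ m * (1 + norm x) ^ 0"
    using norm_symbol_le[of \<alpha> \<xi>] by (simp add: iter_partial_character norm_mult)
qed

lemma schwartz_character_mult: "\<psi> \<in> schwartz \<Longrightarrow> (\<lambda>x. character \<xi> x * \<psi> x) \<in> schwartz"
  using growth_bound_character by (intro schwartz_mult smooth_fun_character) blast+

lemma borel_measurable_character [measurable]: "character \<xi> \<in> borel_measurable borel"
  by (intro borel_measurable_continuous_onI smooth_fun_continuous smooth_fun_character)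

section \<open>Smoothness and decay of Fourier transforms\<close>

lemma fourier_eq:
  assumes [measurable]: "\<psi> \<in> borel_measurable borel"
  shows "fourier \<psi> \<xi> = (LINT x|lborel. character (- \<xi>) x * \<psi> x)"
proof -
  have "fourier \<psi> \<xi> = (LINT x|lebesgue. character (- \<xi>) x * \<psi> x)"
    by (simp add: fourier_def character_def)
  also have "\<dots> = (LINT x|lborel. character (- \<xi>) x * \<psi> x)"
    by (rule integral_completion) measurable
  finally show ?thesis .
qed

lemma norm_fourier_le:
  assumes "\<psi> \<in> schwartz" shows "norm (fourier \<psi> \<xi>) \<le> (LINT x|lborel. norm (\<psi> x))"
proof -
  have "norm (fourier \<psi> \<xi>) \<le> (LINT x|lborel. norm (character (- \<xi>) x * \<psi> x))"
    unfolding fourier_eq[OF schwartz_borel[OF assms]] by (rule integral_norm_bound)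
  then show ?thesis by (simp add: norm_mult)
qed

lemma partial_deriv_coordinate:
  "partial_deriv j (\<lambda>x :: real^'n. c * complex_of_real (x $ k)) = (\<lambda>x. if j = k then c else 0)"
proof
  fix x :: "real^'n"
  have "((\<lambda>x. c * complex_of_real (x $ k)) has_derivative (\<lambda>h. c * complex_of_real (h $ k))) (at x)"
    by (auto intro!: derivative_eq_intros bounded_linear.has_derivative[OF bounded_linear_vec_nth])
  from partial_deriv_eq[OF this] show "partial_deriv j (\<lambda>x. c * complex_of_real (x $ k)) x = (if j = k then c else 0)"
    by (simp add: axis_def)
qed

lemma differentiable_coordinate: "(\<lambda>x :: real^'n. c * complex_of_real (x $ k)) differentiable_on UNIV"
proof -
  have "((\<lambda>x. c * complex_of_real (x $ k)) has_derivative (\<lambda>h. c * complex_of_real (h $ k))) (at x)" for x :: "real^'n"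
    by (auto intro!: derivative_eq_intros bounded_linear.has_derivative[OF bounded_linear_vec_nth])
  then show ?thesis by (auto simp: differentiable_on_def differentiable_def)
qed

lemma smooth_fun_coordinate: "smooth_fun (\<lambda>x :: real^'n. c * complex_of_real (x $ k))"
  by (rule smooth_fun_coinduct[of _ "insert (\<lambda>x. c * complex_of_real (x $ k)) (range (\<lambda>c x. c))"])
    (auto simp: partial_deriv_coordinate differentiable_coordinate split: if_splits)

lemma iter_partial_const: "iter_partial \<alpha> (\<lambda>x. c) = (if \<alpha> = [] then (\<lambda>x. c) else (\<lambda>x. 0))"
  by (induction \<alpha>) auto

lemma growth_bound_coordinate:
  assumes "norm c \<le> 1"
  shows "growth_bound m 1 1 (\<lambda>x :: real^'n. c * complex_of_real (x $ k))"
  unfolding growth_bound_def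
proof (intro allI impI)
  fix \<alpha> :: "'n list" and x :: "real^'n"
  have *: "norm (c * complex_of_real (x $ k)) \<le> 1 * (1 + norm x)"
    unfolding norm_mult using abs_component_le[of x k] assms by (intro mult_mono) auto
  have c: "norm c \<le> 1 + norm x" using assms by (simp add: add_increasing2)
  have "norm (iter_partial \<alpha> (\<lambda>x. c * complex_of_real (x $ k)) x) \<le> 1 + norm x"
  proof (cases \<alpha> rule: rev_cases)
    case (snoc \<beta> j)
    have "iter_partial \<alpha> (\<lambda>x. c * complex_of_real (x $ k)) = iter_partial \<beta> (\<lambda>x. if j = k then c else 0)"
      by (simp only: snoc iter_partial_append iter_partial_Cons iter_partial_Nil partial_deriv_coordinate)
    then show ?thesis using c by (cases "j = k") (auto simp: iter_partial_const)
  qed (use * in simp)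
  then show "norm (iter_partial \<alpha> (\<lambda>x. c * complex_of_real (x $ k)) x) \<le> 1 * (1 + norm x) ^ 1" by simp
qed

lemma schwartz_coordinate_mult:
  assumes "\<psi> \<in> schwartz" "norm c \<le> 1" shows "(\<lambda>x. c * complex_of_real (x $ k) * \<psi> x) \<in> schwartz"
  using growth_bound_coordinate[OF assms(2)] by (intro schwartz_mult smooth_fun_coordinate assms(1)) blast

lemma schwartz_integrable_norm_mult:
  fixes \<psi> :: "real^'n \<Rightarrow> complex"
  assumes "\<psi> \<in> schwartz" shows "integrable lborel (\<lambda>x. (1 + norm x) ^ k * norm (\<psi> x))"
proof -
  obtain c where c: "schwartz_bound (k + 2 * CARD('n)) \<psi> c" by (rule schwartzE_bound[OF assms])
  note [measurable] = schwartz_borel[OF assms]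
  show ?thesis
  proof (rule integrable_of_decay(1))
    fix x :: "real^'n"
    have r: "0 < 1 + norm x" by (simp add: add_pos_nonneg)
    have "(1 + norm x) ^ k * norm (\<psi> x) \<le> (1 + norm x) ^ k * (c / (1 + norm x) ^ (k + 2 * CARD('n)))"
      using schwartz_boundD[OF c, of "[]" "k + 2 * CARD('n)" x] by (intro mult_left_mono) auto
    also have "\<dots> = c / (1 + norm x) ^ (2 * CARD('n))" using r by (simp add: power_add)
    finally show "norm ((1 + norm x) ^ k * norm (\<psi> x)) \<le> c / (1 + norm x) ^ (2 * CARD('n))" by simp
  qed measurable
qed

text \<open>Differentiation under the integral with an explicit remainder: |exp(i t) - 1 - i t| is
  at most t^2 / 2. The integral of (1 + |x|)^2 |\<psi>| then bounds both the candidate derivative as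
  a linear map and the remainder.\<close>

lemma fourier_has_derivative:
  fixes \<psi> :: "real^'n \<Rightarrow> complex"
  assumes \<psi>: "\<psi> \<in> schwartz"
  shows "(fourier \<psi> has_derivative
    (\<lambda>h. LINT x|lborel. (- \<i> * complex_of_real (x \<bullet> h)) * (character (- \<xi>) x * \<psi> x))) (at \<xi>)"
proof -
  note [measurable] = schwartz_borel[OF \<psi>]
  define D where "D h = (LINT x|lborel. (- \<i> * complex_of_real (x \<bullet> h)) * (character (- \<xi>) x * \<psi> x))" for h
  have int1: "integrable lborel (\<lambda>x. (- \<i> * complex_of_real (x \<bullet> h)) * (character (- \<xi>) x * \<psi> x))" for h
  proof (rule Bochner_Integration.integrable_bound[OF integrable_mult_right[OF schwartz_integrable_norm_mult[OF \<psi>, of 1], of "norm h"]])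
    show "AE x in lborel. norm ((- \<i> * complex_of_real (x \<bullet> h)) * (character (- \<xi>) x * \<psi> x)) \<le> norm (norm h * ((1 + norm x) ^ 1 * norm (\<psi> x)))"
    proof (intro AE_I2)
      fix x
      have "\<bar>x \<bullet> h\<bar> * norm (\<psi> x) \<le> (norm h * (1 + norm x)) * norm (\<psi> x)"
      proof (rule mult_right_mono)
        show "\<bar>x \<bullet> h\<bar> \<le> norm h * (1 + norm x)"
          using Cauchy_Schwarz_ineq2[of x h] norm_ge_zero[of h] unfolding distrib_left mult.commute[of "norm x"]
          by linarith
      qed simp
      then show "norm ((- \<i> * complex_of_real (x \<bullet> h)) * (character (- \<xi>) x * \<psi> x)) \<le> norm (norm h * ((1 + norm x) ^ 1 * norm (\<psi> x)))"
        by (simp add: norm_mult mult.assoc abs_mult)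
    qed
  qed measurable
  have int0: "integrable lborel (\<lambda>x. character \<eta> x * \<psi> x)" for \<eta>
    by (rule schwartz_integrable[OF schwartz_character_mult[OF \<psi>]])
  define B where "B = (LINT x|lborel. (1 + norm x) ^ 2 * norm (\<psi> x))"
  have B: "integrable lborel (\<lambda>x. (1 + norm x) ^ 2 * norm (\<psi> x))"
    by (rule schwartz_integrable_norm_mult[OF \<psi>])
  have bl: "bounded_linear D"
  proof (rule bounded_linear_intro[where K=B])
    fix h h' :: "real^'n" and r :: real
    show "D (h + h') = D h + D h'"
      unfolding D_def by (subst Bochner_Integration.integral_add[OF int1 int1, symmetric])
        (simp add: inner_add_right algebra_simps)
    show "D (r *\<^sub>R h) = r *\<^sub>R D h"
      unfolding D_def by (subst integral_scaleR_right[symmetric]) (simp add: scaleR_conv_of_real[where 'a=complex] mult_ac)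
    have "norm (D h) \<le> (LINT x|lborel. norm h * ((1 + norm x) ^ 2 * norm (\<psi> x)))"
      unfolding D_def
    proof (rule Bochner_Integration.integral_norm_bound_integral[OF int1 integrable_mult_right[OF B]])
      fix x :: "real^'n"
      have "norm x \<le> (1 + norm x)\<^sup>2" by (simp add: power2_eq_square algebra_simps)
      then have "\<bar>x \<bullet> h\<bar> \<le> norm h * (1 + norm x)\<^sup>2"
        using Cauchy_Schwarz_ineq2[of x h] mult_left_mono[of "norm x" "(1 + norm x)\<^sup>2" "norm h"]
        by (simp add: mult.commute)
      then have "\<bar>x \<bullet> h\<bar> * norm (\<psi> x) \<le> norm h * (1 + norm x)\<^sup>2 * norm (\<psi> x)" by (intro mult_right_mono) auto
      then show "norm ((- \<i> * complex_of_real (x \<bullet> h)) * (character (- \<xi>) x * \<psi> x)) \<le> norm h * ((1 + norm x)\<^sup>2 * norm (\<psi> x))"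
        by (simp add: norm_mult mult.assoc)
    qed
    then show "norm (D h) \<le> norm h * B" by (simp add: B_def)
  qed
  have rem: "norm (fourier \<psi> (\<xi> + h) - fourier \<psi> \<xi> - D h) \<le> (norm h)\<^sup>2 * B" for h
  proof -
    have "fourier \<psi> (\<xi> + h) - fourier \<psi> \<xi> - D h =
        (LINT x|lborel. (character (- (\<xi> + h)) x * \<psi> x - character (- \<xi>) x * \<psi> x) - (- \<i> * complex_of_real (x \<bullet> h)) * (character (- \<xi>) x * \<psi> x))"
      unfolding fourier_eq[OF schwartz_borel[OF \<psi>]] D_def
      using int0 int1 by (simp add: Bochner_Integration.integral_diff)
    also have "norm \<dots> \<le> (LINT x|lborel. (norm h)\<^sup>2 * ((1 + norm x) ^ 2 * norm (\<psi> x)))"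
    proof (rule Bochner_Integration.integral_norm_bound_integral[OF _ integrable_mult_right[OF B]])
      show "integrable lborel (\<lambda>x. (character (- (\<xi> + h)) x * \<psi> x - character (- \<xi>) x * \<psi> x) - (- \<i> * complex_of_real (x \<bullet> h)) * (character (- \<xi>) x * \<psi> x))"
        by (intro Bochner_Integration.integrable_diff int0 int1)
      fix x :: "real^'n"
      define \<theta> where "\<theta> = - (x \<bullet> h)"
      have "character (- (\<xi> + h)) x = character (- \<xi>) x * iexp \<theta>"
        by (simp add: character_def \<theta>_def inner_add_right exp_add[symmetric] algebra_simps)
      then have "(character (- (\<xi> + h)) x * \<psi> x - character (- \<xi>) x * \<psi> x) - (- \<i> * complex_of_real (x \<bullet> h)) * (character (- \<xi>) x * \<psi> x)
          = character (- \<xi>) x * \<psi> x * (iexp \<theta> - (1 + \<i> * \<theta>))"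
        by (simp add: \<theta>_def algebra_simps)
      then have eq: "norm ((character (- (\<xi> + h)) x * \<psi> x - character (- \<xi>) x * \<psi> x) - (- \<i> * complex_of_real (x \<bullet> h)) * (character (- \<xi>) x * \<psi> x))
          = norm (\<psi> x) * norm (iexp \<theta> - (1 + \<i> * \<theta>))" by (simp add: norm_mult)
      have "norm (iexp \<theta> - (1 + \<i> * \<theta>)) \<le> \<theta>\<^sup>2 / 2"
        using iexp_approx1[of \<theta> 1] by (simp add: power2_eq_square)
      also have "\<theta>\<^sup>2 / 2 \<le> (norm h)\<^sup>2 * (1 + norm x)\<^sup>2"
      proof -
        have "\<bar>\<theta>\<bar> \<le> norm h * (1 + norm x)"
          using Cauchy_Schwarz_ineq2[of x h] norm_ge_zero[of h] unfolding \<theta>_def distrib_left abs_minus_cancel mult.commute[of "norm x"] by linarith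
        then have "\<bar>\<theta>\<bar>\<^sup>2 \<le> (norm h * (1 + norm x))\<^sup>2" by (rule power_mono) simp
        then show ?thesis using zero_le_power2[of \<theta>] unfolding power_mult_distrib power2_abs by linarith
      qed
      finally have "norm (\<psi> x) * norm (iexp \<theta> - (1 + \<i> * \<theta>)) \<le> norm (\<psi> x) * ((norm h)\<^sup>2 * (1 + norm x)\<^sup>2)"
        by (rule mult_left_mono) simp
      then show "norm ((character (- (\<xi> + h)) x * \<psi> x - character (- \<xi>) x * \<psi> x) - (- \<i> * complex_of_real (x \<bullet> h)) * (character (- \<xi>) x * \<psi> x))
          \<le> (norm h)\<^sup>2 * ((1 + norm x) ^ 2 * norm (\<psi> x))"
        unfolding eq by (simp only: mult_ac)
    qed
    also have "\<dots> = (norm h)\<^sup>2 * B" by (simp add: B_def)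
    finally show ?thesis .
  qed
  have "((\<lambda>h. norm (fourier \<psi> (\<xi> + h) - fourier \<psi> \<xi> - D h) / norm h) \<longlongrightarrow> 0) (at 0)"
  proof (rule Lim_null_comparison)
    have "norm (norm (fourier \<psi> (\<xi> + h) - fourier \<psi> \<xi> - D h) / norm h) \<le> norm h * B" for h
    proof (cases "h = 0")
      case False
      then show ?thesis using rem[of h] by (simp add: pos_divide_le_eq power2_eq_square mult_ac)
    qed simp
    then show "\<forall>\<^sub>F h in at 0. norm (norm (fourier \<psi> (\<xi> + h) - fourier \<psi> \<xi> - D h) / norm h) \<le> norm h * B"
      by simp
    have "((\<lambda>h :: real^'n. norm h * B) \<longlongrightarrow> norm (0 :: real^'n) * B) (at 0)" by (intro tendsto_intros)
    then show "((\<lambda>h :: real^'n. norm h * B) \<longlongrightarrow> 0) (at 0)" by simp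
  qed
  then have "(fourier \<psi> has_derivative D) (at \<xi>)"
    using bl by (simp add: has_derivative_at)
  then show ?thesis by (simp add: D_def[abs_def])
qed

lemma partial_deriv_fourier:
  assumes "\<psi> \<in> schwartz"
  shows "partial_deriv j (fourier \<psi>) = fourier (\<lambda>x. (- \<i> * complex_of_real (x $ j)) * \<psi> x)"
proof
  fix \<xi>
  have "partial_deriv j (fourier \<psi>) \<xi> = (LINT x|lborel. (- \<i> * complex_of_real (x $ j)) * (character (- \<xi>) x * \<psi> x))"
    by (simp add: partial_deriv_eq[OF fourier_has_derivative[OF assms]] inner_axis)
  also have "\<dots> = (LINT x|lborel. character (- \<xi>) x * ((- \<i> * complex_of_real (x $ j)) * \<psi> x))"
    by (intro Bochner_Integration.integral_cong refl) simp
  also have "\<dots> = fourier (\<lambda>x. (- \<i> * complex_of_real (x $ j)) * \<psi> x) \<xi>"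
    by (rule fourier_eq[symmetric]) (intro schwartz_borel schwartz_coordinate_mult assms, simp)
  finally show "partial_deriv j (fourier \<psi>) \<xi> = fourier (\<lambda>x. (- \<i> * complex_of_real (x $ j)) * \<psi> x) \<xi>" .
qed

lemma smooth_fun_fourier:
  assumes "\<psi> \<in> schwartz" shows "smooth_fun (fourier \<psi>)"
proof (rule smooth_fun_coinduct[of _ "fourier ` schwartz"])
  show "fourier \<psi> \<in> fourier ` schwartz" using assms by simp
next
  fix g :: "real^'a \<Rightarrow> complex" assume "g \<in> fourier ` schwartz"
  then obtain \<eta> where \<eta>: "g = fourier \<eta>" "\<eta> \<in> schwartz" by blast
  show "g differentiable_on UNIV"
    unfolding \<eta>(1) differentiable_on_def using fourier_has_derivative[OF \<eta>(2)] by (auto simp: differentiable_def)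
  show "partial_deriv j g \<in> fourier ` schwartz" for j
    unfolding \<eta>(1) partial_deriv_fourier[OF \<eta>(2)] by (intro imageI schwartz_coordinate_mult \<eta>(2)) simp
qed

lemma lborel_integral_affine:
  fixes f :: "real^'n \<Rightarrow> complex"
  assumes [measurable]: "f \<in> borel_measurable borel" and c: "c \<noteq> 0"
  shows "(LINT x|lborel. f x) = complex_of_real (\<bar>c\<bar> ^ CARD('n)) * (LINT x|lborel. f (t + c *\<^sub>R x))"
proof -
  have "(LINT x|lborel. f x) = (LINT x|density (distr lborel borel (\<lambda>x. t + c *\<^sub>R x)) (\<lambda>_. ennreal (\<bar>c\<bar> ^ CARD('n))). f x)"
    by (rule arg_cong[OF lborel_affine[OF c, of t, unfolded DIM_cart DIM_real mult_1_right]])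
  also have "\<dots> = (LINT x|distr lborel borel (\<lambda>x. t + c *\<^sub>R x). \<bar>c\<bar> ^ CARD('n) *\<^sub>R f x)"
    by (rule integral_density) auto
  also have "\<dots> = (LINT x|lborel. \<bar>c\<bar> ^ CARD('n) *\<^sub>R f (t + c *\<^sub>R x))"
    by (rule integral_distr) auto
  also have "\<dots> = \<bar>c\<bar> ^ CARD('n) *\<^sub>R (LINT x|lborel. f (t + c *\<^sub>R x))" by (rule integral_scaleR_right)
  finally show ?thesis by (simp add: scaleR_conv_of_real)
qed

lemma directional_difference_le:
  fixes g :: "real^'n \<Rightarrow> complex"
  assumes g: "smooth_fun g" and B: "\<And>\<tau>. 0 \<le> \<tau> \<Longrightarrow> \<tau> \<le> 1 \<Longrightarrow> norm (partial_deriv j g (x + \<tau> *\<^sub>R axis j 1)) \<le> B"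
    and t: "0 \<le> t" "t \<le> 1"
  shows "norm (g (x + t *\<^sub>R axis j 1) - g x) \<le> B * t"
proof -
  note d = smooth_fun_differentiable[OF g]
  have "norm (g (x + t *\<^sub>R axis j 1) - g (x + 0 *\<^sub>R axis j 1)) \<le> B * norm (t - 0)"
  proof (rule differentiable_bound[where S="{0..1}" and f="\<lambda>\<tau>. g (x + \<tau> *\<^sub>R axis j 1)" and f'="\<lambda>\<tau> h. h *\<^sub>R partial_deriv j g (x + \<tau> *\<^sub>R axis j 1)"])
    fix \<tau> :: real assume \<tau>: "\<tau> \<in> {0..1}"
    have lin: "frechet_derivative g (at y) (h *\<^sub>R axis j 1) = h *\<^sub>R partial_deriv j g y" for h y
      unfolding partial_deriv_frechet[OF d] by (rule linear_scale[OF has_derivative_linear[OF has_derivative_frechet[OF d]]])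
    have line: "((\<lambda>\<tau>. x + \<tau> *\<^sub>R axis j 1) has_derivative (\<lambda>h. h *\<^sub>R axis j 1)) (at \<tau>)"
      by (auto intro!: derivative_eq_intros)
    have "((\<lambda>\<tau>. g (x + \<tau> *\<^sub>R axis j 1)) has_derivative (\<lambda>h. h *\<^sub>R partial_deriv j g (x + \<tau> *\<^sub>R axis j 1))) (at \<tau>)"
      using has_derivative_compose[OF line has_derivative_frechet[OF d]] unfolding lin .
    then show "((\<lambda>\<tau>. g (x + \<tau> *\<^sub>R axis j 1)) has_derivative (\<lambda>h. h *\<^sub>R partial_deriv j g (x + \<tau> *\<^sub>R axis j 1))) (at \<tau> within {0..1})"
      by (rule has_derivative_at_withinI)
    show "onorm (\<lambda>h. h *\<^sub>R partial_deriv j g (x + \<tau> *\<^sub>R axis j 1)) \<le> B"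
    proof (rule onorm_le)
      fix h :: real
      show "norm (h *\<^sub>R partial_deriv j g (x + \<tau> *\<^sub>R axis j 1)) \<le> B * norm h"
        using mult_left_mono[OF B, of \<tau> "\<bar>h\<bar>"] \<tau> by (simp add: mult.commute)
    qed
  qed (use t in auto)
  then show ?thesis using t by simp
qed

text \<open>Difference quotients integrate to 0 by translation invariance and converge to the
  partial derivative under a common integrable bound. This is integration by parts without boundary
  terms or iterated integrals.\<close>

lemma integral_partial_deriv:
  fixes g :: "real^'n \<Rightarrow> complex"
  assumes g: "g \<in> schwartz"
  shows "(LINT x|lborel. partial_deriv j g x) = 0"
proof -
  define e where "e = (axis j 1 :: real^'n)"
  have e: "norm e = 1" by (simp add: e_def)
  define t where "t k = 1 / real (Suc k)" for k
  have t: "0 < t k" "t k \<le> 1" for k by (simp_all add: t_def)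
  define q where "q k x = (1 / t k) *\<^sub>R (g (x + t k *\<^sub>R e) - g x)" for k x
  note [measurable] = schwartz_borel[OF g] schwartz_borel[OF schwartz_partial_deriv[OF g]]
  note d = smooth_fun_differentiable[OF schwartz_smooth[OF g]]
  define n where "n = CARD('n)"
  obtain c where c: "schwartz_bound (2 * n + 1) g c" by (rule schwartzE_bound[OF g])
  have c0: "0 \<le> c" by (rule schwartz_bound_nonneg[OF c])
  have int: "integrable lborel (\<lambda>x. g (x + a))" for a
    using schwartz_integrable[OF schwartz_similarity[OF g, of 1 a]] by simp
  have q0: "(LINT x|lborel. q k x) = 0" for k
  proof -
    have "(LINT x|lborel. g (x + t k *\<^sub>R e)) = (LINT x|lborel. g x)"
      using lborel_integral_affine[of g 1 "t k *\<^sub>R e"] by (simp add: add.commute)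
    then show ?thesis
      unfolding q_def using int[of "t k *\<^sub>R e"] schwartz_integrable[OF g]
      by (simp add: Bochner_Integration.integral_diff)
  qed
  have "(\<lambda>k. LINT x|lborel. q k x) \<longlonglongrightarrow> (LINT x|lborel. partial_deriv j g x)"
  proof (rule integral_dominated_convergence)
    show "partial_deriv j g \<in> borel_measurable lborel" by simp
    show "q k \<in> borel_measurable lborel" for k unfolding q_def[abs_def] by measurable
    show "integrable lborel (\<lambda>x :: real^'n. (c * 2 ^ (2 * n)) * (1 / (1 + norm x) ^ (2 * n)))"
      using integrable_inverse_power_norm[where 'n='n, of "2 * n"] by (intro integrable_mult_right) (simp add: n_def)
    show "AE x in lborel. (\<lambda>k. q k x) \<longlonglongrightarrow> partial_deriv j g x"
    proof (intro AE_I2)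
      fix x :: "real^'n"
      have "((\<lambda>h. norm (g (x + h) - g x - frechet_derivative g (at x) h) / norm h) \<longlongrightarrow> 0) (at 0)"
        using has_derivative_frechet[OF d, of x] by (simp add: has_derivative_at)
      moreover have "filterlim (\<lambda>k. t k *\<^sub>R e) (at 0) sequentially"
      proof -
        have "(\<lambda>k. t k *\<^sub>R e) \<longlonglongrightarrow> 0 *\<^sub>R e"
          unfolding t_def by (rule tendsto_scaleR[OF LIMSEQ_Suc[OF lim_1_over_n] tendsto_const])
        moreover have "t k *\<^sub>R e \<noteq> 0" for k using t(1)[of k] e by auto
        ultimately show ?thesis by (simp add: filterlim_at)
      qed
      ultimately have "(\<lambda>k. norm (g (x + t k *\<^sub>R e) - g x - frechet_derivative g (at x) (t k *\<^sub>R e)) / norm (t k *\<^sub>R e)) \<longlonglongrightarrow> 0"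
        by (rule filterlim_compose)
      moreover have "norm (g (x + t k *\<^sub>R e) - g x - frechet_derivative g (at x) (t k *\<^sub>R e)) / norm (t k *\<^sub>R e) = norm (q k x - partial_deriv j g x)" for k
      proof -
        have "q k x - partial_deriv j g x = (1 / t k) *\<^sub>R (g (x + t k *\<^sub>R e) - g x - frechet_derivative g (at x) (t k *\<^sub>R e))"
          using t(1)[of k] by (simp add: q_def e_def linear_scale[OF has_derivative_linear[OF has_derivative_frechet[OF d]]]
            partial_deriv_frechet[OF d] scaleR_diff_right)
        then show ?thesis using t(1)[of k] e by simp
      qed
      ultimately have "(\<lambda>k. norm (q k x - partial_deriv j g x)) \<longlonglongrightarrow> 0" by simp
      then show "(\<lambda>k. q k x) \<longlonglongrightarrow> partial_deriv j g x"
        by (simp add: tendsto_norm_zero_iff LIM_zero_iff)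
    qed
    show "AE x in lborel. norm (q k x) \<le> (c * 2 ^ (2 * n)) * (1 / (1 + norm x) ^ (2 * n))" for k
    proof (intro AE_I2)
      fix x :: "real^'n"
      have r: "0 < 1 + norm x" by (simp add: add_pos_nonneg)
      \<comment> \<open>A shift of length at most 1 changes 1 + |x| at most by the factor 2, whence
        2^(2n) in the dominating function.\<close>
      have B: "norm (partial_deriv j g (x + \<tau> *\<^sub>R axis j 1)) \<le> c * 2 ^ (2 * n) / (1 + norm x) ^ (2 * n)"
        if \<tau>: "0 \<le> \<tau>" "\<tau> \<le> 1" for \<tau>
      proof -
        define y where "y = x + \<tau> *\<^sub>R axis j 1"
        have "norm x \<le> norm y + 1"
          using norm_triangle_ineq4[of y "\<tau> *\<^sub>R axis j (1::real)"] \<tau> by (simp add: y_def)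
        then have "1 + norm x \<le> 1 + (norm y + 1)" by (rule add_left_mono)
        also have "\<dots> \<le> 2 * (1 + norm y)" by simp
        finally have "1 + norm x \<le> 2 * (1 + norm y)" .
        then have "(1 + norm x) ^ (2 * n) \<le> (2 * (1 + norm y)) ^ (2 * n)" using r by (intro power_mono) auto
        then have le: "(1 + norm x) ^ (2 * n) \<le> 2 ^ (2 * n) * (1 + norm y) ^ (2 * n)"
          unfolding power_mult_distrib .
        have y: "0 < (1 + norm y) ^ (2 * n)" by (simp add: add_pos_nonneg)
        have "norm (iter_partial [j] g y) \<le> c / (1 + norm y) ^ (2 * n)"
          by (rule schwartz_boundD[OF c]) auto
        also have "\<dots> \<le> c * 2 ^ (2 * n) / (1 + norm x) ^ (2 * n)"
          using mult_left_mono[OF le c0] r y by (simp add: divide_simps mult_ac)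
        finally show ?thesis by (simp add: y_def)
      qed
      have "norm (g (x + t k *\<^sub>R axis j 1) - g x) \<le> c * 2 ^ (2 * n) / (1 + norm x) ^ (2 * n) * t k"
        using t[of k] by (intro directional_difference_le[OF schwartz_smooth[OF g] B]) auto
      then have "norm (g (x + t k *\<^sub>R e) - g x) / t k \<le> c * 2 ^ (2 * n) / (1 + norm x) ^ (2 * n)"
        using t(1)[of k] by (simp add: pos_divide_le_eq e_def)
      then show "norm (q k x) \<le> (c * 2 ^ (2 * n)) * (1 / (1 + norm x) ^ (2 * n))"
        using t(1)[of k] by (simp add: q_def)
    qed
  qed
  then show ?thesis by (simp add: q0 LIMSEQ_const_iff)
qed

text \<open>The derivative of the product of \<open>\<psi>\<close> with a character has integral 0,
  and the product rule splits it into the two sides.\<close>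

lemma fourier_partial_deriv:
  assumes \<psi>: "\<psi> \<in> schwartz"
  shows "fourier (partial_deriv j \<psi>) \<xi> = \<i> * complex_of_real (\<xi> $ j) * fourier \<psi> \<xi>"
proof -
  note d = smooth_fun_differentiable[OF schwartz_smooth[OF \<psi>]]
  have i1: "integrable lborel (\<lambda>x. character (- \<xi>) x * \<psi> x)"
    by (rule schwartz_integrable[OF schwartz_character_mult[OF \<psi>]])
  have i2: "integrable lborel (\<lambda>x. character (- \<xi>) x * partial_deriv j \<psi> x)"
    by (rule schwartz_integrable[OF schwartz_character_mult[OF schwartz_partial_deriv[OF \<psi>]]])
  have "partial_deriv j (\<lambda>x. character (- \<xi>) x * \<psi> x) =
      (\<lambda>x. (- \<i> * complex_of_real (\<xi> $ j)) * (character (- \<xi>) x * \<psi> x) + character (- \<xi>) x * partial_deriv j \<psi> x)"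
    by (simp add: partial_deriv_mult[OF smooth_fun_differentiable[OF smooth_fun_character] d] partial_deriv_character mult.assoc)
  then have "0 = (LINT x|lborel. (- \<i> * complex_of_real (\<xi> $ j)) * (character (- \<xi>) x * \<psi> x) + character (- \<xi>) x * partial_deriv j \<psi> x)"
    using integral_partial_deriv[OF schwartz_character_mult[OF \<psi>], of j "- \<xi>"] by simp
  also have "\<dots> = (- \<i> * complex_of_real (\<xi> $ j)) * fourier \<psi> \<xi> + fourier (partial_deriv j \<psi>) \<xi>"
    unfolding fourier_eq[OF schwartz_borel[OF \<psi>]] fourier_eq[OF schwartz_borel[OF schwartz_partial_deriv[OF \<psi>]]]
    by (subst Bochner_Integration.integral_add[OF integrable_mult_right[OF i1] i2]) simp
  finally show ?thesis by (simp add: algebra_simps)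
qed

lemma fourier_iter_partial_replicate:
  assumes "\<psi> \<in> schwartz"
  shows "fourier (iter_partial (replicate N j) \<psi>) \<xi> = (\<i> * complex_of_real (\<xi> $ j)) ^ N * fourier \<psi> \<xi>"
  by (induction N) (simp_all add: fourier_partial_deriv schwartz_iter_partial assms)

text \<open>In the direction of the largest coordinate |\<xi>| is at most n |\<xi>_j|, so pure
  derivatives of order N control the whole weight. If that coordinate is at most 1, then |\<xi>|
  \<le> n and the L^1 norm of \<open>\<psi>\<close> suffices.\<close>

lemma fourier_decay:
  fixes \<psi> :: "real^'n \<Rightarrow> complex"
  assumes \<psi>: "\<psi> \<in> schwartz" and L: "\<And>j. (LINT x|lborel. norm (iter_partial (replicate N j) \<psi> x)) \<le> L"
    "(LINT x|lborel. norm (\<psi> x)) \<le> L"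
  shows "(1 + norm \<xi>) ^ N * norm (fourier \<psi> \<xi>) \<le> (1 + real CARD('n)) ^ N * L"
proof -
  define n where "n = real CARD('n)"
  obtain j where j: "\<And>i. \<bar>\<xi> $ i\<bar> \<le> \<bar>\<xi> $ j\<bar>"
  proof -
    have "Max (range (\<lambda>i. \<bar>\<xi> $ i\<bar>)) \<in> range (\<lambda>i. \<bar>\<xi> $ i\<bar>)" by (intro Max_in) auto
    then obtain j where "Max (range (\<lambda>i. \<bar>\<xi> $ i\<bar>)) = \<bar>\<xi> $ j\<bar>" by blast
    moreover have "\<bar>\<xi> $ i\<bar> \<le> Max (range (\<lambda>i. \<bar>\<xi> $ i\<bar>))" for i by (rule Max_ge) auto
    ultimately have "\<bar>\<xi> $ i\<bar> \<le> \<bar>\<xi> $ j\<bar>" for i by simp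
    then show thesis by (rule that)
  qed
  have "norm \<xi> \<le> (\<Sum>i\<in>UNIV. \<bar>\<xi> $ i\<bar>)" by (rule norm_le_l1_cart)
  also have "\<dots> \<le> (\<Sum>i\<in>(UNIV::'n set). \<bar>\<xi> $ j\<bar>)" using j by (intro sum_mono) auto
  finally have le: "norm \<xi> \<le> n * \<bar>\<xi> $ j\<bar>" by (simp add: n_def)
  have n: "0 \<le> n" by (simp add: n_def)
  show ?thesis
  proof (cases "\<bar>\<xi> $ j\<bar> \<le> 1")
    case True
    have "norm \<xi> \<le> n" using le mult_left_mono[OF True n] by simp
    then have "(1 + norm \<xi>) ^ N \<le> (1 + n) ^ N" by (intro power_mono) auto
    moreover have "norm (fourier \<psi> \<xi>) \<le> L" using norm_fourier_le[OF \<psi>, of \<xi>] L(2) by simp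
    ultimately show ?thesis unfolding n_def[symmetric] using n by (intro mult_mono) auto
  next
    case False
    then have "1 + norm \<xi> \<le> (1 + n) * \<bar>\<xi> $ j\<bar>" using le by (simp add: distrib_right)
    then have "(1 + norm \<xi>) ^ N \<le> ((1 + n) * \<bar>\<xi> $ j\<bar>) ^ N" by (intro power_mono) auto
    then have "(1 + norm \<xi>) ^ N * norm (fourier \<psi> \<xi>) \<le> ((1 + n) * \<bar>\<xi> $ j\<bar>) ^ N * norm (fourier \<psi> \<xi>)"
      by (rule mult_right_mono) simp
    also have "\<dots> = (1 + n) ^ N * norm (fourier (iter_partial (replicate N j) \<psi>) \<xi>)"
      by (simp add: fourier_iter_partial_replicate[OF \<psi>] norm_mult norm_power power_mult_distrib)
    also have "\<dots> \<le> (1 + n) ^ N * L"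
      using norm_fourier_le[OF schwartz_iter_partial[OF \<psi>], of "replicate N j" \<xi>] L(1)[of j] n
      by (intro mult_left_mono) auto
    finally show ?thesis by (simp add: n_def)
  qed
qed

text \<open>Multiplication by (-i x)^\<alpha>, the operation that differentiation of the transform
  induces on the original function.\<close>

definition coordinate_mult :: "'n list \<Rightarrow> (real^'n \<Rightarrow> complex) \<Rightarrow> real^'n \<Rightarrow> complex" where
  "coordinate_mult \<alpha> \<psi> = foldr (\<lambda>j \<eta> x. (- \<i> * complex_of_real (x $ j)) * \<eta> x) \<alpha> \<psi>"

lemma coordinate_mult_simps [simp]:
  "coordinate_mult [] \<psi> = \<psi>"
  "coordinate_mult (j # \<alpha>) \<psi> = (\<lambda>x. (- \<i> * complex_of_real (x $ j)) * coordinate_mult \<alpha> \<psi> x)"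
  by (simp_all add: coordinate_mult_def)

lemma schwartz_coordinate_mults: "\<psi> \<in> schwartz \<Longrightarrow> coordinate_mult \<alpha> \<psi> \<in> schwartz"
proof (induction \<alpha>)
  case (Cons j \<alpha>)
  then show ?case unfolding coordinate_mult_simps by (intro schwartz_coordinate_mult) auto
qed simp

lemma iter_partial_fourier:
  "\<psi> \<in> schwartz \<Longrightarrow> iter_partial \<alpha> (fourier \<psi>) = fourier (coordinate_mult \<alpha> \<psi>)"
proof (induction \<alpha>)
  case (Cons j \<alpha>)
  then show ?case by (simp only: iter_partial_Cons partial_deriv_fourier[OF schwartz_coordinate_mults] coordinate_mult_simps)
qed simp

text \<open>Each coordinate factor costs one order of decay and, by Leibniz' rule, a constant of at
  most 2^(m + |\<alpha>|); there are |\<alpha>| factors.\<close>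

lemma schwartz_bound_coordinate_mult:
  assumes "\<psi> \<in> schwartz" "schwartz_bound (m + length \<alpha>) \<psi> c"
  shows "schwartz_bound m (coordinate_mult \<alpha> \<psi>) (2 ^ ((m + length \<alpha>) * length \<alpha>) * c)"
  using assms(2)
proof (induction \<alpha> arbitrary: m)
  case (Cons j \<alpha>)
  define k where "k = length \<alpha>"
  have c: "0 \<le> c" by (rule schwartz_bound_nonneg[OF Cons.prems])
  have "schwartz_bound (m + 1) (coordinate_mult \<alpha> \<psi>) (2 ^ ((m + 1 + k) * k) * c)"
    using Cons.IH[of "m + 1"] Cons.prems by (simp add: k_def)
  from schwartz_bound_mult[OF smooth_fun_coordinate schwartz_smooth[OF schwartz_coordinate_mults[OF assms(1)]]
      growth_bound_coordinate this, of "- \<i>" j]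
  have "schwartz_bound m (coordinate_mult (j # \<alpha>) \<psi>) (2 ^ m * 1 * (2 ^ ((m + 1 + k) * k) * c))" by simp
  moreover have "2 ^ m * 1 * (2 ^ ((m + 1 + k) * k) * c) \<le> 2 ^ ((m + length (j # \<alpha>)) * length (j # \<alpha>)) * c"
  proof -
    have "2 ^ m * 1 * (2 ^ ((m + 1 + k) * k) * c) = 2 ^ (m + (m + 1 + k) * k) * c" by (simp add: power_add)
    also have "\<dots> \<le> 2 ^ ((m + length (j # \<alpha>)) * length (j # \<alpha>)) * c"
      using c by (intro mult_right_mono power_increasing) (auto simp: k_def)
    finally show ?thesis .
  qed
  ultimately show ?case by (rule schwartz_bound_mono[OF _ order_refl])
qed simp

text \<open>The index adds up from N coordinate factors (derivatives of the transform), N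
  derivatives (its decay) and 2n orders for integrability. The constant is independent of the
  function, so the transform is continuous on Schwartz functions.\<close>

lemma fourier_schwartz_bound:
  obtains C where "\<And>\<psi> :: real^'n \<Rightarrow> complex. \<And>c. \<psi> \<in> schwartz \<Longrightarrow> schwartz_bound (2 * N + 2 * CARD('n)) \<psi> c \<Longrightarrow>
    schwartz_bound N (fourier \<psi>) (C * c)"
proof
  define n where "n = CARD('n)"
  define C where "C = (1 + real n) ^ N * (2 ^ ((N + 2 * n + N) * N) * decay_integral TYPE('n))"
  fix \<psi> :: "real^'n \<Rightarrow> complex" and c
  assume \<psi>: "\<psi> \<in> schwartz" and b: "schwartz_bound (2 * N + 2 * CARD('n)) \<psi> c"
  have c: "0 \<le> c" by (rule schwartz_bound_nonneg[OF b])
  show "schwartz_bound N (fourier \<psi>) (C * c)"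
    unfolding schwartz_bound_def
  proof (intro allI impI)
    fix \<alpha> :: "'n list" and \<xi> :: "real^'n" assume \<alpha>: "length \<alpha> \<le> N"
    define g where "g = coordinate_mult \<alpha> \<psi>"
    define c' where "c' = 2 ^ ((N + 2 * n + N) * N) * c"
    have g: "g \<in> schwartz" unfolding g_def by (rule schwartz_coordinate_mults[OF \<psi>])
    have "schwartz_bound (N + 2 * n) g (2 ^ ((N + 2 * n + length \<alpha>) * length \<alpha>) * c)"
      unfolding g_def by (rule schwartz_bound_coordinate_mult[OF \<psi> schwartz_bound_mono[OF b]]) (use \<alpha> in \<open>auto simp: n_def\<close>)
    moreover have "2 ^ ((N + 2 * n + length \<alpha>) * length \<alpha>) * c \<le> c'"
      unfolding c'_def using \<alpha> c by (intro mult_right_mono power_increasing mult_mono) auto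
    ultimately have gb: "schwartz_bound (N + 2 * n) g c'" by (rule schwartz_bound_mono[OF _ order_refl])
    have "(1 + norm \<xi>) ^ N * norm (fourier g \<xi>) \<le> (1 + real CARD('n)) ^ N * (c' * decay_integral TYPE('n))"
    proof (rule fourier_decay[OF g])
      show "(LINT x|lborel. norm (iter_partial (replicate N j) g x)) \<le> c' * decay_integral TYPE('n)" for j
        by (rule schwartz_integrable_bound[OF g gb]) (auto simp: n_def)
      show "(LINT x|lborel. norm (g x)) \<le> c' * decay_integral TYPE('n)"
        using schwartz_integrable_bound[OF g gb, of "[]"] by (simp add: n_def)
    qed
    then show "(1 + norm \<xi>) ^ N * norm (iter_partial \<alpha> (fourier \<psi>) \<xi>) \<le> C * c"
      by (simp add: iter_partial_fourier[OF \<psi>] g_def C_def c'_def n_def mult_ac)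
  qed
qed

lemma schwartz_fourier:
  fixes \<psi> :: "real^'n \<Rightarrow> complex"
  assumes "\<psi> \<in> schwartz" shows "fourier \<psi> \<in> schwartz"
proof (rule schwartzI_bound[OF smooth_fun_fourier[OF assms]])
  fix N
  obtain C where C: "\<And>\<psi> :: real^'n \<Rightarrow> complex. \<And>c. \<psi> \<in> schwartz \<Longrightarrow> schwartz_bound (2 * N + 2 * CARD('n)) \<psi> c \<Longrightarrow>
    schwartz_bound N (fourier \<psi>) (C * c)" using fourier_schwartz_bound by blast
  obtain c where "schwartz_bound (2 * N + 2 * CARD('n)) \<psi> c" by (rule schwartzE_bound[OF assms])
  from C[OF assms this] show "\<exists>c. schwartz_bound N (fourier \<psi>) c" by blast
qed

section \<open>Fourier inversion by Gaussian regularisation\<close>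

lemma inv_fourier_eq:
  fixes \<psi> :: "real^'n \<Rightarrow> complex"
  assumes [measurable]: "\<psi> \<in> borel_measurable borel"
  shows "inv_fourier \<psi> x = complex_of_real (1 / (2 * pi) ^ CARD('n)) * (LINT \<xi>|lborel. character x \<xi> * \<psi> \<xi>)"
proof -
  have "(LINT \<xi>|lebesgue. character x \<xi> * \<psi> \<xi>) = (LINT \<xi>|lborel. character x \<xi> * \<psi> \<xi>)"
    by (rule integral_completion) measurable
  then show ?thesis by (simp add: inv_fourier_def character_def inner_commute)
qed

lemma inv_fourier_fourier_reflect:
  fixes \<psi> :: "real^'n \<Rightarrow> complex"
  assumes "\<psi> \<in> schwartz"
  shows "inv_fourier \<psi> = (\<lambda>x. complex_of_real (1 / (2 * pi) ^ CARD('n)) * fourier \<psi> (- x))"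
  by (rule ext) (simp add: inv_fourier_eq fourier_eq schwartz_borel assms)

lemma schwartz_inv_fourier:
  fixes \<psi> :: "real^'n \<Rightarrow> complex"
  assumes "\<psi> \<in> schwartz" shows "inv_fourier \<psi> \<in> schwartz"
  unfolding inv_fourier_fourier_reflect[OF assms]
  by (rule schwartz_cmult) (use schwartz_similarity[OF schwartz_fourier[OF assms], of "-1" 0] in simp)

text \<open>The characteristic function of the standard normal distribution, rewritten without its
  normalisation.\<close>

lemma integral_character_gauss_1:
  "(LINT t|lborel. iexp (t * s) * complex_of_real (exp (- t\<^sup>2 / 2))) = complex_of_real (sqrt (2 * pi) * exp (- s\<^sup>2 / 2))"
proof -
  have "complex_of_real (exp (- s\<^sup>2 / 2)) = char std_normal_distribution s"
    by (simp add: char_std_normal_distribution)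
  also have "\<dots> = (LINT t|lborel. std_normal_density t *\<^sub>R iexp (s * t))"
    unfolding char_def by (rule integral_density) auto
  also have "\<dots> = (LINT t|lborel. complex_of_real (1 / sqrt (2 * pi)) * (iexp (t * s) * complex_of_real (exp (- t\<^sup>2 / 2))))"
    by (intro Bochner_Integration.integral_cong refl)
      (simp add: std_normal_density_def scaleR_conv_of_real mult_ac)
  also have "\<dots> = complex_of_real (1 / sqrt (2 * pi)) * (LINT t|lborel. iexp (t * s) * complex_of_real (exp (- t\<^sup>2 / 2)))"
    by (rule integral_mult_right_zero)
  finally have "complex_of_real (sqrt (2 * pi)) * complex_of_real (exp (- s\<^sup>2 / 2)) =
      (complex_of_real (sqrt (2 * pi)) * complex_of_real (1 / sqrt (2 * pi))) * (LINT t|lborel. iexp (t * s) * complex_of_real (exp (- t\<^sup>2 / 2)))"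
    by (simp only: mult.assoc)
  moreover have "complex_of_real (sqrt (2 * pi)) * complex_of_real (1 / sqrt (2 * pi)) = 1"
    by (simp flip: of_real_mult)
  ultimately show ?thesis by simp
qed

lemma lborel_integral_prod:
  fixes f :: "'a::euclidean_space \<Rightarrow> real \<Rightarrow> complex"
  assumes f: "\<And>b. b \<in> Basis \<Longrightarrow> integrable lborel (f b)"
  shows "(LINT x|lborel. (\<Prod>b\<in>Basis. f b (x \<bullet> b))) = (\<Prod>b\<in>Basis. LINT t|lborel. f b t)"
proof -
  interpret product_sigma_finite "\<lambda>_ :: 'a. lborel :: real measure" ..
  have m [measurable]: "f b \<in> borel_measurable borel" if "b \<in> Basis" for b
    using borel_measurable_integrable[OF f[OF that]] by simp
  have "(LINT x|lborel. (\<Prod>b\<in>Basis. f b (x \<bullet> b))) =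
      (LINT x|distr (\<Pi>\<^sub>M b\<in>Basis. lborel) borel (\<lambda>f. \<Sum>b\<in>Basis. f b *\<^sub>R (b :: 'a)). (\<Prod>b\<in>Basis. f b (x \<bullet> b)))"
    unfolding lborel_eq_real[symmetric] lborel_def[where 'a='a] ..
  also have "\<dots> = (LINT y|(\<Pi>\<^sub>M b\<in>Basis. lborel). (\<Prod>b\<in>Basis. f b ((\<Sum>b\<in>Basis. y b *\<^sub>R b) \<bullet> b)))"
    by (rule integral_distr) measurable
  also have "\<dots> = (LINT y|(\<Pi>\<^sub>M b\<in>Basis. lborel). (\<Prod>b\<in>Basis. f b (y b)))"
    by (intro Bochner_Integration.integral_cong refl prod.cong) simp
  also have "\<dots> = (\<Prod>b\<in>Basis. LINT t|lborel. f b t)"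
    by (rule product_integral_prod) (auto intro: f)
  finally show ?thesis .
qed

definition gauss :: "real^'n \<Rightarrow> real" where
  "gauss x = exp (- (norm x)\<^sup>2 / 2)"

lemma gauss_pos: "0 < gauss x" by (simp add: gauss_def)

lemma gauss_minus: "gauss (- x) = gauss x" by (simp add: gauss_def)

lemma borel_measurable_gauss [measurable]: "gauss \<in> borel_measurable borel"
  unfolding gauss_def[abs_def] by measurable

text \<open>A function that is not integrable has Bochner integral 0 by convention, while the value
  computed above is nonzero. The same device gives integrability of the Gaussians below.\<close>

lemma integrable_gauss_1: "integrable lborel (\<lambda>t. iexp (t * s) * complex_of_real (exp (- t\<^sup>2 / 2)))"
proof (rule ccontr)
  assume "\<not> ?thesis"
  then have "(LINT t|lborel. iexp (t * s) * complex_of_real (exp (- t\<^sup>2 / 2))) = 0"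
    by (rule not_integrable_integral_eq)
  then show False unfolding integral_character_gauss_1 by simp
qed

lemma integral_character_gauss:
  fixes \<xi> :: "real^'n"
  shows "(LINT x|lborel. character \<xi> x * complex_of_real (gauss x)) = complex_of_real (sqrt (2 * pi) ^ CARD('n) * gauss \<xi>)"
proof -
  have "character \<xi> x * complex_of_real (gauss x) =
      (\<Prod>b\<in>Basis. iexp ((x \<bullet> b) * (\<xi> \<bullet> b)) * complex_of_real (exp (- (x \<bullet> b)\<^sup>2 / 2)))" for x
  proof -
    have "x \<bullet> \<xi> = (\<Sum>b\<in>Basis. (x \<bullet> b) * (\<xi> \<bullet> b))" by (rule euclidean_inner)
    moreover have "(norm x)\<^sup>2 = (\<Sum>b\<in>Basis. (x \<bullet> b)\<^sup>2)"
      unfolding power2_norm_eq_inner by (subst euclidean_inner) (simp add: power2_eq_square)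
    ultimately show ?thesis
      by (simp add: character_def gauss_def prod.distrib exp_sum[symmetric] sum_distrib_left sum_negf
          sum_divide_distrib flip: of_real_prod)
  qed
  then have "(LINT x|lborel. character \<xi> x * complex_of_real (gauss x)) =
      (\<Prod>b\<in>Basis. complex_of_real (sqrt (2 * pi) * exp (- (\<xi> \<bullet> b)\<^sup>2 / 2)))"
    using lborel_integral_prod[where f="\<lambda>b t. iexp (t * (\<xi> \<bullet> b)) * complex_of_real (exp (- t\<^sup>2 / 2))"]
    by (simp only: integral_character_gauss_1 integrable_gauss_1)
  also have "\<dots> = complex_of_real (sqrt (2 * pi) ^ CARD('n) * gauss \<xi>)"
  proof -
    have "(norm \<xi>)\<^sup>2 = (\<Sum>b\<in>Basis. (\<xi> \<bullet> b)\<^sup>2)"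
      unfolding power2_norm_eq_inner by (subst euclidean_inner) (simp add: power2_eq_square)
    then have "(\<Prod>b\<in>Basis. sqrt (2 * pi) * exp (- (\<xi> \<bullet> b)\<^sup>2 / 2)) = sqrt (2 * pi) ^ CARD('n) * gauss \<xi>"
      by (simp add: prod.distrib gauss_def exp_sum[symmetric] sum_negf sum_divide_distrib)
    then show ?thesis by (simp only: of_real_prod[symmetric])
  qed
  finally show ?thesis .
qed

lemma integral_gauss:
  "(LINT x|lborel. complex_of_real (gauss (x :: real^'n))) = complex_of_real (sqrt (2 * pi) ^ CARD('n))"
  using integral_character_gauss[of "0 :: real^'n"] by (simp add: character_def gauss_def)

lemma integrable_gauss: "integrable lborel (gauss :: real^'n \<Rightarrow> real)"
proof -
  have "integrable lborel (\<lambda>x :: real^'n. complex_of_real (gauss x))"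
  proof (rule ccontr)
    assume "\<not> ?thesis"
    then have "(LINT x|lborel. complex_of_real (gauss (x :: real^'n))) = 0"
      by (rule not_integrable_integral_eq)
    then show False unfolding integral_gauss by simp
  qed
  then show ?thesis by (simp only: complex_of_real_integrable_eq)
qed

lemma integrable_gauss_scaled:
  fixes c :: real
  assumes "c \<noteq> 0" shows "integrable lborel (\<lambda>x :: real^'n. gauss (c *\<^sub>R x))"
proof -
  have "complex_of_real (\<bar>c\<bar> ^ CARD('n)) * (LINT x|lborel. complex_of_real (gauss (0 + c *\<^sub>R (x :: real^'n)))) =
      complex_of_real (sqrt (2 * pi) ^ CARD('n))"
    unfolding integral_gauss[symmetric] by (rule lborel_integral_affine[symmetric]) (use assms in auto)
  moreover have "complex_of_real (sqrt (2 * pi) ^ CARD('n)) \<noteq> 0" by simp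
  ultimately have "(LINT x|lborel. complex_of_real (gauss (0 + c *\<^sub>R (x :: real^'n)))) \<noteq> 0"
    by (intro notI) (simp only: mult_zero_right)
  then have "(LINT x|lborel. complex_of_real (gauss (c *\<^sub>R (x :: real^'n)))) \<noteq> 0"
    unfolding add_0 .
  then have "integrable lborel (\<lambda>x :: real^'n. complex_of_real (gauss (c *\<^sub>R x)))"
    using not_integrable_integral_eq by blast
  then show ?thesis by (simp only: complex_of_real_integrable_eq)
qed

text \<open>The Gaussian damping makes the double integral absolutely convergent, so the order can
  be exchanged. The inner integral is then the transform of a scaled Gaussian, and the right-hand
  side averages \<open>\<psi>\<close> around x at scale \<epsilon>.\<close>

lemma integral_fourier_gauss:
  fixes \<psi> :: "real^'n \<Rightarrow> complex"
  assumes \<psi>: "\<psi> \<in> schwartz" and \<epsilon>: "0 < \<epsilon>"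
  shows "(LINT \<xi>|lborel. character x \<xi> * fourier \<psi> \<xi> * complex_of_real (gauss (\<epsilon> *\<^sub>R \<xi>))) =
    complex_of_real (sqrt (2 * pi) ^ CARD('n)) * (LINT z|lborel. \<psi> (x + \<epsilon> *\<^sub>R z) * complex_of_real (gauss z))"
proof -
  note [measurable] = schwartz_borel[OF \<psi>]
  define n where "n = CARD('n)"
  define H where "H y \<xi> = character x \<xi> * (character (- \<xi>) y * \<psi> y) * complex_of_real (gauss (\<epsilon> *\<^sub>R \<xi>))" for y \<xi>
  have Hm: "(\<lambda>(y, \<xi>). H y \<xi>) \<in> borel_measurable (lborel \<Otimes>\<^sub>M lborel)"
    unfolding H_def character_def by measurable
  have ig: "integrable lborel (\<lambda>\<xi> :: real^'n. gauss (\<epsilon> *\<^sub>R \<xi>))" using \<epsilon> by (intro integrable_gauss_scaled) simp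
  have normH: "norm (H y \<xi>) = norm (\<psi> y) * gauss (\<epsilon> *\<^sub>R \<xi>)" for y \<xi>
    using gauss_pos[of "\<epsilon> *\<^sub>R \<xi>"] by (simp add: H_def norm_mult)
  have Hint: "integrable (lborel \<Otimes>\<^sub>M lborel) (\<lambda>(y, \<xi>). H y \<xi>)"
  proof (rule lborel_pair.Fubini_integrable[OF Hm])
    show "integrable lborel (\<lambda>y. LINT \<xi>|lborel. norm (case (y, \<xi>) of (y, \<xi>) \<Rightarrow> H y \<xi>))"
      unfolding prod.case normH using schwartz_integrable[OF \<psi>] by simp
    show "AE y in lborel. integrable lborel (\<lambda>\<xi>. case (y, \<xi>) of (y, \<xi>) \<Rightarrow> H y \<xi>)"
    proof (intro AE_I2)
      fix y
      have "integrable lborel (\<lambda>\<xi> :: real^'n. norm (\<psi> y) * gauss (\<epsilon> *\<^sub>R \<xi>))" using ig by (intro integrable_mult_right)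
      then show "integrable lborel (\<lambda>\<xi>. case (y, \<xi>) of (y, \<xi>) \<Rightarrow> H y \<xi>)"
        unfolding prod.case
      proof (rule Bochner_Integration.integrable_bound)
        show "H y \<in> borel_measurable lborel" unfolding H_def[abs_def] character_def by measurable
        show "AE \<xi> in lborel. norm (H y \<xi>) \<le> norm (norm (\<psi> y) * gauss (\<epsilon> *\<^sub>R \<xi>))"
          by (simp add: normH)
      qed
    qed
  qed
  have "(LINT \<xi>|lborel. character x \<xi> * fourier \<psi> \<xi> * complex_of_real (gauss (\<epsilon> *\<^sub>R \<xi>))) =
      (LINT \<xi>|lborel. (LINT y|lborel. H y \<xi>))"
    unfolding H_def fourier_eq[OF schwartz_borel[OF \<psi>]]
    by (simp only: integral_mult_left_zero integral_mult_right_zero)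
  also have "\<dots> = (LINT y|lborel. (LINT \<xi>|lborel. H y \<xi>))"
    by (rule lborel_pair.Fubini_integral[OF Hint])
  also have "\<dots> = (LINT y|lborel. \<psi> y * complex_of_real (sqrt (2 * pi) ^ n / \<epsilon> ^ n * gauss ((1 / \<epsilon>) *\<^sub>R (x - y))))"
  proof (intro Bochner_Integration.integral_cong refl)
    fix y
    define u where "u = (1 / \<epsilon>) *\<^sub>R (x - y)"
    have "complex_of_real (sqrt (2 * pi) ^ n * gauss u) = (LINT \<eta>|lborel. character u \<eta> * complex_of_real (gauss \<eta>))"
      by (simp only: integral_character_gauss n_def)
    also have "\<dots> = complex_of_real (\<bar>\<epsilon>\<bar> ^ n) * (LINT \<xi>|lborel. character u (0 + \<epsilon> *\<^sub>R \<xi>) * complex_of_real (gauss (0 + \<epsilon> *\<^sub>R \<xi>)))"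
      unfolding n_def by (rule lborel_integral_affine) (use \<epsilon> in auto)
    also have "(LINT \<xi>|lborel. character u (0 + \<epsilon> *\<^sub>R \<xi>) * complex_of_real (gauss (0 + \<epsilon> *\<^sub>R \<xi>))) =
        (LINT \<xi>|lborel. character (x - y) \<xi> * complex_of_real (gauss (\<epsilon> *\<^sub>R \<xi>)))"
      using \<epsilon> by (simp add: character_def u_def)
    finally have "complex_of_real (sqrt (2 * pi) ^ n * gauss u) = complex_of_real (\<epsilon> ^ n) * (LINT \<xi>|lborel. character (x - y) \<xi> * complex_of_real (gauss (\<epsilon> *\<^sub>R \<xi>)))"
      using \<epsilon> by simp
    then have eq: "(LINT \<xi>|lborel. character (x - y) \<xi> * complex_of_real (gauss (\<epsilon> *\<^sub>R \<xi>))) = complex_of_real (sqrt (2 * pi) ^ n / \<epsilon> ^ n * gauss u)"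
      using \<epsilon> by (simp add: field_simps)
    have ch: "character (x - y) \<xi> = character x \<xi> * character (- \<xi>) y" for \<xi>
      by (simp add: character_def inner_diff_right inner_commute exp_add[symmetric] right_diff_distrib)
    have "H y \<xi> = \<psi> y * (character (x - y) \<xi> * complex_of_real (gauss (\<epsilon> *\<^sub>R \<xi>)))" for \<xi>
      unfolding H_def ch by (simp only: mult_ac)
    then have "(LINT \<xi>|lborel. H y \<xi>) = (LINT \<xi>|lborel. \<psi> y * (character (x - y) \<xi> * complex_of_real (gauss (\<epsilon> *\<^sub>R \<xi>))))"
      by (simp only:)
    also have "\<dots> = \<psi> y * (LINT \<xi>|lborel. character (x - y) \<xi> * complex_of_real (gauss (\<epsilon> *\<^sub>R \<xi>)))"
      by (rule integral_mult_right_zero)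
    finally show "(LINT \<xi>|lborel. H y \<xi>) = \<psi> y * complex_of_real (sqrt (2 * pi) ^ n / \<epsilon> ^ n * gauss ((1 / \<epsilon>) *\<^sub>R (x - y)))"
      unfolding eq u_def .
  qed
  also have "\<dots> = complex_of_real (\<bar>\<epsilon>\<bar> ^ n) * (LINT z|lborel. \<psi> (x + \<epsilon> *\<^sub>R z) * complex_of_real (sqrt (2 * pi) ^ n / \<epsilon> ^ n * gauss ((1 / \<epsilon>) *\<^sub>R (x - (x + \<epsilon> *\<^sub>R z)))))"
    unfolding n_def by (rule lborel_integral_affine) (use \<epsilon> in auto)
  also have "\<dots> = complex_of_real (\<bar>\<epsilon>\<bar> ^ n) * (LINT z|lborel. complex_of_real (sqrt (2 * pi) ^ n / \<epsilon> ^ n) * (\<psi> (x + \<epsilon> *\<^sub>R z) * complex_of_real (gauss z)))"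
  proof -
    have "(1 / \<epsilon>) *\<^sub>R (x - (x + \<epsilon> *\<^sub>R z)) = - z" for z using \<epsilon> by simp
    then show ?thesis by (simp only: gauss_minus of_real_mult mult_ac)
  qed
  also have "\<dots> = (complex_of_real (\<bar>\<epsilon>\<bar> ^ n) * complex_of_real (sqrt (2 * pi) ^ n / \<epsilon> ^ n)) * (LINT z|lborel. \<psi> (x + \<epsilon> *\<^sub>R z) * complex_of_real (gauss z))"
    by (simp only: integral_mult_right_zero mult.assoc)
  also have "complex_of_real (\<bar>\<epsilon>\<bar> ^ n) * complex_of_real (sqrt (2 * pi) ^ n / \<epsilon> ^ n) = complex_of_real (sqrt (2 * pi) ^ n)"
    using \<epsilon> by (simp add: field_simps)
  finally show ?thesis by (simp add: n_def)
qed

text \<open>As \<epsilon> tends to 0 both sides of the regularised identity converge dominatedly.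
  One factor sqrt (2 pi)^n comes from the transform of the Gaussian, the other from its total
  mass.\<close>

lemma integral_character_fourier:
  fixes \<psi> :: "real^'n \<Rightarrow> complex"
  assumes \<psi>: "\<psi> \<in> schwartz"
  shows "(LINT \<xi>|lborel. character x \<xi> * fourier \<psi> \<xi>) = complex_of_real ((2 * pi) ^ CARD('n)) * \<psi> x"
proof -
  define \<epsilon> where "\<epsilon> k = 1 / real (Suc k)" for k
  have \<epsilon>: "0 < \<epsilon> k" for k by (simp add: \<epsilon>_def)
  have \<epsilon>0: "\<epsilon> \<longlonglongrightarrow> 0" unfolding \<epsilon>_def[abs_def] by (rule LIMSEQ_Suc[OF lim_1_over_n])
  note F = schwartz_fourier[OF \<psi>]
  note [measurable] = schwartz_borel[OF \<psi>] schwartz_borel[OF F]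
  have g0: "gauss (0 :: real^'n) = 1" by (simp add: gauss_def)
  have gcont: "isCont (gauss :: real^'n \<Rightarrow> real) y" for y unfolding gauss_def[abs_def] by (intro continuous_intros) auto
  have \<psi>cont: "isCont \<psi> y" for y
    using smooth_fun_continuous[OF schwartz_smooth[OF \<psi>]] by (simp add: continuous_on_eq_continuous_at)
  have scal: "(\<lambda>k. \<epsilon> k *\<^sub>R y) \<longlonglongrightarrow> 0" for y :: "real^'n"
    using tendsto_scaleR[OF \<epsilon>0 tendsto_const[of y]] by simp
  have l1: "(\<lambda>k. LINT \<xi>|lborel. character x \<xi> * fourier \<psi> \<xi> * complex_of_real (gauss (\<epsilon> k *\<^sub>R \<xi>))) \<longlonglongrightarrow>
      (LINT \<xi>|lborel. character x \<xi> * fourier \<psi> \<xi>)"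
  proof (rule integral_dominated_convergence)
    show "integrable lborel (\<lambda>\<xi>. norm (fourier \<psi> \<xi>))" by (intro integrable_norm schwartz_integrable F)
    show "AE \<xi> in lborel. (\<lambda>k. character x \<xi> * fourier \<psi> \<xi> * complex_of_real (gauss (\<epsilon> k *\<^sub>R \<xi>))) \<longlonglongrightarrow> character x \<xi> * fourier \<psi> \<xi>"
    proof (intro AE_I2)
      fix \<xi> :: "real^'n"
      have "(\<lambda>k. gauss (\<epsilon> k *\<^sub>R \<xi>)) \<longlonglongrightarrow> gauss (0 :: real^'n)" by (rule isCont_tendsto_compose[OF gcont scal])
      then have "(\<lambda>k. character x \<xi> * fourier \<psi> \<xi> * complex_of_real (gauss (\<epsilon> k *\<^sub>R \<xi>))) \<longlonglongrightarrow> character x \<xi> * fourier \<psi> \<xi> * complex_of_real (gauss (0 :: real^'n))"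
        by (intro tendsto_mult tendsto_const tendsto_of_real)
      then show "(\<lambda>k. character x \<xi> * fourier \<psi> \<xi> * complex_of_real (gauss (\<epsilon> k *\<^sub>R \<xi>))) \<longlonglongrightarrow> character x \<xi> * fourier \<psi> \<xi>"
        by (simp add: g0)
    qed
    show "AE \<xi> in lborel. norm (character x \<xi> * fourier \<psi> \<xi> * complex_of_real (gauss (\<epsilon> k *\<^sub>R \<xi>))) \<le> norm (fourier \<psi> \<xi>)" for k
    proof (intro AE_I2)
      fix \<xi> :: "real^'n"
      have "gauss (\<epsilon> k *\<^sub>R \<xi>) \<le> 1" by (simp add: gauss_def)
      then show "norm (character x \<xi> * fourier \<psi> \<xi> * complex_of_real (gauss (\<epsilon> k *\<^sub>R \<xi>))) \<le> norm (fourier \<psi> \<xi>)"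
        using gauss_pos[of "\<epsilon> k *\<^sub>R \<xi>"] by (simp add: norm_mult mult_left_le)
    qed
  qed measurable
  obtain c where c: "schwartz_bound 0 \<psi> c" by (rule schwartzE_bound[OF \<psi>])
  have l2: "(\<lambda>k. LINT z|lborel. \<psi> (x + \<epsilon> k *\<^sub>R z) * complex_of_real (gauss z)) \<longlonglongrightarrow>
      (LINT z|lborel. \<psi> x * complex_of_real (gauss (z :: real^'n)))"
  proof (rule integral_dominated_convergence)
    show "integrable lborel (\<lambda>z :: real^'n. c * gauss z)" by (intro integrable_mult_right integrable_gauss)
    show "AE z in lborel. (\<lambda>k. \<psi> (x + \<epsilon> k *\<^sub>R z) * complex_of_real (gauss z)) \<longlonglongrightarrow> \<psi> x * complex_of_real (gauss z)"
    proof (intro AE_I2)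
      fix z :: "real^'n"
      have "(\<lambda>k. x + \<epsilon> k *\<^sub>R z) \<longlonglongrightarrow> x" using tendsto_add[OF tendsto_const[of x] scal[of z]] by simp
      from isCont_tendsto_compose[OF \<psi>cont this]
      show "(\<lambda>k. \<psi> (x + \<epsilon> k *\<^sub>R z) * complex_of_real (gauss z)) \<longlonglongrightarrow> \<psi> x * complex_of_real (gauss z)"
        by (intro tendsto_mult tendsto_const)
    qed
    show "AE z in lborel. norm (\<psi> (x + \<epsilon> k *\<^sub>R z) * complex_of_real (gauss z)) \<le> c * gauss z" for k
    proof (intro AE_I2)
      fix z :: "real^'n"
      have "norm (\<psi> (x + \<epsilon> k *\<^sub>R z)) \<le> c" using schwartz_boundD[OF c, of "[]" 0] by simp
      then show "norm (\<psi> (x + \<epsilon> k *\<^sub>R z) * complex_of_real (gauss z)) \<le> c * gauss z"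
        using gauss_pos[of z] by (simp add: norm_mult)
    qed
  qed measurable
  from tendsto_mult[OF tendsto_const l2[unfolded integral_mult_right_zero integral_gauss]]
  have "(\<lambda>k. complex_of_real (sqrt (2 * pi) ^ CARD('n)) * (LINT z|lborel. \<psi> (x + \<epsilon> k *\<^sub>R z) * complex_of_real (gauss z))) \<longlonglongrightarrow>
      complex_of_real (sqrt (2 * pi) ^ CARD('n)) * (\<psi> x * complex_of_real (sqrt (2 * pi) ^ CARD('n)))" .
  then have "(\<lambda>k. LINT \<xi>|lborel. character x \<xi> * fourier \<psi> \<xi> * complex_of_real (gauss (\<epsilon> k *\<^sub>R \<xi>))) \<longlonglongrightarrow>
      complex_of_real (sqrt (2 * pi) ^ CARD('n)) * (\<psi> x * complex_of_real (sqrt (2 * pi) ^ CARD('n)))"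
    unfolding integral_fourier_gauss[OF \<psi> \<epsilon>] .
  from LIMSEQ_unique[OF l1 this]
  have "(LINT \<xi>|lborel. character x \<xi> * fourier \<psi> \<xi>) =
      complex_of_real (sqrt (2 * pi) ^ CARD('n) * sqrt (2 * pi) ^ CARD('n)) * \<psi> x"
    by (simp only: of_real_mult mult_ac)
  also have "sqrt (2 * pi) ^ CARD('n) * sqrt (2 * pi) ^ CARD('n) = (2 * pi) ^ CARD('n)"
    unfolding power_mult_distrib[symmetric] by simp
  finally show ?thesis .
qed

lemma inv_fourier_fourier:
  fixes \<psi> :: "real^'n \<Rightarrow> complex"
  assumes "\<psi> \<in> schwartz" shows "inv_fourier (fourier \<psi>) = \<psi>"
proof
  fix x
  have "complex_of_real (1 / (2 * pi) ^ CARD('n)) * complex_of_real ((2 * pi) ^ CARD('n)) = 1"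
    by (simp flip: of_real_mult)
  then show "inv_fourier (fourier \<psi>) x = \<psi> x"
    unfolding inv_fourier_eq[OF schwartz_borel[OF schwartz_fourier[OF assms]]] integral_character_fourier[OF assms]
    by (simp only: mult.assoc[symmetric] mult_1)
qed

text \<open>The inverse transform is a reflected and scaled forward transform, so a change of
  variable reduces this composition to the opposite one.\<close>

lemma fourier_inv_fourier:
  fixes \<psi> :: "real^'n \<Rightarrow> complex"
  assumes "\<psi> \<in> schwartz" shows "fourier (inv_fourier \<psi>) = \<psi>"
proof
  fix \<xi>
  note [measurable] = schwartz_borel[OF schwartz_fourier[OF assms]]
  define a where "a = complex_of_real (1 / (2 * pi) ^ CARD('n))"
  have "fourier (inv_fourier \<psi>) \<xi> = (LINT x|lborel. character (- \<xi>) x * inv_fourier \<psi> x)"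
    by (rule fourier_eq[OF schwartz_borel[OF schwartz_inv_fourier[OF assms]]])
  also have "\<dots> = (LINT x|lborel. a * (character (- \<xi>) x * fourier \<psi> (- x)))"
    by (simp add: inv_fourier_fourier_reflect[OF assms] a_def mult_ac)
  also have "\<dots> = a * (LINT x|lborel. character (- \<xi>) x * fourier \<psi> (- x))"
    by (rule integral_mult_right_zero)
  also have "(LINT x|lborel. character (- \<xi>) x * fourier \<psi> (- x)) = (LINT x|lborel. character \<xi> x * fourier \<psi> x)"
  proof -
    have "(LINT x|lborel. character \<xi> x * fourier \<psi> x) =
        complex_of_real (\<bar>- 1\<bar> ^ CARD('n)) * (LINT x|lborel. character \<xi> (0 + (- 1) *\<^sub>R x) * fourier \<psi> (0 + (- 1) *\<^sub>R x))"
      by (rule lborel_integral_affine) auto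
    also have "\<dots> = (LINT x|lborel. character (- \<xi>) x * fourier \<psi> (- x))"
      by (simp add: character_def)
    finally show ?thesis ..
  qed
  also have "a * \<dots> = inv_fourier (fourier \<psi>) \<xi>"
    unfolding inv_fourier_eq[OF schwartz_borel[OF schwartz_fourier[OF assms]]] a_def ..
  finally show "fourier (inv_fourier \<psi>) \<xi> = \<psi> \<xi>" by (simp add: inv_fourier_fourier[OF assms])
qed

section \<open>Seminorms and neighbourhoods of zero in the Schwartz topology\<close>

lemma schwartz_bound_cmult:
  assumes "smooth_fun \<psi>" "schwartz_bound N \<psi> c"
  shows "schwartz_bound N (\<lambda>x. a * \<psi> x) (norm a * c)"
  using assms mult_left_mono[of _ c "norm a"]
  by (auto simp: schwartz_bound_def iter_partial_cmult norm_mult mult.left_commute)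

text \<open>The second summand is the seminorm distance from the centre
  \<open>\<psi>\<^sub>0\<close> to the zero function, written as a difference so that it matches
  membership of 0 in a subbasic set.\<close>

lemma schwartz_seminorm_diff_le:
  fixes \<psi> \<psi>\<^sub>0 :: "real^'n \<Rightarrow> complex"
  assumes \<psi>: "\<psi> \<in> schwartz" and \<psi>0: "\<psi>\<^sub>0 \<in> schwartz" and b: "schwartz_bound (max N (length \<alpha>)) \<psi> c"
  shows "schwartz_seminorm N \<alpha> (\<lambda>x. \<psi> x - \<psi>\<^sub>0 x) \<le> c + schwartz_seminorm N \<alpha> (\<lambda>x. 0 - \<psi>\<^sub>0 x)"
  unfolding schwartz_seminorm_def
proof (rule cSUP_least)
  fix x :: "real^'n"
  define \<eta> where "\<eta> = (\<lambda>x. 0 - \<psi>\<^sub>0 x)"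
  have \<eta>: "\<eta> \<in> schwartz" using schwartz_cmult[OF \<psi>0, of "-1"] by (simp add: \<eta>_def)
  have pos: "0 < (1 + norm x) ^ N" by (simp add: add_pos_nonneg)
  have "(\<lambda>x. \<psi> x - \<psi>\<^sub>0 x) = (\<lambda>x. \<psi> x + \<eta> x)" by (simp add: \<eta>_def)
  then have "norm (iter_partial \<alpha> (\<lambda>x. \<psi> x - \<psi>\<^sub>0 x) x) \<le> norm (iter_partial \<alpha> \<psi> x) + norm (iter_partial \<alpha> \<eta> x)"
    by (simp add: iter_partial_add[OF schwartz_smooth[OF \<psi>] schwartz_smooth[OF \<eta>]] norm_triangle_ineq)
  then have "(1 + norm x) ^ N * norm (iter_partial \<alpha> (\<lambda>x. \<psi> x - \<psi>\<^sub>0 x) x) \<le>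
      (1 + norm x) ^ N * norm (iter_partial \<alpha> \<psi> x) + (1 + norm x) ^ N * norm (iter_partial \<alpha> \<eta> x)"
    unfolding distrib_left[symmetric] using pos by (intro mult_left_mono) auto
  also have "(1 + norm x) ^ N * norm (iter_partial \<alpha> \<psi> x) \<le> c"
    using schwartz_boundD[OF b, of \<alpha> N x] pos by (simp add: pos_le_divide_eq mult.commute)
  also have "(1 + norm x) ^ N * norm (iter_partial \<alpha> \<eta> x) \<le> (SUP x. (1 + norm x) ^ N * norm (iter_partial \<alpha> \<eta> x))"
    using \<eta> by (intro cSUP_upper) (auto simp: schwartz_def)
  finally show "(1 + norm x) ^ N * norm (iter_partial \<alpha> (\<lambda>x. \<psi> x - \<psi>\<^sub>0 x) x) \<le>
      c + (SUP x. (1 + norm x) ^ N * norm (iter_partial \<alpha> (\<lambda>x. 0 - \<psi>\<^sub>0 x) x))"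
    by (simp add: \<eta>_def)
qed simp

text \<open>Subbasic sets have arbitrary centres and unrelated seminorms. One that contains 0 leaves
  some slack around it, and because the bounds are directed a finite intersection is again
  controlled by one index and one radius.\<close>

lemma schwartz_nhd_zero:
  fixes U :: "(real^'n \<Rightarrow> complex) set"
  assumes "generate_topology_on
     {{\<psi> \<in> schwartz. schwartz_seminorm N \<alpha> (\<lambda>x. \<psi> x - \<psi>\<^sub>0 x) < e} |N \<alpha> \<psi>\<^sub>0 e. \<psi>\<^sub>0 \<in> schwartz \<and> 0 < e} U"
    and "(\<lambda>x. 0) \<in> U"
  shows "\<exists>N \<delta>. 0 < \<delta> \<and> (\<forall>\<psi>\<in>schwartz. schwartz_bound N \<psi> \<delta> \<longrightarrow> \<psi> \<in> U)"
  using assms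
proof induction
  case (Int a b)
  then obtain N \<delta> M \<epsilon> where *: "0 < \<delta>" "\<And>\<psi>. \<psi> \<in> schwartz \<Longrightarrow> schwartz_bound N \<psi> \<delta> \<Longrightarrow> \<psi> \<in> a"
    "0 < \<epsilon>" "\<And>\<psi>. \<psi> \<in> schwartz \<Longrightarrow> schwartz_bound M \<psi> \<epsilon> \<Longrightarrow> \<psi> \<in> b" by blast
  show ?case
  proof (intro exI[of _ "max N M"] exI[of _ "min \<delta> \<epsilon>"] conjI ballI impI)
    fix \<psi> :: "real^'n \<Rightarrow> complex" assume \<psi>: "\<psi> \<in> schwartz" and b: "schwartz_bound (max N M) \<psi> (min \<delta> \<epsilon>)"
    show "\<psi> \<in> a \<inter> b"
      using *(2)[OF \<psi> schwartz_bound_mono[OF b]] *(4)[OF \<psi> schwartz_bound_mono[OF b]] by simp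
  qed (use * in simp)
next
  case (UN K)
  then obtain k where "k \<in> K" "(\<lambda>x. 0) \<in> k" by blast
  then obtain N \<delta> where "0 < \<delta>" "\<And>\<psi>. \<psi> \<in> schwartz \<Longrightarrow> schwartz_bound N \<psi> \<delta> \<Longrightarrow> \<psi> \<in> k"
    using UN.IH by blast
  then show ?case using \<open>k \<in> K\<close> by blast
next
  case (Basis s)
  then obtain N \<alpha> \<psi>\<^sub>0 e where s: "s = {\<psi> \<in> schwartz. schwartz_seminorm N \<alpha> (\<lambda>x. \<psi> x - \<psi>\<^sub>0 x) < e}"
    "\<psi>\<^sub>0 \<in> schwartz" by blast
  \<comment> \<open>The distance of 0 from the centre. Half of the slack e - e0 is used, since the
    bound for the seminorm is not strict while membership is.\<close>
  define e0 where "e0 = schwartz_seminorm N \<alpha> (\<lambda>x. 0 - \<psi>\<^sub>0 x)"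
  have e0: "e0 < e" using Basis.prems by (simp add: s e0_def)
  show ?case
  proof (intro exI[of _ "max N (length \<alpha>)"] exI[of _ "(e - e0) / 2"] conjI ballI impI)
    fix \<psi> :: "real^'n \<Rightarrow> complex" assume \<psi>: "\<psi> \<in> schwartz" and b: "schwartz_bound (max N (length \<alpha>)) \<psi> ((e - e0) / 2)"
    have "schwartz_seminorm N \<alpha> (\<lambda>x. \<psi> x - \<psi>\<^sub>0 x) \<le> (e - e0) / 2 + e0"
      unfolding e0_def using schwartz_seminorm_diff_le[OF \<psi> s(2) b] by (simp add: e0_def)
    then show "\<psi> \<in> s" using e0 \<psi> by (simp add: s field_simps)
  qed (use e0 in simp)
qed simp

section \<open>Band-limited distributions\<close>

text \<open>The form in which continuity is used: linearity on Schwartz functions and one dominating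
  seminorm. No topology occurs in it, so composition with \<open>fourier\<close> is handled by
  comparing seminorm bounds.\<close>

definition bounded_functional :: "((real^'n \<Rightarrow> complex) \<Rightarrow> complex) \<Rightarrow> bool" where
  "bounded_functional T \<longleftrightarrow>
    (\<forall>\<psi>\<in>schwartz. \<forall>\<eta>\<in>schwartz. \<forall>a b. T (\<lambda>x. a * \<psi> x + b * \<eta> x) = a * T \<psi> + b * T \<eta>) \<and>
    (\<exists>N C. 0 \<le> C \<and> (\<forall>\<psi>\<in>schwartz. \<forall>c. schwartz_bound N \<psi> c \<longrightarrow> norm (T \<psi>) \<le> C * c))"

lemma bounded_functional_linear:
  assumes "bounded_functional T" "\<psi> \<in> schwartz" "\<eta> \<in> schwartz"
  shows "T (\<lambda>x. a * \<psi> x + b * \<eta> x) = a * T \<psi> + b * T \<eta>"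
  using assms by (simp add: bounded_functional_def)

lemma bounded_functional_cmult:
  assumes "bounded_functional T" "\<psi> \<in> schwartz"
  shows "T (\<lambda>x. a * \<psi> x) = a * T \<psi>"
  using bounded_functional_linear[OF assms(1,2,2), of a 0] by simp

lemma bounded_functional_zero:
  assumes "bounded_functional T" shows "T (\<lambda>x. 0) = 0"
  using bounded_functional_cmult[OF assms schwartz_zero, of 0] by simp

lemma bounded_functional_diff:
  assumes "bounded_functional T" "\<psi> \<in> schwartz" "\<eta> \<in> schwartz"
  shows "T (\<lambda>x. \<psi> x - \<eta> x) = T \<psi> - T \<eta>"
  using bounded_functional_linear[OF assms, of 1 "-1"] by simp

lemma bounded_functional_sum:
  assumes T: "bounded_functional T" and A: "finite A" and f: "\<And>i. i \<in> A \<Longrightarrow> f i \<in> schwartz"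
  shows "T (\<lambda>x. \<Sum>i\<in>A. f i x) = (\<Sum>i\<in>A. T (f i))"
  using A f
proof (induction A)
  case (insert i A)
  have "T (\<lambda>x. 1 * f i x + 1 * (\<Sum>i\<in>A. f i x)) = 1 * T (f i) + 1 * T (\<lambda>x. \<Sum>i\<in>A. f i x)"
    using insert by (intro bounded_functional_linear[OF T] schwartz_sum) auto
  then show ?case using insert by simp
qed (simp add: bounded_functional_zero[OF T])

lemma bounded_functional_bound:
  assumes "bounded_functional T"
  shows "\<exists>N C. 0 \<le> C \<and> (\<forall>\<psi>\<in>schwartz. \<forall>c. schwartz_bound N \<psi> c \<longrightarrow> norm (T \<psi>) \<le> C * c)"
  using assms unfolding bounded_functional_def by (rule conjunct2)

text \<open>The preimage of the unit ball is a neighbourhood of 0 and contains all functions with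
  one small seminorm; homogeneity turns this into a linear bound.\<close>

lemma tempered_bounded_functional:
  fixes u :: "'n::finite functional"
  assumes "u \<in> tempered" shows "bounded_functional u"
  unfolding bounded_functional_def
proof (intro conjI)
  show lin: "\<forall>\<psi>\<in>schwartz. \<forall>\<eta>\<in>schwartz. \<forall>a b. u (\<lambda>x. a * \<psi> x + b * \<eta> x) = a * u \<psi> + b * u \<eta>"
    using assms by (simp add: tempered_def)
  have cm: "u (\<lambda>x. a * \<psi> x) = a * u \<psi>" if "\<psi> \<in> schwartz" for a \<psi>
    using lin[rule_format, OF that that, of a 0] by simp
  have u0: "u (\<lambda>x. 0) = 0" using cm[OF schwartz_zero, of 0] by simp
  have cont: "continuous_map schwartz_topology euclidean u" using assms by (simp add: tempered_def)
  have top: "\<psi> \<in> topspace schwartz_topology" if "\<psi> \<in> schwartz" for \<psi> :: "real^'n \<Rightarrow> complex"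
  proof -
    let ?S = "{\<eta> \<in> schwartz. schwartz_seminorm 0 [] (\<lambda>x. \<eta> x - \<psi> x) < 1}"
    have "\<psi> \<in> ?S" using that by (simp add: schwartz_seminorm_def)
    moreover have "?S \<in> {{\<psi> \<in> schwartz. schwartz_seminorm N \<alpha> (\<lambda>x. \<psi> x - \<psi>\<^sub>0 x) < e} |N \<alpha> \<psi>\<^sub>0 e. \<psi>\<^sub>0 \<in> schwartz \<and> 0 < e}"
      by (rule CollectI, intro exI conjI, rule refl, rule that, rule zero_less_one)
    ultimately show ?thesis
      unfolding schwartz_topology_def topology_generated_by_topspace by (rule UnionI[rotated])
  qed
  define U where "U = {\<psi> \<in> topspace schwartz_topology. u \<psi> \<in> ball 0 1}"
  have "openin schwartz_topology U"
    unfolding U_def using cont by (rule openin_continuous_map_preimage) simp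
  moreover have "(\<lambda>x. 0) \<in> U" using top[OF schwartz_zero] by (simp add: U_def u0)
  ultimately have "\<exists>N \<delta>. 0 < \<delta> \<and> (\<forall>\<psi>\<in>schwartz. schwartz_bound N \<psi> \<delta> \<longrightarrow> \<psi> \<in> U)"
    unfolding schwartz_topology_def openin_topology_generated_by_iff by (rule schwartz_nhd_zero)
  then obtain N \<delta> where \<delta>: "0 < \<delta>" and U: "\<And>\<psi>. \<psi> \<in> schwartz \<Longrightarrow> schwartz_bound N \<psi> \<delta> \<Longrightarrow> \<psi> \<in> U"
    by blast
  have "norm (u \<psi>) \<le> 1 / \<delta> * c" if \<psi>: "\<psi> \<in> schwartz" and b: "schwartz_bound N \<psi> c" for \<psi> c
  proof (rule field_le_epsilon)
    fix e :: real assume e: "0 < e"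
    have c: "0 \<le> c" by (rule schwartz_bound_nonneg[OF b])
    \<comment> \<open>The term e * \<delta> keeps the denominator positive when c = 0, and 1 / a = c
      / \<delta> + e is the desired bound up to e.\<close>
    define a where "a = \<delta> / (c + e * \<delta>)"
    have pos: "0 < c + e * \<delta>" using c e \<delta> by (intro add_nonneg_pos) auto
    have a: "0 < a" using \<delta> pos by (simp add: a_def)
    have "a * c \<le> \<delta>" using \<delta> pos c e by (simp add: a_def pos_divide_le_eq mult_left_mono)
    then have "schwartz_bound N (\<lambda>x. complex_of_real a * \<psi> x) \<delta>"
      using schwartz_bound_mono[OF schwartz_bound_cmult[OF schwartz_smooth[OF \<psi>] b, of "complex_of_real a"], of N \<delta>] a by simp
    then have "norm (u (\<lambda>x. complex_of_real a * \<psi> x)) < 1"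
      using U[OF schwartz_cmult[OF \<psi>]] by (simp add: U_def)
    then have "a * norm (u \<psi>) < 1" using a by (simp add: cm[OF \<psi>] norm_mult)
    then have "norm (u \<psi>) < 1 / a" using a by (simp add: pos_less_divide_eq mult.commute)
    also have "1 / a = 1 / \<delta> * c + e" using \<delta> by (simp add: a_def field_simps)
    finally show "norm (u \<psi>) \<le> 1 / \<delta> * c + e" by simp
  qed
  then show "\<exists>N C. 0 \<le> C \<and> (\<forall>\<psi>\<in>schwartz. \<forall>c. schwartz_bound N \<psi> c \<longrightarrow> norm (u \<psi>) \<le> C * c)"
    using \<delta> by (intro exI[of _ N] exI[of _ "1 / \<delta>"]) simp
qed

lemma fourier_linear:
  assumes \<psi>: "\<psi> \<in> schwartz" and \<eta>: "\<eta> \<in> schwartz"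
  shows "fourier (\<lambda>x. a * \<psi> x + b * \<eta> x) = (\<lambda>\<xi>. a * fourier \<psi> \<xi> + b * fourier \<eta> \<xi>)"
proof
  fix \<xi>
  have i1: "integrable lborel (\<lambda>x. a * (character (- \<xi>) x * \<psi> x))"
    using schwartz_integrable[OF schwartz_character_mult[OF \<psi>]] by (intro integrable_mult_right)
  have i2: "integrable lborel (\<lambda>x. b * (character (- \<xi>) x * \<eta> x))"
    using schwartz_integrable[OF schwartz_character_mult[OF \<eta>]] by (intro integrable_mult_right)
  have "character (- \<xi>) x * (a * \<psi> x + b * \<eta> x) = a * (character (- \<xi>) x * \<psi> x) + b * (character (- \<xi>) x * \<eta> x)" for x
    by (simp add: algebra_simps)
  then have "fourier (\<lambda>x. a * \<psi> x + b * \<eta> x) \<xi> =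
      (LINT x|lborel. a * (character (- \<xi>) x * \<psi> x) + b * (character (- \<xi>) x * \<eta> x))"
    unfolding fourier_eq[OF schwartz_borel[OF schwartz_add[OF schwartz_cmult[OF \<psi>] schwartz_cmult[OF \<eta>]]]]
    by (simp only:)
  also have "\<dots> = a * fourier \<psi> \<xi> + b * fourier \<eta> \<xi>"
    unfolding Bochner_Integration.integral_add[OF i1 i2] integral_mult_right_zero
      fourier_eq[OF schwartz_borel[OF \<psi>]] fourier_eq[OF schwartz_borel[OF \<eta>]] ..
  finally show "fourier (\<lambda>x. a * \<psi> x + b * \<eta> x) \<xi> = a * fourier \<psi> \<xi> + b * fourier \<eta> \<xi>" .
qed

lemma bounded_functional_fourier:
  fixes T :: "(real^'n \<Rightarrow> complex) \<Rightarrow> complex"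
  assumes T: "bounded_functional T" shows "bounded_functional (\<lambda>\<psi>. T (fourier \<psi>))"
  unfolding bounded_functional_def
proof (intro conjI ballI allI)
  show "T (fourier (\<lambda>x. a * \<psi> x + b * \<eta> x)) = a * T (fourier \<psi>) + b * T (fourier \<eta>)"
    if "\<psi> \<in> schwartz" "\<eta> \<in> schwartz" for \<psi> \<eta> a b
    unfolding fourier_linear[OF that]
    by (rule bounded_functional_linear[OF T schwartz_fourier[OF that(1)] schwartz_fourier[OF that(2)]])
  obtain N C where C: "0 \<le> C" "\<And>\<psi> c. \<psi> \<in> schwartz \<Longrightarrow> schwartz_bound N \<psi> c \<Longrightarrow> norm (T \<psi>) \<le> C * c"
    using bounded_functional_bound[OF T] by blast
  obtain D where D: "\<And>\<psi> :: real^'n \<Rightarrow> complex. \<And>c. \<psi> \<in> schwartz \<Longrightarrow> schwartz_bound (2 * N + 2 * CARD('n)) \<psi> c \<Longrightarrow>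
    schwartz_bound N (fourier \<psi>) (D * c)" using fourier_schwartz_bound by blast
  have "norm (T (fourier \<psi>)) \<le> (C * \<bar>D\<bar>) * c" if \<psi>: "\<psi> \<in> schwartz" and b: "schwartz_bound (2 * N + 2 * CARD('n)) \<psi> c" for \<psi> c
  proof -
    have "D * c \<le> \<bar>D\<bar> * c" using schwartz_bound_nonneg[OF b] by (intro mult_right_mono) auto
    from schwartz_bound_mono[OF D[OF \<psi> b] order_refl this]
    show ?thesis using C(2)[OF schwartz_fourier[OF \<psi>]] by (simp add: mult.assoc)
  qed
  then show "\<exists>N C. 0 \<le> C \<and> (\<forall>\<psi>\<in>schwartz. \<forall>c. schwartz_bound N \<psi> c \<longrightarrow> norm (T (fourier \<psi>)) \<le> C * c)"
    using C(1) by (intro exI[of _ "2 * N + 2 * CARD('n)"] exI[of _ "C * \<bar>D\<bar>"]) simp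
qed

section \<open>Cut-offs and local Lipschitz estimates for plane waves\<close>

lemma iter_partial_zero_on_open:
  assumes "open S" "\<And>x. x \<in> S \<Longrightarrow> f x = 0" "x \<in> S"
  shows "iter_partial \<alpha> f x = 0"
  using assms(3)
proof (induction \<alpha> arbitrary: x)
  case (Cons j \<alpha>)
  have "(iter_partial \<alpha> f has_derivative (\<lambda>h. 0)) (at x)"
    by (rule has_derivative_transform_within_open[OF has_derivative_const assms(1) Cons.prems]) (use Cons.IH in simp)
  from partial_deriv_eq[OF this] show ?case by simp
qed (use assms in simp)

text \<open>Outside the ball the product vanishes with all derivatives, so derivatives of
  \<open>u\<close> matter on the ball only, where the weight is at most (1 + R)^N. \<open>K\<close>
  is independent of \<open>u\<close>; this allows application to characters, to their differences
  and to approximation errors.\<close>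

lemma cutoff_bound:
  fixes \<phi> :: "real^'n \<Rightarrow> complex"
  assumes \<phi>: "smooth_fun \<phi>" and R: "0 \<le> R" and supp: "\<And>\<xi>. R < norm \<xi> \<Longrightarrow> \<phi> \<xi> = 0"
  shows "\<exists>K\<ge>0. \<forall>u \<delta>. smooth_fun u \<longrightarrow> 0 \<le> \<delta> \<longrightarrow> (\<forall>\<beta> \<xi>. length \<beta> \<le> N \<longrightarrow> norm \<xi> \<le> R \<longrightarrow> norm (iter_partial \<beta> u \<xi>) \<le> \<delta>) \<longrightarrow>
      schwartz_bound N (\<lambda>\<xi>. \<phi> \<xi> * u \<xi>) (K * \<delta>)"
proof -
  have "\<forall>\<beta>. \<exists>b\<ge>0. \<forall>\<xi>\<in>cball 0 R. norm (iter_partial \<beta> \<phi> \<xi>) \<le> b"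
  proof
    fix \<beta> :: "'n list"
    have "continuous_on (cball 0 R) (iter_partial \<beta> \<phi>)"
      using smooth_fun_continuous[OF smooth_fun_iter_partial[OF \<phi>]] by (rule continuous_on_subset) simp
    then have "bounded (iter_partial \<beta> \<phi> ` cball 0 R)"
      by (intro compact_imp_bounded compact_continuous_image) auto
    then show "\<exists>b\<ge>0. \<forall>\<xi>\<in>cball 0 R. norm (iter_partial \<beta> \<phi> \<xi>) \<le> b"
      unfolding bounded_pos by (auto intro: less_imp_le)
  qed
  from choice[OF this] obtain b where b': "\<forall>\<beta>. 0 \<le> b \<beta> \<and> (\<forall>\<xi>\<in>cball 0 R. norm (iter_partial \<beta> \<phi> \<xi>) \<le> b \<beta>)" ..
  have b: "0 \<le> b \<beta>" "norm \<xi> \<le> R \<Longrightarrow> norm (iter_partial \<beta> \<phi> \<xi>) \<le> b \<beta>" for \<beta> \<xi>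
    using b' by simp_all
  define L where "L = {\<beta> :: 'n list. length \<beta> \<le> N}"
  have L: "finite L" unfolding L_def using finite_lists_length_le[of "UNIV :: 'n set" N] by simp
  define B where "B = (\<Sum>\<beta>\<in>L. b \<beta>)"
  have B: "norm (iter_partial \<beta> \<phi> \<xi>) \<le> B" if "length \<beta> \<le> N" "norm \<xi> \<le> R" for \<beta> \<xi>
  proof -
    have "b \<beta> \<le> B" unfolding B_def using that b(1) by (intro member_le_sum L) (auto simp: L_def)
    then show ?thesis using b(2)[OF that(2), of \<beta>] by simp
  qed
  have B0: "0 \<le> B" unfolding B_def using b(1) by (intro sum_nonneg) auto
  define K where "K = (1 + R) ^ N * (2 ^ N * B)"
  have "0 \<le> K" using R B0 by (simp add: K_def)
  moreover have "schwartz_bound N (\<lambda>\<xi>. \<phi> \<xi> * u \<xi>) (K * \<delta>)"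
    if u: "smooth_fun u" and \<delta>: "0 \<le> \<delta>" and le: "\<And>\<beta> \<xi>. length \<beta> \<le> N \<Longrightarrow> norm \<xi> \<le> R \<Longrightarrow> norm (iter_partial \<beta> u \<xi>) \<le> \<delta>" for u \<delta>
    unfolding schwartz_bound_def
  proof (intro allI impI)
    fix \<alpha> :: "'n list" and \<xi> :: "real^'n" assume \<alpha>: "length \<alpha> \<le> N"
    show "(1 + norm \<xi>) ^ N * norm (iter_partial \<alpha> (\<lambda>\<xi>. \<phi> \<xi> * u \<xi>) \<xi>) \<le> K * \<delta>"
    proof (cases "norm \<xi> \<le> R")
      case True
      have "norm (iter_partial \<alpha> (\<lambda>\<xi>. \<phi> \<xi> * u \<xi>) \<xi>) \<le> 2 ^ length \<alpha> * B * \<delta>"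
        using \<alpha> by (intro iter_partial_mult_bound[OF \<phi> u] B le True) auto
      also have "\<dots> \<le> 2 ^ N * B * \<delta>" using \<alpha> B0 \<delta> by (intro mult_right_mono power_increasing) auto
      finally have "(1 + norm \<xi>) ^ N * norm (iter_partial \<alpha> (\<lambda>\<xi>. \<phi> \<xi> * u \<xi>) \<xi>) \<le> (1 + R) ^ N * (2 ^ N * B * \<delta>)"
        using True R by (intro mult_mono power_mono) auto
      then show ?thesis by (simp add: K_def mult.assoc)
    next
      case False
      have "iter_partial \<alpha> (\<lambda>\<xi>. \<phi> \<xi> * u \<xi>) \<xi> = 0"
      proof (rule iter_partial_zero_on_open)
        have "{\<xi> :: real^'n. R < norm \<xi>} = - cball 0 R" by auto
        then show "open {\<xi> :: real^'n. R < norm \<xi>}" by (simp add: open_Compl)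
      qed (use False supp in auto)
      then show ?thesis using \<open>0 \<le> K\<close> \<delta> by simp
    qed
  qed
  ultimately show ?thesis by (intro exI[of _ K] conjI allI impI) auto
qed

lemma schwartz_cutoff:
  fixes \<phi> :: "real^'n \<Rightarrow> complex"
  assumes \<phi>: "smooth_fun \<phi>" and R: "0 \<le> R" and supp: "\<And>\<xi>. R < norm \<xi> \<Longrightarrow> \<phi> \<xi> = 0" and u: "smooth_fun u"
  shows "(\<lambda>\<xi>. \<phi> \<xi> * u \<xi>) \<in> schwartz"
proof (rule schwartzI_bound[OF smooth_fun_mult[OF \<phi> u]])
  fix N
  obtain K where K: "0 \<le> K"
    "\<forall>u \<delta>. smooth_fun u \<longrightarrow> 0 \<le> \<delta> \<longrightarrow> (\<forall>\<beta> \<xi>. length \<beta> \<le> N \<longrightarrow> norm \<xi> \<le> R \<longrightarrow> norm (iter_partial \<beta> u \<xi>) \<le> \<delta>) \<longrightarrow>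
      schwartz_bound N (\<lambda>\<xi>. \<phi> \<xi> * u \<xi>) (K * \<delta>)"
    using cutoff_bound[OF \<phi> R supp, of N] by blast
  have "\<forall>\<beta>. \<exists>b\<ge>0. \<forall>\<xi>\<in>cball 0 R. norm (iter_partial \<beta> u \<xi>) \<le> b"
  proof
    fix \<beta> :: "'n list"
    have "continuous_on (cball 0 R) (iter_partial \<beta> u)"
      using smooth_fun_continuous[OF smooth_fun_iter_partial[OF u]] by (rule continuous_on_subset) simp
    then have "bounded (iter_partial \<beta> u ` cball 0 R)"
      by (intro compact_imp_bounded compact_continuous_image) auto
    then show "\<exists>b\<ge>0. \<forall>\<xi>\<in>cball 0 R. norm (iter_partial \<beta> u \<xi>) \<le> b"
      unfolding bounded_pos by (auto intro: less_imp_le)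
  qed
  from choice[OF this] obtain b where b': "\<forall>\<beta>. 0 \<le> b \<beta> \<and> (\<forall>\<xi>\<in>cball 0 R. norm (iter_partial \<beta> u \<xi>) \<le> b \<beta>)" ..
  have b: "0 \<le> b \<beta>" "norm \<xi> \<le> R \<Longrightarrow> norm (iter_partial \<beta> u \<xi>) \<le> b \<beta>" for \<beta> \<xi>
    using b' by simp_all
  define L where "L = {\<beta> :: 'n list. length \<beta> \<le> N}"
  have L: "finite L" unfolding L_def using finite_lists_length_le[of "UNIV :: 'n set" N] by simp
  have "schwartz_bound N (\<lambda>\<xi>. \<phi> \<xi> * u \<xi>) (K * (\<Sum>\<beta>\<in>L. b \<beta>))"
  proof (rule K(2)[rule_format, OF u])
    fix \<beta> :: "'n list" and \<xi> :: "real^'n" assume *: "length \<beta> \<le> N" "norm \<xi> \<le> R"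
    have "b \<beta> \<le> (\<Sum>\<beta>\<in>L. b \<beta>)" using * b(1) by (intro member_le_sum L) (auto simp: L_def)
    then show "norm (iter_partial \<beta> u \<xi>) \<le> (\<Sum>\<beta>\<in>L. b \<beta>)" using b(2)[OF *(2), of \<beta>] by simp
  qed (use b(1) in \<open>auto intro: sum_nonneg\<close>)
  then show "\<exists>c. schwartz_bound N (\<lambda>\<xi>. \<phi> \<xi> * u \<xi>) c" by blast
qed

lemma symbol_diff_le:
  "norm (symbol \<beta> x - symbol \<beta> y) \<le> real (length \<beta>) * norm (x - y) * (1 + norm x + norm y) ^ length \<beta>"
proof (induction \<beta>)
  case (Cons j \<beta>)
  define \<rho> where "\<rho> = 1 + norm x + norm y"
  define k where "k = length \<beta>"
  have \<rho>: "1 \<le> \<rho>" "norm x \<le> \<rho>" "1 + norm y \<le> \<rho>" by (simp_all add: \<rho>_def)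
  have ii: "norm (\<i> * z) = norm z" for z by (simp add: norm_mult)
  have "symbol (j # \<beta>) x - symbol (j # \<beta>) y =
      \<i> * (complex_of_real (x $ j) * (symbol \<beta> x - symbol \<beta> y) + complex_of_real ((x - y) $ j) * symbol \<beta> y)"
    by (simp add: algebra_simps)
  then have "norm (symbol (j # \<beta>) x - symbol (j # \<beta>) y) \<le>
      norm (complex_of_real (x $ j) * (symbol \<beta> x - symbol \<beta> y)) + norm (complex_of_real ((x - y) $ j) * symbol \<beta> y)"
    by (simp only: ii norm_triangle_ineq)
  also have "norm (complex_of_real (x $ j) * (symbol \<beta> x - symbol \<beta> y)) \<le> \<rho> * (real k * norm (x - y) * \<rho> ^ k)"
  proof -
    have "\<bar>x $ j\<bar> \<le> \<rho>" using abs_component_le[of x j] \<rho>(2) by linarith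
    then show ?thesis unfolding norm_mult norm_of_real using Cons \<rho>(1)
      by (intro mult_mono) (auto simp: \<rho>_def k_def)
  qed
  also have "norm (complex_of_real ((x - y) $ j) * symbol \<beta> y) \<le> norm (x - y) * \<rho> ^ k"
  proof -
    have "norm (symbol \<beta> y) \<le> (1 + norm y) ^ k" unfolding k_def by (rule norm_symbol_le)
    also have "\<dots> \<le> \<rho> ^ k" using \<rho> by (intro power_mono) auto
    finally show ?thesis unfolding norm_mult norm_of_real using abs_component_le[of "x - y" j] by (intro mult_mono) auto
  qed
  also have "norm (x - y) * \<rho> ^ k \<le> norm (x - y) * \<rho> ^ Suc k"
    using \<rho> by (intro mult_left_mono power_increasing) auto
  also have "\<rho> * (real k * norm (x - y) * \<rho> ^ k) + norm (x - y) * \<rho> ^ Suc k = real (Suc k) * norm (x - y) * \<rho> ^ Suc k"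
    by (simp add: algebra_simps)
  finally show ?case by (simp only: \<rho>_def k_def list.size add_0_right add_Suc_right)
qed simp

lemma character_diff_le: "norm (character x \<xi> - character y \<xi>) \<le> norm (x - y) * norm \<xi>"
proof -
  have "character x \<xi> = character y \<xi> * iexp ((x - y) \<bullet> \<xi>)"
    by (simp add: character_def inner_diff_left inner_commute exp_add[symmetric] algebra_simps)
  then have "character x \<xi> - character y \<xi> = character y \<xi> * (iexp ((x - y) \<bullet> \<xi>) - 1)"
    by (simp add: algebra_simps)
  then have "norm (character x \<xi> - character y \<xi>) = norm (iexp ((x - y) \<bullet> \<xi>) - 1)" by (simp add: norm_mult)
  also have "\<dots> \<le> \<bar>(x - y) \<bullet> \<xi>\<bar>" using iexp_approx1[of "(x - y) \<bullet> \<xi>" 0] by simp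
  also have "\<dots> \<le> norm (x - y) * norm \<xi>" by (rule Cauchy_Schwarz_ineq2)
  finally show ?thesis .
qed

text \<open>A Lipschitz estimate in the position variable for all frequency derivatives of a plane
  wave. Its polynomial growth is compensated by the Schwartz function against which it is
  integrated.\<close>

lemma symbol_character_diff_le:
  "norm (symbol \<beta> x * character x \<xi> - symbol \<beta> y * character y \<xi>) \<le>
    (real (length \<beta>) + norm \<xi>) * norm (x - y) * (1 + norm x + norm y) ^ length \<beta>"
proof -
  define \<rho> where "\<rho> = 1 + norm x + norm y"
  have "symbol \<beta> x * character x \<xi> - symbol \<beta> y * character y \<xi> =
      symbol \<beta> x * (character x \<xi> - character y \<xi>) + (symbol \<beta> x - symbol \<beta> y) * character y \<xi>"
    by (simp add: algebra_simps)
  also have "norm \<dots> \<le> norm (symbol \<beta> x) * norm (character x \<xi> - character y \<xi>) + norm (symbol \<beta> x - symbol \<beta> y)"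
    using norm_triangle_ineq[of "symbol \<beta> x * (character x \<xi> - character y \<xi>)" "(symbol \<beta> x - symbol \<beta> y) * character y \<xi>"]
    by (simp add: norm_mult)
  also have "\<dots> \<le> \<rho> ^ length \<beta> * (norm (x - y) * norm \<xi>) + real (length \<beta>) * norm (x - y) * \<rho> ^ length \<beta>"
  proof (intro add_mono mult_mono character_diff_le)
    show "norm (symbol \<beta> x) \<le> \<rho> ^ length \<beta>"
      by (rule order_trans[OF norm_symbol_le]) (simp add: \<rho>_def power_mono)
    show "norm (symbol \<beta> x - symbol \<beta> y) \<le> real (length \<beta>) * norm (x - y) * \<rho> ^ length \<beta>"
      unfolding \<rho>_def by (rule symbol_diff_le)
  qed (auto simp: \<rho>_def)
  finally show ?thesis by (simp add: \<rho>_def algebra_simps)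
qed

text \<open>The inverse Fourier transform without its normalising constant.\<close>

definition synthesis :: "(real^'n \<Rightarrow> complex) \<Rightarrow> real^'n \<Rightarrow> complex" where
  "synthesis \<psi> = fourier (\<lambda>x. \<psi> (- x))"

lemma schwartz_reflect: "\<psi> \<in> schwartz \<Longrightarrow> (\<lambda>x. \<psi> (- x)) \<in> schwartz"
  using schwartz_similarity[of \<psi> "-1" 0] by simp

lemma coordinate_mult_eq: "coordinate_mult \<alpha> \<psi> x = symbol \<alpha> (- x) * \<psi> x"
  by (induction \<alpha>) (simp_all add: mult_ac)

lemma lborel_integral_reflect:
  fixes f :: "real^'n \<Rightarrow> complex"
  assumes "f \<in> borel_measurable borel"
  shows "(LINT x|lborel. f (- x)) = (LINT x|lborel. f x)"
proof -
  have "(LINT x|lborel. f x) = complex_of_real (\<bar>- 1\<bar> ^ CARD('n)) * (LINT x|lborel. f (0 + (- 1) *\<^sub>R x))"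
    by (rule lborel_integral_affine[OF assms]) simp
  then show ?thesis by (simp only: abs_neg_one power_one of_real_1 mult_1 add_0 scaleR_minus_left scaleR_one)
qed

lemma borel_measurable_symbol [measurable]: "symbol \<alpha> \<in> borel_measurable borel"
proof -
  have "continuous_on UNIV (symbol \<alpha>)"
    by (induction \<alpha>) (auto simp: symbol_def intro!: continuous_intros)
  then show ?thesis by (rule borel_measurable_continuous_onI)
qed

text \<open>Derivatives fall on the plane wave and produce the \<open>symbol\<close>; in this form
  the derivatives are compared with those of finite sums of characters.\<close>

lemma iter_partial_synthesis:
  fixes \<psi> :: "real^'n \<Rightarrow> complex"
  assumes \<psi>: "\<psi> \<in> schwartz"
  shows "iter_partial \<alpha> (synthesis \<psi>) \<xi> = (LINT x|lborel. \<psi> x * (symbol \<alpha> x * character x \<xi>))"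
proof -
  note [measurable] = schwartz_borel[OF \<psi>]
  have "iter_partial \<alpha> (synthesis \<psi>) \<xi> = (LINT x|lborel. character (- \<xi>) x * coordinate_mult \<alpha> (\<lambda>x. \<psi> (- x)) x)"
    unfolding synthesis_def iter_partial_fourier[OF schwartz_reflect[OF \<psi>]]
    by (rule fourier_eq[OF schwartz_borel[OF schwartz_coordinate_mults[OF schwartz_reflect[OF \<psi>]]]])
  also have "\<dots> = (LINT x|lborel. \<psi> (- x) * (symbol \<alpha> (- x) * character \<xi> (- x)))"
    by (intro Bochner_Integration.integral_cong refl) (simp add: coordinate_mult_eq character_def)
  also have "\<dots> = (LINT x|lborel. \<psi> x * (symbol \<alpha> x * character \<xi> x))"
    by (rule lborel_integral_reflect) measurable
  finally show ?thesis by (simp only: character_commute)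
qed

lemma synthesis_eq_inv_fourier:
  fixes \<psi> :: "real^'n \<Rightarrow> complex"
  assumes \<psi>: "\<psi> \<in> schwartz"
  shows "inv_fourier \<psi> = (\<lambda>\<xi>. complex_of_real (1 / (2 * pi) ^ CARD('n)) * synthesis \<psi> \<xi>)"
proof
  fix \<xi>
  have "synthesis \<psi> \<xi> = (LINT x|lborel. character \<xi> x * \<psi> x)"
    using iter_partial_synthesis[OF \<psi>, of "[]" \<xi>] by (simp add: character_commute[of _ \<xi>] mult.commute)
  then show "inv_fourier \<psi> \<xi> = complex_of_real (1 / (2 * pi) ^ CARD('n)) * synthesis \<psi> \<xi>"
    by (simp only: inv_fourier_eq[OF schwartz_borel[OF \<psi>]])
qed

lemma smooth_fun_synthesis: "\<psi> \<in> schwartz \<Longrightarrow> smooth_fun (synthesis \<psi>)"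
  unfolding synthesis_def by (intro smooth_fun_fourier schwartz_reflect)

text \<open>The weights are the integrals of \<open>\<psi>\<close> over the level sets of
  \<open>s\<close> and do not depend on \<open>G\<close>. The same finite sum therefore represents
  the integral before and after a linear functional is applied.\<close>

lemma simple_function_weighted_sum:
  fixes s :: "'a \<Rightarrow> 'b" and \<psi> G :: "_ \<Rightarrow> complex"
  assumes s: "simple_function M s" and \<psi>: "integrable M \<psi>"
  defines "w \<equiv> (\<lambda>v. LINT x|M. indicator (s -` {v} \<inter> space M) x *\<^sub>R \<psi> x)"
  shows "(\<Sum>v\<in>s ` space M. w v * G v) = (LINT x|M. \<psi> x * G (s x))"
    and "integrable M (\<lambda>x. \<psi> x * G (s x))"
proof -
  let ?V = "s ` space M"
  have fin: "finite ?V" using s by (rule simple_functionD)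
  have A: "s -` {v} \<inter> space M \<in> sets M" for v using s by (rule simple_functionD)
  have i: "integrable M (\<lambda>x. indicator (s -` {v} \<inter> space M) x *\<^sub>R \<psi> x * G v)" for v
    by (intro integrable_mult_left integrable_mult_indicator A \<psi>)
  have eq: "\<psi> x * G (s x) = (\<Sum>v\<in>?V. indicator (s -` {v} \<inter> space M) x *\<^sub>R \<psi> x * G v)" if "x \<in> space M" for x
  proof -
    have "(\<Sum>v\<in>?V. indicator (s -` {v} \<inter> space M) x *\<^sub>R \<psi> x * G v) = (\<Sum>v\<in>?V. if v = s x then \<psi> x * G (s x) else 0)"
      using that by (intro sum.cong) (auto simp: indicator_def)
    then show ?thesis using that fin by simp
  qed
  show "integrable M (\<lambda>x. \<psi> x * G (s x))"
    using Bochner_Integration.integrable_sum[of ?V M "\<lambda>v x. indicator (s -` {v} \<inter> space M) x *\<^sub>R \<psi> x * G v", OF i]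
    by (rule Bochner_Integration.integrable_cong[THEN iffD2, rotated 2]) (simp_all add: eq)
  have "(LINT x|M. \<psi> x * G (s x)) = (LINT x|M. (\<Sum>v\<in>?V. indicator (s -` {v} \<inter> space M) x *\<^sub>R \<psi> x * G v))"
    by (intro Bochner_Integration.integral_cong refl eq)
  also have "\<dots> = (\<Sum>v\<in>?V. LINT x|M. indicator (s -` {v} \<inter> space M) x *\<^sub>R \<psi> x * G v)"
    by (rule Bochner_Integration.integral_sum[OF i])
  also have "\<dots> = (\<Sum>v\<in>?V. w v * G v)"
    unfolding w_def by (intro sum.cong refl integral_mult_left_zero)
  finally show "(\<Sum>v\<in>?V. w v * G v) = (LINT x|M. \<psi> x * G (s x))" ..
qed

section \<open>Continuous representatives of band-limited distributions\<close>

text \<open>The functional applied to a localised plane wave. If \<open>T\<close> is the Fourier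
  transform of a distribution, this is, up to the normalising constant, the value at x of the
  inverse transform of \<phi> T.\<close>

definition kernel_function :: "((real^'n \<Rightarrow> complex) \<Rightarrow> complex) \<Rightarrow> (real^'n \<Rightarrow> complex) \<Rightarrow> real^'n \<Rightarrow> complex" where
  "kernel_function T \<phi> x = T (\<lambda>\<xi>. \<phi> \<xi> * character x \<xi>)"

text \<open>The Paley-Wiener-Schwartz theorem: \<open>T\<close> commutes with the integral because
  \<open>x\<close> is a limit of simple functions and all seminorms of \<open>\<phi> exp (\<i> x \<bullet> \<cdot>)\<close> are locally Lipschitz in \<open>x\<close>.\<close>

lemma kernel_function_properties:
  fixes \<phi> :: "real^'n \<Rightarrow> complex"
  assumes T: "bounded_functional T" and \<phi>: "smooth_fun \<phi>" and R: "0 \<le> R" and supp: "\<And>\<xi>. R < norm \<xi> \<Longrightarrow> \<phi> \<xi> = 0"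
  shows "continuous_on UNIV (kernel_function T \<phi>)"
    and "\<And>\<psi>. \<psi> \<in> schwartz \<Longrightarrow> integrable lborel (\<lambda>x. kernel_function T \<phi> x * \<psi> x)"
    and "\<And>\<psi>. \<psi> \<in> schwartz \<Longrightarrow> T (\<lambda>\<xi>. \<phi> \<xi> * synthesis \<psi> \<xi>) = (LINT x|lborel. kernel_function T \<phi> x * \<psi> x)"
proof -
  let ?g = "kernel_function T \<phi>"
  obtain N C where C: "0 \<le> C" and TC: "\<And>\<psi> c. \<psi> \<in> schwartz \<Longrightarrow> schwartz_bound N \<psi> c \<Longrightarrow> norm (T \<psi>) \<le> C * c"
    using bounded_functional_bound[OF T] by blast
  obtain K where K: "0 \<le> K"
    "\<forall>u \<delta>. smooth_fun u \<longrightarrow> 0 \<le> \<delta> \<longrightarrow> (\<forall>\<beta> \<xi>. length \<beta> \<le> N \<longrightarrow> norm \<xi> \<le> R \<longrightarrow> norm (iter_partial \<beta> u \<xi>) \<le> \<delta>) \<longrightarrow>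
      schwartz_bound N (\<lambda>\<xi>. \<phi> \<xi> * u \<xi>) (K * \<delta>)"
    using cutoff_bound[OF \<phi> R supp, of N] by blast
  have cut: "(\<lambda>\<xi>. \<phi> \<xi> * u \<xi>) \<in> schwartz" if "smooth_fun u" for u by (rule schwartz_cutoff[OF \<phi> R supp that])
  \<comment> \<open>Every later estimate of \<open>T\<close> passes through this one: derivatives up
    to order N on a fixed ball control the value.\<close>
  have est: "norm (T (\<lambda>\<xi>. \<phi> \<xi> * u \<xi>)) \<le> C * K * \<delta>"
    if u: "smooth_fun u" and \<delta>: "0 \<le> \<delta>" and le: "\<And>\<beta> \<xi>. length \<beta> \<le> N \<Longrightarrow> norm \<xi> \<le> R \<Longrightarrow> norm (iter_partial \<beta> u \<xi>) \<le> \<delta>" for u \<delta>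
  proof -
    have "schwartz_bound N (\<lambda>\<xi>. \<phi> \<xi> * u \<xi>) (K * \<delta>)" using K(2) u \<delta> le by blast
    from TC[OF cut[OF u] this] show ?thesis by (simp only: mult.assoc)
  qed
  have diff: "T (\<lambda>\<xi>. \<phi> \<xi> * u \<xi>) - T (\<lambda>\<xi>. \<phi> \<xi> * v \<xi>) = T (\<lambda>\<xi>. \<phi> \<xi> * (u \<xi> - v \<xi>))"
    if "smooth_fun u" "smooth_fun v" for u v
    using bounded_functional_diff[OF T cut[OF that(1)] cut[OF that(2)]] by (simp add: right_diff_distrib)
  have sdiff: "smooth_fun (\<lambda>\<xi>. u \<xi> - v \<xi>)" "iter_partial \<beta> (\<lambda>\<xi>. u \<xi> - v \<xi>) = (\<lambda>\<xi>. iter_partial \<beta> u \<xi> - iter_partial \<beta> v \<xi>)"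
    if uv: "smooth_fun u" "smooth_fun v" for u v :: "real^'n \<Rightarrow> complex" and \<beta>
  proof -
    have eq: "(\<lambda>\<xi>. u \<xi> - v \<xi>) = (\<lambda>\<xi>. u \<xi> + (- 1) * v \<xi>)" by simp
    show "smooth_fun (\<lambda>\<xi>. u \<xi> - v \<xi>)" unfolding eq by (rule smooth_fun_add[OF uv(1) smooth_fun_cmult[OF uv(2)]])
    show "iter_partial \<beta> (\<lambda>\<xi>. u \<xi> - v \<xi>) = (\<lambda>\<xi>. iter_partial \<beta> u \<xi> - iter_partial \<beta> v \<xi>)"
      unfolding eq iter_partial_add[OF uv(1) smooth_fun_cmult[OF uv(2)]] iter_partial_cmult[OF uv(2)] by simp
  qed
  define A where "A = C * K"
  have A: "0 \<le> A" using C K(1) by (simp add: A_def)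
  have growth: "norm (?g x) \<le> A * (1 + norm x) ^ N" for x
    unfolding kernel_function_def A_def
  proof (rule est[OF smooth_fun_character])
    fix \<beta> :: "'n list" and \<xi> :: "real^'n" assume b: "length \<beta> \<le> N"
    have "norm (iter_partial \<beta> (character x) \<xi>) \<le> (1 + norm x) ^ length \<beta>"
      using norm_symbol_le[of \<beta> x] by (simp add: iter_partial_character norm_mult)
    also have "\<dots> \<le> (1 + norm x) ^ N" using b by (intro power_increasing) auto
    finally show "norm (iter_partial \<beta> (character x) \<xi>) \<le> (1 + norm x) ^ N" .
  qed simp
  define D where "D = real N + R"
  have D: "0 \<le> D" using R by (simp add: D_def)
  have sc: "norm (symbol \<beta> x * character x \<xi> - symbol \<beta> y * character y \<xi>) \<le> D * norm (x - y) * (1 + norm x + norm y) ^ N"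
    if "length \<beta> \<le> N" "norm \<xi> \<le> R" for \<beta> x y and \<xi> :: "real^'n"
  proof -
    have "norm (symbol \<beta> x * character x \<xi> - symbol \<beta> y * character y \<xi>) \<le>
        (real (length \<beta>) + norm \<xi>) * norm (x - y) * (1 + norm x + norm y) ^ length \<beta>" by (rule symbol_character_diff_le)
    also have "\<dots> \<le> D * norm (x - y) * (1 + norm x + norm y) ^ N"
      using that D by (intro mult_mono power_increasing) (auto simp: D_def)
    finally show ?thesis .
  qed
  have lip: "norm (?g x - ?g y) \<le> A * (D * norm (x - y) * (1 + norm x + norm y) ^ N)" for x y
    unfolding kernel_function_def diff[OF smooth_fun_character smooth_fun_character] A_def
  proof (rule est)
    show "smooth_fun (\<lambda>\<xi>. character x \<xi> - character y \<xi>)" by (rule sdiff[OF smooth_fun_character smooth_fun_character])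
    show "norm (iter_partial \<beta> (\<lambda>\<xi>. character x \<xi> - character y \<xi>) \<xi>) \<le> D * norm (x - y) * (1 + norm x + norm y) ^ N"
      if "length \<beta> \<le> N" "norm \<xi> \<le> R" for \<beta> \<xi>
      unfolding sdiff(2)[OF smooth_fun_character smooth_fun_character] iter_partial_character by (rule sc[OF that])
  qed (use D in simp)
  show cont: "continuous_on UNIV ?g"
    unfolding continuous_on_def
  proof
    fix y :: "real^'n"
    have "((\<lambda>x. ?g x - ?g y) \<longlongrightarrow> 0) (at y)"
    proof (rule Lim_null_comparison)
      show "\<forall>\<^sub>F x in at y. norm (?g x - ?g y) \<le> A * (D * norm (x - y) * (1 + norm x + norm y) ^ N)"
        using lip by simp
      have "((\<lambda>x. A * (D * norm (x - y) * (1 + norm x + norm y) ^ N)) \<longlongrightarrow> A * (D * norm (y - y) * (1 + norm y + norm y) ^ N)) (at y)"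
        by (intro tendsto_intros)
      then show "((\<lambda>x. A * (D * norm (x - y) * (1 + norm x + norm y) ^ N)) \<longlongrightarrow> 0) (at y)" by simp
    qed
    then show "(?g \<longlongrightarrow> ?g y) (at y within UNIV)" by (rule LIM_zero_cancel)
  qed
  then have gm [measurable]: "?g \<in> borel_measurable borel" by (rule borel_measurable_continuous_onI)
  show int: "integrable lborel (\<lambda>x. ?g x * \<psi> x)" if \<psi>: "\<psi> \<in> schwartz" for \<psi>
  proof (rule Bochner_Integration.integrable_bound[OF integrable_mult_right[OF schwartz_integrable_norm_mult[OF \<psi>, of N], of A]])
    note [measurable] = schwartz_borel[OF \<psi>]
    show "(\<lambda>x. ?g x * \<psi> x) \<in> borel_measurable lborel" by measurable
    show "AE x in lborel. norm (?g x * \<psi> x) \<le> norm (A * ((1 + norm x) ^ N * norm (\<psi> x)))"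
    proof (intro AE_I2)
      fix x
      have "norm (?g x * \<psi> x) \<le> A * (1 + norm x) ^ N * norm (\<psi> x)"
        unfolding norm_mult by (rule mult_right_mono[OF growth]) simp
      then show "norm (?g x * \<psi> x) \<le> norm (A * ((1 + norm x) ^ N * norm (\<psi> x)))"
        using A by (simp add: mult.assoc abs_mult)
    qed
  qed
  fix \<psi> :: "real^'n \<Rightarrow> complex" assume \<psi>: "\<psi> \<in> schwartz"
  note [measurable] = schwartz_borel[OF \<psi>]
  note i\<psi> = schwartz_integrable[OF \<psi>]
  \<comment> \<open>Simple functions converging to the identity map. The bound by 2 |x| supplies the
    dominating functions below.\<close>
  have "\<exists>F. (\<forall>i. simple_function lborel (F i)) \<and> (\<forall>x\<in>space lborel. (\<lambda>i. F i x) \<longlonglongrightarrow> x) \<and>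
     (\<forall>i. \<forall>x\<in>space lborel. dist (F i x) 0 \<le> 2 * dist (x :: real^'n) 0)"
    using borel_measurable_implies_sequence_metric[of "\<lambda>x :: real^'n. x" lborel 0] by auto
  then obtain F where F: "\<And>i. simple_function lborel (F i)" "\<And>x. (\<lambda>i. F i x) \<longlonglongrightarrow> x"
    "\<And>i x. norm (F i x) \<le> 2 * norm (x :: real^'n)" by auto
  have [measurable]: "F i \<in> borel_measurable lborel" for i by (rule borel_measurable_simple_function[OF F(1)])
  define w where "w i v = (LINT x|lborel. indicator (F i -` {v} \<inter> space lborel) x *\<^sub>R \<psi> x)" for i v
  define V where "V i = F i ` space lborel" for i
  have V: "finite (V i)" for i unfolding V_def using F(1) by (rule simple_functionD)
  have wsum: "(\<Sum>v\<in>V i. w i v * G v) = (LINT x|lborel. \<psi> x * G (F i x))" for i and G :: "real^'n \<Rightarrow> complex"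
    unfolding V_def w_def by (rule simple_function_weighted_sum[OF F(1) i\<psi>])
  have wint: "integrable lborel (\<lambda>x. \<psi> x * G (F i x))" for i and G :: "real^'n \<Rightarrow> complex"
    by (rule simple_function_weighted_sum[OF F(1) i\<psi>])
  \<comment> \<open>A finite combination of plane waves replacing \<open>synthesis \<psi>\<close>;
    by linearity \<open>T\<close> acts on it term by term.\<close>
  define U where "U i \<xi> = (\<Sum>v\<in>V i. w i v * character v \<xi>)" for i \<xi>
  have U: "smooth_fun (U i)" for i
    unfolding U_def[abs_def] by (intro smooth_fun_sum V smooth_fun_cmult smooth_fun_character)
  have dU: "iter_partial \<beta> (U i) \<xi> = (LINT x|lborel. \<psi> x * (symbol \<beta> (F i x) * character (F i x) \<xi>))" for \<beta> i \<xi>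
  proof -
    have "iter_partial \<beta> (U i) \<xi> = (\<Sum>v\<in>V i. w i v * (symbol \<beta> v * character v \<xi>))"
      unfolding U_def[abs_def] by (simp add: iter_partial_sum V smooth_fun_cmult smooth_fun_character iter_partial_cmult iter_partial_character)
    then show ?thesis unfolding wsum .
  qed
  have TU: "T (\<lambda>\<xi>. \<phi> \<xi> * U i \<xi>) = (LINT x|lborel. \<psi> x * ?g (F i x))" for i
  proof -
    have "(\<lambda>\<xi>. \<phi> \<xi> * U i \<xi>) = (\<lambda>\<xi>. \<Sum>v\<in>V i. w i v * (\<phi> \<xi> * character v \<xi>))"
      by (simp add: U_def sum_distrib_left mult_ac)
    then have "T (\<lambda>\<xi>. \<phi> \<xi> * U i \<xi>) = (\<Sum>v\<in>V i. T (\<lambda>\<xi>. w i v * (\<phi> \<xi> * character v \<xi>)))"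
      by (simp only: bounded_functional_sum[OF T V schwartz_cmult[OF cut[OF smooth_fun_character]]])
    also have "\<dots> = (\<Sum>v\<in>V i. w i v * ?g v)"
      unfolding kernel_function_def by (simp only: bounded_functional_cmult[OF T cut[OF smooth_fun_character]])
    finally show ?thesis unfolding wsum .
  qed
  define P where "P x = norm (\<psi> x) * (1 + norm x) ^ N" for x
  have P0: "0 \<le> P x" for x by (simp add: P_def)
  have [measurable]: "P \<in> borel_measurable borel" unfolding P_def[abs_def] by measurable
  have iP: "integrable lborel (\<lambda>x. 3 * (norm (\<psi> x) * (1 + norm x) ^ Suc N))"
    using schwartz_integrable_norm_mult[OF \<psi>, of "Suc N"] by (intro integrable_mult_right) (simp only: mult.commute)
  have dist3: "norm (x - F i x) \<le> 3 * norm x" for i x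
    using norm_triangle_ineq4[of x "F i x"] F(3)[of i x] by linarith
  have Ple: "P x * norm (x - F i x) \<le> 3 * (norm (\<psi> x) * (1 + norm x) ^ Suc N)" for i x
  proof -
    have "norm (x - F i x) \<le> 3 * (1 + norm x)" using dist3[of x i] by simp
    then have "P x * norm (x - F i x) \<le> P x * (3 * (1 + norm x))" using P0 by (rule mult_left_mono)
    also have "\<dots> = 3 * (norm (\<psi> x) * (1 + norm x) ^ Suc N)"
      unfolding P_def power_Suc by (simp only: mult_ac)
    finally show ?thesis .
  qed
  have iPF: "integrable lborel (\<lambda>x. P x * norm (x - F i x))" for i
    by (rule Bochner_Integration.integrable_bound[OF iP]) (use Ple P0 in \<open>auto simp: abs_mult\<close>)
  \<comment> \<open>A weighted L^1 distance between the simple function and the identity. It bounds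
    all derivatives of order at most N of the error at once; the factor 3^N in the estimate comes
    from 1 + |x| + |F i x| \<le> 3 (1 + |x|).\<close>
  define \<delta> where "\<delta> i = (LINT x|lborel. P x * norm (x - F i x))" for i
  have \<delta>0: "0 \<le> \<delta> i" for i unfolding \<delta>_def using P0 by (intro integral_nonneg_AE AE_I2) simp
  have "\<delta> \<longlonglongrightarrow> (LINT x :: real^'n|lborel. 0 :: real)"
    unfolding \<delta>_def[abs_def]
  proof (rule integral_dominated_convergence[OF _ _ iP])
    show "AE x in lborel. (\<lambda>i. P x * norm (x - F i x)) \<longlonglongrightarrow> 0"
    proof (intro AE_I2)
      fix x
      have "(\<lambda>i. P x * norm (x - F i x)) \<longlonglongrightarrow> P x * norm (x - x)"
        by (intro tendsto_mult tendsto_const tendsto_norm tendsto_diff F(2))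
      then show "(\<lambda>i. P x * norm (x - F i x)) \<longlonglongrightarrow> 0" by simp
    qed
    show "AE x in lborel. norm (P x * norm (x - F i x)) \<le> 3 * (norm (\<psi> x) * (1 + norm x) ^ Suc N)" for i
      using Ple P0 by (intro AE_I2) (auto simp: abs_mult)
  qed simp_all
  then have \<delta>lim: "\<delta> \<longlonglongrightarrow> 0" by simp
  have close: "norm (T (\<lambda>\<xi>. \<phi> \<xi> * synthesis \<psi> \<xi>) - T (\<lambda>\<xi>. \<phi> \<xi> * U i \<xi>)) \<le> C * K * (D * 3 ^ N * \<delta> i)" for i
    unfolding diff[OF smooth_fun_synthesis[OF \<psi>] U]
  proof (rule est[OF sdiff(1)[OF smooth_fun_synthesis[OF \<psi>] U]])
    show "0 \<le> D * 3 ^ N * \<delta> i" using D \<delta>0 by simp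
    fix \<beta> :: "'n list" and \<xi> :: "real^'n" assume *: "length \<beta> \<le> N" "norm \<xi> \<le> R"
    have i1: "integrable lborel (\<lambda>x. \<psi> x * (symbol \<beta> x * character x \<xi>))"
    proof (rule Bochner_Integration.integrable_bound[OF schwartz_integrable_norm_mult[OF \<psi>, of "length \<beta>"]])
      have "(\<lambda>x. \<psi> x * (symbol \<beta> x * character \<xi> x)) \<in> borel_measurable lborel" by measurable
      then show "(\<lambda>x. \<psi> x * (symbol \<beta> x * character x \<xi>)) \<in> borel_measurable lborel" by (simp only: character_commute)
      show "AE x in lborel. norm (\<psi> x * (symbol \<beta> x * character x \<xi>)) \<le> norm ((1 + norm x) ^ length \<beta> * norm (\<psi> x))"
        using norm_symbol_le[of \<beta>] by (intro AE_I2) (simp add: norm_mult abs_mult mult.commute mult_left_mono)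
    qed
    have "iter_partial \<beta> (\<lambda>\<xi>. synthesis \<psi> \<xi> - U i \<xi>) \<xi> =
        (LINT x|lborel. \<psi> x * (symbol \<beta> x * character x \<xi>) - \<psi> x * (symbol \<beta> (F i x) * character (F i x) \<xi>))"
      unfolding sdiff(2)[OF smooth_fun_synthesis[OF \<psi>] U] iter_partial_synthesis[OF \<psi>] dU
      by (rule Bochner_Integration.integral_diff[OF i1 wint, symmetric])
    also have "norm \<dots> \<le> (LINT x|lborel. (D * 3 ^ N) * (P x * norm (x - F i x)))"
    proof (rule Bochner_Integration.integral_norm_bound_integral)
      show "integrable lborel (\<lambda>x. \<psi> x * (symbol \<beta> x * character x \<xi>) - \<psi> x * (symbol \<beta> (F i x) * character (F i x) \<xi>))"
        by (rule Bochner_Integration.integrable_diff[OF i1 wint])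
      show "integrable lborel (\<lambda>x. (D * 3 ^ N) * (P x * norm (x - F i x)))" by (intro integrable_mult_right iPF)
      fix x
      have "\<psi> x * (symbol \<beta> x * character x \<xi>) - \<psi> x * (symbol \<beta> (F i x) * character (F i x) \<xi>) =
          \<psi> x * (symbol \<beta> x * character x \<xi> - symbol \<beta> (F i x) * character (F i x) \<xi>)"
        by (simp only: right_diff_distrib)
      also have "norm \<dots> \<le> norm (\<psi> x) * (D * norm (x - F i x) * (1 + norm x + norm (F i x)) ^ N)"
        unfolding norm_mult[of "\<psi> x"] by (rule mult_left_mono[OF sc[OF *]]) simp
      also have "\<dots> \<le> norm (\<psi> x) * (D * norm (x - F i x) * (3 * (1 + norm x)) ^ N)"
        using D F(3)[of i x] by (intro mult_left_mono power_mono) auto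
      also have "\<dots> = (D * 3 ^ N) * (P x * norm (x - F i x))"
        unfolding power_mult_distrib P_def by (simp only: mult_ac)
      finally show "norm (\<psi> x * (symbol \<beta> x * character x \<xi>) - \<psi> x * (symbol \<beta> (F i x) * character (F i x) \<xi>)) \<le> (D * 3 ^ N) * (P x * norm (x - F i x))" .
    qed
    also have "\<dots> = D * 3 ^ N * \<delta> i" unfolding \<delta>_def by (rule integral_mult_right_zero)
    finally show "norm (iter_partial \<beta> (\<lambda>\<xi>. synthesis \<psi> \<xi> - U i \<xi>) \<xi>) \<le> D * 3 ^ N * \<delta> i" .
  qed
  have l1: "(\<lambda>i. T (\<lambda>\<xi>. \<phi> \<xi> * U i \<xi>)) \<longlonglongrightarrow> T (\<lambda>\<xi>. \<phi> \<xi> * synthesis \<psi> \<xi>)"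
  proof -
    have "(\<lambda>i. T (\<lambda>\<xi>. \<phi> \<xi> * synthesis \<psi> \<xi>) - T (\<lambda>\<xi>. \<phi> \<xi> * U i \<xi>)) \<longlonglongrightarrow> 0"
    proof (rule Lim_null_comparison)
      show "\<forall>\<^sub>F i in sequentially. norm (T (\<lambda>\<xi>. \<phi> \<xi> * synthesis \<psi> \<xi>) - T (\<lambda>\<xi>. \<phi> \<xi> * U i \<xi>)) \<le> C * K * (D * 3 ^ N * \<delta> i)"
        using close by simp
      show "(\<lambda>i. C * K * (D * 3 ^ N * \<delta> i)) \<longlonglongrightarrow> 0"
        by (intro tendsto_mult_right_zero \<delta>lim)
    qed
    from tendsto_diff[OF tendsto_const[of "T (\<lambda>\<xi>. \<phi> \<xi> * synthesis \<psi> \<xi>)"] this] show ?thesis by simp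
  qed
  have l2: "(\<lambda>i. LINT x|lborel. \<psi> x * ?g (F i x)) \<longlonglongrightarrow> (LINT x|lborel. ?g x * \<psi> x)"
  proof (rule integral_dominated_convergence)
    show "integrable lborel (\<lambda>x. (A * 2 ^ N) * ((1 + norm x) ^ N * norm (\<psi> x)))"
      by (intro integrable_mult_right schwartz_integrable_norm_mult[OF \<psi>])
    show "AE x in lborel. (\<lambda>i. \<psi> x * ?g (F i x)) \<longlonglongrightarrow> ?g x * \<psi> x"
    proof (intro AE_I2)
      fix x
      have "isCont ?g x" using cont by (simp add: continuous_on_eq_continuous_at)
      from isCont_tendsto_compose[OF this F(2)[of x]]
      have "(\<lambda>i. \<psi> x * ?g (F i x)) \<longlonglongrightarrow> \<psi> x * ?g x" by (intro tendsto_mult tendsto_const)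
      then show "(\<lambda>i. \<psi> x * ?g (F i x)) \<longlonglongrightarrow> ?g x * \<psi> x" by (simp only: mult.commute)
    qed
    show "AE x in lborel. norm (\<psi> x * ?g (F i x)) \<le> (A * 2 ^ N) * ((1 + norm x) ^ N * norm (\<psi> x))" for i
    proof (intro AE_I2)
      fix x
      have "norm (?g (F i x)) \<le> A * (1 + norm (F i x)) ^ N" by (rule growth)
      also have "\<dots> \<le> A * (2 * (1 + norm x)) ^ N"
        using A F(3)[of i x] by (intro mult_left_mono power_mono) auto
      finally have "norm (\<psi> x) * norm (?g (F i x)) \<le> norm (\<psi> x) * (A * (2 * (1 + norm x)) ^ N)"
        by (rule mult_left_mono) simp
      also have "\<dots> = (A * 2 ^ N) * ((1 + norm x) ^ N * norm (\<psi> x))"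
        unfolding power_mult_distrib by (simp only: mult_ac)
      finally show "norm (\<psi> x * ?g (F i x)) \<le> (A * 2 ^ N) * ((1 + norm x) ^ N * norm (\<psi> x))" unfolding norm_mult .
    qed
  qed measurable
  show "T (\<lambda>\<xi>. \<phi> \<xi> * synthesis \<psi> \<xi>) = (LINT x|lborel. ?g x * \<psi> x)"
    using l1 l2 unfolding TU by (rule LIMSEQ_unique)
qed

text \<open>The set where \<open>k\<close> is nonzero is open, and a nonempty open set is not
  negligible.\<close>

lemma continuous_ae_zero:
  fixes k :: "real^'n \<Rightarrow> real"
  assumes "continuous_on UNIV k" "AE x in lborel. k x = 0"
  shows "k x = 0"
proof (rule ccontr)
  assume x: "k x \<noteq> 0"
  have op: "open {x. k x \<noteq> 0}"
    using open_vimage[of "- {0}" k] assms(1) by (simp add: vimage_def open_Compl Collect_neg_eq)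
  have "{x. k x \<noteq> 0} \<in> null_sets lborel"
    using assms(2) op AE_iff_null[of lborel "\<lambda>x. k x = 0"] by simp
  then have "negligible {x. k x \<noteq> 0}"
    by (simp add: negligible_iff_null_sets null_sets_completionI)
  then show False using open_not_negligible[OF op] x by blast
qed

text \<open>A smooth function supported in a ball, made nonnegative by multiplying with its conjugate and rescaled,
  serves as a bump function.\<close>

lemma continuous_zero_of_pairings:
  fixes h \<phi> :: "real^'n \<Rightarrow> complex"
  assumes \<phi>: "smooth_fun \<phi>" and R: "0 \<le> R" and supp: "\<And>\<xi>. R < norm \<xi> \<Longrightarrow> \<phi> \<xi> = 0" and \<phi>0: "\<phi> 0 \<noteq> 0"
    and h: "continuous_on UNIV h"
    and int: "\<And>\<psi>. \<psi> \<in> schwartz \<Longrightarrow> integrable lborel (\<lambda>x. h x * \<psi> x)"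
    and zero: "\<And>\<psi>. \<psi> \<in> schwartz \<Longrightarrow> (LINT x|lborel. h x * \<psi> x) = 0"
  shows "h y = 0"
proof (rule ccontr)
  assume hy: "h y \<noteq> 0"
  \<comment> \<open>Multiplication by cnj (h y) makes the function real and positive at y, hence
    positive real part persists on a ball around y.\<close>
  have c1: "continuous_on UNIV (\<lambda>x. Re (cnj (h y) * h x))" by (intro continuous_intros h)
  have "Re (cnj (h y) * h y) = (norm (h y))\<^sup>2"
    unfolding cmod_power2 by (simp add: power2_eq_square)
  then have pos: "Re (cnj (h y) * h y) \<in> {0<..}" using hy by simp
  have "open ((\<lambda>x. Re (cnj (h y) * h x)) -` {0<..})" using c1 by (rule open_vimage[rotated]) simp
  then obtain r where r: "0 < r" "ball y r \<subseteq> (\<lambda>x. Re (cnj (h y) * h x)) -` {0<..}"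
    using pos open_contains_ball by (metis vimageI)
  \<comment> \<open>Scaling by a shrinks the support radius R to R / a < r; the summand 1 keeps a
    positive when R = 0.\<close>
  define a where "a = R / r + 1"
  have a: "0 < a" using R r(1) by (simp add: a_def add_nonneg_pos)
  have \<phi>s: "\<phi> \<in> schwartz" using schwartz_cutoff[OF \<phi> R supp smooth_fun_const[of 1]] by simp
  define \<kappa> where "\<kappa> x = \<phi> (a *\<^sub>R x + (- a *\<^sub>R y))" for x
  have \<kappa>s: "\<kappa> \<in> schwartz" unfolding \<kappa>_def[abs_def] using a by (intro schwartz_similarity \<phi>s) simp
  define b where "b x = cnj (\<kappa> x) * \<kappa> x" for x
  have bs: "b \<in> schwartz"
    unfolding b_def[abs_def] using growth_bound_schwartz[OF schwartz_cnj[OF \<kappa>s]]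
    by (intro schwartz_mult schwartz_smooth[OF schwartz_cnj[OF \<kappa>s]] \<kappa>s) blast
  have b_eq: "b x = complex_of_real ((norm (\<kappa> x))\<^sup>2)" for x
    unfolding b_def complex_norm_square by (rule mult.commute)
  have bsupp: "b x = 0" if "x \<notin> ball y r" for x
  proof -
    have "r \<le> norm (x - y)" using that by (simp add: dist_norm norm_minus_commute)
    then have "a * r \<le> norm (a *\<^sub>R (x - y))" using a by (simp add: mult_left_mono)
    moreover have "R < a * r" using r(1) by (simp add: a_def distrib_right)
    ultimately have "R < norm (a *\<^sub>R x + (- a *\<^sub>R y))" by (simp add: scaleR_diff_right)
    then show ?thesis using supp by (simp add: b_def \<kappa>_def)
  qed
  define k where "k x = Re (cnj (h y) * (h x * b x))" for x
  have k_eq: "k x = Re (cnj (h y) * h x) * (norm (\<kappa> x))\<^sup>2" for x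
  proof -
    have "Re (z * complex_of_real t) = Re z * t" for z t by simp
    then show ?thesis unfolding k_def b_eq mult.assoc[symmetric] .
  qed
  have k0: "0 \<le> k x" for x
  proof (cases "x \<in> ball y r")
    case True
    then show ?thesis using r(2) unfolding k_eq by (intro mult_nonneg_nonneg) auto
  qed (simp add: k_def bsupp)
  have ki: "integrable lborel k"
    unfolding k_def[abs_def] using int[OF bs] by (intro integrable_Re integrable_mult_right)
  have "(LINT x|lborel. k x) = Re (LINT x|lborel. cnj (h y) * (h x * b x))"
    unfolding k_def using int[OF bs] by (intro integral_Re integrable_mult_right)
  also have "\<dots> = 0" unfolding integral_mult_right_zero zero[OF bs] by simp
  finally have "AE x in lborel. k x = 0"
    using integral_nonneg_eq_0_iff_AE[OF ki] k0 by simp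
  moreover have "continuous_on UNIV k"
    unfolding k_def[abs_def] by (intro continuous_intros h smooth_fun_continuous schwartz_smooth bs)
  ultimately have "k y = 0" by (intro continuous_ae_zero)
  moreover have "\<kappa> y = \<phi> 0" by (simp add: \<kappa>_def)
  ultimately show False using pos \<phi>0 by (simp add: k_eq)
qed

lemma integral_lebesgue_eq:
  fixes f :: "real^'n \<Rightarrow> complex"
  assumes "f \<in> borel_measurable borel"
  shows "(LINT x|lebesgue. f x) = (LINT x|lborel. f x)" "integrable lebesgue f \<longleftrightarrow> integrable lborel f"
  by (rule integral_completion integrable_completion, simp add: assms)+

text \<open>The function \<open>\<phi>\<^sub>0\<close> only supplies the bumps that separate two candidates for \<^const>\<open>function_of\<close>.\<close>

lemma band_limited_function:
  fixes \<phi> \<phi>\<^sub>0 :: "real^'n \<Rightarrow> complex"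
  assumes T: "bounded_functional T"
    and \<phi>: "smooth_fun \<phi>" and R: "0 \<le> R" and supp: "\<And>\<xi>. R < norm \<xi> \<Longrightarrow> \<phi> \<xi> = 0"
    and \<phi>0: "smooth_fun \<phi>\<^sub>0" and R0: "0 \<le> R\<^sub>0" and supp0: "\<And>\<xi>. R\<^sub>0 < norm \<xi> \<Longrightarrow> \<phi>\<^sub>0 \<xi> = 0" and nz: "\<phi>\<^sub>0 0 \<noteq> 0"
  defines "G \<equiv> (\<lambda>x. complex_of_real (1 / (2 * pi) ^ CARD('n)) * kernel_function T \<phi> x)"
  shows "continuous_on UNIV G"
    and "\<And>\<psi>. \<psi> \<in> schwartz \<Longrightarrow> integrable lebesgue (\<lambda>x. G x * \<psi> x)"
    and "\<And>\<psi>. \<psi> \<in> schwartz \<Longrightarrow> T (\<lambda>\<xi>. \<phi> \<xi> * inv_fourier \<psi> \<xi>) = regular_distr G \<psi>"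
    and "function_of (\<lambda>\<psi>. T (\<lambda>\<xi>. \<phi> \<xi> * inv_fourier \<psi> \<xi>)) = G"
proof -
  define c where "c = complex_of_real (1 / (2 * pi) ^ CARD('n))"
  have K1: "continuous_on UNIV (kernel_function T \<phi>)"
    by (rule kernel_function_properties(1)[OF T \<phi> R supp])
  have K2: "integrable lborel (\<lambda>x. kernel_function T \<phi> x * \<psi> x)" if "\<psi> \<in> schwartz" for \<psi>
    by (rule kernel_function_properties(2)[OF T \<phi> R supp that])
  have K3: "T (\<lambda>\<xi>. \<phi> \<xi> * synthesis \<psi> \<xi>) = (LINT x|lborel. kernel_function T \<phi> x * \<psi> x)" if "\<psi> \<in> schwartz" for \<psi>
    by (rule kernel_function_properties(3)[OF T \<phi> R supp that])
  have Gc: "G = (\<lambda>x. c * kernel_function T \<phi> x)" by (simp add: G_def c_def)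
  show cont: "continuous_on UNIV G" unfolding Gc by (intro continuous_intros K1)
  then have Gm [measurable]: "G \<in> borel_measurable borel" by (rule borel_measurable_continuous_onI)
  have i: "integrable lborel (\<lambda>x. G x * \<psi> x)" if "\<psi> \<in> schwartz" for \<psi>
    unfolding Gc mult.assoc using K2[OF that] by (intro integrable_mult_right)
  show int: "integrable lebesgue (\<lambda>x. G x * \<psi> x)" if "\<psi> \<in> schwartz" for \<psi>
  proof -
    note [measurable] = schwartz_borel[OF that]
    show ?thesis by (subst integral_lebesgue_eq(2)) (measurable, rule i[OF that])
  qed
  show rep: "T (\<lambda>\<xi>. \<phi> \<xi> * inv_fourier \<psi> \<xi>) = regular_distr G \<psi>" if \<psi>: "\<psi> \<in> schwartz" for \<psi>
  proof -
    note [measurable] = schwartz_borel[OF \<psi>]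
    have "(\<lambda>\<xi>. \<phi> \<xi> * inv_fourier \<psi> \<xi>) = (\<lambda>\<xi>. c * (\<phi> \<xi> * synthesis \<psi> \<xi>))"
      by (simp add: synthesis_eq_inv_fourier[OF \<psi>] c_def mult_ac)
    then have "T (\<lambda>\<xi>. \<phi> \<xi> * inv_fourier \<psi> \<xi>) = c * T (\<lambda>\<xi>. \<phi> \<xi> * synthesis \<psi> \<xi>)"
      by (simp only: bounded_functional_cmult[OF T schwartz_cutoff[OF \<phi> R supp smooth_fun_synthesis[OF \<psi>]]])
    also have "\<dots> = (LINT x|lborel. c * (kernel_function T \<phi> x * \<psi> x))"
      unfolding K3[OF \<psi>] by (rule integral_mult_right_zero[symmetric])
    also have "\<dots> = (LINT x|lborel. G x * \<psi> x)" by (simp only: Gc mult.assoc)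
    also have "\<dots> = (LINT x|lebesgue. G x * \<psi> x)" by (rule integral_lebesgue_eq(1)[symmetric]) measurable
    finally show ?thesis by (simp only: regular_distr_def)
  qed
  show "function_of (\<lambda>\<psi>. T (\<lambda>\<xi>. \<phi> \<xi> * inv_fourier \<psi> \<xi>)) = G"
    unfolding function_of_def
  proof (rule the_equality)
    show "continuous_on UNIV G \<and> (\<forall>\<psi>\<in>schwartz. integrable lebesgue (\<lambda>x. G x * \<psi> x) \<and>
      T (\<lambda>\<xi>. \<phi> \<xi> * inv_fourier \<psi> \<xi>) = regular_distr G \<psi>)" using cont int rep by blast
  next
    fix g
    assume g: "continuous_on UNIV g \<and> (\<forall>\<psi>\<in>schwartz. integrable lebesgue (\<lambda>x. g x * \<psi> x) \<and>
      T (\<lambda>\<xi>. \<phi> \<xi> * inv_fourier \<psi> \<xi>) = regular_distr g \<psi>)"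
    have gm [measurable]: "g \<in> borel_measurable borel" using g by (intro borel_measurable_continuous_onI) blast
    have gi: "integrable lborel (\<lambda>x. g x * \<psi> x)" if "\<psi> \<in> schwartz" for \<psi>
    proof -
      note [measurable] = schwartz_borel[OF that]
      have "(\<lambda>x. g x * \<psi> x) \<in> borel_measurable borel" by measurable
      from integral_lebesgue_eq(2)[OF this] show ?thesis using g that by blast
    qed
    have "(LINT x|lborel. g x * \<psi> x) = (LINT x|lborel. G x * \<psi> x)" if \<psi>: "\<psi> \<in> schwartz" for \<psi>
    proof -
      note [measurable] = schwartz_borel[OF \<psi>]
      have "regular_distr g \<psi> = regular_distr G \<psi>" using g rep[OF \<psi>] \<psi> by metis
      then have "(LINT x|lebesgue. g x * \<psi> x) = (LINT x|lebesgue. G x * \<psi> x)" by (simp only: regular_distr_def)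
      moreover have "(LINT x|lebesgue. g x * \<psi> x) = (LINT x|lborel. g x * \<psi> x)" by (rule integral_lebesgue_eq(1)) measurable
      moreover have "(LINT x|lebesgue. G x * \<psi> x) = (LINT x|lborel. G x * \<psi> x)" by (rule integral_lebesgue_eq(1)) measurable
      ultimately show ?thesis by simp
    qed
    then have z: "(LINT x|lborel. (g x - G x) * \<psi> x) = 0" if "\<psi> \<in> schwartz" for \<psi>
      unfolding left_diff_distrib using Bochner_Integration.integral_diff[OF gi[OF that] i[OF that]] that by simp
    have zi: "integrable lborel (\<lambda>x. (g x - G x) * \<psi> x)" if "\<psi> \<in> schwartz" for \<psi>
      unfolding left_diff_distrib by (rule Bochner_Integration.integrable_diff[OF gi[OF that] i[OF that]])
    have hc: "continuous_on UNIV (\<lambda>x. g x - G x)" using g cont by (intro continuous_on_diff) auto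
    have "g y - G y = 0" for y
      by (rule continuous_zero_of_pairings[OF \<phi>0 R0 supp0 nz hc zi z])
    then show "g = G" by (intro ext) simp
  qed
qed

section \<open>Frequency-uniform decompositions\<close>

lemma finite_int_vec_box: "finite {k :: int^'n. \<forall>i. \<bar>k $ i\<bar> \<le> m}"
proof -
  have "{k :: int^'n. \<forall>i. \<bar>k $ i\<bar> \<le> m} \<subseteq> vec_lambda ` (UNIV \<rightarrow>\<^sub>E {-m..m})"
  proof
    fix k :: "int^'n" assume "k \<in> {k. \<forall>i. \<bar>k $ i\<bar> \<le> m}"
    then have "($) k \<in> UNIV \<rightarrow>\<^sub>E {-m..m}" by (auto simp: abs_le_iff minus_le_iff)
    then show "k \<in> vec_lambda ` (UNIV \<rightarrow>\<^sub>E {-m..m})" by (intro image_eqI[of _ _ "($) k"]) simp_all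
  qed
  moreover have "finite (vec_lambda ` ((UNIV :: 'n set) \<rightarrow>\<^sub>E {-m..m}))" by (intro finite_imageI finite_PiE) auto
  ultimately show ?thesis by (rule finite_subset)
qed

text \<open>The supports of \<open>\<phi>\<^sub>k\<close> and \<open>\<phi>\<^sub>l\<close> are disjoint if a coordinate of \<open>l - k\<close> exceeds twice the square root of
  the dimension; the root is dropped to have an integer bound.\<close>

definition neighbours :: "(int^'n) set" where
  "neighbours = {l. \<forall>i. \<bar>l $ i\<bar> \<le> 2 * int CARD('n)}"

lemma finite_neighbours: "finite neighbours"
  unfolding neighbours_def by (rule finite_int_vec_box)

lemma uminus_neighbours: "- l \<in> neighbours \<longleftrightarrow> l \<in> neighbours"
  by (simp add: neighbours_def)

lemma neighboursI:
  fixes k l :: "int^'n"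
  assumes "norm (\<xi> - real_vec k) \<le> sqrt (real CARD('n))" "norm (\<xi> - real_vec l) \<le> sqrt (real CARD('n))"
  shows "l - k \<in> neighbours"
  unfolding neighbours_def
proof (intro CollectI allI)
  fix i
  define n where "n = real CARD('n)"
  have "sqrt n \<le> n"
  proof (rule real_le_lsqrt)
    have "1 \<le> n" by (simp add: n_def Suc_leI)
    then show "0 \<le> n" "n \<le> n\<^sup>2" using mult_left_mono[of 1 n n] by (auto simp: power2_eq_square)
  qed
  have "norm (real_vec l - real_vec k) \<le> norm (\<xi> - real_vec k) + norm (\<xi> - real_vec l)"
    using norm_triangle_ineq4[of "\<xi> - real_vec k" "\<xi> - real_vec l"] by simp
  also have "\<dots> \<le> 2 * n" using assms \<open>sqrt n \<le> n\<close> by (simp add: n_def)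
  finally have "\<bar>(real_vec l - real_vec k) $ i\<bar> \<le> 2 * n"
    using component_le_norm_cart order_trans by blast
  then have "\<bar>real_of_int ((l - k) $ i)\<bar> \<le> real_of_int (2 * int CARD('n))" by (simp add: real_vec_def n_def)
  then show "\<bar>(l - k) $ i\<bar> \<le> 2 * int CARD('n)" by linarith
qed

text \<open>Moving an index by a neighbour changes the bracket at most by a fixed factor in either
  direction. For negative \<open>s\<close> the inequality is applied from k + l back to k, as -l is
  a neighbour too.\<close>

lemma bracket_powr_le:
  fixes s :: real
  obtains D where "0 < D" "\<And>(k :: int^'n) l. l \<in> neighbours \<Longrightarrow> bracket k powr s \<le> D * bracket (k + l) powr s"
proof -
  define L where "L = real CARD('n) * (2 * real CARD('n))"
  \<comment> \<open>\<open>L\<close> bounds the l^1 length of a neighbour, and (u + L)^2 \<le> 2 u^2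
    + 2 L^2 leads to this factor.\<close>
  define M where "M = sqrt (2 + 2 * L\<^sup>2)"
  define a where "a k = (\<Sum>i\<in>UNIV. \<bar>real_of_int (k $ i)\<bar>)" for k :: "int^'n"
  have br: "bracket k = sqrt (1 + (a k)\<^sup>2)" for k :: "int^'n" by (simp add: bracket_def a_def)
  have pos: "0 < bracket k" for k :: "int^'n" unfolding br by (simp add: add_pos_nonneg)
  have M: "1 \<le> M" unfolding M_def by (simp add: real_le_rsqrt)
  have le: "bracket k \<le> M * bracket (k + l)" if l: "l \<in> neighbours" for k l :: "int^'n"
  proof -
    have "a k \<le> (\<Sum>i\<in>UNIV. \<bar>real_of_int ((k + l) $ i)\<bar> + 2 * real CARD('n))"
      unfolding a_def
    proof (rule sum_mono)
      fix i
      have "\<bar>l $ i\<bar> \<le> 2 * int CARD('n)" using l by (simp add: neighbours_def)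
      then have "\<bar>real_of_int (l $ i)\<bar> \<le> 2 * real CARD('n)" by linarith
      then show "\<bar>real_of_int (k $ i)\<bar> \<le> \<bar>real_of_int ((k + l) $ i)\<bar> + 2 * real CARD('n)" by simp
    qed
    also have "\<dots> = a (k + l) + L" by (simp add: a_def L_def sum.distrib)
    finally have "a k \<le> a (k + l) + L" .
    moreover have a0: "0 \<le> a k" unfolding a_def by (intro sum_nonneg) simp
    ultimately have "(a k)\<^sup>2 \<le> (a (k + l) + L)\<^sup>2" by (intro power_mono)
    also have "\<dots> \<le> 2 * (a (k + l))\<^sup>2 + 2 * L\<^sup>2"
      using sum_squares_ge_zero[of "a (k + l) - L" 0] by (simp add: power2_eq_square algebra_simps)
    finally have "1 + (a k)\<^sup>2 \<le> 1 + (2 * (a (k + l))\<^sup>2 + 2 * L\<^sup>2)" by simp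
    also have "\<dots> \<le> (2 + 2 * L\<^sup>2) * (1 + (a (k + l))\<^sup>2)"
      using mult_nonneg_nonneg[OF zero_le_power2[of L] zero_le_power2[of "a (k + l)"]] by (simp add: algebra_simps)
    finally have "sqrt (1 + (a k)\<^sup>2) \<le> sqrt ((2 + 2 * L\<^sup>2) * (1 + (a (k + l))\<^sup>2))" by (rule real_sqrt_le_mono)
    then show ?thesis by (simp add: br M_def real_sqrt_mult)
  qed
  have "bracket k powr s \<le> M powr \<bar>s\<bar> * bracket (k + l) powr s" if l: "l \<in> neighbours" for k l :: "int^'n"
  proof (cases "0 \<le> s")
    case True
    have "bracket k powr s \<le> (M * bracket (k + l)) powr s"
      using True le[OF l, of k] pos[of k] by (intro powr_mono2) auto
    then show ?thesis using True M pos[of "k + l"] by (simp add: powr_mult)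
  next
    case False
    have "bracket (k + l) \<le> M * bracket (k + l + - l)" by (rule le) (simp add: uminus_neighbours l)
    then have "bracket (k + l) \<le> M * bracket k" by simp
    then have "(M * bracket k) powr s \<le> bracket (k + l) powr s"
      using False pos[of "k + l"] by (intro powr_mono2') auto
    then have "M powr s * bracket k powr s \<le> bracket (k + l) powr s" using M pos[of k] by (simp add: powr_mult)
    then have "M powr - s * (M powr s * bracket k powr s) \<le> M powr - s * bracket (k + l) powr s"
      by (rule mult_left_mono) simp
    moreover have "M powr - s * M powr s = 1" using M by (simp flip: powr_add)
    ultimately show ?thesis using False by (simp add: mult.assoc[symmetric])
  qed
  moreover have "0 < M powr \<bar>s\<bar>" using M by simp
  ultimately show thesis by (intro that)
qed

lemma infsum_ennreal_SUP: "infsum f UNIV = (SUP A\<in>{A. finite A}. sum f A)" for f :: "'a \<Rightarrow> ennreal"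
  using nonneg_infsum_complete[of UNIV f] by simp

lemma lq_norm_member:
  assumes q: "0 < q" and fin: "lq_norm q a < top" shows "a k < top"
proof (cases "q = top")
  case True
  then show ?thesis using fin le_less_trans[OF SUP_upper[of k UNIV a]] by (simp add: lq_norm_def)
next
  case False
  have "ennpowr (a k) (enn2real q) = sum (\<lambda>k. ennpowr (a k) (enn2real q)) {k}" by simp
  also have "\<dots> \<le> (\<Sum>\<^sub>\<infinity>k. ennpowr (a k) (enn2real q))"
    unfolding infsum_ennreal_SUP by (rule SUP_upper) simp
  also have "\<dots> < top" using fin False by (simp add: lq_norm_def)
  finally show ?thesis by simp
qed

text \<open>Each b (k + l) is at most the 1/r-th power of the sum of the r-th powers over all
  neighbours, so the sum of fixed length is estimated without a triangle inequality; this covers q <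
  1. Each shift only reindexes, so its partial sums stay below the full sum.\<close>

lemma lq_norm_le_neighbours:
  fixes D :: ennreal
  assumes q: "0 < q" and D: "D < top"
  obtains E where "E < top"
    "\<And>a b :: int^'n \<Rightarrow> ennreal. (\<And>k. a k \<le> D * (\<Sum>l\<in>neighbours. b (k + l))) \<Longrightarrow> lq_norm q a \<le> E * lq_norm q b"
proof (cases "q = top")
  case True
  define E where "E = D * of_nat (card (neighbours :: (int^'n) set))"
  have "E < top" using D by (simp add: E_def ennreal_mult_less_top ennreal_of_nat_eq_real_of_nat)
  moreover have "lq_norm q a \<le> E * lq_norm q b" if le: "\<And>k. a k \<le> D * (\<Sum>l\<in>neighbours. b (k + l))" for a b :: "int^'n \<Rightarrow> ennreal"
  proof -
    have "a k \<le> E * (SUP k. b k)" for k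
    proof -
      have "(\<Sum>l\<in>neighbours. b (k + l)) \<le> (\<Sum>l\<in>(neighbours :: (int^'n) set). SUP k. b k)"
        by (intro sum_mono SUP_upper) simp
      then have "D * (\<Sum>l\<in>neighbours. b (k + l)) \<le> D * (of_nat (card (neighbours :: (int^'n) set)) * (SUP k. b k))"
        by (intro mult_left_mono) simp_all
      then show ?thesis using le[of k] by (simp add: E_def mult.assoc)
    qed
    then show ?thesis using True by (simp add: lq_norm_def SUP_least)
  qed
  ultimately show thesis by (rule that)
next
  case False
  define r where "r = enn2real q"
  have r: "0 < r" using q False by (simp add: r_def enn2real_positive_iff less_top)
  define c where "c = (of_nat (card (neighbours :: (int^'n) set)) :: ennreal)"
  have c: "c < top" by (simp add: c_def ennreal_of_nat_eq_real_of_nat)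
  define E where "E = ennpowr (ennpowr (D * c) r * c) (1 / r)"
  have "E < top" using D c by (simp add: E_def ennreal_mult_less_top)
  moreover have "lq_norm q a \<le> E * lq_norm q b" if le: "\<And>k. a k \<le> D * (\<Sum>l\<in>neighbours. b (k + l))" for a b :: "int^'n \<Rightarrow> ennreal"
  proof -
    define B where "B k = ennpowr (b k) r" for k
    define Z where "Z = (\<Sum>\<^sub>\<infinity>k. B k)"
    have pt: "ennpowr (a k) r \<le> ennpowr (D * c) r * (\<Sum>l\<in>neighbours. B (k + l))" for k
    proof -
      define Y where "Y = (\<Sum>l\<in>neighbours. B (k + l))"
      have "b (k + l) \<le> ennpowr Y (1 / r)" if "l \<in> neighbours" for l
      proof -
        have "B (k + l) \<le> Y" unfolding Y_def using that finite_neighbours by (intro member_le_sum) auto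
        then have "ennpowr (B (k + l)) (1 / r) \<le> ennpowr Y (1 / r)" using r by (intro ennpowr_mono[of "1 / r"]) auto
        then show ?thesis using r by (simp add: B_def ennpowr_ennpowr)
      qed
      then have "(\<Sum>l\<in>neighbours. b (k + l)) \<le> (\<Sum>l\<in>(neighbours :: (int^'n) set). ennpowr Y (1 / r))" by (rule sum_mono)
      then have "D * (\<Sum>l\<in>neighbours. b (k + l)) \<le> D * (c * ennpowr Y (1 / r))"
        by (intro mult_left_mono) (simp_all add: c_def)
      then have "a k \<le> (D * c) * ennpowr Y (1 / r)" using le[of k] by (simp add: mult.assoc)
      then have "ennpowr (a k) r \<le> ennpowr ((D * c) * ennpowr Y (1 / r)) r" using r by (intro ennpowr_mono[of r]) auto
      also have "\<dots> = ennpowr (D * c) r * Y" using r by (simp add: ennpowr_mult[of r "D * c"] ennpowr_ennpowr)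
      finally show ?thesis by (simp add: Y_def)
    qed
    have "(\<Sum>\<^sub>\<infinity>k. ennpowr (a k) r) \<le> ennpowr (D * c) r * c * Z"
      unfolding infsum_ennreal_SUP
    proof (rule SUP_least)
      fix A :: "(int^'n) set" assume "A \<in> {A. finite A}"
      then have A: "finite A" by simp
      have "(\<Sum>k\<in>A. ennpowr (a k) r) \<le> (\<Sum>k\<in>A. ennpowr (D * c) r * (\<Sum>l\<in>neighbours. B (k + l)))" by (rule sum_mono[OF pt])
      also have "\<dots> = ennpowr (D * c) r * (\<Sum>l\<in>neighbours. \<Sum>k\<in>A. B (k + l))"
        unfolding sum_distrib_left[symmetric] by (subst sum.swap) (rule refl)
      also have "\<dots> \<le> ennpowr (D * c) r * (\<Sum>l\<in>(neighbours :: (int^'n) set). Z)"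
      proof (intro mult_left_mono sum_mono)
        fix l :: "int^'n"
        have "(\<Sum>k\<in>A. B (k + l)) = sum B ((\<lambda>k. k + l) ` A)" by (subst sum.reindex) (auto simp: inj_on_def)
        also have "\<dots> \<le> Z" unfolding Z_def infsum_ennreal_SUP using A by (intro SUP_upper) simp
        finally show "(\<Sum>k\<in>A. B (k + l)) \<le> Z" .
      qed simp
      finally show "(\<Sum>k\<in>A. ennpowr (a k) r) \<le> ennpowr (D * c) r * c * Z" by (simp add: c_def mult.assoc)
    qed
    then have "ennpowr (\<Sum>\<^sub>\<infinity>k. ennpowr (a k) r) (1 / r) \<le> ennpowr (ennpowr (D * c) r * c * Z) (1 / r)"
      using r by (intro ennpowr_mono[of "1 / r"]) auto
    also have "\<dots> = E * ennpowr Z (1 / r)" using r by (simp add: E_def ennpowr_mult[of "1 / r"])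
    finally show ?thesis using False by (simp add: lq_norm_def r_def[symmetric] Z_def B_def)
  qed
  ultimately show thesis by (rule that)
qed

lemma freq_box_apply:
  "(freq_box \<phi> k f $ i) \<psi> = (f $ i) (fourier (\<lambda>\<xi>. \<phi> k \<xi> * inv_fourier \<psi> \<xi>))"
  by (simp add: freq_box_def distr_inv_fourier_def distr_mult_def distr_fourier_def)

section \<open>Partitions of unity in the class Y\<close>

context
  fixes \<phi> :: "int^'n \<Rightarrow> real^'n \<Rightarrow> complex"
  assumes Y: "\<phi> \<in> class_Y"
begin

lemma class_Y_smooth: "smooth_fun (\<phi> k)"
  using Y by (simp add: class_Y_def)

lemma class_Y_support: "\<phi> k \<xi> \<noteq> 0 \<Longrightarrow> norm (\<xi> - real_vec k) \<le> sqrt (real CARD('n))"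
  using Y closure_subset[of "{\<xi>. \<phi> k \<xi> \<noteq> 0}"] by (auto simp: class_Y_def)

lemma class_Y_zero: "sqrt (real CARD('n)) < norm (\<xi> - real_vec k) \<Longrightarrow> \<phi> k \<xi> = 0"
  using class_Y_support[of k \<xi>] by linarith

lemma class_Y_has_sum: "((\<lambda>k. \<phi> k \<xi>) has_sum 1) UNIV"
  using Y by (simp add: class_Y_def)

lemma class_Y_bound: "\<exists>C. \<forall>k \<xi> \<alpha>. length \<alpha> \<le> \<beta> \<longrightarrow> norm (iter_partial \<alpha> (\<phi> k) \<xi>) \<le> C"
  using Y by (simp add: class_Y_def)

lemma class_Y_zero_far: "norm (real_vec k) + sqrt (real CARD('n)) < norm \<xi> \<Longrightarrow> \<phi> k \<xi> = 0"
  using norm_triangle_ineq2[of \<xi> "real_vec k"] by (intro class_Y_zero) linarith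

text \<open>The lower bound on unit cubes, taken at the origin, makes \<phi>_0 usable as the bump
  function that separates continuous representatives.\<close>

lemma class_Y_nonzero: "\<phi> 0 0 \<noteq> 0"
proof -
  have "0 \<in> unit_cube (0 :: int^'n)" by (simp add: unit_cube_def)
  then show ?thesis using Y unfolding class_Y_def by fastforce
qed

lemma class_Y_zero0: "sqrt (real CARD('n)) < norm \<xi> \<Longrightarrow> \<phi> 0 \<xi> = 0"
  using class_Y_zero[of \<xi> 0] by (simp add: real_vec_def zero_vec_def[symmetric])

lemma class_Y_iter_partial_zero:
  assumes "sqrt (real CARD('n)) < norm (\<xi> - real_vec k)" shows "iter_partial \<alpha> (\<phi> k) \<xi> = 0"
proof (rule iter_partial_zero_on_open)
  have "{\<xi>. sqrt (real CARD('n)) < norm (\<xi> - real_vec k)} = - cball (real_vec k) (sqrt (real CARD('n)))"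
    by (auto simp: dist_norm norm_minus_commute)
  then show "open {\<xi>. sqrt (real CARD('n)) < norm (\<xi> - real_vec k)}" by (simp add: open_Compl)
qed (use assms class_Y_zero in auto)

lemma class_Y_finite_sum:
  assumes A: "finite A" and sub: "\<And>k. \<phi> k \<xi> \<noteq> 0 \<Longrightarrow> k \<in> A"
  shows "(\<Sum>k\<in>A. \<phi> k \<xi>) = 1"
proof -
  have "((\<lambda>k. \<phi> k \<xi>) has_sum (\<Sum>k\<in>A. \<phi> k \<xi>)) UNIV"
    by (rule has_sum_finite_neutralI[OF A]) (use sub in auto)
  then show ?thesis using class_Y_has_sum by (rule has_sum_unique)
qed

text \<open>Where \<phi>_k does not vanish, every other nonvanishing \<phi>_m has m - k among the
  neighbours, so the finite sum is the whole partition of unity there.\<close>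

lemma class_Y_partition: "\<phi> k \<xi> * (\<Sum>l\<in>neighbours. \<phi> (k + l) \<xi>) = \<phi> k \<xi>"
proof (cases "\<phi> k \<xi> = 0")
  case False
  have "(\<Sum>l\<in>neighbours. \<phi> (k + l) \<xi>) = (\<Sum>m\<in>(+) k ` neighbours. \<phi> m \<xi>)"
    by (subst sum.reindex) (auto simp: inj_on_def)
  also have "\<dots> = 1"
  proof (rule class_Y_finite_sum)
    fix m assume "\<phi> m \<xi> \<noteq> 0"
    then have "m - k \<in> neighbours"
      using neighboursI[OF class_Y_support[OF False] class_Y_support] by blast
    then show "m \<in> (+) k ` neighbours" by (intro image_eqI[of _ _ "m - k"]) auto
  qed (simp add: finite_neighbours)
  finally show ?thesis by simp
qed simp

lemma class_Y_mult_zero: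
  assumes "k - l \<notin> neighbours" shows "\<phi> l \<xi> * \<phi> k \<xi> = 0"
proof (rule ccontr)
  assume "\<phi> l \<xi> * \<phi> k \<xi> \<noteq> 0"
  then show False using neighboursI[OF class_Y_support[of l \<xi>] class_Y_support[of k \<xi>]] assms by auto
qed

lemma schwartz_class_Y_mult: "smooth_fun u \<Longrightarrow> (\<lambda>\<xi>. \<phi> k \<xi> * u \<xi>) \<in> schwartz"
  by (rule schwartz_cutoff[OF class_Y_smooth _ class_Y_zero_far]) auto

text \<open>The remainder 1 - (sum over A) vanishes on a large ball and has derivatives bounded
  uniformly in A, because only boundedly many supports overlap. One additional order of decay of
  \<open>\<eta>\<close> then makes the product small in the seminorm that dominates
  \<open>T\<close>.\<close>

lemma class_Y_expansion:
  fixes T :: "(real^'n \<Rightarrow> complex) \<Rightarrow> complex"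
  assumes T: "bounded_functional T" and \<eta>: "\<eta> \<in> schwartz"
  shows "((\<lambda>k. T (\<lambda>\<xi>. \<phi> k \<xi> * \<eta> \<xi>)) has_sum T \<eta>) UNIV"
  unfolding has_sum_def tendsto_iff
proof (intro allI impI)
  fix e :: real assume e: "0 < e"
  define r where "r = sqrt (real CARD('n))"
  obtain N C where C: "0 \<le> C" and TC: "\<And>\<psi> c. \<psi> \<in> schwartz \<Longrightarrow> schwartz_bound N \<psi> c \<Longrightarrow> norm (T \<psi>) \<le> C * c"
    using bounded_functional_bound[OF T] by blast
  obtain L0 where L0: "\<And>k \<xi> \<alpha>. length \<alpha> \<le> N \<Longrightarrow> norm (iter_partial \<alpha> (\<phi> k) \<xi>) \<le> L0"
    using class_Y_bound[of N] by blast
  have L0_nonneg: "0 \<le> L0" using L0[of "[]" 0 0] norm_ge_zero order_trans by (metis le0 list.size(3))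
  \<comment> \<open>One order more than \<open>T\<close> requires: the surplus factor 1 / (1 +
    |\<xi>|) is at most 1 / (1 + \<rho>) outside the ball of radius \<rho>.\<close>
  obtain c where c: "schwartz_bound (N + 1) \<eta> c" by (rule schwartzE_bound[OF \<eta>])
  have c0: "0 \<le> c" by (rule schwartz_bound_nonneg[OF c])
  define B where "B = 1 + real (card (neighbours :: (int^'n) set)) * L0"
  have B: "0 \<le> B" using L0_nonneg by (simp add: B_def)
  define Q where "Q = C * (2 ^ N * B * c)"
  have Q: "0 \<le> Q" using C B c0 by (simp add: Q_def)
  \<comment> \<open>Makes Q / (1 + \<rho>) = Q e / (e + Q) smaller than e; \<open>Q\<close> collects
    all constants of the estimate.\<close>
  define \<rho> where "\<rho> = Q / e"
  have \<rho>: "0 \<le> \<rho>" using Q e by (simp add: \<rho>_def)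
  define X where "X = {k :: int^'n. norm (real_vec k) \<le> \<rho> + r}"
  have "finite X"
  proof (rule finite_subset[OF _ finite_int_vec_box])
    show "X \<subseteq> {k. \<forall>i. \<bar>k $ i\<bar> \<le> \<lceil>\<rho> + r\<rceil>}"
    proof (intro subsetI CollectI allI)
      fix k :: "int^'n" and i assume "k \<in> X"
      then have "\<bar>real_vec k $ i\<bar> \<le> \<rho> + r" using component_le_norm_cart[of "real_vec k" i] by (simp add: X_def)
      then show "\<bar>k $ i\<bar> \<le> \<lceil>\<rho> + r\<rceil>" unfolding real_vec_def by (simp add: le_ceiling_iff)
    qed
  qed
  moreover have "dist (\<Sum>k\<in>A. T (\<lambda>\<xi>. \<phi> k \<xi> * \<eta> \<xi>)) (T \<eta>) < e" if A: "finite A" "X \<subseteq> A" for A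
  proof -
    define \<kappa> where "\<kappa> \<xi> = 1 + (\<Sum>k\<in>A. (- 1) * \<phi> k \<xi>)" for \<xi>
    have s1: "smooth_fun (\<lambda>\<xi>. \<Sum>k\<in>A. (- 1) * \<phi> k \<xi>)"
      by (intro smooth_fun_sum A smooth_fun_cmult class_Y_smooth)
    have \<kappa>s: "smooth_fun \<kappa>" unfolding \<kappa>_def[abs_def] by (intro smooth_fun_add smooth_fun_const s1)
    have \<kappa>b: "norm (iter_partial \<beta> \<kappa> \<xi>) \<le> B" if \<beta>: "length \<beta> \<le> N" for \<beta> \<xi>
    proof -
      have eq: "iter_partial \<beta> \<kappa> \<xi> = iter_partial \<beta> (\<lambda>\<xi>. 1) \<xi> + (\<Sum>k\<in>A. (- 1) * iter_partial \<beta> (\<phi> k) \<xi>)"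
        unfolding \<kappa>_def[abs_def]
        by (simp only: iter_partial_add[OF smooth_fun_const s1] iter_partial_sum[OF A(1) smooth_fun_cmult[OF class_Y_smooth]]
            iter_partial_cmult[OF class_Y_smooth])
      \<comment> \<open>Only indices whose support ball contains \<xi> contribute. Subtracting one
        of them maps the rest injectively into the neighbours, so their number does not depend on
        A.\<close>
      define A' where "A' = {k \<in> A. norm (\<xi> - real_vec k) \<le> r}"
      have "norm (\<Sum>k\<in>A. (- 1) * iter_partial \<beta> (\<phi> k) \<xi>) \<le> (\<Sum>k\<in>A. norm (iter_partial \<beta> (\<phi> k) \<xi>))"
        by (rule order_trans[OF norm_sum]) simp
      also have "\<dots> = (\<Sum>k\<in>A'. norm (iter_partial \<beta> (\<phi> k) \<xi>))"
        unfolding A'_def using A(1) class_Y_iter_partial_zero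
        by (intro sum.mono_neutral_right) (auto simp: r_def not_le)
      also have "\<dots> \<le> (\<Sum>k\<in>A'. L0)" by (intro sum_mono L0 \<beta>)
      also have "\<dots> = real (card A') * L0" by simp
      also have "\<dots> \<le> real (card (neighbours :: (int^'n) set)) * L0"
      proof -
        have "card A' \<le> card (neighbours :: (int^'n) set)"
        proof (cases "A' = {}")
          case False
          then obtain m where m: "m \<in> A'" by blast
          show ?thesis
          proof (rule card_inj_on_le[of "\<lambda>k. k - m"])
            show "(\<lambda>k. k - m) ` A' \<subseteq> neighbours"
              using m neighboursI[of \<xi> m] by (auto simp: A'_def r_def)
          qed (auto simp: inj_on_def finite_neighbours)
        qed simp
        then show ?thesis using L0_nonneg by (intro mult_right_mono) simp_all
      qed
      finally have "norm (\<Sum>k\<in>A. (- 1) * iter_partial \<beta> (\<phi> k) \<xi>) \<le> real (card (neighbours :: (int^'n) set)) * L0" .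
      moreover have "norm (iter_partial \<beta> (\<lambda>\<xi>. 1) \<xi>) \<le> 1" by (simp add: iter_partial_const)
      ultimately show ?thesis unfolding eq B_def by (intro norm_triangle_le add_mono)
    qed
    have \<kappa>0: "\<kappa> \<xi> = 0" if "norm \<xi> < \<rho>" for \<xi>
    proof -
      have "(\<Sum>k\<in>A. \<phi> k \<xi>) = 1"
      proof (rule class_Y_finite_sum[OF A(1)])
        fix k assume "\<phi> k \<xi> \<noteq> 0"
        from class_Y_support[OF this] have "norm (real_vec k) \<le> \<rho> + r"
          using norm_triangle_ineq4[of \<xi> "\<xi> - real_vec k"] that by (simp add: r_def)
        then show "k \<in> A" using A(2) by (auto simp: X_def)
      qed
      then show ?thesis by (simp add: \<kappa>_def sum_negf)
    qed
    have "schwartz_bound N (\<lambda>\<xi>. \<kappa> \<xi> * \<eta> \<xi>) (2 ^ N * B * c / (1 + \<rho>))"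
      unfolding schwartz_bound_def
    proof (intro allI impI)
      fix \<alpha> :: "'n list" and \<xi> :: "real^'n" assume \<alpha>: "length \<alpha> \<le> N"
      show "(1 + norm \<xi>) ^ N * norm (iter_partial \<alpha> (\<lambda>\<xi>. \<kappa> \<xi> * \<eta> \<xi>) \<xi>) \<le> 2 ^ N * B * c / (1 + \<rho>)"
      proof (cases "norm \<xi> < \<rho>")
        case True
        have "iter_partial \<alpha> (\<lambda>\<xi>. \<kappa> \<xi> * \<eta> \<xi>) \<xi> = 0"
          by (rule iter_partial_zero_on_open[of "ball 0 \<rho>"]) (use True \<kappa>0 in auto)
        then show ?thesis using B c0 \<rho> by simp
      next
        case False
        define t where "t = 1 + norm \<xi>"
        have t: "0 < t" "1 + \<rho> \<le> t" using False \<rho> by (auto simp: t_def)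
        have "norm (iter_partial \<alpha> (\<lambda>\<xi>. \<kappa> \<xi> * \<eta> \<xi>) \<xi>) \<le> 2 ^ length \<alpha> * B * (c / t ^ (N + 1))"
        proof (rule iter_partial_mult_bound[OF \<kappa>s schwartz_smooth[OF \<eta>]])
          show "norm (iter_partial \<beta> \<kappa> \<xi>) \<le> B" if "length \<beta> \<le> length \<alpha>" for \<beta>
            using that \<alpha> by (intro \<kappa>b) simp
          show "norm (iter_partial \<beta> \<eta> \<xi>) \<le> c / t ^ (N + 1)" if "length \<beta> \<le> length \<alpha>" for \<beta>
            unfolding t_def using that \<alpha> by (intro schwartz_boundD[OF c]) auto
        qed
        also have "\<dots> \<le> 2 ^ N * B * (c / t ^ (N + 1))"
          using \<alpha> B c0 t by (intro mult_right_mono power_increasing) auto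
        finally have "t ^ N * norm (iter_partial \<alpha> (\<lambda>\<xi>. \<kappa> \<xi> * \<eta> \<xi>) \<xi>) \<le> t ^ N * (2 ^ N * B * (c / t ^ (N + 1)))"
          using t by (intro mult_left_mono) auto
        also have "\<dots> = 2 ^ N * B * c / t" using t by simp
        also have "\<dots> \<le> 2 ^ N * B * c / (1 + \<rho>)"
          using t \<rho> B c0 by (intro divide_left_mono) auto
        finally show ?thesis by (simp add: t_def)
      qed
    qed
    moreover have \<kappa>\<eta>: "(\<lambda>\<xi>. \<kappa> \<xi> * \<eta> \<xi>) \<in> schwartz"
    proof -
      have "(\<lambda>\<xi>. \<kappa> \<xi> * \<eta> \<xi>) = (\<lambda>\<xi>. \<eta> \<xi> + (\<Sum>k\<in>A. (- 1) * (\<phi> k \<xi> * \<eta> \<xi>)))"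
        by (simp add: \<kappa>_def left_diff_distrib sum_distrib_right sum_negf)
      then show ?thesis
        by (simp only: schwartz_add[OF \<eta> schwartz_sum[OF A(1) schwartz_cmult[OF schwartz_class_Y_mult[OF schwartz_smooth[OF \<eta>]]]]])
    qed
    ultimately have "norm (T (\<lambda>\<xi>. \<kappa> \<xi> * \<eta> \<xi>)) \<le> C * (2 ^ N * B * c / (1 + \<rho>))" by (intro TC)
    also have "\<dots> = Q / (1 + \<rho>)" by (simp add: Q_def)
    also have "\<dots> < e" using e \<rho> Q by (simp add: \<rho>_def field_simps)
    finally have lt: "norm (T (\<lambda>\<xi>. \<kappa> \<xi> * \<eta> \<xi>)) < e" .
    have "(\<lambda>\<xi>. \<kappa> \<xi> * \<eta> \<xi>) = (\<lambda>\<xi>. \<eta> \<xi> - (\<Sum>k\<in>A. \<phi> k \<xi> * \<eta> \<xi>))"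
      by (simp add: \<kappa>_def left_diff_distrib sum_distrib_right sum_negf)
    then have "T (\<lambda>\<xi>. \<kappa> \<xi> * \<eta> \<xi>) = T \<eta> - (\<Sum>k\<in>A. T (\<lambda>\<xi>. \<phi> k \<xi> * \<eta> \<xi>))"
      by (simp only: bounded_functional_diff[OF T \<eta> schwartz_sum[OF A(1) schwartz_class_Y_mult[OF schwartz_smooth[OF \<eta>]]]]
          bounded_functional_sum[OF T A(1) schwartz_class_Y_mult[OF schwartz_smooth[OF \<eta>]]])
    then show ?thesis using lt by (simp add: dist_norm norm_minus_commute)
  qed
  ultimately show "\<forall>\<^sub>F A in finite_subsets_at_top UNIV. dist (\<Sum>k\<in>A. T (\<lambda>\<xi>. \<phi> k \<xi> * \<eta> \<xi>)) (T \<eta>) < e"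
    unfolding eventually_finite_subsets_at_top by blast
qed

text \<open>The function estimated here is the convolution kernel of \<open>\<box>\<^sub>l \<box>\<^sub>k\<close>.\<close>

lemma class_Y_kernel_decay:
  obtains c where "0 \<le> c" "\<And>k l z. norm (inv_fourier (\<lambda>\<xi>. \<phi> l \<xi> * \<phi> k \<xi>) z) \<le> c / (1 + norm z) ^ N"
proof -
  define r where "r = sqrt (real CARD('n))"
  define a where "a = 1 / (2 * pi) ^ CARD('n)"
  have a: "0 \<le> a" by (simp add: a_def)
  obtain L0 where L0: "\<And>k \<xi> \<alpha>. length \<alpha> \<le> N \<Longrightarrow> norm (iter_partial \<alpha> (\<phi> k) \<xi>) \<le> L0"
    using class_Y_bound[of N] by blast
  have L0_nonneg: "0 \<le> L0" using L0[of "[]" 0 0] norm_ge_zero order_trans by (metis le0 list.size(3))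
  \<comment> \<open>The volume of the ball around l that contains the support of the product. It is
    the same for all l, and with the common derivative bounds it gives L^1 estimates uniform in k
    and l.\<close>
  define v where "v = unit_ball_vol (real CARD('n)) * r ^ CARD('n)"
  have v: "0 \<le> v" by (simp add: v_def r_def)
  define L where "L = 2 ^ N * L0 * L0 * v"
  have L: "0 \<le> L" using L0_nonneg v by (simp add: L_def)
  have int: "(LINT \<xi>|lborel. norm (iter_partial \<alpha> (\<lambda>\<xi>. \<phi> l \<xi> * \<phi> k \<xi>) \<xi>)) \<le> L" if \<alpha>: "length \<alpha> \<le> N" for \<alpha> k l
  proof -
    define B where "B = cball (real_vec l) r"
    have s: "(\<lambda>\<xi>. \<phi> l \<xi> * \<phi> k \<xi>) \<in> schwartz" by (rule schwartz_class_Y_mult[OF class_Y_smooth])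
    have "(LINT \<xi>|lborel. norm (iter_partial \<alpha> (\<lambda>\<xi>. \<phi> l \<xi> * \<phi> k \<xi>) \<xi>)) \<le> (LINT \<xi>|lborel. (2 ^ N * L0 * L0) * indicator B \<xi>)"
    proof (rule integral_mono)
      show "integrable lborel (\<lambda>\<xi>. norm (iter_partial \<alpha> (\<lambda>\<xi>. \<phi> l \<xi> * \<phi> k \<xi>) \<xi>))"
        by (intro integrable_norm schwartz_integrable schwartz_iter_partial s)
      show "integrable lborel (\<lambda>\<xi>. (2 ^ N * L0 * L0) * indicator B \<xi>)"
        unfolding B_def by (intro integrable_mult_right integrable_real_indicator) (simp_all add: emeasure_cball r_def)
      fix \<xi>
      show "norm (iter_partial \<alpha> (\<lambda>\<xi>. \<phi> l \<xi> * \<phi> k \<xi>) \<xi>) \<le> (2 ^ N * L0 * L0) * indicator B \<xi>"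
      proof (cases "\<xi> \<in> B")
        case True
        have "norm (iter_partial \<alpha> (\<lambda>\<xi>. \<phi> l \<xi> * \<phi> k \<xi>) \<xi>) \<le> 2 ^ length \<alpha> * L0 * L0"
          by (rule iter_partial_mult_bound[OF class_Y_smooth class_Y_smooth]) (use \<alpha> in \<open>auto intro: L0\<close>)
        also have "\<dots> \<le> 2 ^ N * L0 * L0" using \<alpha> L0_nonneg by (intro mult_right_mono power_increasing) auto
        finally show ?thesis using True by simp
      next
        case False
        have "iter_partial \<alpha> (\<lambda>\<xi>. \<phi> l \<xi> * \<phi> k \<xi>) \<xi> = 0"
        proof (rule iter_partial_zero_on_open[of "- B"])
          show "open (- B)" by (simp add: B_def open_Compl)
          show "\<phi> l x * \<phi> k x = 0" if "x \<in> - B" for x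
            using that class_Y_zero[of x l] by (simp add: B_def r_def dist_norm norm_minus_commute)
        qed (use False in simp)
        then show ?thesis using False by simp
      qed
    qed
    also have "\<dots> = (2 ^ N * L0 * L0) * measure lborel B" by (simp add: B_def)
    also have "measure lborel B = v" unfolding B_def v_def by (simp add: content_cball r_def)
    finally show ?thesis by (simp add: L_def)
  qed
  have "norm (inv_fourier (\<lambda>\<xi>. \<phi> l \<xi> * \<phi> k \<xi>) z) \<le> a * ((1 + real CARD('n)) ^ N * L) / (1 + norm z) ^ N" for k l z
  proof -
    have s: "(\<lambda>\<xi>. \<phi> l \<xi> * \<phi> k \<xi>) \<in> schwartz" by (rule schwartz_class_Y_mult[OF class_Y_smooth])
    have pos: "0 < (1 + norm z) ^ N" by (simp add: add_pos_nonneg)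
    have "(1 + norm (- z)) ^ N * norm (fourier (\<lambda>\<xi>. \<phi> l \<xi> * \<phi> k \<xi>) (- z)) \<le> (1 + real CARD('n)) ^ N * L"
      by (rule fourier_decay[OF s]) (use int[of "[]" l k] int[of "replicate N _" l k] in auto)
    then have "norm (fourier (\<lambda>\<xi>. \<phi> l \<xi> * \<phi> k \<xi>) (- z)) \<le> (1 + real CARD('n)) ^ N * L / (1 + norm z) ^ N"
      using pos by (simp add: pos_le_divide_eq mult.commute)
    then have "a * norm (fourier (\<lambda>\<xi>. \<phi> l \<xi> * \<phi> k \<xi>) (- z)) \<le> a * ((1 + real CARD('n)) ^ N * L / (1 + norm z) ^ N)"
      using a by (rule mult_left_mono)
    moreover have "norm (inv_fourier (\<lambda>\<xi>. \<phi> l \<xi> * \<phi> k \<xi>) z) = a * norm (fourier (\<lambda>\<xi>. \<phi> l \<xi> * \<phi> k \<xi>) (- z))"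
      unfolding inv_fourier_fourier_reflect[OF s] norm_mult norm_of_real using a by (simp add: a_def)
    ultimately show ?thesis by simp
  qed
  moreover have "0 \<le> a * ((1 + real CARD('n)) ^ N * L)" using a L by simp
  ultimately show thesis by (intro that)
qed

section \<open>The pieces of a distribution as functions\<close>

text \<open>The explicit value of \<box>_k f at x: the Fourier transform of f applied to \<phi>_k
  times a plane wave. It is shown below to be the function that \<open>function_of\<close>
  denotes.\<close>

definition box_function :: "('n functional ^ 'm) \<Rightarrow> int^'n \<Rightarrow> real^'n \<Rightarrow> complex^'m" where
  "box_function f k x = (\<chi> i. complex_of_real (1 / (2 * pi) ^ CARD('n)) *
     kernel_function (\<lambda>\<psi>. (f $ i) (fourier \<psi>)) (\<phi> k) x)"

lemma bounded_functional_component: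
  fixes f :: "'n functional ^ 'm"
  assumes "f \<in> tempered_vec" shows "bounded_functional (\<lambda>\<psi>. (f $ i) (fourier \<psi>))"
  using assms by (intro bounded_functional_fourier tempered_bounded_functional) (simp add: tempered_vec_def)

lemma box_function_properties:
  fixes f :: "'n functional ^ 'm"
  assumes f: "f \<in> tempered_vec"
  shows "continuous_on UNIV (\<lambda>x. box_function f k x $ i)"
    and "\<And>\<psi>. \<psi> \<in> schwartz \<Longrightarrow> integrable lebesgue (\<lambda>x. box_function f k x $ i * \<psi> x)"
    and "\<And>\<psi>. \<psi> \<in> schwartz \<Longrightarrow> (f $ i) (fourier (\<lambda>\<xi>. \<phi> k \<xi> * inv_fourier \<psi> \<xi>)) = regular_distr (\<lambda>x. box_function f k x $ i) \<psi>"
    and "function_of (freq_box \<phi> k f $ i) = (\<lambda>x. box_function f k x $ i)"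
proof -
  define R where "R = norm (real_vec k) + sqrt (real CARD('n))"
  have R: "0 \<le> R" by (simp add: R_def)
  have z: "\<phi> k \<xi> = 0" if "R < norm \<xi>" for \<xi> using class_Y_zero_far that by (simp add: R_def)
  have eq: "(\<lambda>x. box_function f k x $ i) = (\<lambda>x. complex_of_real (1 / (2 * pi) ^ CARD('n)) *
     kernel_function (\<lambda>\<psi>. (f $ i) (fourier \<psi>)) (\<phi> k) x)" by (simp add: box_function_def)
  have eq2: "freq_box \<phi> k f $ i = (\<lambda>\<psi>. (f $ i) (fourier (\<lambda>\<xi>. \<phi> k \<xi> * inv_fourier \<psi> \<xi>)))"
    by (rule ext) (rule freq_box_apply)
  have s0: "0 \<le> sqrt (real CARD('n))" by simp
  note B = bounded_functional_component[OF f, of i] class_Y_smooth[of k]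
  note B0 = class_Y_smooth[of 0] s0
  show "continuous_on UNIV (\<lambda>x. box_function f k x $ i)"
    unfolding eq by (rule band_limited_function(1)[OF B R z B0 class_Y_zero0 class_Y_nonzero])
  show "integrable lebesgue (\<lambda>x. box_function f k x $ i * \<psi> x)" if "\<psi> \<in> schwartz" for \<psi>
    unfolding eq fun_cong[OF eq]
    by (rule band_limited_function(2)[OF B R z B0 class_Y_zero0 class_Y_nonzero that])
  show "(f $ i) (fourier (\<lambda>\<xi>. \<phi> k \<xi> * inv_fourier \<psi> \<xi>)) = regular_distr (\<lambda>x. box_function f k x $ i) \<psi>" if "\<psi> \<in> schwartz" for \<psi>
    unfolding eq by (rule band_limited_function(3)[OF B R z B0 class_Y_zero0 class_Y_nonzero that])
  show "function_of (freq_box \<phi> k f $ i) = (\<lambda>x. box_function f k x $ i)"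
    unfolding eq eq2 by (rule band_limited_function(4)[OF B R z B0 class_Y_zero0 class_Y_nonzero])
qed

lemma function_of_vec_freq_box:
  fixes f :: "'n functional ^ 'm"
  assumes "f \<in> tempered_vec"
  shows "function_of_vec (freq_box \<phi> k f) = box_function f k"
  by (rule ext) (simp add: function_of_vec_def box_function_properties(4)[OF assms] vec_eq_iff)

lemma continuous_box_function:
  fixes f :: "'n functional ^ 'm"
  assumes "f \<in> tempered_vec"
  shows "continuous_on UNIV (box_function f k)"
proof -
  have "continuous_on UNIV (\<lambda>x. \<chi> i. box_function f k x $ i)"
    by (intro continuous_on_vec_lambda box_function_properties(1)[OF assms])
  then show ?thesis by simp
qed

lemma measurable_continuous_lebesgue:
  fixes F :: "real^'n \<Rightarrow> complex^'m"
  assumes "continuous_on UNIV F" shows "F \<in> borel_measurable lebesgue"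
  using borel_measurable_continuous_onI[OF assms] by (intro measurable_completion) simp

definition regroup :: "('n functional ^ 'm) \<Rightarrow> int^'n \<Rightarrow> real^'n \<Rightarrow> complex^'m" where
  "regroup f k x = (\<Sum>l\<in>neighbours. box_function f (k + l) x)"

text \<open>Moved to the test function, the neighbour sum multiplies \<phi>_k by the sum of the
  \<phi>_(k+l) and changes nothing, so the k-th term is \<box>_k f itself; the expansion along the
  partition of unity then gives f.\<close>

lemma distr_sums_regroup:
  fixes f :: "'n functional ^ 'm"
  assumes f: "f \<in> tempered_vec"
  shows "distr_sums (\<lambda>k. freq_box \<phi> k (regular_distr_vec (regroup f k))) f"
  unfolding distr_sums_def
proof (intro allI ballI)
  fix i and \<psi> :: "real^'n \<Rightarrow> complex" assume \<psi>: "\<psi> \<in> schwartz"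
  define T where "T = (\<lambda>\<psi>. (f $ i) (fourier \<psi>))"
  have T: "bounded_functional T" unfolding T_def by (rule bounded_functional_component[OF f])
  note inv = schwartz_inv_fourier[OF \<psi>]
  have "(freq_box \<phi> k (regular_distr_vec (regroup f k)) $ i) \<psi> = T (\<lambda>\<xi>. \<phi> k \<xi> * inv_fourier \<psi> \<xi>)" for k
  proof -
    define \<zeta> where "\<zeta> = (\<lambda>\<xi>. \<phi> k \<xi> * inv_fourier \<psi> \<xi>)"
    have \<zeta>: "\<zeta> \<in> schwartz" unfolding \<zeta>_def by (rule schwartz_class_Y_mult[OF schwartz_smooth[OF inv]])
    \<comment> \<open>Pairing \<box>_k g with \<psi> is pairing g with this function, and by
      inversion its inverse transform is \<zeta>; the representation of each piece is thus applied
      at \<eta>.\<close>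
    define \<eta> where "\<eta> = fourier \<zeta>"
    have \<eta>: "\<eta> \<in> schwartz" unfolding \<eta>_def by (rule schwartz_fourier[OF \<zeta>])
    have inv\<eta>: "inv_fourier \<eta> = \<zeta>" unfolding \<eta>_def by (rule inv_fourier_fourier[OF \<zeta>])
    have m: "(\<lambda>\<xi>. \<phi> j \<xi> * \<zeta> \<xi>) \<in> schwartz" for j by (rule schwartz_class_Y_mult[OF schwartz_smooth[OF \<zeta>]])
    have "(freq_box \<phi> k (regular_distr_vec (regroup f k)) $ i) \<psi> = (LINT x|lebesgue. regroup f k x $ i * \<eta> x)"
      unfolding freq_box_apply \<zeta>_def[symmetric] \<eta>_def[symmetric] by (simp add: regular_distr_vec_def regular_distr_def)
    also have "\<dots> = (LINT x|lebesgue. (\<Sum>l\<in>neighbours. box_function f (k + l) x $ i * \<eta> x))"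
      by (simp add: regroup_def sum_distrib_right)
    also have "\<dots> = (\<Sum>l\<in>neighbours. LINT x|lebesgue. box_function f (k + l) x $ i * \<eta> x)"
      by (rule Bochner_Integration.integral_sum) (rule box_function_properties(2)[OF f \<eta>])
    also have "\<dots> = (\<Sum>l\<in>neighbours. T (\<lambda>\<xi>. \<phi> (k + l) \<xi> * \<zeta> \<xi>))"
      unfolding T_def using box_function_properties(3)[OF f \<eta>, of i, unfolded inv\<eta> regular_distr_def]
      by simp
    also have "\<dots> = T (\<lambda>\<xi>. \<Sum>l\<in>neighbours. \<phi> (k + l) \<xi> * \<zeta> \<xi>)"
      by (rule bounded_functional_sum[OF T finite_neighbours m, symmetric])
    also have "(\<lambda>\<xi>. \<Sum>l\<in>neighbours. \<phi> (k + l) \<xi> * \<zeta> \<xi>) = \<zeta>"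
    proof
      fix \<xi>
      have "(\<Sum>l\<in>neighbours. \<phi> (k + l) \<xi> * \<zeta> \<xi>) = (\<phi> k \<xi> * (\<Sum>l\<in>neighbours. \<phi> (k + l) \<xi>)) * inv_fourier \<psi> \<xi>"
        by (simp add: \<zeta>_def sum_distrib_right sum_distrib_left mult_ac)
      then show "(\<Sum>l\<in>neighbours. \<phi> (k + l) \<xi> * \<zeta> \<xi>) = \<zeta> \<xi>"
        unfolding class_Y_partition \<zeta>_def .
    qed
    finally show ?thesis unfolding \<zeta>_def .
  qed
  moreover have "((\<lambda>k. T (\<lambda>\<xi>. \<phi> k \<xi> * inv_fourier \<psi> \<xi>)) has_sum T (inv_fourier \<psi>)) UNIV"
    by (rule class_Y_expansion[OF T inv])
  moreover have "T (inv_fourier \<psi>) = (f $ i) \<psi>" by (simp add: T_def fourier_inv_fourier[OF \<psi>])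
  ultimately show "((\<lambda>k. (freq_box \<phi> k (regular_distr_vec (regroup f k)) $ i) \<psi>) has_sum (f $ i) \<psi>) UNIV"
    by simp
qed

text \<open>The value of \<box>_l f at x is f paired with one particular Schwartz function. Pairing
  the series with that function gives a scalar sum in which only terms with overlapping supports
  survive, each of them a convolution evaluated at x.\<close>

lemma box_function_eq_convolutions:
  fixes f :: "'n functional ^ 'm" and F :: "int^'n \<Rightarrow> real^'n \<Rightarrow> complex^'m"
  assumes f: "f \<in> tempered_vec" and sums: "distr_sums (\<lambda>k. freq_box \<phi> k (regular_distr_vec (F k))) f"
  shows "box_function f l x = (\<Sum>m\<in>neighbours. \<chi> i. LINT y|lebesgue. F (l + m) y $ i *
    inv_fourier (\<lambda>\<xi>. \<phi> l \<xi> * \<phi> (l + m) \<xi>) (x - y))"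
proof -
  define c where "c = complex_of_real (1 / (2 * pi) ^ CARD('n))"
  have "box_function f l x $ i = (\<Sum>m\<in>neighbours. LINT y|lebesgue. F (l + m) y $ i *
    inv_fourier (\<lambda>\<xi>. \<phi> l \<xi> * \<phi> (l + m) \<xi>) (x - y))" for i
  proof -
    define T where "T = (\<lambda>\<psi>. (f $ i) (fourier \<psi>))"
    have T: "bounded_functional T" unfolding T_def by (rule bounded_functional_component[OF f])
    \<comment> \<open>Its Fourier transform is the test function that reads off the value at x;
      multiplication by \<phi>_k before transforming produces the convolution kernel at x -
      y.\<close>
    define \<zeta> where "\<zeta> \<xi> = c * (\<phi> l \<xi> * character x \<xi>)" for \<xi>
    have \<zeta>: "\<zeta> \<in> schwartz" unfolding \<zeta>_def[abs_def]
      by (intro schwartz_cmult schwartz_class_Y_mult smooth_fun_character)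
    define \<eta> where "\<eta> = fourier \<zeta>"
    have \<eta>: "\<eta> \<in> schwartz" unfolding \<eta>_def by (rule schwartz_fourier[OF \<zeta>])
    have inv\<eta>: "inv_fourier \<eta> = \<zeta>" unfolding \<eta>_def by (rule inv_fourier_fourier[OF \<zeta>])
    have "box_function f l x $ i = c * T (\<lambda>\<xi>. \<phi> l \<xi> * character x \<xi>)"
      by (simp add: box_function_def kernel_function_def T_def c_def)
    also have "\<dots> = T \<zeta>"
      unfolding \<zeta>_def[abs_def]
      by (rule bounded_functional_cmult[OF T schwartz_class_Y_mult[OF smooth_fun_character], symmetric])
    finally have gl: "box_function f l x $ i = (f $ i) \<eta>" by (simp add: T_def \<eta>_def)
    define S where "S k = (LINT y|lebesgue. F k y $ i * inv_fourier (\<lambda>\<xi>. \<phi> l \<xi> * \<phi> k \<xi>) (x - y))" for k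
    have Sk: "(freq_box \<phi> k (regular_distr_vec (F k)) $ i) \<eta> = S k" for k
    proof -
      have s: "(\<lambda>\<xi>. \<phi> l \<xi> * \<phi> k \<xi>) \<in> schwartz" by (rule schwartz_class_Y_mult[OF class_Y_smooth])
      note [measurable] = schwartz_borel[OF s]
      have s2: "(\<lambda>\<xi>. \<phi> k \<xi> * \<zeta> \<xi>) \<in> schwartz" by (rule schwartz_class_Y_mult[OF schwartz_smooth[OF \<zeta>]])
      have "fourier (\<lambda>\<xi>. \<phi> k \<xi> * \<zeta> \<xi>) y = inv_fourier (\<lambda>\<xi>. \<phi> l \<xi> * \<phi> k \<xi>) (x - y)" for y
      proof -
        have "fourier (\<lambda>\<xi>. \<phi> k \<xi> * \<zeta> \<xi>) y = (LINT \<xi>|lborel. character (- y) \<xi> * (\<phi> k \<xi> * \<zeta> \<xi>))"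
          by (rule fourier_eq[OF schwartz_borel[OF s2]])
        also have "\<dots> = (LINT \<xi>|lborel. c * (character (x - y) \<xi> * (\<phi> l \<xi> * \<phi> k \<xi>)))"
        proof (intro Bochner_Integration.integral_cong refl)
          fix \<xi> :: "real^'n"
          have "character (x - y) \<xi> = character x \<xi> * character (- y) \<xi>"
            using character_add[of x "- y" \<xi>] by simp
          then show "character (- y) \<xi> * (\<phi> k \<xi> * \<zeta> \<xi>) = c * (character (x - y) \<xi> * (\<phi> l \<xi> * \<phi> k \<xi>))"
            by (simp add: \<zeta>_def mult_ac)
        qed
        also have "\<dots> = c * (LINT \<xi>|lborel. character (x - y) \<xi> * (\<phi> l \<xi> * \<phi> k \<xi>))"
          by (rule integral_mult_right_zero)
        also have "\<dots> = inv_fourier (\<lambda>\<xi>. \<phi> l \<xi> * \<phi> k \<xi>) (x - y)"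
          unfolding c_def by (rule inv_fourier_eq[OF schwartz_borel[OF s], symmetric])
        finally show ?thesis .
      qed
      then have "fourier (\<lambda>\<xi>. \<phi> k \<xi> * inv_fourier \<eta> \<xi>) = (\<lambda>y. inv_fourier (\<lambda>\<xi>. \<phi> l \<xi> * \<phi> k \<xi>) (x - y))"
        unfolding inv\<eta> by (rule ext)
      then show ?thesis
        unfolding freq_box_apply by (simp only: regular_distr_vec_def regular_distr_def vec_lambda_beta S_def)
    qed
    have "(S has_sum (f $ i) \<eta>) UNIV"
      using sums[unfolded distr_sums_def, rule_format, OF \<eta>, of i] unfolding Sk .
    \<comment> \<open>For k - l outside the neighbours \<phi>_l \<phi>_k = 0, so kernel and term
      vanish; by uniqueness of sums the series collapses to a finite one.\<close>
    moreover have "(S has_sum (\<Sum>k\<in>(+) l ` neighbours. S k)) UNIV"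
    proof (rule has_sum_finite_neutralI)
      fix k assume "k \<in> UNIV - (+) l ` neighbours"
      then have nk: "k - l \<notin> neighbours" by (metis DiffD2 add.commute diff_add_cancel imageI)
      then have "(\<lambda>\<xi>. \<phi> l \<xi> * \<phi> k \<xi>) = (\<lambda>\<xi>. 0)" using class_Y_mult_zero by blast
      then show "S k = 0" unfolding S_def by (simp add: inv_fourier_def)
    qed (simp_all add: finite_neighbours)
    ultimately have "(f $ i) \<eta> = (\<Sum>k\<in>(+) l ` neighbours. S k)" by (rule has_sum_unique)
    also have "\<dots> = (\<Sum>m\<in>neighbours. S (l + m))" by (subst sum.reindex) (auto simp: inj_on_def)
    finally show ?thesis unfolding gl S_def .
  qed
  then show ?thesis by (simp add: vec_eq_iff)
qed

section \<open>The two norm inequalities\<close>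

context
  fixes s p :: real and q :: ennreal and W :: "real^'n \<Rightarrow> complex^'m^'m"
  assumes p: "1 \<le> p" and q: "0 < q" and W: "W \<in> Muckenhoupt p"
begin

lemma weight: "matrix_weight W"
  using W by (auto simp: Muckenhoupt_def)

lemma mod_norm_eq:
  assumes "f \<in> tempered_vec"
  shows "mod_norm \<phi> s p q W f = lq_norm q (\<lambda>k. ennreal (bracket k powr s) * LpW_norm p W (box_function f k))"
  by (simp add: mod_norm_def function_of_vec_freq_box[OF assms])

lemma bracket_pos: "0 < bracket (k :: int^'n)"
  by (simp add: bracket_def add_pos_nonneg)

text \<open>The weight at k is exchanged for the weight at k + l before the neighbour sum enters the
  l^q estimate; the constant therefore depends on s, p, q and the dimension but not on f.\<close>

lemma regroup_decomposition:
  obtains E where "E < top" "\<And>f. f \<in> mod_space \<phi> s p q W \<Longrightarrow> regroup f \<in> decompositions \<phi> s p q W f"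
    "\<And>f. f \<in> mod_space \<phi> s p q W \<Longrightarrow> lqLpW_norm q p W (\<lambda>k x. bracket k powr s *\<^sub>R regroup f k x) \<le> E * mod_norm \<phi> s p q W f"
proof -
  define c where "c = ennreal (real (card (neighbours :: (int^'n) set)) * real (card (neighbours :: (int^'n) set)) powr (1/p))"
  obtain D where D: "0 < D" "\<And>(k :: int^'n) l. l \<in> neighbours \<Longrightarrow> bracket k powr s \<le> D * bracket (k + l) powr s"
    using bracket_powr_le[of s] by blast
  have "ennreal D * c < top" by (simp add: c_def ennreal_mult_less_top)
  from lq_norm_le_neighbours[where 'n='n, OF q this] obtain E where E: "E < top"
    "\<And>a b :: int^'n \<Rightarrow> ennreal. (\<And>k. a k \<le> ennreal D * c * (\<Sum>l\<in>neighbours. b (k + l))) \<Longrightarrow> lq_norm q a \<le> E * lq_norm q b"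
    by blast
  \<comment> \<open>A finite l^q norm bounds each single term, and the bracket weight is positive,
    so it can be removed.\<close>
  have fin: "LpW_norm p W (box_function f k) < top" if f: "f \<in> mod_space \<phi> s p q W" for f k
  proof -
    have ft: "f \<in> tempered_vec" and "mod_norm \<phi> s p q W f < top" using f by (auto simp: mod_space_def)
    then have "lq_norm q (\<lambda>k. ennreal (bracket k powr s) * LpW_norm p W (box_function f k)) < top"
      by (simp only: mod_norm_eq)
    from lq_norm_member[OF q this]
    have "ennreal (bracket k powr s) * LpW_norm p W (box_function f k) < top" .
    moreover have "ennreal (bracket k powr s) \<noteq> 0" using bracket_pos[of k] by simp
    ultimately show ?thesis unfolding ennreal_mult_less_top by (elim disjE conjE) simp_all
  qed
  have meas: "box_function f k \<in> borel_measurable lebesgue" if "f \<in> tempered_vec" for f :: "'n functional ^ 'm" and k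
    by (rule measurable_continuous_lebesgue[OF continuous_box_function[OF that]])
  have rcont: "continuous_on UNIV (regroup f k)" if "f \<in> tempered_vec" for f :: "'n functional ^ 'm" and k
    unfolding regroup_def[abs_def] by (intro continuous_on_sum continuous_box_function that)
  have Fle: "LpW_norm p W (regroup f k) \<le> c * (\<Sum>l\<in>neighbours. LpW_norm p W (box_function f (k + l)))"
    if "f \<in> tempered_vec" for f k
    unfolding regroup_def[abs_def] c_def by (rule LpW_norm_sum_le[OF p weight finite_neighbours meas[OF that]])
  have norm_le: "lqLpW_norm q p W (\<lambda>k x. bracket k powr s *\<^sub>R regroup f k x) \<le> E * mod_norm \<phi> s p q W f"
    if f: "f \<in> tempered_vec" for f
    unfolding lqLpW_norm_def mod_norm_eq[OF f]
  proof (rule E(2))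
    fix k
    have "LpW_norm p W (\<lambda>x. bracket k powr s *\<^sub>R regroup f k x) = ennreal (bracket k powr s) * LpW_norm p W (regroup f k)"
      by (rule LpW_norm_scaleR[OF p weight measurable_continuous_lebesgue[OF rcont[OF f]]]) simp
    also have "\<dots> \<le> ennreal (bracket k powr s) * (c * (\<Sum>l\<in>neighbours. LpW_norm p W (box_function f (k + l))))"
      by (intro mult_left_mono Fle f) simp
    also have "\<dots> = c * (\<Sum>l\<in>neighbours. ennreal (bracket k powr s) * LpW_norm p W (box_function f (k + l)))"
      by (simp add: sum_distrib_left mult_ac)
    also have "\<dots> \<le> c * (\<Sum>l\<in>neighbours. ennreal D * (ennreal (bracket (k + l) powr s) * LpW_norm p W (box_function f (k + l))))"
    proof (intro mult_left_mono sum_mono)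
      fix l :: "int^'n" assume "l \<in> neighbours"
      then have "ennreal (bracket k powr s) \<le> ennreal (D * bracket (k + l) powr s)" using D(2) by (intro ennreal_leI)
      also have "\<dots> = ennreal D * ennreal (bracket (k + l) powr s)" using D(1) by (simp add: ennreal_mult)
      finally have "ennreal (bracket k powr s) * LpW_norm p W (box_function f (k + l)) \<le>
          ennreal D * ennreal (bracket (k + l) powr s) * LpW_norm p W (box_function f (k + l))" by (rule mult_right_mono) simp
      then show "ennreal (bracket k powr s) * LpW_norm p W (box_function f (k + l)) \<le>
          ennreal D * (ennreal (bracket (k + l) powr s) * LpW_norm p W (box_function f (k + l)))" by (simp only: mult.assoc)
    qed simp
    also have "\<dots> = ennreal D * c * (\<Sum>l\<in>neighbours. ennreal (bracket (k + l) powr s) * LpW_norm p W (box_function f (k + l)))"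
      by (simp only: sum_distrib_left[symmetric] mult_ac)
    finally show "LpW_norm p W (\<lambda>x. bracket k powr s *\<^sub>R regroup f k x) \<le>
        ennreal D * c * (\<Sum>l\<in>neighbours. ennreal (bracket (k + l) powr s) * LpW_norm p W (box_function f (k + l)))" .
  qed
  show thesis
  proof (rule that[OF E(1)])
    fix f assume f: "f \<in> mod_space \<phi> s p q W"
    then have ft: "f \<in> tempered_vec" and mn: "mod_norm \<phi> s p q W f < top" by (auto simp: mod_space_def)
    show "lqLpW_norm q p W (\<lambda>k x. bracket k powr s *\<^sub>R regroup f k x) \<le> E * mod_norm \<phi> s p q W f"
      by (rule norm_le[OF ft])
    then have fin': "lqLpW_norm q p W (\<lambda>k x. bracket k powr s *\<^sub>R regroup f k x) < top"
      by (rule le_less_trans) (use E(1) mn in \<open>simp add: ennreal_mult_less_top\<close>)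
    have "LpW_norm p W (regroup f k) < top" for k
    proof (rule le_less_trans[OF Fle[OF ft]])
      have "(\<Sum>l\<in>neighbours. LpW_norm p W (box_function f (k + l))) < top"
        unfolding ennreal_sum_less_top[OF finite_neighbours] by (intro ballI fin f)
      then show "c * (\<Sum>l\<in>neighbours. LpW_norm p W (box_function f (k + l))) < top"
        by (simp add: c_def ennreal_mult_less_top)
    qed
    then show "regroup f \<in> decompositions \<phi> s p q W f"
      unfolding decompositions_def LpW_def
      using rcont[OF ft] measurable_continuous_lebesgue[OF rcont[OF ft]] distr_sums_regroup[OF ft] fin' by simp
  qed
qed

text \<open>The finite convolution formula and the weighted convolution bound give an estimate for
  each k by the neighbouring members of the decomposition; the l^q estimate for neighbour sums then
  applies as in the opposite direction.\<close>

lemma decomposition_bound: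
  obtains E where "E < top"
    "\<And>f F. f \<in> tempered_vec \<Longrightarrow> F \<in> decompositions \<phi> s p q W f \<Longrightarrow>
      mod_norm \<phi> s p q W f \<le> E * lqLpW_norm q p W (\<lambda>k x. bracket k powr s *\<^sub>R F k x)"
proof -
  define c where "c = ennreal (real (card (neighbours :: (int^'n) set)) * real (card (neighbours :: (int^'n) set)) powr (1/p))"
  obtain D where D: "0 < D" "\<And>(k :: int^'n) l. l \<in> neighbours \<Longrightarrow> bracket k powr s \<le> D * bracket (k + l) powr s"
    using bracket_powr_le[of s] by blast
  obtain C where C: "C < \<infinity>" and conv:
    "\<And>K c F. K \<in> borel_measurable borel \<Longrightarrow> 0 \<le> c \<Longrightarrow>
      (\<And>z. norm (K z) \<le> c / (1 + norm z) ^ (6 * CARD('n))) \<Longrightarrow> F \<in> LpW p W \<Longrightarrow>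
      LpW_norm p W (\<lambda>x. \<chi> i. LINT y|lebesgue. F y $ i * K (x - y)) \<le> C * ennreal c * LpW_norm p W F"
    by (rule LpW_norm_convolution_le[OF p W]) (rule that, assumption, simp)
  \<comment> \<open>The decay order demanded by the weighted convolution bound; a single constant
    serves all pairs of indices.\<close>
  obtain d where d: "0 \<le> d" "\<And>k l z. norm (inv_fourier (\<lambda>\<xi>. \<phi> l \<xi> * \<phi> k \<xi>) z) \<le> d / (1 + norm z) ^ (6 * CARD('n))"
    using class_Y_kernel_decay[of "6 * CARD('n)"] by blast
  define B where "B = ennreal D * (c * (C * ennreal d))"
  have "B < top" using C by (simp add: B_def c_def ennreal_mult_less_top)
  from lq_norm_le_neighbours[where 'n='n, OF q this] obtain E where E: "E < top"
    "\<And>a b :: int^'n \<Rightarrow> ennreal. (\<And>k. a k \<le> B * (\<Sum>l\<in>neighbours. b (k + l))) \<Longrightarrow> lq_norm q a \<le> E * lq_norm q b"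
    by blast
  show thesis
  proof (rule that[OF E(1)])
    fix f :: "'n functional ^ 'm" and F assume f: "f \<in> tempered_vec" and F: "F \<in> decompositions \<phi> s p q W f"
    have Fk: "F k \<in> LpW p W" for k using F by (simp add: decompositions_def)
    then have Fm: "F k \<in> borel_measurable lebesgue" for k by (simp add: LpW_def)
    have sums: "distr_sums (\<lambda>k. freq_box \<phi> k (regular_distr_vec (F k))) f" using F by (simp add: decompositions_def)
    define K where "K l m = inv_fourier (\<lambda>\<xi>. \<phi> l \<xi> * \<phi> (l + m) \<xi>)" for l m
    have Km: "K l m \<in> borel_measurable borel" for l m
      unfolding K_def by (rule schwartz_borel[OF schwartz_inv_fourier[OF schwartz_class_Y_mult[OF class_Y_smooth]]])
    define H where "H l m x = (\<chi> i. LINT y|lebesgue. F (l + m) y $ i * K l m (x - y))" for l m x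
    have Hm: "H l m \<in> borel_measurable lebesgue" for l m
      unfolding H_def[abs_def] by (rule measurable_convolution[OF Fm Km])
    have Hle: "LpW_norm p W (H l m) \<le> C * ennreal d * LpW_norm p W (F (l + m))" for l m
      unfolding H_def[abs_def] by (rule conv[OF Km d(1) _ Fk]) (unfold K_def, rule d(2))
    have "box_function f l = (\<lambda>x. \<Sum>m\<in>neighbours. H l m x)" for l
      by (rule ext) (simp only: box_function_eq_convolutions[OF f sums] H_def K_def)
    then have gle: "LpW_norm p W (box_function f l) \<le> c * (\<Sum>m\<in>neighbours. LpW_norm p W (H l m))" for l
      unfolding c_def using LpW_norm_sum_le[OF p weight finite_neighbours Hm[of l]] by simp
    show "mod_norm \<phi> s p q W f \<le> E * lqLpW_norm q p W (\<lambda>k x. bracket k powr s *\<^sub>R F k x)"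
      unfolding mod_norm_eq[OF f] lqLpW_norm_def
    proof (rule E(2))
      fix k
      have "ennreal (bracket k powr s) * LpW_norm p W (box_function f k) \<le>
          ennreal (bracket k powr s) * (c * (\<Sum>m\<in>neighbours. C * ennreal d * LpW_norm p W (F (k + m))))"
        by (intro mult_left_mono order_trans[OF gle] sum_mono Hle) simp_all
      also have "\<dots> = c * (C * ennreal d) * (\<Sum>m\<in>neighbours. ennreal (bracket k powr s) * LpW_norm p W (F (k + m)))"
        by (simp only: sum_distrib_left[symmetric] mult_ac)
      also have "\<dots> \<le> c * (C * ennreal d) * (\<Sum>m\<in>neighbours. ennreal D * LpW_norm p W (\<lambda>x. bracket (k + m) powr s *\<^sub>R F (k + m) x))"
      proof (intro mult_left_mono sum_mono)
        fix m :: "int^'n" assume "m \<in> neighbours"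
        then have "ennreal (bracket k powr s) \<le> ennreal (D * bracket (k + m) powr s)" using D(2) by (intro ennreal_leI)
        also have "\<dots> = ennreal D * ennreal (bracket (k + m) powr s)" using D(1) by (simp add: ennreal_mult)
        finally have "ennreal (bracket k powr s) * LpW_norm p W (F (k + m)) \<le>
            ennreal D * ennreal (bracket (k + m) powr s) * LpW_norm p W (F (k + m))" by (rule mult_right_mono) simp
        also have "ennreal D * ennreal (bracket (k + m) powr s) * LpW_norm p W (F (k + m)) =
            ennreal D * LpW_norm p W (\<lambda>x. bracket (k + m) powr s *\<^sub>R F (k + m) x)"
          unfolding mult.assoc by (subst LpW_norm_scaleR[OF p weight Fm]) simp_all
        finally show "ennreal (bracket k powr s) * LpW_norm p W (F (k + m)) \<le>
            ennreal D * LpW_norm p W (\<lambda>x. bracket (k + m) powr s *\<^sub>R F (k + m) x)" .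
      qed simp
      also have "\<dots> = B * (\<Sum>m\<in>neighbours. LpW_norm p W (\<lambda>x. bracket (k + m) powr s *\<^sub>R F (k + m) x))"
        unfolding B_def by (simp only: sum_distrib_left[symmetric] mult_ac)
      finally show "ennreal (bracket k powr s) * LpW_norm p W (box_function f k) \<le>
          B * (\<Sum>m\<in>neighbours. LpW_norm p W (\<lambda>x. bracket (k + m) powr s *\<^sub>R F (k + m) x))" .
    qed
  qed
qed

end

end

theorem theorem4p5:
  fixes s p :: real and q :: ennreal
    and W :: "real^'n \<Rightarrow> complex^'m^'m"
    and \<phi> :: "int^'n \<Rightarrow> real^'n \<Rightarrow> complex"
  assumes "1 \<le> p" and "0 < q"
    and "W \<in> Muckenhoupt p"
    and "\<phi> \<in> class_Y"
  shows "(\<forall>f\<in>tempered_vec.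
            f \<in> mod_space \<phi> s p q W \<longleftrightarrow> (\<exists>F. F \<in> decompositions \<phi> s p q W f)) \<and>
         (\<exists>c C :: real. 0 < c \<and> 0 < C \<and>
            (\<forall>f\<in>mod_space \<phi> s p q W.
               ennreal c * (INF F\<in>decompositions \<phi> s p q W f.
                   lqLpW_norm q p W (\<lambda>k x. bracket k powr s *\<^sub>R F k x))
                 \<le> mod_norm \<phi> s p q W f \<and>
               mod_norm \<phi> s p q W f
                 \<le> ennreal C * (INF F\<in>decompositions \<phi> s p q W f.
                   lqLpW_norm q p W (\<lambda>k x. bracket k powr s *\<^sub>R F k x))))"
proof -
  obtain E1 where E1: "E1 < top" and dec: "\<And>f. f \<in> mod_space \<phi> s p q W \<Longrightarrow> regroup \<phi> f \<in> decompositions \<phi> s p q W f"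
    and le1: "\<And>f. f \<in> mod_space \<phi> s p q W \<Longrightarrow>
      lqLpW_norm q p W (\<lambda>k x. bracket k powr s *\<^sub>R regroup \<phi> f k x) \<le> E1 * mod_norm \<phi> s p q W f"
    by (rule regroup_decomposition[OF assms(4,1,2,3), where s = s]) (rule that, assumption, simp, simp)
  obtain E2 where E2: "E2 < top" and le2: "\<And>f F. f \<in> tempered_vec \<Longrightarrow> F \<in> decompositions \<phi> s p q W f \<Longrightarrow>
      mod_norm \<phi> s p q W f \<le> E2 * lqLpW_norm q p W (\<lambda>k x. bracket k powr s *\<^sub>R F k x)"
    by (rule decomposition_bound[OF assms(4,1,2,3), where s = s]) (rule that, assumption, simp)
  \<comment> \<open>Turns a finite extended constant, possibly 0, into a positive real one; the
    lower equivalence constant is then 1 / C1.\<close>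
  define C1 where "C1 = enn2real E1 + 1"
  define C2 where "C2 = enn2real E2 + 1"
  have C1: "0 < C1" "E1 \<le> ennreal C1" and C2: "0 < C2" "E2 \<le> ennreal C2"
    using E1 E2 by (simp_all add: C1_def C2_def add_nonneg_pos ennreal_plus ennreal_enn2real)
  have iff: "f \<in> mod_space \<phi> s p q W \<longleftrightarrow> (\<exists>F. F \<in> decompositions \<phi> s p q W f)" if f: "f \<in> tempered_vec" for f
  proof
    assume "\<exists>F. F \<in> decompositions \<phi> s p q W f"
    then obtain F where F: "F \<in> decompositions \<phi> s p q W f" ..
    then have "lqLpW_norm q p W (\<lambda>k x. bracket k powr s *\<^sub>R F k x) < top" by (simp add: decompositions_def)
    then have "mod_norm \<phi> s p q W f < top"
      by (intro le_less_trans[OF le2[OF f F]]) (simp add: ennreal_mult_less_top E2)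
    then show "f \<in> mod_space \<phi> s p q W" using f by (simp add: mod_space_def)
  qed (use dec in blast)
  have "ennreal (1 / C1) * (INF F\<in>decompositions \<phi> s p q W f. lqLpW_norm q p W (\<lambda>k x. bracket k powr s *\<^sub>R F k x))
      \<le> mod_norm \<phi> s p q W f \<and>
    mod_norm \<phi> s p q W f \<le> ennreal C2 * (INF F\<in>decompositions \<phi> s p q W f. lqLpW_norm q p W (\<lambda>k x. bracket k powr s *\<^sub>R F k x))"
    (is "?a * ?I \<le> ?n \<and> _") if f: "f \<in> mod_space \<phi> s p q W" for f
  proof
    have ft: "f \<in> tempered_vec" using f by (simp add: mod_space_def)
    have "?I \<le> E1 * ?n" by (rule order_trans[OF _ le1[OF f]]) (rule INF_lower[OF dec[OF f]])
    also have "\<dots> \<le> ennreal C1 * ?n" using C1(2) by (rule mult_right_mono) simp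
    finally have "?a * ?I \<le> ?a * (ennreal C1 * ?n)" by (rule mult_left_mono) simp
    also have "\<dots> = ?n" using C1(1) by (simp add: mult.assoc[symmetric] flip: ennreal_mult)
    finally show "?a * ?I \<le> ?n" .
    \<comment> \<open>The constant is moved to the left by division, so that the bound for every
      single decomposition passes to the infimum.\<close>
    have "?n / ennreal C2 \<le> ?I"
    proof (rule INF_greatest)
      fix F assume F: "F \<in> decompositions \<phi> s p q W f"
      have "?n \<le> E2 * lqLpW_norm q p W (\<lambda>k x. bracket k powr s *\<^sub>R F k x)" by (rule le2[OF ft F])
      also have "\<dots> \<le> ennreal C2 * lqLpW_norm q p W (\<lambda>k x. bracket k powr s *\<^sub>R F k x)" using C2(2) by (rule mult_right_mono) simp
      finally show "?n / ennreal C2 \<le> lqLpW_norm q p W (\<lambda>k x. bracket k powr s *\<^sub>R F k x)"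
        using C2(1) by (intro divide_le_posI_ennreal) (simp_all add: mult.commute)
    qed
    then have "ennreal C2 * (?n / ennreal C2) \<le> ennreal C2 * ?I" by (rule mult_left_mono) simp
    then show "?n \<le> ennreal C2 * ?I" unfolding ennreal_mult_divide_cancel[OF C2(1)] .
  qed
  moreover have "0 < 1 / C1" using C1(1) by simp
  ultimately show ?thesis using iff C2(1) by blast
qed

end
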